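(* Suppose $p\in (0,\sharp ]$ and let $A$ be a real $d\times d$ matrix. Then $$s_{p,A}(\mathbf R^{2d})\,\#_A\, s_{\sharp ,A}(\mathbf R^{2d}) = s_{p,A}(\mathbf R^{2d})\,\#_A\, s_{\infty ,A}(\mathbf R^{2d}) = s_{p,A}(\mathbf R^{2d}).$$
   Context: Index set: $\mathbf R_\sharp=\mathbf R_+\cup\{\sharp,\infty\}$ with $\mathbf R_+=(0,\infty)$, ordered so that $x<\sharp<\infty$ for $x\in\mathbf R_+$; $(0,\sharp]=\mathbf R_+\cup\{\sharp\}$. Schatten classes: for a linear operator $T$ on $L^2(\mathbf R^d)$ let $\sigma_j(T)=\inf\|T-T_0\|_{L^2\to L^2}$, infimum over all linear operators $T_0$ of rank at most $j-1$, $j\ge1$. For $p\in(0,\infty]$, $\mathscr I_p$ is the set of all $T$ with $\|T\|_{\mathscr I_p}=\|\{\sigma_j(T)\}_{j\ge1}\|_{\ell^p}<\infty$ (so $\mathscr I_\infty$ is the set of bounded operators), and $\mathscr I_\sharp$ is the set of compact operators with the operator norm. $\Sigma_1(\mathbf R^n)$ is the Fréchet space of all $f\in C^\infty(\mathbf R^n)$ with $\sup_{\alpha,\beta}\frac{\|x^\alpha D^\beta f\|_{L^\infty}}{h^{|\alpha+\beta|}\alpha!\beta!}<\infty$ for every $h>0$, and $\Sigma_1'(\mathbf R^n)$ is its dual. Pseudo-differential operators: for a real $d\times d$ matrix $A$ and $a\in\Sigma_1'(\mathbf R^{2d})$, $$\operatorname{Op}_A(a)f(x)=(2\pi)^{-d}\iint_{\mathbf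 R^{2d}} a(x-A(x-y),\xi)f(y)e^{i\langle x-y,\xi\rangle}\,dy\,d\xi$$ (in distribution sense); $a\mapsto\operatorname{Op}_A(a)$ is a bijection from $\Sigma_1'(\mathbf R^{2d})$ onto the continuous linear operators from $\Sigma_1(\mathbf R^d)$ to $\Sigma_1'(\mathbf R^d)$. For $p\in\mathbf R_\sharp$, $s_{p,A}(\mathbf R^{2d})$ is the set of $a\in\Sigma_1'(\mathbf R^{2d})$ such that $\operatorname{Op}_A(a)$ (extends to an operator which) belongs to $\mathscr I_p$. The symbol product $\#_A$ is defined by $\operatorname{Op}_A(a\,\#_A\,b)=\operatorname{Op}_A(a)\circ\operatorname{Op}_A(b)$. For sets $E,F$, $E\,\#_A\,F=\{a\,\#_A\,b:a\in E,\ b\in F\}$ (single products). *)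

theory Defs
  imports "HOL-Analysis.Analysis"
begin

section \<open>The Hilbert space of square-integrable functions\<close>

definition square_integrable :: "('a::euclidean_space \<Rightarrow> complex) \<Rightarrow> bool" where
  "square_integrable f \<longleftrightarrow>
     f \<in> borel_measurable lborel \<and> integrable lborel (\<lambda>x. (cmod (f x))\<^sup>2)"

lemma square_integrable_mult:
  assumes "square_integrable f" "square_integrable g"
  shows "integrable lborel (\<lambda>x. f x * g x)"
proof (rule Bochner_Integration.integrable_bound)
  show "integrable lborel (\<lambda>x. (cmod (f x))\<^sup>2 + (cmod (g x))\<^sup>2)"
    using assms by (auto simp: square_integrable_def)
  show "(\<lambda>x. f x * g x) \<in> borel_measurable lborel"
    using assms by (auto simp: square_integrable_def)
  have "cmod (f x) * cmod (g x) \<le> (cmod (f x))\<^sup>2 + (cmod (g x))\<^sup>2" for x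
    using sum_squares_bound[of "cmod (f x)" "cmod (g x)"]
      mult_nonneg_nonneg[of "cmod (f x)" "cmod (g x)"]
    unfolding mult.assoc using norm_ge_zero[of "f x"] norm_ge_zero[of "g x"] by linarith
  then show "AE x in lborel. norm (f x * g x) \<le> norm ((cmod (f x))\<^sup>2 + (cmod (g x))\<^sup>2)"
    by (simp add: norm_mult)
qed

lemma square_integrable_zero: "square_integrable (\<lambda>_. 0)"
  by (simp add: square_integrable_def)

lemma square_integrable_cmult:
  "square_integrable f \<Longrightarrow> square_integrable (\<lambda>x. c * f x)"
  by (auto simp: square_integrable_def norm_mult power_mult_distrib)

lemma square_integrable_cnj: "square_integrable f \<Longrightarrow> square_integrable (\<lambda>x. cnj (f x))"
  unfolding square_integrable_def
  by (auto intro: measurable_compose[OF _ borel_measurable_continuous_onI]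
      simp: continuous_on_cnj)

lemma square_integrable_add:
  assumes "square_integrable f" "square_integrable g"
  shows "square_integrable (\<lambda>x. f x + g x)"
  unfolding square_integrable_def
proof
  show m: "(\<lambda>x. f x + g x) \<in> borel_measurable lborel"
    using assms by (auto simp: square_integrable_def)
  show "integrable lborel (\<lambda>x. (cmod (f x + g x))\<^sup>2)"
  proof (rule Bochner_Integration.integrable_bound)
    show "integrable lborel (\<lambda>x. 2 * (cmod (f x))\<^sup>2 + 2 * (cmod (g x))\<^sup>2)"
      using assms by (auto simp: square_integrable_def)
    show "(\<lambda>x. (cmod (f x + g x))\<^sup>2) \<in> borel_measurable lborel"
      using m by measurable
    have "(cmod (f x + g x))\<^sup>2 \<le> 2 * (cmod (f x))\<^sup>2 + 2 * (cmod (g x))\<^sup>2" for x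
    proof -
      have "(cmod (f x + g x))\<^sup>2 \<le> (cmod (f x) + cmod (g x))\<^sup>2"
        by (intro power_mono norm_triangle_ineq) auto
      also have "\<dots> \<le> 2 * (cmod (f x))\<^sup>2 + 2 * (cmod (g x))\<^sup>2"
        using sum_squares_bound[of "cmod (f x)" "cmod (g x)"] by (simp add: power2_sum)
      finally show ?thesis .
    qed
    then show "AE x in lborel. norm ((cmod (f x + g x))\<^sup>2)
        \<le> norm (2 * (cmod (f x))\<^sup>2 + 2 * (cmod (g x))\<^sup>2)"
      by simp
  qed
qed

definition L2_rel :: "('a::euclidean_space \<Rightarrow> complex) \<Rightarrow> ('a \<Rightarrow> complex) \<Rightarrow> bool" where
  "L2_rel f g \<longleftrightarrow> square_integrable f \<and> square_integrable g \<and> (AE x in lborel. f x = g x)"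

lemma part_equivp_L2_rel: "part_equivp L2_rel"
proof (rule part_equivpI)
  show "\<exists>f::'a \<Rightarrow> complex. L2_rel f f"
    by (rule exI[of _ "\<lambda>_. 0"]) (simp add: L2_rel_def square_integrable_zero)
  show "symp (L2_rel :: ('a \<Rightarrow> complex) \<Rightarrow> _)"
    by (auto simp: symp_def L2_rel_def elim: eventually_mono)
  show "transp (L2_rel :: ('a \<Rightarrow> complex) \<Rightarrow> _)"
    unfolding transp_def L2_rel_def by (auto elim: eventually_elim2)
qed

quotient_type (overloaded) 'a L2 = "'a::euclidean_space \<Rightarrow> complex" / partial: L2_rel
  by (rule part_equivp_L2_rel)

lift_definition cscale :: "complex \<Rightarrow> 'a::euclidean_space L2 \<Rightarrow> 'a L2"
  is "\<lambda>c f x. c * f x"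
  by (auto simp: L2_rel_def square_integrable_cmult elim: eventually_mono)

instantiation L2 :: (euclidean_space) real_vector
begin

lift_definition zero_L2 :: "'a L2" is "\<lambda>_. 0"
  by (simp add: L2_rel_def square_integrable_zero)

lift_definition plus_L2 :: "'a L2 \<Rightarrow> 'a L2 \<Rightarrow> 'a L2" is "\<lambda>f g x. f x + g x"
  unfolding L2_rel_def by (auto simp: square_integrable_add elim: eventually_elim2)

definition uminus_L2 :: "'a L2 \<Rightarrow> 'a L2" where "uminus_L2 f = cscale (-1) f"

definition minus_L2 :: "'a L2 \<Rightarrow> 'a L2 \<Rightarrow> 'a L2" where "minus_L2 f g = f + (- g)"

definition scaleR_L2 :: "real \<Rightarrow> 'a L2 \<Rightarrow> 'a L2" where
  "scaleR_L2 r f = cscale (complex_of_real r) f"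

instance
proof
  fix f g h :: "'a L2" and a b :: real
  show "f + g + h = f + (g + h)"
    by transfer (auto simp: L2_rel_def square_integrable_add add.assoc)
  show "f + g = g + f"
    by transfer (auto simp: L2_rel_def square_integrable_add add.commute)
  show "0 + f = f"
    by transfer (auto simp: L2_rel_def)
  show "- f + f = 0"
    unfolding uminus_L2_def
    by transfer
      (auto simp: L2_rel_def square_integrable_zero)
  show "f - g = f + - g"
    by (simp add: minus_L2_def)
  show "a *\<^sub>R (f + g) = a *\<^sub>R f + a *\<^sub>R g"
    unfolding scaleR_L2_def
    by transfer (simp add: L2_rel_def square_integrable_add square_integrable_cmult distrib_left)
  show "(a + b) *\<^sub>R f = a *\<^sub>R f + b *\<^sub>R f"
    unfolding scaleR_L2_def
    by transfer (auto simp: L2_rel_def square_integrable_add square_integrable_cmult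
        distrib_right)
  show "a *\<^sub>R b *\<^sub>R f = (a * b) *\<^sub>R f"
    unfolding scaleR_L2_def
    by transfer (auto simp: L2_rel_def square_integrable_cmult mult.assoc)
  show "1 *\<^sub>R f = f"
    unfolding scaleR_L2_def by transfer (auto simp: L2_rel_def)
qed

end

instantiation L2 :: (euclidean_space) real_inner
begin

text \<open>The real part of the usual sesquilinear inner product, which induces the usual norm.\<close>

lift_definition inner_L2 :: "'a L2 \<Rightarrow> 'a L2 \<Rightarrow> real"
  is "\<lambda>f g. Re (LINT x|lborel. f x * cnj (g x))"
proof -
  fix f f' g g' :: "'a \<Rightarrow> complex"
  assume "L2_rel f f'" "L2_rel g g'"
  then have [measurable]: "f \<in> borel_measurable lborel" "f' \<in> borel_measurable lborel"
      "(\<lambda>x. cnj (g x)) \<in> borel_measurable lborel" "(\<lambda>x. cnj (g' x)) \<in> borel_measurable lborel"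
    and ae: "AE x in lborel. f x = f' x" "AE x in lborel. g x = g' x"
    using square_integrable_cnj by (auto simp: L2_rel_def square_integrable_def)
  have "(LINT x|lborel. f x * cnj (g x)) = (LINT x|lborel. f' x * cnj (g' x))"
  proof (rule integral_cong_AE)
    show "AE x in lborel. f x * cnj (g x) = f' x * cnj (g' x)"
      using ae by (auto elim: eventually_elim2)
  qed measurable
  then show "Re (LINT x|lborel. f x * cnj (g x)) = Re (LINT x|lborel. f' x * cnj (g' x))"
    by simp
qed

definition norm_L2 :: "'a L2 \<Rightarrow> real" where "norm_L2 f = sqrt (f \<bullet> f)"

definition sgn_L2 :: "'a L2 \<Rightarrow> 'a L2" where "sgn_L2 f = f /\<^sub>R norm f"

definition dist_L2 :: "'a L2 \<Rightarrow> 'a L2 \<Rightarrow> real" where "dist_L2 f g = norm (f - g)"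

definition uniformity_L2 :: "('a L2 \<times> 'a L2) filter" where
  "uniformity_L2 = (INF e\<in>{0<..}. principal {(f, g). dist f g < e})"

definition open_L2 :: "'a L2 set \<Rightarrow> bool" where
  "open_L2 U \<longleftrightarrow> (\<forall>f\<in>U. \<forall>\<^sub>F (f', g) in uniformity. f' = f \<longrightarrow> g \<in> U)"

instance
proof
  fix f g h :: "'a L2" and r :: real and U :: "'a L2 set"
  show "dist f g = norm (f - g)" by (rule dist_L2_def)
  show "sgn f = f /\<^sub>R norm f" by (rule sgn_L2_def)
  show "uniformity = (INF e\<in>{0<..}. principal {(f :: 'a L2, g). dist f g < e})"
    by (rule uniformity_L2_def)
  show "open U = (\<forall>f\<in>U. \<forall>\<^sub>F (f', g) in uniformity. f' = f \<longrightarrow> g \<in> U)"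
    by (rule open_L2_def)
  show "norm f = sqrt (f \<bullet> f)" by (rule norm_L2_def)
  show "f \<bullet> g = g \<bullet> f"
  proof transfer
    fix f g :: "'a \<Rightarrow> complex"
    assume "L2_rel f f" "L2_rel g g"
    then have i: "integrable lborel (\<lambda>x. f x * cnj (g x))" "integrable lborel (\<lambda>x. g x * cnj (f x))"
      by (auto simp: L2_rel_def intro!: square_integrable_mult square_integrable_cnj)
    show "Re (LINT x|lborel. f x * cnj (g x)) = Re (LINT x|lborel. g x * cnj (f x))"
      unfolding integral_Re[OF i(1), symmetric] integral_Re[OF i(2), symmetric]
      by (rule Bochner_Integration.integral_cong) (auto simp: algebra_simps)
  qed
  show "(f + g) \<bullet> h = f \<bullet> h + g \<bullet> h"
  proof transfer
    fix f g h :: "'a \<Rightarrow> complex"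
    assume "L2_rel f f" "L2_rel g g" "L2_rel h h"
    then have i: "integrable lborel (\<lambda>x. f x * cnj (h x))" "integrable lborel (\<lambda>x. g x * cnj (h x))"
      by (auto simp: L2_rel_def intro!: square_integrable_mult square_integrable_cnj)
    show "Re (LINT x|lborel. (f x + g x) * cnj (h x)) =
        Re (LINT x|lborel. f x * cnj (h x)) + Re (LINT x|lborel. g x * cnj (h x))"
      using i by (simp add: distrib_right)
  qed
  show "(r *\<^sub>R f) \<bullet> g = r * (f \<bullet> g)"
    unfolding scaleR_L2_def by transfer (simp add: mult.assoc)
  have self: "(LINT x|lborel. k x * cnj (k x)) = of_real (LINT x|lborel. (cmod (k x))\<^sup>2)"
    for k :: "'a \<Rightarrow> complex"
    by (simp only: complex_norm_square[symmetric] integral_complex_of_real)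
  show "0 \<le> f \<bullet> f"
    by transfer (simp add: self)
  show "(f \<bullet> f = 0) = (f = 0)"
  proof transfer
    fix f :: "'a \<Rightarrow> complex"
    assume f: "L2_rel f f"
    then have "integrable lborel (\<lambda>x. (cmod (f x))\<^sup>2)"
      by (simp add: L2_rel_def square_integrable_def)
    then have "Re (LINT x|lborel. f x * cnj (f x)) = 0 \<longleftrightarrow> (AE x in lborel. (cmod (f x))\<^sup>2 = 0)"
      unfolding self by (simp only: Re_complex_of_real) (rule integral_nonneg_eq_0_iff_AE, auto)
    then show "(Re (LINT x|lborel. f x * cnj (f x)) = 0) = L2_rel f (\<lambda>_. 0)"
      using f by (simp add: L2_rel_def square_integrable_zero)
  qed
qed

end

interpretation L2: vector_space "cscale :: complex \<Rightarrow> 'a::euclidean_space L2 \<Rightarrow> 'a L2"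
proof
  fix a b :: complex and f g :: "'a L2"
  show "cscale a (f + g) = cscale a f + cscale a g"
    by transfer (auto simp: L2_rel_def square_integrable_add square_integrable_cmult
        distrib_left)
  show "cscale (a + b) f = cscale a f + cscale b f"
    by transfer (auto simp: L2_rel_def square_integrable_add square_integrable_cmult
        distrib_right)
  show "cscale a (cscale b f) = cscale (a * b) f"
    by transfer (auto simp: L2_rel_def square_integrable_cmult mult.assoc)
  show "cscale 1 f = f"
    by transfer (auto simp: L2_rel_def)
qed

abbreviation clinear_L2 :: "('a::euclidean_space L2 \<Rightarrow> 'a L2) \<Rightarrow> bool" where
  "clinear_L2 \<equiv> Vector_Spaces.linear cscale cscale"


section \<open>Schatten classes\<close>

text \<open>The index set $\mathbf R_\sharp$; only positive reals are admitted in the real part.\<close>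

datatype schatten_index = Fin real | Sharp | Infty

definition Rsharp :: "schatten_index set" where
  "Rsharp = {Fin p |p. 0 < p} \<union> {Sharp, Infty}"

instantiation schatten_index :: linorder
begin

fun less_eq_schatten_index :: "schatten_index \<Rightarrow> schatten_index \<Rightarrow> bool" where
  "Fin p \<le> Fin q \<longleftrightarrow> p \<le> q"
| "Fin p \<le> Sharp \<longleftrightarrow> True"
| "Fin p \<le> Infty \<longleftrightarrow> True"
| "Sharp \<le> Fin q \<longleftrightarrow> False"
| "Sharp \<le> Sharp \<longleftrightarrow> True"
| "Sharp \<le> Infty \<longleftrightarrow> True"
| "Infty \<le> Fin q \<longleftrightarrow> False"
| "Infty \<le> Sharp \<longleftrightarrow> False"
| "Infty \<le> Infty \<longleftrightarrow> True"

definition less_schatten_index :: "schatten_index \<Rightarrow> schatten_index \<Rightarrow> bool" where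
  "less_schatten_index p q \<longleftrightarrow> p \<le> q \<and> \<not> q \<le> p"

instance
proof
  fix p q r :: schatten_index
  show "p < q \<longleftrightarrow> p \<le> q \<and> \<not> q \<le> p" by (rule less_schatten_index_def)
  show "p \<le> p" by (cases p) auto
  show "p \<le> q \<Longrightarrow> q \<le> r \<Longrightarrow> p \<le> r" by (cases p; cases q; cases r) auto
  show "p \<le> q \<Longrightarrow> q \<le> p \<Longrightarrow> p = q" by (cases p; cases q) auto
  show "p \<le> q \<or> q \<le> p" by (cases p; cases q) auto
qed

end

text \<open>Norms are taken in \<^typ>\<open>ennreal\<close>, so that they make sense for unbounded operators.\<close>

definition op_norm :: "('a::euclidean_space L2 \<Rightarrow> 'a L2) \<Rightarrow> ennreal" where
  "op_norm T = (SUP f\<in>cball 0 1. ennreal (norm (T f)))"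

definition rank_le :: "('a::euclidean_space L2 \<Rightarrow> 'a L2) \<Rightarrow> nat \<Rightarrow> bool" where
  "rank_le T k \<longleftrightarrow> (\<exists>B. finite B \<and> card B \<le> k \<and> range T \<subseteq> L2.span B)"

text \<open>Only \<open>j \<ge> 1\<close> is meaningful.\<close>

definition sing_val :: "nat \<Rightarrow> ('a::euclidean_space L2 \<Rightarrow> 'a L2) \<Rightarrow> ennreal" where
  "sing_val j T = (INF T0\<in>{T0. clinear_L2 T0 \<and> rank_le T0 (j - 1)}. op_norm (\<lambda>f. T f - T0 f))"

definition ennreal_powr :: "ennreal \<Rightarrow> real \<Rightarrow> ennreal" where
  "ennreal_powr x r = (if x = \<infinity> then \<infinity> else ennreal (enn2real x powr r))"

fun schatten_norm :: "schatten_index \<Rightarrow> ('a::euclidean_space L2 \<Rightarrow> 'a L2) \<Rightarrow> ennreal" where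
  "schatten_norm (Fin p) T =
     ennreal_powr (\<Sum>j. ennreal_powr (sing_val (Suc j) T) p) (1 / p)"
| "schatten_norm Sharp T = op_norm T"
| "schatten_norm Infty T = (SUP j\<in>{1..}. sing_val j T)"

definition compact_op :: "('a::euclidean_space L2 \<Rightarrow> 'a L2) \<Rightarrow> bool" where
  "compact_op T \<longleftrightarrow> clinear_L2 T \<and> compact (closure (T ` cball 0 1))"

definition schatten_class :: "schatten_index \<Rightarrow> ('a::euclidean_space L2 \<Rightarrow> 'a L2) set" where
  "schatten_class p =
     (if p = Sharp then {T. compact_op T} else {T. clinear_L2 T \<and> schatten_norm p T < \<infinity>})"


section \<open>The space \<open>\<Sigma>\<^sub>1\<close> and its dual\<close>

definition partial :: "'a::euclidean_space \<Rightarrow> ('a \<Rightarrow> complex) \<Rightarrow> 'a \<Rightarrow> complex" where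
  "partial b f = (\<lambda>x. frechet_derivative f (at x) b)"

text \<open>A function is smooth iff all its iterated partial derivatives are (Fr\'echet) differentiable;
  the iterated partial derivatives are then continuous, too.\<close>

definition smooth :: "('a::euclidean_space \<Rightarrow> complex) \<Rightarrow> bool" where
  "smooth f \<longleftrightarrow> (\<forall>bs\<in>lists Basis. \<forall>x. foldr partial bs f differentiable (at x))"

text \<open>Multi-indices are functions \<open>'a \<Rightarrow> nat\<close>, of which only the values on \<^const>\<open>Basis\<close> matter.
  The partial derivatives are taken in the order of an arbitrary enumeration of the basis; for
  smooth functions the order is immaterial. We use \<open>\<partial>\<close> instead of \<open>D = -i\<partial>\<close>, which
  does not affect absolute values.\<close>

definition basis_enum :: "'a::euclidean_space list" where
  "basis_enum = (SOME bs. distinct bs \<and> set bs = Basis)"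

definition mderiv :: "('a::euclidean_space \<Rightarrow> nat) \<Rightarrow> ('a \<Rightarrow> complex) \<Rightarrow> 'a \<Rightarrow> complex" where
  "mderiv \<beta> f = foldr (\<lambda>b g. (partial b ^^ \<beta> b) g) basis_enum f"

definition mpow :: "'a::euclidean_space \<Rightarrow> ('a \<Rightarrow> nat) \<Rightarrow> real" where
  "mpow x \<alpha> = (\<Prod>b\<in>Basis. (x \<bullet> b) ^ \<alpha> b)"

definition mabs :: "('a::euclidean_space \<Rightarrow> nat) \<Rightarrow> nat" where
  "mabs \<alpha> = (\<Sum>b\<in>Basis. \<alpha> b)"

definition mfact :: "('a::euclidean_space \<Rightarrow> nat) \<Rightarrow> real" where
  "mfact \<alpha> = (\<Prod>b\<in>Basis. fact (\<alpha> b))"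

definition Sigma1_norm :: "real \<Rightarrow> ('a::euclidean_space \<Rightarrow> complex) \<Rightarrow> ennreal" where
  "Sigma1_norm h f =
     (SUP \<alpha>. SUP \<beta>. SUP x.
        ennreal (cmod (of_real (mpow x \<alpha>) * mderiv \<beta> f x)
                 / (h ^ (mabs \<alpha> + mabs \<beta>) * mfact \<alpha> * mfact \<beta>)))"

definition Sigma1 :: "('a::euclidean_space \<Rightarrow> complex) set" where
  "Sigma1 = {f. smooth f \<and> (\<forall>h>0. Sigma1_norm h f < \<infinity>)}"

definition Sigma1_topology :: "('a::euclidean_space \<Rightarrow> complex) topology" where
  "Sigma1_topology = topology_generated_by
     {{g \<in> Sigma1. Sigma1_norm h (\<lambda>x. g x - f x) < ennreal r} |f h r.
        f \<in> Sigma1 \<and> 0 < h \<and> 0 < r}"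

text \<open>Functionals are complex linear, so that the pairing of distributions and test functions
  is bilinear. They are made \<^const>\<open>undefined\<close> outside of \<open>\<Sigma>\<^sub>1\<close>
  in order that equality of functionals be equality on \<open>\<Sigma>\<^sub>1\<close>.\<close>

definition Sigma1_dual :: "(('a::euclidean_space \<Rightarrow> complex) \<Rightarrow> complex) set" where
  "Sigma1_dual = {u \<in> extensional Sigma1.
     (\<forall>f\<in>Sigma1. \<forall>g\<in>Sigma1. u (\<lambda>x. f x + g x) = u f + u g) \<and>
     (\<forall>c. \<forall>f\<in>Sigma1. u (\<lambda>x. c * f x) = c * u f) \<and>
     continuous_map Sigma1_topology euclidean u}"


section \<open>Pseudo-differential operators\<close>

text \<open>The function which \<open>a\<close> is tested against in \<open>\<langle>Op\<^sub>A(a) f, \<phi>\<rangle>\<close>. It comes from the formal integral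
  \[ (2\pi)^{-d} \iiint a(x - A(x-y), \xi) f(y) \phi(x) e^{i \langle x-y, \xi\rangle} dy\,d\xi\,dx \]
  by the substitution \<open>t = x - y\<close>, \<open>z = x - A(x-y)\<close> of determinant \<open>\<plusminus>1\<close>, that is
  \<open>x = z + At\<close> and \<open>y = z + At - t\<close>.\<close>

definition cross_wigner ::
  "real^'d^'d \<Rightarrow> (real^'d \<Rightarrow> complex) \<Rightarrow> (real^'d \<Rightarrow> complex) \<Rightarrow> (real^'d) \<times> (real^'d) \<Rightarrow> complex"
where
  "cross_wigner A f \<phi> = (\<lambda>(z, \<xi>).
     LINT t|lborel. f (z + A *v t - t) * \<phi> (z + A *v t) * exp (\<i> * of_real (t \<bullet> \<xi>)))"

definition Op :: "real^'d^'d \<Rightarrow> (((real^'d) \<times> (real^'d) \<Rightarrow> complex) \<Rightarrow> complex) \<Rightarrow>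
    (real^'d \<Rightarrow> complex) \<Rightarrow> (real^'d \<Rightarrow> complex) \<Rightarrow> complex" where
  "Op A a = (\<lambda>f\<in>Sigma1. \<lambda>\<phi>\<in>Sigma1.
     a (cross_wigner A f \<phi>) / of_real ((2 * pi) ^ CARD('d)))"

text \<open>The embeddings \<open>\<Sigma>\<^sub>1 \<subseteq> L\<^sup>2 \<subseteq> \<Sigma>\<^sub>1'\<close> are \<^const>\<open>abs_L2\<close> and the following.\<close>

lift_definition L2_functional :: "'a::euclidean_space L2 \<Rightarrow> ('a \<Rightarrow> complex) \<Rightarrow> complex"
  is "\<lambda>u. \<lambda>\<phi>\<in>Sigma1. LINT x|lborel. u x * \<phi> x"
proof -
  fix u v :: "'a \<Rightarrow> complex"
  assume uv: "L2_rel u v"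
  have "(LINT x|lborel. u x * \<phi> x) = (LINT x|lborel. v x * \<phi> x)" if "\<phi> \<in> Sigma1" for \<phi>
  proof (rule integral_cong_AE)
    have "foldr partial [] \<phi> differentiable (at x)" for x
      using that unfolding Sigma1_def smooth_def by blast
    then have "continuous_on UNIV \<phi>"
      by (auto intro!: continuous_at_imp_continuous_on differentiable_imp_continuous_within)
    then have "\<phi> \<in> borel_measurable lborel"
      by (simp add: borel_measurable_continuous_onI)
    then show "(\<lambda>x. u x * \<phi> x) \<in> borel_measurable lborel"
        "(\<lambda>x. v x * \<phi> x) \<in> borel_measurable lborel"
      using uv by (auto simp: L2_rel_def square_integrable_def)
    show "AE x in lborel. u x * \<phi> x = v x * \<phi> x"
      using uv by (auto simp: L2_rel_def elim: eventually_mono)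
  qed
  then show "(\<lambda>\<phi>\<in>Sigma1. LINT x|lborel. u x * \<phi> x) = (\<lambda>\<phi>\<in>Sigma1. LINT x|lborel. v x * \<phi> x)"
    by (auto simp: restrict_def)
qed

definition L2_restrict :: "('a::euclidean_space L2 \<Rightarrow> 'a L2) \<Rightarrow>
    ('a \<Rightarrow> complex) \<Rightarrow> ('a \<Rightarrow> complex) \<Rightarrow> complex" where
  "L2_restrict T = (\<lambda>f\<in>Sigma1. L2_functional (T (abs_L2 f)))"

text \<open>The symbol class \<open>s\<^bsub>p,A\<^esub>\<close>.\<close>

definition symbol_class ::
  "schatten_index \<Rightarrow> real^'d^'d \<Rightarrow> (((real^'d) \<times> (real^'d) \<Rightarrow> complex) \<Rightarrow> complex) set"
where
  "symbol_class p A = {a \<in> Sigma1_dual. \<exists>T\<in>schatten_class p. L2_restrict T = Op A a}"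

text \<open>The composition of two operators from \<open>\<Sigma>\<^sub>1\<close> to \<open>\<Sigma>\<^sub>1'\<close> which extend to bounded operators on
  \<open>L\<^sup>2\<close>; the bounded extensions are unique, because \<open>\<Sigma>\<^sub>1\<close> is dense in \<open>L\<^sup>2\<close>.\<close>

definition L2_extension :: "(('a::euclidean_space \<Rightarrow> complex) \<Rightarrow> ('a \<Rightarrow> complex) \<Rightarrow> complex) \<Rightarrow>
    'a L2 \<Rightarrow> 'a L2" where
  "L2_extension S = (THE T. T \<in> schatten_class Infty \<and> L2_restrict T = S)"

definition op_comp (infixr "\<circ>\<^sub>L" 55) where
  "S1 \<circ>\<^sub>L S2 = L2_restrict (L2_extension S1 \<circ> L2_extension S2)"

text \<open>\<open>Op\<^sub>A\<close> is a bijection from \<open>\<Sigma>\<^sub>1'(\<real>\<^sup>2\<^sup>d)\<close> onto the continuous linear operators from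
  \<open>\<Sigma>\<^sub>1(\<real>\<^sup>d)\<close> to \<open>\<Sigma>\<^sub>1'(\<real>\<^sup>d)\<close>; the product is its inverse applied to the composition.\<close>

definition symbol_product :: "real^'d^'d \<Rightarrow> (((real^'d) \<times> (real^'d) \<Rightarrow> complex) \<Rightarrow> complex) \<Rightarrow>
    (((real^'d) \<times> (real^'d) \<Rightarrow> complex) \<Rightarrow> complex) \<Rightarrow>
    ((real^'d) \<times> (real^'d) \<Rightarrow> complex) \<Rightarrow> complex" where
  "symbol_product A a b = the_inv_into Sigma1_dual (Op A) (Op A a \<circ>\<^sub>L Op A b)"

definition symbol_set_product ::
  "real^'d^'d \<Rightarrow> (((real^'d) \<times> (real^'d) \<Rightarrow> complex) \<Rightarrow> complex) set \<Rightarrow>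
    (((real^'d) \<times> (real^'d) \<Rightarrow> complex) \<Rightarrow> complex) set \<Rightarrow>
    (((real^'d) \<times> (real^'d) \<Rightarrow> complex) \<Rightarrow> complex) set" where
  "symbol_set_product A E F = {symbol_product A a b |a b. a \<in> E \<and> b \<in> F}"

end

theory Submission
  imports Defs "HOL-Complex_Analysis.Complex_Analysis"
begin

text \<open>The inclusion of \<open>s\<^bsub>p\<^esub> # s\<^bsub>\<infinity>\<^esub>\<close> in \<open>s\<^bsub>p\<^esub>\<close> is the ideal property of the Schatten classes. Conversely, an
  operator \<open>T\<close> in \<open>I\<^bsub>p\<^esub>\<close> is compact and has a singular value decomposition with singular values
  \<open>s i\<close>. These factor as \<open>s i = t i * \<mu> i\<close>, where \<open>t\<close> decreases and is still in \<open>\<ell>\<^sup>p\<close> (or tends to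
  zero, if \<open>p = \<sharp>\<close>) and \<open>\<mu>\<close> decreases to zero, so that \<open>T\<close> is the product of a diagonal operator
  in \<open>I\<^bsub>p\<^esub>\<close> and a compact one.

  In order to pass from operators to symbols, one needs that \<open>Op\<^sub>A\<close> is injective and that its range
  contains the bounded operators. The functions in \<open>\<Sigma>\<^sub>1\<close> are the restrictions to real arguments of
  the entire functions which are \<open>O(exp (- R |x|))\<close> in the tube \<open>|y| \<le> R\<close>, for every \<open>R\<close>; in this
  form \<open>\<Sigma>\<^sub>1\<close> is visibly stable under partial Fourier transformation. Therefore the cross Wigner
  transformation factors through automorphisms of \<open>\<Sigma>\<^sub>1\<close>. Injectivity follows because a continuous
  functional on \<open>\<Sigma>\<^sub>1\<close> that annihilates all translates of narrow Gaussians, which are tensor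
  products, is zero. The symbol of a bounded operator \<open>T\<close> is obtained by letting \<open>T\<close> act under the
  integral sign in a Fourier expansion of the test function.\<close>

section \<open>Entire functions with exponential decay in tubes\<close>

text \<open>The product of symbols is built from a definite description of an L2 extension and from
  an inverse of \<open>Op A\<close>, so it cannot be evaluated before extensions are known to be
  unique; this takes the density of \<open>Sigma1\<close> in L2. The compactness arguments in turn
  take the completeness of L2. Entire functions enter because bounds by
  \<open>h ^ k * fact k\<close> for every \<open>h\<close> give Taylor series that converge
  everywhere, and the same bounds for powers of \<open>x\<close> sum to
  \<open>exp (R * norm x)\<close>. Holomorphy on complex lines in real directions is enough:
  Cauchy's estimates on these lines, together with additivity of the directional derivative, replace
  the theory of several complex variables. The kernel of a bounded operator is in general only a
  distribution, and exponentials are not in L2; hence the expansion uses exponentials divided by a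
  growing entire weight, which is multiplied onto the test function instead. On the operator side
  monotonicity is the obstacle: for decreasing coefficients the next coefficient bounds the error of
  truncating a diagonal operator, and this bounds its singular values.\<close>

text \<open>A function \<open>F\<close> on complexified Euclidean space is given as a function of real and imaginary part,
  \<open>F x y\<close> standing for the value at \<open>x + iy\<close>. It is required to be holomorphic only on the complex
  lines in real directions.\<close>

definition cline :: "('a::euclidean_space \<Rightarrow> 'a \<Rightarrow> complex) \<Rightarrow> 'a \<Rightarrow> 'a \<Rightarrow> 'a \<Rightarrow> complex \<Rightarrow> complex" where
  "cline F x y v z = F (x + Re z *\<^sub>R v) (y + Im z *\<^sub>R v)"

definition line_holomorphic :: "('a::euclidean_space \<Rightarrow> 'a \<Rightarrow> complex) \<Rightarrow> bool" where
  "line_holomorphic F \<longleftrightarrow> (\<forall>x y v. cline F x y v holomorphic_on UNIV)"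

text \<open>One number \<open>R\<close> measures both the width of the tube and the rate of decay,
  so that the seminorms form a scale indexed by \<open>R\<close> alone. For negative
  \<open>R\<close> the condition is void.\<close>

definition tube :: "real \<Rightarrow> real \<Rightarrow> ('a::euclidean_space \<Rightarrow> 'a \<Rightarrow> complex) \<Rightarrow> bool" where
  "tube R C F \<longleftrightarrow> (\<forall>x y. norm y \<le> R \<longrightarrow> cmod (F x y) \<le> C * exp (- (R * norm x)))"

definition entire :: "('a::euclidean_space \<Rightarrow> 'a \<Rightarrow> complex) \<Rightarrow> bool" where
  "entire F \<longleftrightarrow> line_holomorphic F \<and> (\<forall>R. \<exists>C. tube R C F)"

definition dirder :: "'a \<Rightarrow> ('a::euclidean_space \<Rightarrow> 'a \<Rightarrow> complex) \<Rightarrow> 'a \<Rightarrow> 'a \<Rightarrow> complex" where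
  "dirder v F x y = deriv (cline F x y v) 0"

lemma line_holomorphicD: "line_holomorphic F \<Longrightarrow> cline F x y v holomorphic_on S"
  unfolding line_holomorphic_def by (blast intro: holomorphic_on_subset)

lemma cline_0 [simp]: "cline F x y v 0 = F x y"
  and cline_1: "cline F x y v 1 = F (x + v) y"
  and cline_real: "cline F x y v (of_real t) = F (x + t *\<^sub>R v) y"
  by (simp_all add: cline_def)

lemma cline_shift: "cline F (x + Re w *\<^sub>R v) (y + Im w *\<^sub>R v) v z = cline F x y v (w + z)"
  by (simp add: cline_def algebra_simps)

lemma cline_shift_fun:
  "cline F (x + Re w *\<^sub>R v) (y + Im w *\<^sub>R v) v = (\<lambda>z. cline F x y v (w + z))"
  "cline F (x + t *\<^sub>R v) y v = (\<lambda>z. cline F x y v (of_real t + z))"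
  using cline_shift[of F x w v y] cline_shift[of F x "of_real t" v y] by auto

lemma cline_scale: "cline F x y (c *\<^sub>R v) z = cline F x y v (of_real c * z)"
  by (simp add: cline_def algebra_simps)

lemma hol_local_derivative: "line_holomorphic F \<Longrightarrow> (cline F x y v has_field_derivative deriv (cline F x y v) z) (at z)"
  by (rule holomorphic_derivI[where S=UNIV]) (auto simp: line_holomorphicD)

lemma tube_nonneg: assumes "tube R C F" "0 \<le> R" shows "0 \<le> C"
proof -
  have "0 \<le> cmod (F 0 0)" "cmod (F 0 0) \<le> C * exp (- (R * norm 0))"
    using assms unfolding tube_def by (force, metis norm_zero)
  then show ?thesis by (metis mult_zero_right norm_zero exp_zero minus_zero mult.right_neutral order_trans)
qed

lemma tube_mono: "tube R C F \<Longrightarrow> C \<le> C' \<Longrightarrow> tube R C' F"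
  unfolding tube_def by (meson exp_ge_zero mult_right_mono order_trans)

lemma tube_antimono: assumes "tube R C F" "R' \<le> R" "0 \<le> R" shows "tube R' C F"
  unfolding tube_def
proof (intro allI impI)
  fix x y :: 'a assume "norm y \<le> R'"
  then have "cmod (F x y) \<le> C * exp (- (R * norm x))" using assms unfolding tube_def by auto
  also have "\<dots> \<le> C * exp (- (R' * norm x))"
    using tube_nonneg[OF assms(1,3)] assms(2) by (intro mult_left_mono) (auto intro: mult_right_mono)
  finally show "cmod (F x y) \<le> C * exp (- (R' * norm x))" .
qed

text \<open>A step of length at most \<open>r\<close> along \<open>v\<close> uses up
  \<open>r * norm v\<close> of the width of the tube; by the triangle inequality it weakens the
  decay by the last factor.\<close>

lemma cline_bound:
  assumes "tube R C F" "norm y + r * norm v \<le> R" "cmod z \<le> r"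
  shows "cmod (cline F x y v z) \<le> C * exp (- (R * norm x)) * exp (R * (r * norm v))"
proof -
  have r: "0 \<le> r" using assms(3) norm_ge_zero order_trans by blast
  then have R: "0 \<le> R" using assms(2) by (smt (verit) mult_nonneg_nonneg norm_ge_zero)
  have i: "norm (Im z *\<^sub>R v) \<le> r * norm v" "norm (Re z *\<^sub>R v) \<le> r * norm v"
    using abs_Im_le_cmod[of z] abs_Re_le_cmod[of z] assms(3) by (auto intro!: mult_right_mono)
  have "norm (y + Im z *\<^sub>R v) \<le> R"
    using i norm_triangle_ineq[of y "Im z *\<^sub>R v"] assms(2) by linarith
  then have "cmod (cline F x y v z) \<le> C * exp (- (R * norm (x + Re z *\<^sub>R v)))"
    using assms(1) by (simp add: tube_def cline_def)
  also have "\<dots> \<le> C * exp (- (R * norm x) + R * (r * norm v))"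
  proof -
    have "norm x \<le> norm (x + Re z *\<^sub>R v) + r * norm v"
      using i norm_triangle_ineq4[of "x + Re z *\<^sub>R v" "Re z *\<^sub>R v"] by simp
    then have "R * norm x \<le> R * norm (x + Re z *\<^sub>R v) + R * (r * norm v)"
      using R by (metis distrib_left mult_left_mono)
    then show ?thesis
      using tube_nonneg[OF assms(1) R] by (intro mult_left_mono) auto
  qed
  finally show ?thesis by (simp only: exp_add mult.assoc)
qed

text \<open>Cauchy's inequality on a circle whose radius \<open>r\<close> stays free: it becomes
  \<open>1 / norm v\<close> in the Taylor estimates and \<open>1 / h\<close> in the estimate of
  \<open>Sigma1_norm\<close>.\<close>

lemma higher_deriv_cline_bound:
  assumes "line_holomorphic F" "tube R C F" "norm y + r * norm v \<le> R" "0 < r"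
  shows "cmod ((deriv ^^ k) (cline F x y v) 0)
           \<le> fact k * (C * exp (- (R * norm x)) * exp (R * (r * norm v))) / r ^ k"
proof (rule Cauchy_inequality)
  show "cline F x y v holomorphic_on ball 0 r" using assms(1) by (rule line_holomorphicD)
  show "continuous_on (cball 0 r) (cline F x y v)"
    using assms(1) by (intro holomorphic_on_imp_continuous_on line_holomorphicD)
  show "cmod (cline F x y v z) \<le> C * exp (- (R * norm x)) * exp (R * (r * norm v))"
    if "cmod (0 - z) = r" for z
    using that by (intro cline_bound assms) auto
qed fact

lemma deriv_comp_add: 
  fixes g :: "complex \<Rightarrow> complex"
  assumes "g holomorphic_on UNIV" shows "deriv (\<lambda>z. g (w + z)) z = deriv g (w + z)"
proof (rule DERIV_imp_deriv)
  have "(g has_field_derivative deriv g (w + z)) (at (w + z))"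
    using assms by (rule holomorphic_derivI) auto
  then show "((\<lambda>z. g (w + z)) has_field_derivative deriv g (w + z)) (at z)"
    using DERIV_shift[of g "deriv g (w+z)" z w] by (simp add: add.commute)
qed

lemma higher_deriv_comp_add:
  fixes g :: "complex \<Rightarrow> complex"
  assumes "g holomorphic_on UNIV" shows "(deriv ^^ k) (\<lambda>z. g (w + z)) z = (deriv ^^ k) g (w + z)"
proof (induction k arbitrary: z)
  case (Suc k)
  have "(deriv ^^ Suc k) (\<lambda>z. g (w + z)) z = deriv (\<lambda>z. (deriv ^^ k) g (w + z)) z"
    using ext[of "\<lambda>z. (deriv ^^ k) (\<lambda>z. g (w + z)) z", OF Suc.IH] by simp
  also have "\<dots> = deriv ((deriv ^^ k) g) (w + z)"
    by (rule deriv_comp_add) (use assms in \<open>auto intro: holomorphic_higher_deriv\<close>)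
  finally show ?case by simp
qed simp

lemma cline_dirder:
  assumes "line_holomorphic F" shows "cline (dirder v F) x y v = deriv (cline F x y v)"
proof
  fix z
  show "cline (dirder v F) x y v z = deriv (cline F x y v) z"
    using deriv_comp_add[OF line_holomorphicD[OF assms], of x y v z 0]
    by (simp add: cline_def[of "dirder v F"] dirder_def cline_shift_fun(1))
qed

text \<open>Cauchy's inequality with radius \<open>1 / norm v\<close> displaces the imaginary part
  by at most 1, whatever \<open>v\<close> is, and its denominator produces
  \<open>(norm v)\<^sup>2\<close>. The constant depends neither on \<open>x\<close> nor on
  \<open>v\<close>, so difference quotients converge uniformly.\<close>

lemma taylor1_tube:
  assumes "line_holomorphic F" "tube R C F" "norm y + 1 \<le> R"
  shows "cmod (F (x + v) y - F x y - dirder v F x y) \<le> 2 * C * exp R * (norm v)\<^sup>2"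
proof (cases "v = 0")
  case True
  then have "cline F x y v = (\<lambda>z. F x y)" by (auto simp: cline_def)
  then show ?thesis using True by (simp add: dirder_def)
next
  case False
  define g where "g = cline F x y v"
  have R: "0 \<le> R" using assms(3) norm_ge_zero[of y] by linarith
  have C: "0 \<le> C" using assms(2) R by (rule tube_nonneg)
  have g: "g holomorphic_on UNIV" unfolding g_def using assms(1) by (rule line_holomorphicD)
  have b: "cmod ((deriv ^^ 2) g z) \<le> 2 * C * exp R * (norm v)\<^sup>2" if "z \<in> \<real>" for z
  proof -
    from that obtain t where t: "z = of_real t" by (rule Reals_cases)
    have "(deriv ^^ 2) g z = (deriv ^^ 2) (cline F (x + t *\<^sub>R v) y v) 0"
      using higher_deriv_comp_add[OF g, of 2 z 0] unfolding g_def t cline_shift_fun by simp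
    also have "cmod \<dots> \<le> fact 2 * (C * exp (- (R * norm (x + t *\<^sub>R v)))
        * exp (R * (1 / norm v * norm v))) / (1 / norm v) ^ 2"
      using False assms by (intro higher_deriv_cline_bound) auto
    also have "\<dots> = 2 * C * exp R * (norm v)\<^sup>2 * exp (- (R * norm (x + t *\<^sub>R v)))"
      using False by (simp add: power_divide)
    also have "\<dots> \<le> 2 * C * exp R * (norm v)\<^sup>2 * 1"
      using C R by (intro mult_left_mono) auto
    finally show ?thesis by simp
  qed
  have "cmod ((deriv ^^ 0) g 1 - (\<Sum>i\<le>1. (deriv ^^ i) g 0 * (1 - 0) ^ i / fact i))
      \<le> (2 * C * exp R * (norm v)\<^sup>2) * cmod (1 - 0) ^ Suc 1 / fact 1"
  proof (rule complex_Taylor[where S="closed_segment 0 1"])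
    fix i z assume "z \<in> closed_segment 0 (1::complex)"
    show "((deriv ^^ i) g has_field_derivative (deriv ^^ Suc i) g z) (at z within closed_segment 0 1)"
      using holomorphic_derivI[OF holomorphic_higher_deriv[OF g open_UNIV, of i] open_UNIV, of z "closed_segment 0 1"]
      by simp
  next
    fix z assume "z \<in> closed_segment 0 (1::complex)"
    then have "z \<in> \<real>" by (auto simp: closed_segment_def scaleR_conv_of_real)
    from b[OF this] show "cmod ((deriv ^^ Suc 1) g z) \<le> 2 * C * exp R * (norm v)\<^sup>2" by (simp add: numeral_2_eq_2)
  qed auto
  then show ?thesis by (simp add: g_def dirder_def cline_1 algebra_simps)
qed

text \<open>The circle of radius \<open>1 / norm v\<close> again, now for the first derivative. The
  factor \<open>exp (- (R * norm x))\<close> is kept because differences of translates will have to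
  be bounded in tubes themselves.\<close>

lemma lipschitz_tube:
  assumes "line_holomorphic F" "tube R C F" "norm y + 1 \<le> R"
  shows "cmod (F (x + v) y - F x y) \<le> norm v * (C * exp (R * (norm v + 1)) * exp (- (R * norm x)))"
proof (cases "v = 0")
  case False
  define g where "g = cline F x y v"
  have R: "0 \<le> R" using assms(3) norm_ge_zero[of y] by linarith
  have C: "0 \<le> C" using assms(2) R by (rule tube_nonneg)
  have g: "g holomorphic_on UNIV" unfolding g_def using assms(1) by (rule line_holomorphicD)
  have "cmod (g 1 - g 0) \<le> (norm v * (C * exp (R * (norm v + 1)) * exp (- (R * norm x)))) * cmod (1 - 0)"
  proof (rule field_differentiable_bound[where S="closed_segment 0 1"])
    fix z :: complex assume "z \<in> closed_segment 0 1"
    then obtain t where t: "z = of_real t" "0 \<le> t" "t \<le> 1" by (auto simp: closed_segment_def scaleR_conv_of_real)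
    show "(g has_field_derivative deriv g z) (at z within closed_segment 0 1)"
      using g by (intro holomorphic_derivI) auto
    have "deriv g z = deriv (cline F (x + t *\<^sub>R v) y v) 0"
      using deriv_comp_add[OF g, of z 0] unfolding g_def t cline_shift_fun by simp
    also have "cmod \<dots> \<le> fact 1 * (C * exp (- (R * norm (x + t *\<^sub>R v)))
        * exp (R * (1 / norm v * norm v))) / (1 / norm v) ^ 1"
      using False assms higher_deriv_cline_bound[of F R C y "1 / norm v" v 1] by auto
    also have "\<dots> = norm v * (C * (exp R * exp (- (R * norm (x + t *\<^sub>R v)))))"
      using False by simp
    also have "\<dots> \<le> norm v * (C * (exp (R * (norm v + 1)) * exp (- (R * norm x))))"
    proof -
      have "norm x \<le> norm (x + t *\<^sub>R v) + norm (t *\<^sub>R v)"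
        using norm_triangle_ineq4[of "x + t *\<^sub>R v" "t *\<^sub>R v"] by simp
      moreover have "norm (t *\<^sub>R v) \<le> norm v" using t by (simp add: mult_left_le_one_le)
      ultimately have "R * norm x \<le> R * (norm (x + t *\<^sub>R v) + norm v)" using R by (intro mult_left_mono) auto
      then show ?thesis using C by (intro mult_left_mono) (auto simp flip: exp_add simp: algebra_simps)
    qed
    finally show "cmod (deriv g z) \<le> norm v * (C * exp (R * (norm v + 1)) * exp (- (R * norm x)))" by (simp add: mult.assoc)
  qed auto
  then show ?thesis by (simp add: g_def cline_1)
qed simp

lemma dirder_scale:
  assumes "line_holomorphic F" shows "dirder (c *\<^sub>R v) F x y = c *\<^sub>R dirder v F x y"
proof -
  have "((\<lambda>z. cline F x y v (of_real c * z)) has_field_derivative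
      deriv (cline F x y v) (of_real c * 0) * of_real c) (at 0)"
    using hol_local_derivative[OF assms, of x y v "of_real c * 0"]
    by (rule DERIV_chain2) (auto intro!: derivative_eq_intros)
  moreover have "cline F x y (c *\<^sub>R v) = (\<lambda>z. cline F x y v (of_real c * z))"
    by (auto simp: cline_scale)
  ultimately show ?thesis
    by (simp add: dirder_def DERIV_imp_deriv scaleR_conv_of_real mult.commute)
qed

text \<open>On a complex line in direction \<open>u\<close> the difference quotients in direction
  \<open>v\<close> are holomorphic, being built from two translates of \<open>F\<close>, and
  \<open>taylor1_tube\<close> makes them converge locally uniformly. Weierstrass' theorem thus takes
  the place of joint holomorphy in both directions.\<close>

lemma hol_dirder:
  assumes "entire F" shows "line_holomorphic (dirder v F)"
  unfolding line_holomorphic_def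
proof (intro allI)
  fix x y u
  have F: "line_holomorphic F" using assms by (simp add: entire_def)
  define f where "f n z = of_nat (Suc n) * (cline F (x + (1 / Suc n) *\<^sub>R v) y u z - cline F x y u z)" for n z
  show "cline (dirder v F) x y u holomorphic_on UNIV"
  proof (rule holomorphic_uniform_sequence[where f=f])
    show "f n holomorphic_on UNIV" for n
      unfolding f_def by (intro holomorphic_intros line_holomorphicD F)
    fix z0 :: complex
    define R where "R = norm y + (cmod z0 + 1) * norm u + 1"
    obtain C where C: "tube R C F" using assms by (auto simp: entire_def)
    define K where "K = 2 * C * exp R * (norm v)\<^sup>2"
    have err: "cmod (f n z - cline (dirder v F) x y u z) \<le> K * (1 / Suc n)" if "z \<in> cball z0 1" for n z
    proof -
      define x' where "x' = x + Re z *\<^sub>R u"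
      define y' where "y' = y + Im z *\<^sub>R u"
      have "cmod z \<le> cmod z0 + 1" using that norm_triangle_ineq2[of z z0] by (simp add: dist_norm norm_minus_commute)
      then have "\<bar>Im z\<bar> * norm u \<le> (cmod z0 + 1) * norm u"
        using abs_Im_le_cmod[of z] by (intro mult_right_mono) auto
      then have "norm y' + 1 \<le> R"
        using norm_triangle_ineq[of y "Im z *\<^sub>R u"] by (simp add: y'_def R_def)
      from taylor1_tube[OF F C this, of x' "(1 / Suc n) *\<^sub>R v"]
      have t: "cmod (F (x' + (1 / Suc n) *\<^sub>R v) y' - F x' y' - (1 / Suc n) *\<^sub>R dirder v F x' y') \<le> K * (1 / Suc n)\<^sup>2"
        by (simp only: dirder_scale[OF F]) (simp add: K_def power_divide)
      have "f n z - cline (dirder v F) x y u z =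
         of_nat (Suc n) * (F (x' + (1 / Suc n) *\<^sub>R v) y' - F x' y' - (1 / Suc n) *\<^sub>R dirder v F x' y')"
        unfolding f_def x'_def y'_def cline_def
        by (simp add: algebra_simps scaleR_conv_of_real del: of_nat_Suc)
      then have "cmod (f n z - cline (dirder v F) x y u z) \<le> real (Suc n) * (K * (1 / Suc n)\<^sup>2)"
        using t by (simp add: norm_mult del: of_nat_Suc)
      then show ?thesis by (simp add: power2_eq_square del: of_nat_Suc)
    qed
    have "uniform_limit (cball z0 1) f (cline (dirder v F) x y u) sequentially"
    proof (rule uniform_limitI)
      fix e :: real assume "0 < e"
      have "(\<lambda>n. K * (1 / Suc n)) \<longlonglongrightarrow> K * 0"
        by (intro tendsto_mult tendsto_const LIMSEQ_Suc[OF lim_1_over_n])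
      then have "\<forall>\<^sub>F n in sequentially. K * (1 / Suc n) < e"
        using \<open>0 < e\<close> by (intro order_tendstoD(2)) auto
      then show "\<forall>\<^sub>F n in sequentially. \<forall>z\<in>cball z0 1. dist (f n z) (cline (dirder v F) x y u z) < e"
        
        by eventually_elim (auto simp: dist_norm simp del: of_nat_Suc intro: le_less_trans[OF err])
    qed
    then show "\<exists>d>0. cball z0 d \<subseteq> UNIV \<and> uniform_limit (cball z0 d) f (cline (dirder v F) x y u) sequentially"
      by (intro exI[of _ 1]) auto
  qed simp
qed

lemma ent_dirder:
  assumes "entire F" shows "entire (dirder v F)"
  unfolding entire_def
proof (intro conjI allI)
  show "line_holomorphic (dirder v F)" by (rule hol_dirder) fact
  fix R
  obtain C where C: "tube (R + norm v) C F" using assms by (auto simp: entire_def)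
  have b: "cmod (dirder v F x y) \<le> fact 1 * (C * exp (- ((R + norm v) * norm x)) * exp ((R + norm v) * (1 * norm v))) / 1 ^ 1"
    if "norm y \<le> R" for x y
    using that higher_deriv_cline_bound[of F "R + norm v" C y 1 v 1 x] C assms by (simp add: dirder_def entire_def)
  have e: "exp (- ((R + norm v) * norm x)) \<le> exp (- (R * norm x))" for x :: 'a
    by (simp add: distrib_right)
  have "cmod (dirder v F x y) \<le> (C * exp ((R + norm v) * norm v)) * exp (- (R * norm x))"
    if "norm y \<le> R" for x y
  proof -
    have "0 \<le> R + norm v" using that by (meson add_nonneg_nonneg norm_ge_zero order_trans)
    then have "0 \<le> C * exp ((R + norm v) * norm v)" using tube_nonneg[OF C] by simp
    from mult_left_mono[OF e[of x] this] show ?thesis using b[OF that, of x] by (simp add: mult_ac)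
  qed
  then show "\<exists>C. tube R C (dirder v F)" unfolding tube_def by blast
qed

lemma ent_dirder_power: "entire F \<Longrightarrow> entire ((dirder v ^^ k) F)"
  by (induction k) (auto intro: ent_dirder)

lemma dirder_power:
  assumes "entire F" shows "cline ((dirder v ^^ k) F) x y v = (deriv ^^ k) (cline F x y v)"
proof (induction k)
  case (Suc k)
  have "line_holomorphic ((dirder v ^^ k) F)" using ent_dirder_power[OF assms] by (simp add: entire_def)
  then show ?case using Suc by (simp add: cline_dirder)
qed simp

lemma tube_dirder_power:
  assumes "entire F" "tube (R + r * norm v) C F" "0 < r" "0 \<le> R"
  shows "tube R (C * exp ((R + r * norm v) * (r * norm v)) * fact k / r ^ k) ((dirder v ^^ k) F)"
  unfolding tube_def
proof (intro allI impI)
  fix x y :: 'a assume y: "norm y \<le> R"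
  define R' where "R' = R + r * norm v"
  have C: "0 \<le> C" using assms by (intro tube_nonneg[OF assms(2)]) auto
  have "cmod ((dirder v ^^ k) F x y) = cmod ((deriv ^^ k) (cline F x y v) 0)"
    by (simp flip: dirder_power[OF assms(1)])
  also have "\<dots> \<le> fact k * (C * exp (- (R' * norm x)) * exp (R' * (r * norm v))) / r ^ k"
    using assms y by (intro higher_deriv_cline_bound) (auto simp: entire_def R'_def)
  also have "\<dots> \<le> fact k * (C * exp (- (R * norm x)) * exp (R' * (r * norm v))) / r ^ k"
    using C assms by (intro divide_right_mono mult_left_mono mult_right_mono)
      (auto simp: R'_def distrib_right)
  finally show "cmod ((dirder v ^^ k) F x y)
      \<le> C * exp ((R + r * norm v) * (r * norm v)) * fact k / r ^ k * exp (- (R * norm x))"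
    by (simp add: R'_def mult_ac)
qed

text \<open>The increment \<open>t *\<^sub>R (v + w)\<close> is taken once in a single step and once
  as a step along \<open>v\<close> followed by a step along \<open>w\<close>. The first-order
  expansions agree up to \<open>O(t\<^sup>2)\<close>, where the Lipschitz bound for
  \<open>dirder w F\<close> moves the base point of the second step back to \<open>x\<close>;
  dividing by \<open>t\<close> leaves additivity.\<close>

lemma dirder_add:
  assumes "entire F" shows "dirder (v + w) F x y = dirder v F x y + dirder w F x y"
proof -
  have F: "line_holomorphic F" and F': "line_holomorphic (dirder w F)" using assms hol_dirder by (auto simp: entire_def)
  define R where "R = norm y + 1"
  obtain C where C: "tube R C F" using assms by (auto simp: entire_def)
  obtain C' where C': "tube R C' (dirder w F)" using ent_dirder[OF assms] by (auto simp: entire_def)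
  have R: "norm y + 1 \<le> R" "0 \<le> R" by (auto simp: R_def add_nonneg_nonneg)
  define K where "K = 2 * C * exp R"
  define L where "L = norm v * (C' * exp (R * (norm v + 1)))"
  define M where "M = K * (norm (v + w))\<^sup>2 + K * (norm v)\<^sup>2 + K * (norm w)\<^sup>2 + L"
  define D where "D = dirder (v + w) F x y - dirder v F x y - dirder w F x y"
  have C'0: "0 \<le> C'" using tube_nonneg[OF C' R(2)] .
  have tri: "cmod (a + b + c - d) \<le> A + B + E + G"
    if "cmod a \<le> A" "cmod b \<le> B" "cmod c \<le> E" "cmod d \<le> G" for a b c d A B E G
    using that norm_triangle_ineq[of a b] norm_triangle_ineq[of "a + b" c] norm_triangle_ineq4[of "a + b + c" d]
    by linarith
  have "cmod D \<le> M * (1 / Suc n)" for n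
  proof -
    define t where "t = 1 / real (Suc n)"
    have t: "0 < t" "t \<le> 1" by (auto simp: t_def)
    note T = taylor1_tube[OF F C R(1), folded K_def]
    have e1: "cmod (F (x + t *\<^sub>R (v + w)) y - F x y - t *\<^sub>R dirder (v + w) F x y) \<le> K * (norm (v + w))\<^sup>2 * t\<^sup>2"
      using T[of x "t *\<^sub>R (v + w)"] t by (simp only: dirder_scale[OF F]) (simp add: power_mult_distrib mult_ac)
    have e2: "cmod (F (x + t *\<^sub>R v) y - F x y - t *\<^sub>R dirder v F x y) \<le> K * (norm v)\<^sup>2 * t\<^sup>2"
      using T[of x "t *\<^sub>R v"] t by (simp only: dirder_scale[OF F]) (simp add: power_mult_distrib mult_ac)
    have e3: "cmod (F (x + t *\<^sub>R v + t *\<^sub>R w) y - F (x + t *\<^sub>R v) y - t *\<^sub>R dirder w F (x + t *\<^sub>R v) y) \<le> K * (norm w)\<^sup>2 * t\<^sup>2"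
      using T[of "x + t *\<^sub>R v" "t *\<^sub>R w"] t by (simp only: dirder_scale[OF F]) (simp add: power_mult_distrib mult_ac)
    have "cmod (dirder w F (x + t *\<^sub>R v) y - dirder w F x y)
      \<le> norm (t *\<^sub>R v) * (C' * exp (R * (norm (t *\<^sub>R v) + 1)) * exp (- (R * norm x)))"
      by (rule lipschitz_tube[OF F' C' R(1)])
    also have "\<dots> \<le> norm (t *\<^sub>R v) * (C' * exp (R * (norm v + 1)) * 1)"
      using t C'0 R by (intro mult_mono) (auto intro!: mult_left_mono simp: mult_left_le_one_le)
    finally have "cmod (dirder w F (x + t *\<^sub>R v) y - dirder w F x y) \<le> L * t"
      using t by (simp add: L_def mult_ac)
    then have e4: "cmod (t *\<^sub>R (dirder w F (x + t *\<^sub>R v) y - dirder w F x y)) \<le> L * t\<^sup>2"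
      using t by (simp add: power2_eq_square mult_left_mono mult.left_commute)
    have "t *\<^sub>R D = (F (x + t *\<^sub>R v) y - F x y - t *\<^sub>R dirder v F x y)
       + (F (x + t *\<^sub>R v + t *\<^sub>R w) y - F (x + t *\<^sub>R v) y - t *\<^sub>R dirder w F (x + t *\<^sub>R v) y)
       + (t *\<^sub>R (dirder w F (x + t *\<^sub>R v) y - dirder w F x y))
       - (F (x + t *\<^sub>R (v + w)) y - F x y - t *\<^sub>R dirder (v + w) F x y)"
      by (simp add: D_def scaleR_add_right scaleR_diff_right add.assoc)
    then have "cmod (t *\<^sub>R D) \<le> K * (norm v)\<^sup>2 * t\<^sup>2 + K * (norm w)\<^sup>2 * t\<^sup>2 + L * t\<^sup>2 + K * (norm (v + w))\<^sup>2 * t\<^sup>2"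
      using tri[OF e2 e3 e4 e1] by simp
    then have "t * cmod D \<le> t * (M * t)"
      using t by (simp add: M_def algebra_simps power2_eq_square)
    then show ?thesis using t by (simp only: mult_le_cancel_left_pos t_def)
  qed
  moreover have "(\<lambda>n. M * (1 / Suc n)) \<longlonglongrightarrow> M * 0"
    by (intro tendsto_mult tendsto_const LIMSEQ_Suc[OF lim_1_over_n])
  ultimately have "cmod D \<le> 0"
    by (intro LIMSEQ_le_const[of "\<lambda>n. M * (1 / Suc n)"]) auto
  then show ?thesis by (simp add: D_def algebra_simps)
qed

text \<open>Additivity and homogeneity of \<open>dirder\<close> supply the linear candidate, and the
  quadratic remainder of \<open>taylor1_tube\<close> is uniform in the direction.\<close>

lemma ent_has_derivative:
  assumes "entire F" shows "((\<lambda>x. F x 0) has_derivative (\<lambda>v. dirder v F x 0)) (at x)"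
proof -
  have F: "line_holomorphic F" using assms by (simp add: entire_def)
  obtain C where C: "tube 1 C F" using assms by (auto simp: entire_def)
  define K where "K = 2 * C * exp 1"
  have T: "cmod (F (x + v) 0 - F x 0 - dirder v F x 0) \<le> K * (norm v)\<^sup>2" for v
    using taylor1_tube[OF F C, of 0 x v] by (simp add: K_def)
  have "bounded_linear (\<lambda>v. dirder v F x 0)"
    unfolding linear_conv_bounded_linear[symmetric]
    by (rule linearI) (auto simp: dirder_add[OF assms] dirder_scale[OF F])
  moreover have "(\<lambda>h. norm (F (x + h) 0 - F x 0 - dirder h F x 0) / norm h) \<midarrow>0\<rightarrow> 0"
  proof (rule Lim_null_comparison)
    have "norm (norm (F (x + h) 0 - F x 0 - dirder h F x 0) / norm h) \<le> K * norm h" for h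
      using T[of h] by (cases "h = 0") (auto simp: divide_simps power2_eq_square mult_ac)
    then show "\<forall>\<^sub>F h in at 0. norm (norm (F (x + h) 0 - F x 0 - dirder h F x 0) / norm h) \<le> K * norm h"
      by simp
    show "((\<lambda>h. K * norm h) \<longlongrightarrow> 0) (at (0::'a))"
      by (rule tendsto_eq_intros refl | simp)+
  qed
  ultimately show ?thesis by (simp add: has_derivative_at)
qed

lemma partial_ent: "entire F \<Longrightarrow> partial v (\<lambda>x. F x 0) = (\<lambda>x. dirder v F x 0)"
  by (auto simp: partial_def frechet_derivative_at[OF ent_has_derivative, symmetric])

lemma foldr_partial_ent:
  assumes "entire F"
  shows "entire (foldr dirder bs F)" "foldr partial bs (\<lambda>x. F x 0) = (\<lambda>x. foldr dirder bs F x 0)"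
  using assms by (induction bs) (auto simp: ent_dirder partial_ent)

lemma partial_power_ent:
  assumes "entire F" shows "(partial v ^^ k) (\<lambda>x. F x 0) = (\<lambda>x. (dirder v ^^ k) F x 0)"
  by (induction k) (auto simp: partial_ent ent_dirder_power assms)

lemma smooth_ent: "entire F \<Longrightarrow> smooth (\<lambda>x. F x 0)"
  unfolding smooth_def foldr_partial_ent(2)
  using ent_has_derivative[OF foldr_partial_ent(1)] differentiable_def by blast


section \<open>From tube bounds to the seminorms of \<open>Sigma1\<close>\<close>

lemma power_le_fact_exp:
  fixes x :: real assumes "0 \<le> x" shows "x ^ n \<le> fact n * exp x"
proof -
  have "(\<Sum>k\<in>{n}. inverse (fact k) *\<^sub>R x ^ k) \<le> exp x"
    unfolding exp_def by (rule sum_le_suminf[OF summable_exp_generic]) (use assms in auto)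
  then show ?thesis by (simp add: field_simps)
qed

lemma basis_enum: "distinct (basis_enum :: 'a::euclidean_space list)" "set (basis_enum :: 'a list) = Basis"
  "length (basis_enum :: 'a list) = DIM('a)"
proof -
  have "\<exists>bs :: 'a list. distinct bs \<and> set bs = Basis"
    using finite_distinct_list[OF finite_Basis] by blast
  from someI_ex[OF this] have *: "distinct (basis_enum :: 'a list) \<and> set (basis_enum :: 'a list) = Basis"
    unfolding basis_enum_def .
  then show "distinct (basis_enum :: 'a list)" "set (basis_enum :: 'a list) = Basis" by auto
  then show "length (basis_enum :: 'a list) = DIM('a)" using distinct_card[of "basis_enum :: 'a list"] by simp
qed

text \<open>Each entry of the list takes \<open>r\<close> from the width of the tube. The quantity
  \<open>R + length bs * r\<close> is invariant under the induction step, so \<open>K\<close> is the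
  same factor for every entry.\<close>

lemma tube_iterated_dirder:
  fixes R r :: real
  assumes "entire F" "0 \<le> R" "0 < r" "\<forall>b\<in>set bs. norm b = 1" "tube (R + length bs * r) C F"
  defines "K \<equiv> exp ((R + length bs * r) * r)"
  shows "entire (foldr (\<lambda>b G. (dirder b ^^ \<beta> b) G) bs F) \<and>
    tube R (C * (\<Prod>b\<leftarrow>bs. K * fact (\<beta> b) / r ^ \<beta> b)) (foldr (\<lambda>b G. (dirder b ^^ \<beta> b) G) bs F)"
  using assms(2,4,5) unfolding K_def
proof (induction bs arbitrary: R)
  case Nil
  then show ?case using assms(1) by simp
next
  case (Cons b bs)
  define G where "G = foldr (\<lambda>b G. (dirder b ^^ \<beta> b) G) bs F"
  define K where "K = exp ((R + length (b # bs) * r) * r)"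
  define D where "D = C * (\<Prod>b\<leftarrow>bs. K * fact (\<beta> b) / r ^ \<beta> b)"
  have eq: "R + r + length bs * r = R + length (b # bs) * r" by (simp add: algebra_simps)
  have IH: "entire G" "tube (R + r) D G"
    using Cons.IH[of "R + r"] Cons.prems assms(3) unfolding eq G_def D_def K_def by auto
  have D: "0 \<le> D" using tube_nonneg[OF IH(2)] Cons.prems assms by auto
  have "tube R (D * exp ((R + r * norm b) * (r * norm b)) * fact (\<beta> b) / r ^ \<beta> b) ((dirder b ^^ \<beta> b) G)"
    by (rule tube_dirder_power) (use IH Cons.prems assms in auto)
  moreover have "D * exp ((R + r * norm b) * (r * norm b)) * fact (\<beta> b) / r ^ \<beta> b
     \<le> D * K * fact (\<beta> b) / r ^ \<beta> b"
    using D Cons.prems assms(3)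
    by (intro divide_right_mono mult_right_mono mult_left_mono) (auto simp: K_def algebra_simps)
  ultimately have "tube R (D * K * fact (\<beta> b) / r ^ \<beta> b) ((dirder b ^^ \<beta> b) G)"
    by (rule tube_mono)
  moreover have "entire ((dirder b ^^ \<beta> b) G)" using IH(1) by (rule ent_dirder_power)
  ultimately show ?case by (simp add: D_def G_def K_def mult_ac)
qed

lemma foldr_partial_powers_ent:
  assumes "entire F"
  shows "entire (foldr (\<lambda>b G. (dirder b ^^ \<beta> b) G) bs F) \<and> foldr (\<lambda>b g. (partial b ^^ \<beta> b) g) bs (\<lambda>x. F x 0)
    = (\<lambda>x. foldr (\<lambda>b G. (dirder b ^^ \<beta> b) G) bs F x 0)"
  using assms by (induction bs) (auto simp: partial_power_ent ent_dirder_power)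

lemma mfact_pos: "0 < mfact \<alpha>"
  by (auto simp: mfact_def intro: prod_pos)

text \<open>A single term of the exponential series bounds each factor
  \<open>\<bar>x \<bullet> b\<bar> ^ \<alpha> b\<close>; multiplying over the basis adds up the
  rates.\<close>

lemma mpow_le:
  fixes x :: "'a::euclidean_space" and r :: real
  assumes "0 < r"
  shows "\<bar>mpow x \<alpha>\<bar> \<le> mfact \<alpha> / r ^ mabs \<alpha> * exp (DIM('a) * r * norm x)"
proof -
  have b: "\<bar>x \<bullet> b\<bar> ^ \<alpha> b \<le> fact (\<alpha> b) / r ^ \<alpha> b * exp (r * norm x)" if "b \<in> Basis" for b
  proof -
    have "(r * \<bar>x \<bullet> b\<bar>) ^ \<alpha> b \<le> fact (\<alpha> b) * exp (r * \<bar>x \<bullet> b\<bar>)"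
      using assms by (intro power_le_fact_exp) auto
    also have "\<dots> \<le> fact (\<alpha> b) * exp (r * norm x)"
      using assms Basis_le_norm[OF that, of x] by simp
    finally show ?thesis using assms by (simp add: power_mult_distrib field_simps)
  qed
  have "\<bar>mpow x \<alpha>\<bar> = (\<Prod>b\<in>Basis. \<bar>x \<bullet> b\<bar> ^ \<alpha> b)"
    by (simp add: mpow_def abs_prod power_abs)
  also have "\<dots> \<le> (\<Prod>b\<in>Basis. fact (\<alpha> b) / r ^ \<alpha> b * exp (r * norm x))"
    using b by (intro prod_mono) auto
  also have "\<dots> = mfact \<alpha> / r ^ mabs \<alpha> * exp (DIM('a) * r * norm x)"
    by (simp add: prod.distrib prod_dividef mfact_def mabs_def power_sum exp_of_nat_mult[symmetric] mult.assoc)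
  finally show ?thesis .
qed

text \<open>The exponent is the width \<open>2 * DIM('a) / h\<close> of the tube times the Cauchy
  radius \<open>1 / h\<close>, once for each basis direction.\<close>

definition Sigma1_const :: "'a::euclidean_space itself \<Rightarrow> real \<Rightarrow> real" where
  "Sigma1_const _ h = exp (2 * DIM('a) / h / h) ^ DIM('a)"

text \<open>Here \<open>r = 1 / h\<close> is both the Cauchy radius and the rate in
  \<open>mpow_le\<close>. Half of \<open>2 * DIM('a) / h\<close> is spent on the derivatives, and
  the rate of decay that remains cancels the growth of the power of \<open>x\<close>
  exactly.\<close>

lemma Sigma1_norm_ent_le:
  fixes F :: "'a::euclidean_space \<Rightarrow> 'a \<Rightarrow> complex"
  assumes "entire F" "0 < h" "tube (2 * DIM('a) / h) C F"
  shows "Sigma1_norm h (\<lambda>x. F x 0) \<le> ennreal (Sigma1_const TYPE('a) h * C)"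
  unfolding Sigma1_norm_def
proof (intro SUP_least)
  fix \<alpha> \<beta> :: "'a \<Rightarrow> nat" and x :: 'a
  define n where "n = DIM('a)"
  define r where "r = 1 / h"
  define R where "R = n * r"
  define K where "K = exp (2 * n / h / h)"
  define G where "G = foldr (\<lambda>b G. (dirder b ^^ \<beta> b) G) basis_enum F"
  have r: "0 < r" "0 \<le> R" using assms by (auto simp: r_def R_def)
  have eq: "R + length (basis_enum :: 'a list) * r = 2 * DIM('a) / h" "(2 * DIM('a) / h) * r = 2 * n / h / h"
    by (auto simp: basis_enum R_def r_def n_def)
  have tube: "tube R (C * (\<Prod>b\<leftarrow>basis_enum. K * fact (\<beta> b) / r ^ \<beta> b)) G"
    using tube_iterated_dirder[OF assms(1) r(2,1), of basis_enum C \<beta>] assms(3) unfolding eq G_def K_def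
    by (auto simp: basis_enum)
  have "(\<Prod>b\<leftarrow>basis_enum. K * fact (\<beta> b) / r ^ \<beta> b) = (\<Prod>b\<in>Basis. K * fact (\<beta> b) / r ^ \<beta> b)"
    by (subst prod.distinct_set_conv_list[symmetric]) (simp_all add: basis_enum)
  also have "\<dots> = K ^ n * mfact \<beta> / r ^ mabs \<beta>"
    by (simp add: prod.distrib prod_dividef mfact_def mabs_def power_sum n_def)
  finally have tube: "tube R (C * (K ^ n * mfact \<beta> / r ^ mabs \<beta>)) G" using tube by simp
  have "mderiv \<beta> (\<lambda>x. F x 0) x = G x 0"
    unfolding mderiv_def G_def by (simp add: foldr_partial_powers_ent[OF assms(1)])
  also have "cmod \<dots> \<le> C * (K ^ n * mfact \<beta> / r ^ mabs \<beta>) * exp (- (R * norm x))"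
    using tube r by (auto simp: tube_def)
  finally have "cmod (of_real (mpow x \<alpha>) * mderiv \<beta> (\<lambda>x. F x 0) x)
     \<le> (mfact \<alpha> / r ^ mabs \<alpha> * exp (DIM('a) * r * norm x)) * (C * (K ^ n * mfact \<beta> / r ^ mabs \<beta>) * exp (- (R * norm x)))"
    unfolding norm_mult norm_of_real using r less_imp_le[OF mfact_pos, of \<alpha>]
    by (intro mult_mono mpow_le) auto
  also have "\<dots> = (K ^ n * C) * (h ^ (mabs \<alpha> + mabs \<beta>) * mfact \<alpha> * mfact \<beta>)"
    by (simp add: R_def n_def exp_minus r_def power_add power_divide)
  finally have "cmod (of_real (mpow x \<alpha>) * mderiv \<beta> (\<lambda>x. F x 0) x) / (h ^ (mabs \<alpha> + mabs \<beta>) * mfact \<alpha> * mfact \<beta>) \<le> K ^ n * C"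
    using assms(2) mfact_pos[of \<alpha>] mfact_pos[of \<beta>] by (subst pos_divide_le_eq) auto
  then show "ennreal (cmod (of_real (mpow x \<alpha>) * mderiv \<beta> (\<lambda>x. F x 0) x) / (h ^ (mabs \<alpha> + mabs \<beta>) * mfact \<alpha> * mfact \<beta>))
    \<le> ennreal (Sigma1_const TYPE('a) h * C)"
    by (auto intro: ennreal_leI simp: Sigma1_const_def K_def n_def)
qed

lemma Sigma1_ent: 
  fixes F :: "'a::euclidean_space \<Rightarrow> 'a \<Rightarrow> complex"
  assumes "entire F" shows "(\<lambda>x. F x 0) \<in> Sigma1"
proof -
  have "Sigma1_norm h (\<lambda>x. F x 0) < \<infinity>" if "0 < h" for h
  proof -
    obtain C where "tube (2 * DIM('a) / h) C F" using assms by (auto simp: entire_def)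
    from Sigma1_norm_ent_le[OF assms that this] show ?thesis by (rule le_less_trans) simp
  qed
  then show ?thesis using smooth_ent[OF assms] by (simp add: Sigma1_def)
qed


section \<open>Entire extension by Taylor series\<close>

text \<open>The mean value inequality in direction \<open>b\<close> compares the second difference
  with \<open>t\<^sup>2\<close> times the mixed derivative, using the derivative of
  \<open>partial b f\<close> at the single point \<open>x\<close>. As the second difference is
  symmetric in \<open>b\<close> and \<open>c\<close>, mixed derivatives agree once both limits
  exist.\<close>

lemma second_difference_tendsto:
  fixes f :: "'a::euclidean_space \<Rightarrow> complex"
  assumes f: "\<And>x. f differentiable (at x)" and g: "partial b f differentiable (at x)"
  shows "((\<lambda>t. (f (x + t *\<^sub>R b + t *\<^sub>R c) - f (x + t *\<^sub>R b) - f (x + t *\<^sub>R c) + f x) / (of_real t)\<^sup>2)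
     \<longlongrightarrow> partial c (partial b f) x) (at_right 0)"
proof (rule tendstoI)
  fix e :: real assume e: "0 < e"
  define L where "L = frechet_derivative (partial b f) (at x)"
  have L: "(partial b f has_derivative L) (at x)"
    unfolding L_def using g by (simp add: frechet_derivative_works)
  have lin: "linear L" using has_derivative_linear[OF L] .
  have D: "partial c (partial b f) x = L c" by (simp add: partial_def[of c] L_def)
  \<comment> \<open>Per unit of \<open>t\<close>, the two values of \<open>partial b f\<close> are
    taken within distance \<open>norm c + norm b\<close> and \<open>norm b\<close> of
    \<open>x\<close>, and their errors are added; the 1 makes \<open>N\<close> positive.\<close>
  define N where "N = 2 * norm b + norm c + 1"
  have N: "0 < N" by (auto simp: N_def intro!: add_nonneg_pos)
  define \<epsilon> where "\<epsilon> = e / (2 * N)"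
  have \<epsilon>: "0 < \<epsilon>" using e N by (simp add: \<epsilon>_def)
  obtain d where d: "0 < d" "\<And>y. norm (y - x) < d \<Longrightarrow> norm (partial b f y - partial b f x - L (y - x)) \<le> \<epsilon> * norm (y - x)"
    using L \<epsilon> unfolding has_derivative_at_alt by blast
  have fd: "((\<lambda>s. f (p + s *\<^sub>R b)) has_vector_derivative partial b f (p + s *\<^sub>R b)) (at s within A)" for p s A
  proof -
    have "(f has_derivative frechet_derivative f (at (p + s *\<^sub>R b))) (at (p + s *\<^sub>R b))"
      using f by (simp add: frechet_derivative_works[symmetric])
    then have "((\<lambda>s. f (p + s *\<^sub>R b)) has_derivative (\<lambda>h. frechet_derivative f (at (p + s *\<^sub>R b)) (h *\<^sub>R b))) (at s within A)"
      by (rule has_derivative_compose[rotated]) (auto intro!: derivative_eq_intros)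
    then show ?thesis
      unfolding has_vector_derivative_def partial_def
      by (simp add: linear_scale[OF linear_frechet_derivative[OF f]])
  qed
  have "dist ((f (x + t *\<^sub>R b + t *\<^sub>R c) - f (x + t *\<^sub>R b) - f (x + t *\<^sub>R c) + f x) / (of_real t)\<^sup>2) (L c) < e"
    if t: "0 < t" "t < d / N" for t
  proof -
    define u where "u s = f ((x + t *\<^sub>R c) + s *\<^sub>R b) - f (x + s *\<^sub>R b) - s *\<^sub>R (t *\<^sub>R L c)" for s
    have "norm (u t - u 0) \<le> (\<epsilon> * (N * t)) * norm (t - 0)"
    proof (rule differentiable_bound[where S="{0..t}"])
      fix s assume s: "s \<in> {0..t}"
      define u' where "u' = partial b f (x + t *\<^sub>R c + s *\<^sub>R b) - partial b f (x + s *\<^sub>R b) - t *\<^sub>R L c"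
      have "(u has_vector_derivative u') (at s within {0..t})"
        unfolding u_def u'_def by (intro has_vector_derivative_diff fd) (auto intro!: derivative_eq_intros simp: has_vector_derivative_def)
      then show "(u has_derivative (\<lambda>h. h *\<^sub>R u')) (at s within {0..t})"
        by (simp add: has_vector_derivative_def)
      have n1: "norm (t *\<^sub>R c + s *\<^sub>R b) \<le> t * (norm c + norm b)"
        using norm_triangle_ineq[of "t *\<^sub>R c" "s *\<^sub>R b"] s mult_right_mono[of s t "norm b"] by (auto simp: distrib_left)
      have n2: "norm (s *\<^sub>R b) \<le> t * norm b"
        using s mult_right_mono[of s t "norm b"] by auto
      have tN: "t * N < d" using t N by (simp add: field_simps)
      have nb: "norm c + norm b < N" "norm b < N"
        using norm_ge_zero[of b] norm_ge_zero[of c] unfolding N_def by linarith+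
      have "t * (norm c + norm b) < t * N" "t * norm b < t * N"
        by (rule mult_strict_left_mono[OF nb(1) t(1)], rule mult_strict_left_mono[OF nb(2) t(1)])
      then have "norm (t *\<^sub>R c + s *\<^sub>R b) < d" "norm (s *\<^sub>R b) < d" using n1 n2 tN by linarith+
      then have a: "norm (partial b f (x + t *\<^sub>R c + s *\<^sub>R b) - partial b f x - L (t *\<^sub>R c + s *\<^sub>R b)) \<le> \<epsilon> * (t * (norm c + norm b))"
        "norm (partial b f (x + s *\<^sub>R b) - partial b f x - L (s *\<^sub>R b)) \<le> \<epsilon> * (t * norm b)"
        using d(2)[of "x + t *\<^sub>R c + s *\<^sub>R b"] d(2)[of "x + s *\<^sub>R b"] n1 n2 \<epsilon>
        by (auto simp: add.assoc elim!: order_trans intro!: mult_left_mono)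
      have "u' = (partial b f (x + t *\<^sub>R c + s *\<^sub>R b) - partial b f x - L (t *\<^sub>R c + s *\<^sub>R b))
         - (partial b f (x + s *\<^sub>R b) - partial b f x - L (s *\<^sub>R b))"
        by (simp add: u'_def linear_add[OF lin] linear_scale[OF lin])
      then have "norm u' \<le> \<epsilon> * (t * (norm c + norm b)) + \<epsilon> * (t * norm b)"
        using a by (metis norm_triangle_le_diff add_mono)
      also have "\<dots> \<le> \<epsilon> * (N * t)" using \<epsilon> t by (simp add: N_def algebra_simps)
      finally have "norm u' \<le> \<epsilon> * (N * t)" .
      then show "onorm (\<lambda>h. h *\<^sub>R u') \<le> \<epsilon> * (N * t)"
        using \<epsilon> N t by (intro onorm_bound) (auto simp: mult.commute[of "\<epsilon> * (N * t)"] intro: mult_left_mono)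
    qed (use t in auto)
    then have "norm (u t - u 0) \<le> \<epsilon> * N * t\<^sup>2" using t by (simp add: power2_eq_square mult_ac)
    then have "norm ((u t - u 0) / (of_real t)\<^sup>2) \<le> \<epsilon> * N" using t by (simp add: norm_divide norm_power divide_le_eq)
    moreover have "(u t - u 0) / (of_real t)\<^sup>2 = (f (x + t *\<^sub>R b + t *\<^sub>R c) - f (x + t *\<^sub>R b) - f (x + t *\<^sub>R c) + f x) / (of_real t)\<^sup>2 - L c"
      using t by (simp add: u_def field_simps power2_eq_square scaleR_conv_of_real)
    moreover have "\<epsilon> * N < e" using e N by (simp add: \<epsilon>_def)
    ultimately show ?thesis by (simp add: dist_norm)
  qed
  then show "\<forall>\<^sub>F t in at_right 0. dist ((f (x + t *\<^sub>R b + t *\<^sub>R c) - f (x + t *\<^sub>R b) - f (x + t *\<^sub>R c) + f x) / (of_real t)\<^sup>2) (partial c (partial b f) x) < e"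
    unfolding eventually_at_right_field D using d(1) N by (intro exI[of _ "d / N"]) auto
qed

lemma partial_commute:
  fixes f :: "'a::euclidean_space \<Rightarrow> complex"
  assumes "\<And>x. f differentiable (at x)" "\<And>x. partial b f differentiable (at x)" "\<And>x. partial c f differentiable (at x)"
  shows "partial b (partial c f) = partial c (partial b f)"
proof
  fix x
  have "((\<lambda>t. (f (x + t *\<^sub>R b + t *\<^sub>R c) - f (x + t *\<^sub>R b) - f (x + t *\<^sub>R c) + f x) / (of_real t)\<^sup>2)
     \<longlongrightarrow> partial b (partial c f) x) (at_right 0)"
    using second_difference_tendsto[of f c x b] assms by (simp add: algebra_simps)
  with second_difference_tendsto[of f b x c] assms
  show "partial b (partial c f) x = partial c (partial b f) x"
    by (intro tendsto_unique[of "at_right (0::real)"]) auto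
qed

section \<open>Independence of the order of differentiation\<close>

lemma smooth_imp_differentiable: "smooth f \<Longrightarrow> bs \<in> lists Basis \<Longrightarrow> foldr partial bs f differentiable (at x)"
  by (simp add: smooth_def)

lemma smooth_differentiable: "smooth f \<Longrightarrow> f differentiable (at x)"
  using smooth_imp_differentiable[of f "[]"] by simp

lemma smooth_foldr_partial: "smooth f \<Longrightarrow> bs \<in> lists Basis \<Longrightarrow> smooth (foldr partial bs f)"
  unfolding smooth_def by (metis append_in_lists_conv foldr_append)

lemma smooth_partial: "smooth f \<Longrightarrow> b \<in> Basis \<Longrightarrow> smooth (partial b f)"
  using smooth_foldr_partial[of f "[b]"] by simp

lemma partial_foldr_commute:
  assumes "smooth f" "b \<in> Basis" "bs \<in> lists Basis"
  shows "partial b (foldr partial bs f) = foldr partial bs (partial b f)"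
  using assms(3)
proof (induction bs)
  case (Cons c bs)
  then have s: "smooth (foldr partial bs f)" "c \<in> Basis" using assms smooth_foldr_partial by auto
  then have "partial b (partial c (foldr partial bs f)) = partial c (partial b (foldr partial bs f))"
    using assms by (intro partial_commute smooth_differentiable smooth_partial)
  then show ?case using Cons by simp
qed simp

lemma foldr_partial_permute:
  assumes "smooth f" "bs \<in> lists Basis" "mset bs = mset cs"
  shows "foldr partial bs f = foldr partial cs f"
  using assms(2,3)
proof (induction bs arbitrary: cs rule: list.induct)
  case (Cons b bs)
  have "b \<in> set cs" using Cons.prems(2) by (metis list.set_intros(1) set_mset_mset)
  then obtain c1 c2 where cs: "cs = c1 @ b # c2" by (meson split_list)
  have sets: "set cs \<subseteq> Basis" using Cons.prems mset_eq_setD by fastforce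
  have "mset bs = mset (c1 @ c2)" using Cons.prems(2) by (simp add: cs)
  then have "foldr partial (b # bs) f = partial b (foldr partial c1 (foldr partial c2 f))"
    using Cons.IH[of "c1 @ c2"] Cons.prems(1) by simp
  also have "\<dots> = foldr partial c1 (partial b (foldr partial c2 f))"
    using sets assms(1) Cons.prems(1) by (intro partial_foldr_commute smooth_foldr_partial) (auto simp: cs)
  finally show ?case by (simp add: cs)
qed simp

lemma foldr_powers_eq_concat:
  "foldr (\<lambda>b g. (partial b ^^ \<beta> b) g) bs f = foldr partial (concat (map (\<lambda>b. replicate (\<beta> b) b) bs)) f"
proof (induction bs)
  case (Cons b bs)
  have "foldr partial (replicate k b) g = (partial b ^^ k) g" for k g
    by (induction k) auto
  then show ?case using Cons by simp
qed simp

text \<open>\<open>mderiv\<close> fixes one order of differentiation, while powers of a derivative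
  in a complex direction expand into words in all orders. Since partial derivatives commute, a word
  depends only on its multiset of letters.\<close>

lemma foldr_partial_eq_mderiv:
  fixes f :: "'a::euclidean_space \<Rightarrow> complex"
  assumes "smooth f" "bs \<in> lists Basis"
  shows "foldr partial bs f = mderiv (count_list bs) f"
  unfolding mderiv_def foldr_powers_eq_concat
proof (rule foldr_partial_permute[OF assms], rule multiset_eqI)
  fix x :: 'a
  have *: "distinct L \<Longrightarrow> count (mset (concat (map (\<lambda>b. replicate (\<beta> b) b) L))) x = (if x \<in> set L then \<beta> x else 0)"
    for L :: "'a list" and \<beta> :: "'a \<Rightarrow> nat"
    by (induction L) auto
  have "x \<notin> set bs" if "x \<notin> Basis" using that assms(2) by auto
  moreover have c: "count_list bs y = count (mset bs) y" for y by (induction bs) auto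
  ultimately have "count_list bs x = 0" if "x \<notin> Basis" using that by (auto simp: count_list_0_iff)
  then show "count (mset bs) x = count (mset (concat (map (\<lambda>b. replicate (count_list bs b) b) basis_enum))) x"
    by (simp add: *[OF basis_enum(1)] basis_enum(2) c)
qed

section \<open>Exponential decay of all derivatives of a test function\<close>

lemma mfact_le: "mfact \<beta> \<le> fact (mabs \<beta>)"
proof -
  have "(\<Prod>b\<in>B. fact (\<beta> b) :: real) \<le> fact (\<Sum>b\<in>B. \<beta> b)" if "finite B" for B
    using that
  proof (induction B rule: finite_induct)
    case (insert b B)
    have "(fact (\<beta> b) :: nat) * fact (\<Sum>b\<in>B. \<beta> b) \<le> fact (\<beta> b + (\<Sum>b\<in>B. \<beta> b))"
      by (intro dvd_imp_le fact_fact_dvd_fact) auto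
    then have "(fact (\<beta> b) :: real) * fact (\<Sum>b\<in>B. \<beta> b) \<le> fact (\<beta> b + (\<Sum>b\<in>B. \<beta> b))"
      by (metis of_nat_fact of_nat_le_iff of_nat_mult)
    moreover have "(fact (\<beta> b) :: real) * (\<Prod>b\<in>B. fact (\<beta> b)) \<le> fact (\<beta> b) * fact (\<Sum>b\<in>B. \<beta> b)"
      using insert by (intro mult_left_mono) auto
    ultimately have "(fact (\<beta> b) :: real) * (\<Prod>b\<in>B. fact (\<beta> b)) \<le> fact (\<beta> b + (\<Sum>b\<in>B. \<beta> b))"
      by (rule order_trans[rotated])
    then show ?case using insert(1,2) by simp
  qed simp
  then show ?thesis by (simp add: mfact_def mabs_def)
qed

lemma Sigma1_norm_bound:
  assumes "Sigma1_norm h f \<le> ennreal c" "0 \<le> c" "0 < h"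
  shows "\<bar>mpow x \<alpha>\<bar> * cmod (mderiv \<beta> f x) \<le> c * (h ^ (mabs \<alpha> + mabs \<beta>) * mfact \<alpha> * mfact \<beta>)"
proof -
  have "ennreal (cmod (of_real (mpow x \<alpha>) * mderiv \<beta> f x) / (h ^ (mabs \<alpha> + mabs \<beta>) * mfact \<alpha> * mfact \<beta>)) \<le> Sigma1_norm h f"
    unfolding Sigma1_norm_def by (rule SUP_upper2[where i=\<alpha>], simp, rule SUP_upper2[where i=\<beta>], simp, rule SUP_upper2[where i=x], simp_all)
  also note assms(1)
  finally have "cmod (of_real (mpow x \<alpha>) * mderiv \<beta> f x) / (h ^ (mabs \<alpha> + mabs \<beta>) * mfact \<alpha> * mfact \<beta>) \<le> c"
    using assms(2) by (simp add: ennreal_le_iff)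
  then show ?thesis
    using assms(3) mfact_pos[of \<alpha>] mfact_pos[of \<beta>] by (subst (asm) pos_divide_le_eq) (auto simp: norm_mult)
qed

text \<open>Only powers of the largest coordinate \<open>t\<close> of \<open>x\<close> are used, for
  which \<open>norm x \<le> DIM('a) * t\<close>. The seminorm bounds \<open>t ^ m\<close> times the
  derivative by a multiple of \<open>h ^ m * fact m\<close>; multiplied by
  \<open>(DIM('a) * R) ^ m / fact m\<close> and summed over \<open>m\<close>, this bounds the
  exponential by a geometric series of ratio \<open>q \<le> 1/2\<close>, whose sum is at most
  2.\<close>

lemma Sigma1_derivative_decay:
  fixes f :: "'a::euclidean_space \<Rightarrow> complex" and R :: real
  assumes "smooth f" "Sigma1_norm h f \<le> ennreal c" "0 \<le> c" "0 < h" "0 \<le> R" "2 * DIM('a) * R * h \<le> 1"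
    and "bs \<in> lists Basis"
  shows "cmod (foldr partial bs f x) \<le> 2 * c * exp (- (R * norm x)) * (h ^ length bs * fact (length bs))"
proof -
  define D where "D = cmod (foldr partial bs f x)"
  define k where "k = length bs"
  have "Max ((\<lambda>b. \<bar>x \<bullet> b\<bar>) ` Basis) \<in> (\<lambda>b. \<bar>x \<bullet> b\<bar>) ` Basis" by (intro Max_in) auto
  then obtain b0 where b0': "b0 \<in> Basis" "Max ((\<lambda>b. \<bar>x \<bullet> b\<bar>) ` Basis) = \<bar>x \<bullet> b0\<bar>" by (elim imageE)
  have b0: "b0 \<in> Basis" "\<And>b. b \<in> Basis \<Longrightarrow> \<bar>x \<bullet> b\<bar> \<le> \<bar>x \<bullet> b0\<bar>"
    using b0' by (auto simp flip: b0'(2))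
  define t where "t = \<bar>x \<bullet> b0\<bar>"
  have "norm x \<le> (\<Sum>b\<in>Basis. \<bar>x \<bullet> b\<bar>)" by (rule norm_le_l1)
  also have "\<dots> \<le> (\<Sum>b\<in>(Basis::'a set). t)" using b0 by (intro sum_mono) (auto simp: t_def)
  finally have xt: "norm x \<le> DIM('a) * t" by simp
  have mabs: "mabs (count_list bs) = k"
    using assms(7) by (auto simp: mabs_def k_def intro!: sum_count_set)
  have m: "t ^ m * D \<le> c * h ^ k * fact k * (h ^ m * fact m)" for m
  proof -
    define \<alpha> where "\<alpha> b = (if b = b0 then m else 0)" for b
    have a: "mabs \<alpha> = m" "mfact \<alpha> = fact m" "\<bar>mpow x \<alpha>\<bar> = t ^ m"
      using b0(1) by (auto simp: mabs_def mfact_def mpow_def \<alpha>_def t_def sum.delta prod.delta if_distrib power_abs abs_prod cong: if_cong)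
    have "t ^ m * D \<le> c * (h ^ (m + k) * fact m * mfact (count_list bs))"
      using Sigma1_norm_bound[OF assms(2-4), of x \<alpha> "count_list bs"]
      unfolding foldr_partial_eq_mderiv[OF assms(1,7)] D_def a mabs .
    also have "\<dots> \<le> c * (h ^ (m + k) * fact m * fact k)"
      using mfact_le[of "count_list bs"] assms unfolding mabs by (intro mult_left_mono) auto
    finally show ?thesis by (simp add: power_add mult_ac)
  qed
  define q where "q = DIM('a) * R * h"
  have q: "0 \<le> q" "q \<le> 1/2" using assms by (auto simp: q_def)
  have D: "0 \<le> D" by (simp add: D_def)
  have "exp (R * norm x) * D \<le> exp (DIM('a) * R * t) * D"
    using xt assms(5) D mult_left_mono[OF xt assms(5)] by (intro mult_right_mono) (auto simp: mult_ac)
  also have "\<dots> = (\<Sum>m. inverse (fact m) *\<^sub>R (DIM('a) * R * t) ^ m * D)"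
    unfolding exp_def by (rule suminf_mult2[OF summable_exp_generic])
  also have "\<dots> \<le> (\<Sum>m. c * h ^ k * fact k * q ^ m)"
  proof (rule suminf_le)
    show "inverse (fact m) *\<^sub>R (DIM('a) * R * t) ^ m * D \<le> c * h ^ k * fact k * q ^ m" for m
    proof -
      have "inverse (fact m) *\<^sub>R (DIM('a) * R * t) ^ m * D = (DIM('a) * R) ^ m / fact m * (t ^ m * D)"
        by (simp add: power_mult_distrib field_simps)
      also have "\<dots> \<le> (DIM('a) * R) ^ m / fact m * (c * h ^ k * fact k * (h ^ m * fact m))"
        using m assms by (intro mult_left_mono) auto
      finally show ?thesis by (simp add: q_def power_mult_distrib mult_ac)
    qed
    show "summable (\<lambda>m. inverse (fact m) *\<^sub>R (DIM('a) * R * t) ^ m * D)"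
      by (intro summable_mult2 summable_exp_generic)
    show "summable (\<lambda>m. c * h ^ k * fact k * q ^ m)"
      using q by (intro summable_mult summable_geometric) auto
  qed
  also have "\<dots> = c * h ^ k * fact k * (1 / (1 - q))"
    using q by (simp add: suminf_mult suminf_geometric)
  also have "\<dots> \<le> c * h ^ k * fact k * 2"
    using q assms by (intro mult_left_mono) (auto simp: field_simps)
  finally show ?thesis by (simp add: D_def k_def exp_minus field_simps)
qed

section \<open>Derivatives in complex directions and the Taylor extension\<close>

definition cpart :: "('a::euclidean_space \<Rightarrow> complex) \<Rightarrow> ('a \<Rightarrow> complex) \<Rightarrow> 'a \<Rightarrow> complex" where
  "cpart z f = (\<lambda>x. \<Sum>b\<in>Basis. z b * partial b f x)"

lemma partial_lincomb:
  assumes "\<And>i. i \<in> I \<Longrightarrow> g i differentiable (at x)"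
  shows "partial b (\<lambda>x. \<Sum>i\<in>I. c i * g i x) x = (\<Sum>i\<in>I. c i * partial b (g i) x)"
proof -
  have "((\<lambda>x. \<Sum>i\<in>I. c i * g i x) has_derivative (\<lambda>h. \<Sum>i\<in>I. c i * frechet_derivative (g i) (at x) h)) (at x)"
    using assms by (intro has_derivative_sum has_derivative_mult_right) (simp add: frechet_derivative_works[symmetric])
  from frechet_derivative_at[OF this] show ?thesis by (simp add: partial_def fun_eq_iff)
qed

lemma foldr_partial_lincomb:
  assumes "\<And>i. i \<in> I \<Longrightarrow> smooth (g i)" "bs \<in> lists Basis"
  shows "foldr partial bs (\<lambda>x. \<Sum>i\<in>I. c i * g i x) = (\<lambda>x. \<Sum>i\<in>I. c i * foldr partial bs (g i) x)"
  using assms(2)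
proof (induction bs)
  case (Cons b bs)
  have "partial b (\<lambda>x. \<Sum>i\<in>I. c i * foldr partial bs (g i) x) x = (\<Sum>i\<in>I. c i * partial b (foldr partial bs (g i)) x)" for x
    using Cons assms(1) by (intro partial_lincomb smooth_imp_differentiable) auto
  then show ?case using Cons by auto
qed simp

lemma smooth_lincomb:
  assumes "finite I" "\<And>i. i \<in> I \<Longrightarrow> smooth (g i)"
  shows "smooth (\<lambda>x. \<Sum>i\<in>I. c i * g i x)"
  unfolding smooth_def
  using assms by (auto simp: foldr_partial_lincomb intro!: differentiable_sum differentiable_mult smooth_imp_differentiable)

lemma smooth_cpart: "smooth f \<Longrightarrow> smooth (cpart z f)"
  unfolding cpart_def by (rule smooth_lincomb) (auto intro: smooth_partial)

lemma smooth_cpart_power: "smooth f \<Longrightarrow> smooth ((cpart z ^^ k) f)"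
  by (induction k) (auto intro: smooth_cpart)

lemma foldr_partial_cpart:
  assumes "smooth f" "bs \<in> lists Basis"
  shows "foldr partial bs (cpart z f) x = (\<Sum>b\<in>Basis. z b * foldr partial (bs @ [b]) f x)"
  using assms by (simp add: cpart_def foldr_partial_lincomb smooth_partial)

text \<open>Expanding \<open>cpart z\<close> once turns a word of partial derivatives into words
  that are one letter longer, weighted by the coordinates of \<open>z\<close>. A bound that depends
  on the length of the word alone therefore survives, at the cost of the l1 norm of
  \<open>z\<close>.\<close>

lemma cpart_power_bound:
  assumes "smooth f" "\<And>bs. bs \<in> lists Basis \<Longrightarrow> cmod (foldr partial bs f x) \<le> M (length bs)" "bs \<in> lists Basis"
  shows "cmod (foldr partial bs ((cpart z ^^ k) f) x) \<le> (\<Sum>b\<in>Basis. cmod (z b)) ^ k * M (length bs + k)"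
  using assms(3)
proof (induction k arbitrary: bs)
  case 0 then show ?case using assms(2) by simp
next
  case (Suc k)
  define S where "S = (\<Sum>b\<in>Basis. cmod (z b))"
  have "cmod (foldr partial bs ((cpart z ^^ Suc k) f) x) \<le> (\<Sum>b\<in>Basis. cmod (z b * foldr partial (bs @ [b]) ((cpart z ^^ k) f) x))"
    using Suc.prems smooth_cpart_power[OF assms(1)] by (simp only: funpow.simps o_def foldr_partial_cpart norm_sum)
  also have "\<dots> \<le> (\<Sum>b\<in>Basis. cmod (z b) * (S ^ k * M (length bs + Suc k)))"
    unfolding norm_mult using Suc.IH[of "bs @ [_]"] Suc.prems by (intro sum_mono mult_left_mono) (auto simp: S_def)
  also have "\<dots> = S ^ Suc k * M (length bs + Suc k)" by (simp add: S_def sum_distrib_right[symmetric] mult.assoc)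
  finally show ?case by (simp add: S_def)
qed

lemma cpart_power_holomorphic:
  assumes "smooth f" "bs \<in> lists Basis" "\<And>b. (\<lambda>w. z w b) holomorphic_on S"
  shows "(\<lambda>w. foldr partial bs ((cpart (z w) ^^ k) f) x) holomorphic_on S"
  using assms(2)
proof (induction k arbitrary: bs)
  case (Suc k)
  have "(\<lambda>w. \<Sum>b\<in>Basis. z w b * foldr partial (bs @ [b]) ((cpart (z w) ^^ k) f) x) holomorphic_on S"
    by (intro holomorphic_on_sum holomorphic_on_mult assms(3) Suc.IH) (use Suc.prems in auto)
  then show ?case using Suc.prems smooth_cpart_power[OF assms(1)] by (simp add: foldr_partial_cpart)
qed simp

lemma cpart_real:
  assumes "f differentiable (at x)" shows "cpart (\<lambda>b. of_real (y \<bullet> b)) f x = frechet_derivative f (at x) y"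
proof -
  have lin: "linear (frechet_derivative f (at x))" using assms by (rule linear_frechet_derivative)
  have "frechet_derivative f (at x) y = frechet_derivative f (at x) (\<Sum>b\<in>Basis. (y \<bullet> b) *\<^sub>R b)"
    by (simp add: euclidean_representation)
  also have "\<dots> = cpart (\<lambda>b. of_real (y \<bullet> b)) f x"
    by (simp add: linear_sum[OF lin] linear_scale[OF lin] cpart_def partial_def scaleR_conv_of_real)
  finally show ?thesis by simp
qed

lemma line_has_vector_derivative:
  fixes f :: "'a::euclidean_space \<Rightarrow> complex"
  assumes "f differentiable (at (x + t *\<^sub>R y))"
  shows "((\<lambda>t. f (x + t *\<^sub>R y)) has_vector_derivative cpart (\<lambda>b. of_real (y \<bullet> b)) f (x + t *\<^sub>R y)) (at t within A)"
proof -
  have "(f has_derivative frechet_derivative f (at (x + t *\<^sub>R y))) (at (x + t *\<^sub>R y))"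
    using assms by (simp add: frechet_derivative_works[symmetric])
  then have "((\<lambda>t. f (x + t *\<^sub>R y)) has_derivative (\<lambda>h. frechet_derivative f (at (x + t *\<^sub>R y)) (h *\<^sub>R y))) (at t within A)"
    by (rule has_derivative_compose[rotated]) (auto intro!: derivative_eq_intros)
  then show ?thesis
    unfolding has_vector_derivative_def
    by (simp add: linear_scale[OF linear_frechet_derivative[OF assms]] cpart_real[OF assms])
qed

lemma Sigma1_cpart_bound:
  fixes f :: "'a::euclidean_space \<Rightarrow> complex" and R :: real
  assumes "smooth f" "Sigma1_norm h f \<le> ennreal c" "0 \<le> c" "0 < h" "0 \<le> R" "2 * DIM('a) * R * h \<le> 1"
  shows "cmod ((cpart z ^^ k) f x) \<le> (\<Sum>b\<in>Basis. cmod (z b)) ^ k * (2 * c * exp (- (R * norm x)) * (h ^ k * fact k))"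
  using cpart_power_bound[OF assms(1) Sigma1_derivative_decay[OF assms], where bs="[]" and z=z and k=k and x=x] by simp

text \<open>\<open>cpart z\<close> is the derivative in the complex direction \<open>z\<close>, so
  this is the Taylor series of \<open>f\<close> about the origin, taken at \<open>x + iy\<close>.
  One centre suffices for functions in \<open>Sigma1\<close>, because their derivatives of order
  \<open>k\<close> are \<open>O(h ^ k * fact k)\<close> for every \<open>h\<close>.\<close>

definition taylor_ext :: "('a::euclidean_space \<Rightarrow> complex) \<Rightarrow> 'a \<Rightarrow> 'a \<Rightarrow> complex" where
  "taylor_ext f x y = (\<Sum>k. (cpart (\<lambda>b. Complex (x \<bullet> b) (y \<bullet> b)) ^^ k) f 0 / fact k)"

lemma Sigma1_norm_finite:
  assumes "f \<in> Sigma1" "0 < h" obtains c where "0 \<le> c" "Sigma1_norm h f \<le> ennreal c"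
  using assms by (metis (mono_tags, lifting) Sigma1_def enn2real_nonneg ennreal_enn2real_if infinity_ennreal_def less_irrefl mem_Collect_eq order_refl)

text \<open>Membership in \<open>Sigma1\<close> lets \<open>h\<close> depend on \<open>S\<close>.
  With \<open>\<bar>S\<bar> * h \<le> 1/2\<close> the terms decrease geometrically, uniformly in
  \<open>z\<close>, as the Weierstrass test requires.\<close>

lemma taylor_ext_term_bound:
  fixes f :: "'a::euclidean_space \<Rightarrow> complex"
  assumes f: "f \<in> Sigma1" 
  shows "\<exists>c\<ge>0. \<forall>z k. (\<Sum>b\<in>Basis. cmod (z b)) \<le> S \<longrightarrow> cmod ((cpart z ^^ k) f 0 / fact k) \<le> c * (1 / 2) ^ k"
proof -
  define h where "h = 1 / (2 * (\<bar>S\<bar> + 1))"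
  have h: "0 < h" "\<bar>S\<bar> * h \<le> 1/2" by (auto simp: h_def field_simps)
  obtain c where c: "0 \<le> c" "Sigma1_norm h f \<le> ennreal c" using Sigma1_norm_finite[OF f h(1)] .
  show ?thesis
  proof (intro exI[of _ "2 * c"] conjI allI impI)
    fix z :: "'a \<Rightarrow> complex" and k assume z: "(\<Sum>b\<in>Basis. cmod (z b)) \<le> S"
    have "cmod ((cpart z ^^ k) f 0) \<le> (\<Sum>b\<in>Basis. cmod (z b)) ^ k * (2 * c * exp (- (0 * norm (0::'a))) * (h ^ k * fact k))"
      using f c h by (intro Sigma1_cpart_bound) (auto simp: Sigma1_def)
    also have "\<dots> \<le> \<bar>S\<bar> ^ k * (2 * c * (h ^ k * fact k))"
      using z c h by (auto intro!: mult_right_mono power_mono sum_nonneg)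
    also have "\<dots> = 2 * c * (\<bar>S\<bar> * h) ^ k * fact k" by (simp add: power_mult_distrib)
    also have "\<dots> \<le> 2 * c * (1 / 2) ^ k * fact k" using h c by (intro mult_right_mono mult_left_mono power_mono) auto
    finally show "cmod ((cpart z ^^ k) f 0 / fact k) \<le> 2 * c * (1 / 2) ^ k" by (simp add: norm_divide field_simps)
  qed (use c in auto)
qed

lemma hol_taylor_ext:
  fixes f :: "'a::euclidean_space \<Rightarrow> complex"
  assumes f: "f \<in> Sigma1" shows "line_holomorphic (taylor_ext f)"
  unfolding line_holomorphic_def
proof (intro allI)
  fix x y v :: 'a
  define Z where "Z w b = Complex (x \<bullet> b) (y \<bullet> b) + w * of_real (v \<bullet> b)" for w b
  define p where "p k w = (cpart (Z w) ^^ k) f 0 / fact k" for k w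
  have eq: "cline (taylor_ext f) x y v w = (\<Sum>k. p k w)" for w
  proof -
    have "(\<lambda>b. Complex ((x + Re w *\<^sub>R v) \<bullet> b) ((y + Im w *\<^sub>R v) \<bullet> b)) = Z w"
      by (auto simp: Z_def complex_eq_iff inner_add_left)
    then show ?thesis by (simp add: cline_def taylor_ext_def p_def)
  qed
  have "(\<lambda>w. cline (taylor_ext f) x y v w) holomorphic_on UNIV"
    unfolding eq
  proof (rule holomorphic_uniform_sequence[where f="\<lambda>n w. \<Sum>k<n. p k w"])
    have "p k holomorphic_on UNIV" for k
    proof -
      have "(\<lambda>w. Z w b) holomorphic_on UNIV" for b unfolding Z_def by (intro holomorphic_intros)
      then show ?thesis
        unfolding p_def using cpart_power_holomorphic[of f "[]" Z UNIV k 0] f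
        by (auto intro!: holomorphic_intros simp: Sigma1_def)
    qed
    then show "(\<lambda>w. \<Sum>k<n. p k w) holomorphic_on UNIV" for n by (intro holomorphic_on_sum) 
    fix w0 :: complex
    define S where "S = (\<Sum>b\<in>(Basis::'a set). cmod (Complex (x \<bullet> b) (y \<bullet> b)) + (cmod w0 + 1) * \<bar>v \<bullet> b\<bar>)"
    obtain c where c: "0 \<le> c" "\<And>z k. (\<Sum>b\<in>Basis. cmod (z b)) \<le> S \<Longrightarrow> cmod ((cpart z ^^ k) f 0 / fact k) \<le> c * (1 / 2) ^ k"
      using taylor_ext_term_bound[OF f, of S] by blast
    have "uniform_limit (cball w0 1) (\<lambda>n w. \<Sum>k<n. p k w) (\<lambda>w. \<Sum>k. p k w) sequentially"
    proof (rule Weierstrass_m_test)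
      fix k w assume w: "w \<in> cball w0 1"
      have w: "cmod w \<le> cmod w0 + 1" using w norm_triangle_ineq2[of w w0] by (simp add: dist_norm norm_minus_commute)
      have "(\<Sum>b\<in>Basis. cmod (Z w b)) \<le> S"
        unfolding S_def Z_def using w
        by (intro sum_mono norm_triangle_le add_left_mono) (auto simp: norm_mult intro: mult_right_mono)
      then show "cmod (p k w) \<le> c * (1 / 2) ^ k" unfolding p_def by (rule c(2))
    qed (auto intro!: summable_mult summable_geometric)
    then show "\<exists>d>0. cball w0 d \<subseteq> UNIV \<and> uniform_limit (cball w0 d) (\<lambda>n w. \<Sum>k<n. p k w) (\<lambda>w. \<Sum>k. p k w) sequentially"
      by (intro exI[of _ 1]) auto
  qed simp
  then show "cline (taylor_ext f) x y v holomorphic_on UNIV" .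
qed

text \<open>Taylor's formula with integral remainder along the segment from 0 to \<open>x\<close>.
  The quotient \<open>fact (Suc n) / fact n\<close> costs only a factor \<open>Suc n\<close>, which
  the power of 1/2 absorbs.\<close>

lemma taylor_ext_real:
  fixes f :: "'a::euclidean_space \<Rightarrow> complex"
  assumes f: "f \<in> Sigma1" shows "taylor_ext f x 0 = f x"
proof -
  have sm: "smooth f" using f by (simp add: Sigma1_def)
  define z where "z b = complex_of_real (x \<bullet> b)" for b
  define S where "S = (\<Sum>b\<in>Basis. cmod (z b))"
  have S: "0 \<le> S" by (simp add: S_def sum_nonneg)
  define h where "h = 1 / (2 * (S + 1))"
  have h: "0 < h" "S * h \<le> 1/2" using S by (auto simp: h_def field_simps)
  obtain c where c: "0 \<le> c" "Sigma1_norm h f \<le> ennreal c" using Sigma1_norm_finite[OF f h(1)] .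
  define Df where "Df k t = (cpart z ^^ k) f (0 + t *\<^sub>R x)" for k t
  have b: "norm (Df k t) \<le> 2 * c * (1/2) ^ k * fact k" for k t
  proof -
    have "norm (Df k t) \<le> S ^ k * (2 * c * exp (- (0 * norm (0 + t *\<^sub>R x))) * (h ^ k * fact k))"
      unfolding Df_def S_def using f c h by (intro Sigma1_cpart_bound sm) auto
    also have "\<dots> = 2 * c * (S * h) ^ k * fact k" by (simp add: power_mult_distrib)
    also have "\<dots> \<le> 2 * c * (1/2) ^ k * fact k" using h S c by (intro mult_right_mono mult_left_mono power_mono) auto
    finally show ?thesis .
  qed
  have nb: "norm (f x - (\<Sum>i<Suc n. Df i 0 / fact i)) \<le> 2 * c * (real (Suc n) * (1/2) ^ Suc n)" for n
  proof -
    have "((\<lambda>t. ((1 - t) ^ (Suc n - 1) / fact (Suc n - 1)) *\<^sub>R Df (Suc n) t)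
        has_integral Df 0 1 - (\<Sum>i<Suc n. ((1 - 0) ^ i / fact i) *\<^sub>R Df i 0)) {0..1}"
    proof (rule Taylor_has_integral)
      fix m and t :: real
      have "((\<lambda>t. (cpart z ^^ m) f (0 + t *\<^sub>R x)) has_vector_derivative cpart z ((cpart z ^^ m) f) (0 + t *\<^sub>R x)) (at t within {0..1})"
        unfolding z_def by (intro line_has_vector_derivative smooth_differentiable smooth_cpart_power sm)
      then show "(Df m has_vector_derivative Df (Suc m) t) (at t within {0..1})"
        by (simp add: Df_def[abs_def])
    qed auto
    then have "norm (Df 0 1 - (\<Sum>i<Suc n. ((1 - 0) ^ i / fact i) *\<^sub>R Df i 0)) \<le> (2 * c * (1/2) ^ Suc n * fact (Suc n) / fact n) * measure lborel {0..1::real}"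
    proof (rule has_integral_bound_real[where S="{}", rotated 2])
      fix t :: real assume "t \<in> {0..1} - {}"
      then have t: "t \<in> {0..1}" by simp
      have "norm (((1 - t) ^ (Suc n - 1) / fact (Suc n - 1)) *\<^sub>R Df (Suc n) t) \<le> (1 / fact n) * (2 * c * (1/2) ^ Suc n * fact (Suc n))"
        unfolding norm_scaleR using t
        by (intro mult_mono b) (auto simp: abs_mult power_abs intro!: divide_right_mono power_le_one)
      then show "norm (((1 - t) ^ (Suc n - 1) / fact (Suc n - 1)) *\<^sub>R Df (Suc n) t) \<le> 2 * c * (1/2) ^ Suc n * fact (Suc n) / fact n" by simp
    qed (use c in auto)
    moreover have "Df 0 1 - (\<Sum>i<Suc n. ((1 - 0) ^ i / fact i) *\<^sub>R Df i 0) = f x - (\<Sum>i<Suc n. Df i 0 / fact i)"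
      by (simp add: Df_def scaleR_conv_of_real divide_inverse mult.commute)
    moreover have "2 * c * (1/2) ^ Suc n * fact (Suc n) / fact n * measure lborel {0..1::real} = 2 * c * (real (Suc n) * (1/2) ^ Suc n)"
      by (simp add: field_simps)
    ultimately show ?thesis by (simp only:)
  qed
  have "(\<lambda>n. 2 * c * (real n * (1/2) ^ n)) \<longlonglongrightarrow> 2 * c * 0"
    by (intro tendsto_mult tendsto_const powser_times_n_limit_0) auto
  then have "(\<lambda>n. 2 * c * (real (Suc n) * (1/2) ^ Suc n)) \<longlonglongrightarrow> 2 * c * 0" by (rule LIMSEQ_Suc)
  then have lim: "(\<lambda>n. 2 * c * (real (Suc n) * (1/2) ^ Suc n)) \<longlonglongrightarrow> 0" by (simp only: mult_zero_right)
  have "(\<lambda>n. f x - (\<Sum>i<Suc n. Df i 0 / fact i)) \<longlonglongrightarrow> 0"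
    by (rule Lim_null_comparison[OF always_eventually[OF allI[OF nb]] lim])
  then have "(\<lambda>n. f x - (f x - (\<Sum>i<Suc n. Df i 0 / fact i))) \<longlonglongrightarrow> f x - 0"
    by (intro tendsto_diff tendsto_const)
  then have "(\<lambda>n. \<Sum>i<Suc n. Df i 0 / fact i) \<longlonglongrightarrow> f x" by simp
  then have "(\<lambda>n. \<Sum>i<n. Df i 0 / fact i) \<longlonglongrightarrow> f x" by (rule LIMSEQ_imp_Suc)
  then have "(\<lambda>i. Df i 0 / fact i) sums f x" by (simp add: sums_def)
  moreover have "(\<lambda>b. Complex (x \<bullet> b) (0 \<bullet> b)) = z" by (auto simp: z_def complex_eq_iff)
  ultimately show ?thesis by (simp add: taylor_ext_def Df_def sums_iff)
qed

text \<open>Along the real line complex derivatives are vector derivatives, so agreement of the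
  values propagates to all orders. The extension, defined by a series at the origin, can thus be
  expanded again at any real \<open>x\<close>, where the decay of \<open>f\<close> is
  visible.\<close>

lemma higher_deriv_taylor_ext:
  fixes f :: "'a::euclidean_space \<Rightarrow> complex"
  assumes f: "f \<in> Sigma1"
  shows "(deriv ^^ k) (cline (taylor_ext f) x 0 y) (of_real t) = (cpart (\<lambda>b. of_real (y \<bullet> b)) ^^ k) f (x + t *\<^sub>R y)"
proof (induction k arbitrary: t)
  case 0
  then show ?case by (simp add: cline_real taylor_ext_real[OF f])
next
  case (Suc k)
  define g where "g = (deriv ^^ k) (cline (taylor_ext f) x 0 y)"
  have "g holomorphic_on UNIV" unfolding g_def by (intro holomorphic_higher_deriv line_holomorphicD hol_taylor_ext f) auto
  then have "(g has_field_derivative deriv g (of_real t)) (at (of_real t))" by (intro holomorphic_derivI) auto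
  then have 1: "((\<lambda>t. g (of_real t)) has_vector_derivative deriv g (of_real t)) (at t)"
    by (rule has_vector_derivative_real_field)
  have sm: "smooth f" using f by (simp add: Sigma1_def)
  have 2: "((\<lambda>t. (cpart (\<lambda>b. of_real (y \<bullet> b)) ^^ k) f (x + t *\<^sub>R y)) has_vector_derivative
     cpart (\<lambda>b. of_real (y \<bullet> b)) ((cpart (\<lambda>b. of_real (y \<bullet> b)) ^^ k) f) (x + t *\<^sub>R y)) (at t)"
    by (intro line_has_vector_derivative smooth_differentiable smooth_cpart_power sm)
  have "(\<lambda>t. g (of_real t)) = (\<lambda>t. (cpart (\<lambda>b. of_real (y \<bullet> b)) ^^ k) f (x + t *\<^sub>R y))"
    using Suc by (simp add: g_def)
  with 1 2 show ?case by (simp add: g_def vector_derivative_unique_at)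
qed

text \<open>The extension is expanded along the complex line through \<open>x\<close> in direction
  \<open>y\<close> and evaluated at \<open>\<i>\<close>. The coefficients are derivatives of
  \<open>f\<close> at the real point \<open>x\<close> and carry \<open>exp (- (R * norm x))\<close>.
  A geometric series of ratio 1/2 doubles the factor 2 of \<open>Sigma1_derivative_decay\<close>,
  whence the 4.\<close>

lemma tube_taylor_ext:
  fixes f :: "'a::euclidean_space \<Rightarrow> complex" and R :: real
  assumes f: "f \<in> Sigma1" and c: "Sigma1_norm h f \<le> ennreal c" "0 \<le> c" "0 < h" "0 \<le> R" "2 * DIM('a) * R * h \<le> 1"
  shows "tube R (4 * c) (taylor_ext f)"
  unfolding tube_def
proof (intro allI impI)
  fix x y :: 'a assume y: "norm y \<le> R"
  define S where "S = (\<Sum>b\<in>Basis. cmod (of_real (y \<bullet> b)))"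
  have "S \<le> (\<Sum>b\<in>(Basis::'a set). R)" unfolding S_def using y Basis_le_norm[of _ y] by (intro sum_mono) (auto intro: order_trans)
  then have "S * h \<le> DIM('a) * R * h" using c by (intro mult_right_mono) auto
  then have Sh: "S * h \<le> 1/2" using c by linarith
  have "0 \<le> S" by (simp add: S_def sum_nonneg)
  note Sh = Sh this
  define g where "g = cline (taylor_ext f) x 0 y"
  have "(\<lambda>n. (deriv ^^ n) g 0 / fact n * (\<i> - 0) ^ n) sums g \<i>"
    unfolding g_def by (rule holomorphic_power_series[where r=2]) (auto intro!: line_holomorphicD hol_taylor_ext f)
  then have g: "(\<lambda>n. (deriv ^^ n) g 0 / fact n * \<i> ^ n) sums taylor_ext f x y" by (simp add: g_def cline_def)
  have b: "norm ((deriv ^^ n) g 0 / fact n * \<i> ^ n) \<le> 2 * c * exp (- (R * norm x)) * (1/2) ^ n" for n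
  proof -
    have "(deriv ^^ n) g 0 = (cpart (\<lambda>b. of_real (y \<bullet> b)) ^^ n) f x"
      using higher_deriv_taylor_ext[OF f, of n x y 0] by (simp add: g_def)
    also have "cmod \<dots> \<le> S ^ n * (2 * c * exp (- (R * norm x)) * (h ^ n * fact n))"
      unfolding S_def using f by (intro Sigma1_cpart_bound c) (auto simp: Sigma1_def)
    also have "\<dots> = 2 * c * exp (- (R * norm x)) * (S * h) ^ n * fact n" by (simp add: power_mult_distrib)
    also have "\<dots> \<le> 2 * c * exp (- (R * norm x)) * (1/2) ^ n * fact n" using Sh c by (intro mult_right_mono mult_left_mono power_mono) auto
    finally show ?thesis by (simp add: norm_mult norm_divide norm_power field_simps)
  qed
  have sb: "summable (\<lambda>n. 2 * c * exp (- (R * norm x)) * (1/2) ^ n)" by (intro summable_mult summable_geometric) auto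
  have sn: "summable (\<lambda>n. norm ((deriv ^^ n) g 0 / fact n * \<i> ^ n))"
    by (rule summable_comparison_test'[OF sb, of 0]) (use b in simp)
  have "cmod (taylor_ext f x y) \<le> (\<Sum>n. 2 * c * exp (- (R * norm x)) * (1/2) ^ n)"
    unfolding sums_unique[OF g]
    by (rule order_trans[OF summable_norm[OF sn] suminf_le[OF b sn sb]])
  also have "\<dots> = 2 * c * exp (- (R * norm x)) * 2" by (subst suminf_mult) (auto simp: suminf_geometric)
  finally show "cmod (taylor_ext f x y) \<le> 4 * c * exp (- (R * norm x))" by simp
qed

lemma ent_taylor_ext:
  fixes f :: "'a::euclidean_space \<Rightarrow> complex"
  assumes f: "f \<in> Sigma1" shows "entire (taylor_ext f)"
  unfolding entire_def
proof (intro conjI allI hol_taylor_ext f)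
  fix R :: real
  define h where "h = 1 / (2 * DIM('a) * (\<bar>R\<bar> + 1))"
  have h: "0 < h" "2 * DIM('a) * \<bar>R\<bar> * h \<le> 1" by (auto simp: h_def divide_simps)
  obtain c where c: "0 \<le> c" "Sigma1_norm h f \<le> ennreal c" using Sigma1_norm_finite[OF f h(1)] .
  have "tube \<bar>R\<bar> (4 * c) (taylor_ext f)" using c h by (intro tube_taylor_ext[OF f c(2)]) auto
  then show "\<exists>C. tube R C (taylor_ext f)" using tube_antimono[of "\<bar>R\<bar>" _ _ R] by fastforce
qed


section \<open>Tube bounds as seminorms\<close>

text \<open>Says that \<open>C\<close> bounds the seminorm of index \<open>R\<close> without forming
  a supremum, so that explicit constants can be passed through linear maps, Fourier transforms and
  integrals.\<close>

definition entire_bd :: "real \<Rightarrow> real \<Rightarrow> ('a::euclidean_space \<Rightarrow> complex) \<Rightarrow> bool" where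
  "entire_bd R C f \<longleftrightarrow> (\<exists>F. entire F \<and> tube R C F \<and> (\<forall>x. F x 0 = f x))"

lemma entire_bdI: "entire F \<Longrightarrow> tube R C F \<Longrightarrow> (\<And>x. F x 0 = f x) \<Longrightarrow> entire_bd R C f"
  by (auto simp: entire_bd_def)

lemma entire_bdE: assumes "entire_bd R C f" obtains F where "entire F" "tube R C F" "f = (\<lambda>x. F x 0)"
  using assms unfolding entire_bd_def by (metis ext)

lemma Sigma1_iff_ent: "f \<in> Sigma1 \<longleftrightarrow> (\<exists>F. entire F \<and> f = (\<lambda>x. F x 0))"
  using ent_taylor_ext taylor_ext_real Sigma1_ent by (metis ext)

lemma Sigma1_ent_bd: "f \<in> Sigma1 \<Longrightarrow> \<exists>C. entire_bd R C f"
proof -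
  assume "f \<in> Sigma1"
  then obtain F where "entire F" "f = (\<lambda>x. F x 0)" unfolding Sigma1_iff_ent by blast
  moreover from this obtain C where "tube R C F" by (auto simp: entire_def)
  ultimately show ?thesis by (auto simp: entire_bd_def)
qed

lemma entire_bd_Sigma1: "entire_bd R C f \<Longrightarrow> f \<in> Sigma1"
  by (elim entire_bdE) (auto intro: Sigma1_ent)

lemma entire_bd_nonneg: "entire_bd R C f \<Longrightarrow> 0 \<le> R \<Longrightarrow> 0 \<le> C"
  by (elim entire_bdE) (auto intro: tube_nonneg)

lemma entire_bd_antimono: "entire_bd R C f \<Longrightarrow> R' \<le> R \<Longrightarrow> 0 \<le> R \<Longrightarrow> entire_bd R' C f"
  unfolding entire_bd_def using tube_antimono by blast

lemma entire_bd_real: "entire_bd R C f \<Longrightarrow> 0 \<le> R \<Longrightarrow> cmod (f x) \<le> C * exp (- (R * norm x))"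
  by (elim entire_bdE) (auto simp: tube_def)

lemma Sigma1_norm_ent_bd:
  fixes f :: "'a::euclidean_space \<Rightarrow> complex"
  shows "0 < h \<Longrightarrow> entire_bd (2 * DIM('a) / h) C f \<Longrightarrow> Sigma1_norm h f \<le> ennreal (Sigma1_const TYPE('a) h * C)"
  by (elim entire_bdE) (auto intro: Sigma1_norm_ent_le)

lemma entire_bd_Sigma1_norm:
  fixes f :: "'a::euclidean_space \<Rightarrow> complex" and R h :: real
  assumes "f \<in> Sigma1" "Sigma1_norm h f \<le> ennreal c" "0 \<le> c" "0 < h" "0 \<le> R" "2 * DIM('a) * R * h \<le> 1"
  shows "entire_bd R (4 * c) f"
  using assms by (intro entire_bdI[of "taylor_ext f"] ent_taylor_ext tube_taylor_ext taylor_ext_real)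

section \<open>Linear operations, substitutions and tensor products\<close>

lemma hol_line: "line_holomorphic F \<Longrightarrow> (\<lambda>z. F (x + Re z *\<^sub>R v) (y + Im z *\<^sub>R v)) holomorphic_on S"
  using line_holomorphicD[of F x y v S] by (simp add: cline_def[abs_def])

lemma line_holomorphicI: "(\<And>x y v. (\<lambda>z. F (x + Re z *\<^sub>R v) (y + Im z *\<^sub>R v)) holomorphic_on UNIV) \<Longrightarrow> line_holomorphic F"
  by (simp add: line_holomorphic_def cline_def[abs_def])

lemma hol_add: "line_holomorphic F \<Longrightarrow> line_holomorphic G \<Longrightarrow> line_holomorphic (\<lambda>x y. F x y + G x y)"
  by (rule line_holomorphicI, rule holomorphic_on_add) (rule hol_line, assumption)+

lemma hol_mult: "line_holomorphic F \<Longrightarrow> line_holomorphic G \<Longrightarrow> line_holomorphic (\<lambda>x y. F x y * G x y)"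
  by (rule line_holomorphicI, rule holomorphic_on_mult) (rule hol_line, assumption)+

lemma hol_cmult: "line_holomorphic F \<Longrightarrow> line_holomorphic (\<lambda>x y. c * F x y)"
  by (rule line_holomorphicI, rule holomorphic_on_mult[OF holomorphic_on_const]) (rule hol_line, assumption)

lemma hol_compose_linear:
  assumes "line_holomorphic F" "linear L" shows "line_holomorphic (\<lambda>x y. F (L x) (L y))"
  using hol_line[OF assms(1)] by (intro line_holomorphicI) (simp add: linear_add[OF assms(2)] linear_scale[OF assms(2)])

lemma tube_add:
  assumes "tube R C F" "tube R D G" shows "tube R (C + D) (\<lambda>x y. F x y + G x y)"
  using assms unfolding tube_def
  by (auto simp: distrib_right intro!: order_trans[OF norm_triangle_ineq] add_mono)

lemma tube_cmult: "tube R C F \<Longrightarrow> tube R (cmod c * C) (\<lambda>x y. c * F x y)"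
  unfolding tube_def by (auto simp: norm_mult mult.assoc intro: mult_left_mono)

lemma ent_add: "entire F \<Longrightarrow> entire G \<Longrightarrow> entire (\<lambda>x y. F x y + G x y)"
  unfolding entire_def using hol_add tube_add by blast

lemma ent_cmult: "entire F \<Longrightarrow> entire (\<lambda>x y. c * F x y)"
  unfolding entire_def using hol_cmult tube_cmult by blast

lemma entire_bd_add: "entire_bd R C f \<Longrightarrow> entire_bd R D g \<Longrightarrow> entire_bd R (C + D) (\<lambda>x. f x + g x)"
  by (elim entire_bdE, rule entire_bdI, rule ent_add, assumption+, rule tube_add, assumption+, simp)

lemma entire_bd_cmult: "entire_bd R C f \<Longrightarrow> entire_bd R (cmod c * C) (\<lambda>x. c * f x)"
  by (elim entire_bdE, rule entire_bdI, rule ent_cmult, assumption, rule tube_cmult, assumption, simp)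

lemma Sigma1_add: "f \<in> Sigma1 \<Longrightarrow> g \<in> Sigma1 \<Longrightarrow> (\<lambda>x. f x + g x) \<in> Sigma1"
  using Sigma1_ent_bd[of f 0] Sigma1_ent_bd[of g 0] by (auto intro: entire_bd_Sigma1[OF entire_bd_add])

lemma Sigma1_cmult: "f \<in> Sigma1 \<Longrightarrow> (\<lambda>x. c * f x) \<in> Sigma1"
  using Sigma1_ent_bd[of f 0] by (auto intro: entire_bd_Sigma1[OF entire_bd_cmult])

lemma Sigma1_diff: "f \<in> Sigma1 \<Longrightarrow> g \<in> Sigma1 \<Longrightarrow> (\<lambda>x. f x - g x) \<in> Sigma1"
  using Sigma1_add[of f "\<lambda>x. - 1 * g x"] Sigma1_cmult[of g "- 1"] by simp

lemma ent_zero: "entire (\<lambda>x y. 0)"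
  by (auto simp: entire_def tube_def intro!: line_holomorphicI exI[of _ 0])

lemma Sigma1_zero: "(\<lambda>x. 0) \<in> Sigma1"
  using Sigma1_ent[OF ent_zero] .

lemma entire_bd_zero: "entire_bd R 0 f \<Longrightarrow> 0 \<le> R \<Longrightarrow> f = (\<lambda>x. 0)"
  using entire_bd_real[of R 0 f] by auto

text \<open>\<open>\<kappa>\<close> bounds \<open>L\<close> from above and from below. The upper
  bound keeps \<open>L y\<close> in the wider tube, the lower one turns decay in \<open>L x\<close>
  into decay in \<open>x\<close>.\<close>

lemma entire_bd_linear:
  fixes L :: "'b::euclidean_space \<Rightarrow> 'a::euclidean_space"
  assumes "entire_bd (\<kappa> * R) C f" "linear L" "1 \<le> \<kappa>" "0 \<le> R"
    "\<And>x. norm x \<le> \<kappa> * norm (L x)" "\<And>x. norm (L x) \<le> \<kappa> * norm x"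
  shows "entire_bd R C (\<lambda>x. f (L x))"
proof -
  have t: "tube R C (\<lambda>x y. F (L x) (L y))" if F: "tube (\<kappa> * R) C F" and R: "0 \<le> R" for R C F
    unfolding tube_def
  proof (intro allI impI)
    fix x y :: 'b assume y: "norm y \<le> R"
    have "norm (L y) \<le> \<kappa> * R" using assms(3) by (intro order_trans[OF assms(6) mult_left_mono[OF y]]) simp
    then have "cmod (F (L x) (L y)) \<le> C * exp (- (\<kappa> * R * norm (L x)))" using F by (simp add: tube_def)
    also have "\<dots> \<le> C * exp (- (R * norm x))"
      using tube_nonneg[OF F] assms(3) R mult_left_mono[OF assms(5)[of x] R]
      by (intro mult_left_mono) (auto simp: mult_ac)
    finally show "cmod (F (L x) (L y)) \<le> C * exp (- (R * norm x))" .
  qed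
  obtain F where F: "entire F" "tube (\<kappa> * R) C F" "f = (\<lambda>x. F x 0)" using assms(1) by (rule entire_bdE)
  have "\<exists>C. tube R' C (\<lambda>x y. F (L x) (L y))" for R'
  proof -
    obtain C where "tube (\<kappa> * \<bar>R'\<bar>) C F" using F(1) by (auto simp: entire_def)
    from tube_antimono[OF t[OF this abs_ge_zero] abs_ge_self abs_ge_zero] show ?thesis by blast
  qed
  then have "entire (\<lambda>x y. F (L x) (L y))"
    using F(1) assms(2) by (auto simp: entire_def hol_compose_linear)
  then show ?thesis
    using t[OF F(2) assms(4)] by (rule entire_bdI) (simp add: F(3) linear_0[OF assms(2)])
qed

lemma tube_tensor:
  assumes "tube R C F" "tube R D G" "0 \<le> R"
  shows "tube R (C * D) (\<lambda>p q. F (fst p) (fst q) * G (snd p) (snd q))"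
  unfolding tube_def
proof (intro allI impI)
  fix p q :: "'a \<times> 'b" assume q: "norm q \<le> R"
  then have q': "norm (fst q) \<le> R" "norm (snd q) \<le> R"
    using norm_fst_le[of "fst q" "snd q"] norm_snd_le[of "snd q" "fst q"] by auto
  have CD: "0 \<le> C" "0 \<le> D" using assms tube_nonneg by auto
  have "cmod (F (fst p) (fst q) * G (snd p) (snd q)) \<le> (C * exp (- (R * norm (fst p)))) * (D * exp (- (R * norm (snd p))))"
    unfolding norm_mult using assms q' CD by (intro mult_mono) (auto simp: tube_def)
  also have "\<dots> = C * D * exp (- (R * (norm (fst p) + norm (snd p))))"
    by (simp add: distrib_left exp_diff exp_minus field_simps exp_add)
  also have "\<dots> \<le> C * D * exp (- (R * norm p))"
    using CD assms(3) norm_Pair_le[of "fst p" "snd p"] by (intro mult_left_mono) (auto intro: mult_left_mono)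
  finally show "cmod (F (fst p) (fst q) * G (snd p) (snd q)) \<le> C * D * exp (- (R * norm p))" .
qed

lemma ent_tensor:
  assumes "entire F" "entire G" shows "entire (\<lambda>p q. F (fst p) (fst q) * G (snd p) (snd q))"
  unfolding entire_def
proof (intro conjI allI)
  show "line_holomorphic (\<lambda>p q. F (fst p) (fst q) * G (snd p) (snd q))"
    using assms by (intro hol_mult[OF hol_compose_linear[of F fst] hol_compose_linear[of G snd]]) (auto simp: entire_def linear_iff)
  fix R :: real
  obtain C where C: "tube \<bar>R\<bar> C F" using assms(1) by (auto simp: entire_def)
  obtain D where D: "tube \<bar>R\<bar> D G" using assms(2) by (auto simp: entire_def)
  from tube_antimono[OF tube_tensor[OF C D abs_ge_zero] abs_ge_self abs_ge_zero]
  show "\<exists>C. tube R C (\<lambda>p q. F (fst p) (fst q) * G (snd p) (snd q))" by blast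
qed

lemma entire_bd_tensor:
  assumes "entire_bd R C f" "entire_bd R D g" "0 \<le> R"
  shows "entire_bd R (C * D) (\<lambda>p. f (fst p) * g (snd p))"
proof -
  obtain F where F: "entire F" "tube R C F" "f = (\<lambda>x. F x 0)" using assms(1) by (rule entire_bdE)
  obtain G where G: "entire G" "tube R D G" "g = (\<lambda>x. G x 0)" using assms(2) by (rule entire_bdE)
  show ?thesis
    by (rule entire_bdI[OF ent_tensor[OF F(1) G(1)] tube_tensor[OF F(2) G(2) assms(3)]]) (simp add: F G)
qed

section \<open>The topology of \<open>Sigma1\<close> and its dual in terms of tube bounds\<close>

lemma mderiv_add:
  assumes "smooth f" "smooth g" shows "mderiv \<beta> (\<lambda>x. f x + g x) = (\<lambda>x. mderiv \<beta> f x + mderiv \<beta> g x)"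
proof -
  define bs where "bs = concat (map (\<lambda>b. replicate (\<beta> b) b) (basis_enum :: 'a list))"
  have bs: "bs \<in> lists Basis" by (auto simp: bs_def basis_enum)
  define G where "G i = (if i then f else g)" for i :: bool
  have "foldr partial bs (\<lambda>x. \<Sum>i\<in>UNIV. 1 * G i x) = (\<lambda>x. \<Sum>i\<in>UNIV. 1 * foldr partial bs (G i) x)"
    using assms by (intro foldr_partial_lincomb bs) (auto simp: G_def)
  then show ?thesis by (simp add: mderiv_def foldr_powers_eq_concat bs_def[symmetric] UNIV_bool G_def add.commute)
qed

lemma Sigma1_norm_triangle:
  assumes "smooth f" "smooth g" "0 < h"
  shows "Sigma1_norm h (\<lambda>x. f x + g x) \<le> Sigma1_norm h f + Sigma1_norm h g"
proof -
  define T where "T f \<alpha> \<beta> x = ennreal (cmod (of_real (mpow x \<alpha>) * mderiv \<beta> f x) / (h ^ (mabs \<alpha> + mabs \<beta>) * mfact \<alpha> * mfact \<beta>))"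
    for f :: "'a \<Rightarrow> complex" and \<alpha> \<beta> x
  have N: "Sigma1_norm h f = (SUP \<alpha>. SUP \<beta>. SUP x. T f \<alpha> \<beta> x)" for f
    by (simp add: Sigma1_norm_def T_def)
  have le: "T f \<alpha> \<beta> x \<le> Sigma1_norm h f" for f \<alpha> \<beta> x
    unfolding N by (rule SUP_upper2[where i=\<alpha>], simp, rule SUP_upper2[where i=\<beta>], simp, rule SUP_upper) simp
  have pos: "0 < h ^ (mabs \<alpha> + mabs \<beta>) * mfact \<alpha> * mfact \<beta>" for \<alpha> \<beta> :: "'a \<Rightarrow> nat"
    using assms(3) mfact_pos[of \<alpha>] mfact_pos[of \<beta>] by simp
  have "T (\<lambda>x. f x + g x) \<alpha> \<beta> x \<le> T f \<alpha> \<beta> x + T g \<alpha> \<beta> x" for \<alpha> \<beta> x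
    unfolding T_def mderiv_add[OF assms(1,2)] using pos[of \<alpha> \<beta>]
    by (subst ennreal_plus[symmetric])
      (auto intro!: ennreal_leI divide_right_mono simp: distrib_left norm_triangle_ineq add_divide_distrib[symmetric])
  then have "T (\<lambda>x. f x + g x) \<alpha> \<beta> x \<le> Sigma1_norm h f + Sigma1_norm h g" for \<alpha> \<beta> x
    using le by (meson add_mono order_trans)
  then show ?thesis unfolding N[of "\<lambda>x. f x + g x"] by (intro SUP_least) auto
qed

lemma Sigma1_norm_antimono:
  assumes "0 < h" "h \<le> h'" shows "Sigma1_norm h' f \<le> Sigma1_norm h f"
  unfolding Sigma1_norm_def using assms
  by (intro SUP_mono' ennreal_leI divide_left_mono mult_right_mono power_mono)
    (auto simp: less_imp_le mfact_pos)

lemma topspace_Sigma1: "topspace Sigma1_topology = Sigma1"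
proof -
  have "f \<in> {g \<in> Sigma1. Sigma1_norm 1 (\<lambda>x. g x - f x) < ennreal 1}" if f: "f \<in> Sigma1" for f :: "'a \<Rightarrow> complex"
  proof -
    have "entire_bd (2 * DIM('a) / 1) 0 (\<lambda>x::'a. 0::complex)" by (auto intro!: entire_bdI[OF ent_zero] simp: tube_def)
    from Sigma1_norm_ent_bd[OF _ this] f show ?thesis by simp
  qed
  moreover have "{g \<in> Sigma1. Sigma1_norm 1 (\<lambda>x. g x - f x) < ennreal 1}
      \<in> {{g \<in> Sigma1. Sigma1_norm h (\<lambda>x. g x - f x) < ennreal r} |f h r. f \<in> Sigma1 \<and> 0 < h \<and> 0 < r}"
    if "f \<in> Sigma1" for f :: "'a \<Rightarrow> complex"
    using that zero_less_one[where 'a=real] by blast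
  ultimately have "Sigma1 \<subseteq> topspace (Sigma1_topology :: ('a \<Rightarrow> complex) topology)"
    unfolding Sigma1_topology_def topology_generated_by_topspace by (intro subsetI UnionI)
  moreover have "topspace (Sigma1_topology :: ('a \<Rightarrow> complex) topology) \<subseteq> Sigma1"
    unfolding Sigma1_topology_def topology_generated_by_topspace by auto
  ultimately show ?thesis by (rule subset_antisym[rotated])
qed

text \<open>The sets that generate the topology are balls about arbitrary centres; the triangle
  inequality recentres them at \<open>g0\<close>. In an intersection the smaller \<open>h\<close>
  gives the larger seminorm, so one ball fits into both sets.\<close>

lemma openin_Sigma1_ball:
  assumes "openin Sigma1_topology U" "g0 \<in> U"
  shows "\<exists>h>0. \<exists>r>0. \<forall>g\<in>Sigma1. Sigma1_norm h (\<lambda>x. g x - g0 x) < ennreal r \<longrightarrow> g \<in> U"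
  using assms unfolding Sigma1_topology_def openin_topology_generated_by_iff
proof (induction arbitrary: g0 rule: generate_topology_on.induct)
  case (Int a b)
  then obtain h r h' r' where *: "h > 0" "r > 0" "\<forall>g\<in>Sigma1. Sigma1_norm h (\<lambda>x. g x - g0 x) < ennreal r \<longrightarrow> g \<in> a"
    "h' > 0" "r' > 0" "\<forall>g\<in>Sigma1. Sigma1_norm h' (\<lambda>x. g x - g0 x) < ennreal r' \<longrightarrow> g \<in> b"
    using Int.IH(1)[of g0] Int.IH(2)[of g0] Int.prems by blast
  have "g \<in> a \<inter> b" if g: "g \<in> Sigma1" and n: "Sigma1_norm (min h h') (\<lambda>x. g x - g0 x) < ennreal (min r r')" for g
  proof -
    have "Sigma1_norm h (\<lambda>x. g x - g0 x) \<le> Sigma1_norm (min h h') (\<lambda>x. g x - g0 x)"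
      "Sigma1_norm h' (\<lambda>x. g x - g0 x) \<le> Sigma1_norm (min h h') (\<lambda>x. g x - g0 x)"
      using * by (auto intro!: Sigma1_norm_antimono)
    moreover have "ennreal (min r r') \<le> ennreal r" "ennreal (min r r') \<le> ennreal r'" by (auto intro!: ennreal_leI)
    ultimately show ?thesis using * g n by (meson IntI le_less_trans less_le_trans)
  qed
  then show ?case using * by (intro exI[of _ "min h h'"] conjI exI[of _ "min r r'"]) auto
next
  case (UN K)
  then obtain k where "k \<in> K" "g0 \<in> k" by auto
  with UN.IH[of k g0] show ?case by blast
next
  case (Basis s)
  then obtain f h r where s: "s = {g \<in> Sigma1. Sigma1_norm h (\<lambda>x. g x - f x) < ennreal r}" "f \<in> Sigma1" "0 < h" "0 < r"
    by auto
  then have g0: "g0 \<in> Sigma1" "Sigma1_norm h (\<lambda>x. g0 x - f x) < ennreal r" using Basis by auto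
  define m where "m = enn2real (Sigma1_norm h (\<lambda>x. g0 x - f x))"
  have m: "Sigma1_norm h (\<lambda>x. g0 x - f x) = ennreal m"
    using g0(2) by (simp add: m_def ennreal_enn2real_if) (metis ennreal_less_top less_trans top.not_eq_extremum)
  have mr: "m < r" "0 \<le> m" using g0(2) s unfolding m by (auto simp: m_def ennreal_less_iff)
  have "g \<in> s" if g: "g \<in> Sigma1" "Sigma1_norm h (\<lambda>x. g x - g0 x) < ennreal (r - m)" for g
  proof -
    have "Sigma1_norm h (\<lambda>x. (g x - g0 x) + (g0 x - f x)) \<le> Sigma1_norm h (\<lambda>x. g x - g0 x) + Sigma1_norm h (\<lambda>x. g0 x - f x)"
      using Sigma1_diff[OF g(1) g0(1)] Sigma1_diff[OF g0(1) s(2)] s(3)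
      by (intro Sigma1_norm_triangle) (auto simp: Sigma1_def)
    also have "\<dots> < ennreal (r - m) + ennreal m"
      unfolding m using g(2) by (simp add: add.commute[of _ "ennreal m"] ennreal_add_left_cancel_less)
    also have "\<dots> = ennreal r" using mr by (subst ennreal_plus[symmetric]) auto
    finally show ?thesis using g s by simp
  qed
  then show ?case using mr s by (intro exI[of _ h] conjI exI[of _ "r - m"]) auto
qed simp

text \<open>Continuity at 0 bounds the functional on a seminorm ball, and homogeneity spreads the
  bound. In terms of \<open>entire_bd\<close> it can be composed with the transformations to
  come.\<close>

lemma Sigma1_dual_bound:
  fixes a :: "('a::euclidean_space \<Rightarrow> complex) \<Rightarrow> complex"
  assumes a: "a \<in> Sigma1_dual"
  shows "\<exists>R\<ge>0. \<exists>K\<ge>0. \<forall>f C. entire_bd R C f \<longrightarrow> cmod (a f) \<le> K * C"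
proof -
  have ac: "\<And>c f. f \<in> Sigma1 \<Longrightarrow> a (\<lambda>x. c * f x) = c * a f"
    and cont: "continuous_map Sigma1_topology euclidean a"
    using a unfolding Sigma1_dual_def by auto
  have a0: "a (\<lambda>x. 0) = 0" using ac[OF Sigma1_zero, of 0] by simp
  have "openin Sigma1_topology {f \<in> topspace Sigma1_topology. a f \<in> ball 0 1}"
    using cont by (rule openin_continuous_map_preimage) auto
  from openin_Sigma1_ball[OF this, of "\<lambda>x. 0"]
  obtain h r where hr: "0 < h" "0 < r" "\<And>g. g \<in> Sigma1 \<Longrightarrow> Sigma1_norm h g < ennreal r \<Longrightarrow> cmod (a g) < 1"
    by (auto simp: topspace_Sigma1 Sigma1_zero a0)
  define K where "K = Sigma1_const TYPE('a) h"
  have K: "0 < K" by (simp add: K_def Sigma1_const_def)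
  have "cmod (a f) \<le> (2 * K / r) * C" if f: "entire_bd (2 * DIM('a) / h) C f" for f C
  proof -
    have C: "0 \<le> C" using entire_bd_nonneg[OF f] hr by simp
    show ?thesis
    proof (cases "C = 0")
      case True
      with f have "f = (\<lambda>x. 0)" using entire_bd_zero hr by (metis divide_nonneg_pos mult_nonneg_nonneg of_nat_0_le_iff zero_le_numeral)
      then show ?thesis using True by (simp add: a0)
    next
      case False
      \<comment> \<open>Scales \<open>f\<close> so that its seminorm is at most
        \<open>r / 2\<close>. For \<open>C = 0\<close> there is no such factor, but then
        \<open>f\<close> vanishes identically.\<close>
      define t where "t = r / (2 * K * C)"
      have t: "0 < t" using C False K hr by (simp add: t_def)
      have "entire_bd (2 * DIM('a) / h) (cmod t * C) (\<lambda>x. of_real t * f x)" using entire_bd_cmult[OF f, of t] by simp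
      then have "Sigma1_norm h (\<lambda>x. of_real t * f x) \<le> ennreal (K * (cmod t * C))"
        unfolding K_def by (intro Sigma1_norm_ent_bd hr)
      also have "K * (cmod t * C) = K * (t * C)" using t by simp
      also have "K * (t * C) = r / 2" using C False K by (simp add: t_def)
      also have "ennreal (r / 2) < ennreal r" using hr by (simp add: ennreal_less_iff)
      finally have "cmod (a (\<lambda>x. of_real t * f x)) < 1"
        using entire_bd_Sigma1[OF f] by (intro hr Sigma1_cmult)
      then have "t * cmod (a f) < 1" using t ac[OF entire_bd_Sigma1[OF f], of t] by (simp add: norm_mult)
      then show ?thesis using t C False K hr by (simp add: t_def field_simps)
    qed
  qed
  then show ?thesis using K hr by (intro exI[of _ "2 * DIM('a) / h"] conjI exI[of _ "2 * K / r"]) auto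
qed

lemma Sigma1_dualI:
  fixes a :: "('a::euclidean_space \<Rightarrow> complex) \<Rightarrow> complex"
  assumes ext: "a \<in> extensional Sigma1"
    and add: "\<And>f g. f \<in> Sigma1 \<Longrightarrow> g \<in> Sigma1 \<Longrightarrow> a (\<lambda>x. f x + g x) = a f + a g"
    and cmult: "\<And>c f. f \<in> Sigma1 \<Longrightarrow> a (\<lambda>x. c * f x) = c * a f"
    and bd: "\<And>f C. entire_bd R C f \<Longrightarrow> cmod (a f) \<le> K * C" and R: "0 \<le> R" "0 \<le> K"
  shows "a \<in> Sigma1_dual"
proof -
  have "openin Sigma1_topology {f \<in> Sigma1. a f \<in> V}" if V: "open V" for V
  proof (subst openin_subopen, intro ballI)
    fix f assume f: "f \<in> {f \<in> Sigma1. a f \<in> V}"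
    then obtain e where e: "0 < e" "ball (a f) e \<subseteq> V" using V openE by blast
    \<comment> \<open>Small enough for the norm of index \<open>h\<close> to control the tube of
      width \<open>R\<close>; \<open>R + 1\<close> keeps the denominator positive.\<close>
    define h where "h = 1 / (2 * DIM('a) * (R + 1))"
    have h: "0 < h" "2 * DIM('a) * R * h \<le> 1" using R by (auto simp: h_def divide_simps)
    \<comment> \<open>The 4 is the constant in \<open>entire_bd_Sigma1_norm\<close>, and
      \<open>K + 1\<close> admits \<open>K = 0\<close>.\<close>
    define r where "r = e / (4 * (K + 1))"
    have r: "0 < r" "K * (4 * r) < e" using R e by (auto simp: r_def field_simps)
    define B where "B = {g \<in> Sigma1. Sigma1_norm h (\<lambda>x. g x - f x) < ennreal r}"
    have "openin Sigma1_topology B"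
      unfolding Sigma1_topology_def openin_topology_generated_by_iff using f h r
      by (intro generate_topology_on.Basis) (auto simp: B_def)
    moreover have "f \<in> B"
    proof -
      have "entire_bd (2 * DIM('a) / h) 0 (\<lambda>x::'a. 0::complex)" by (auto intro!: entire_bdI[OF ent_zero] simp: tube_def)
      from Sigma1_norm_ent_bd[OF h(1) this] f r show ?thesis by (simp add: B_def)
    qed
    moreover have "B \<subseteq> {f \<in> Sigma1. a f \<in> V}"
    proof
      fix g assume g: "g \<in> B"
      then have gf: "(\<lambda>x. g x - f x) \<in> Sigma1" "g \<in> Sigma1" using f by (auto simp: B_def Sigma1_diff)
      have "entire_bd R (4 * r) (\<lambda>x. g x - f x)"
        using g h r R by (intro entire_bd_Sigma1_norm[OF gf(1)]) (auto simp: B_def)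
      then have "cmod (a (\<lambda>x. g x - f x)) < e" using bd r by (meson le_less_trans)
      moreover have "a (\<lambda>x. g x - f x) = a g - a f"
        using add[OF gf(1), of f] f by simp
      ultimately have "a g \<in> ball (a f) e" by (simp add: dist_norm norm_minus_commute)
      then show "g \<in> {f \<in> Sigma1. a f \<in> V}" using e gf by auto
    qed
    ultimately show "\<exists>T. openin Sigma1_topology T \<and> f \<in> T \<and> T \<subseteq> {f \<in> Sigma1. a f \<in> V}" by blast
  qed
  then have "continuous_map Sigma1_topology euclidean a"
    by (auto simp: continuous_map_def topspace_Sigma1)
  then show ?thesis using ext add cmult by (auto simp: Sigma1_dual_def)
qed


section \<open>Integration against exponentially decaying functions\<close>

lemma integrable_dominated:
  fixes f :: "'a \<Rightarrow> 'b::{banach, second_countable_topology}" and B :: "'a \<Rightarrow> real"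
  assumes "integrable M B" "f \<in> borel_measurable M" "\<And>x. norm (f x) \<le> B x"
  shows "integrable M f"
  using assms(1,2)
proof (rule Bochner_Integration.integrable_bound)
  have "norm (f x) \<le> norm (B x)" for x using order_trans[OF assms(3) abs_ge_self] by simp
  then show "AE x in M. norm (f x) \<le> norm (B x)" by simp
qed

lemma nn_integral_exp_abs_finite:
  assumes "0 < (k::real)" shows "(\<integral>\<^sup>+t. ennreal (exp (- (k * \<bar>t\<bar>))) \<partial>lborel) < \<infinity>"
proof -
  have "((\<lambda>t. - (exp (- (k * t)) / k)) \<longlongrightarrow> 0) at_top"
  proof -
    have "filterlim (\<lambda>t. k * t) at_top at_top"
      using assms by (intro filterlim_tendsto_pos_mult_at_top[OF tendsto_const]) (auto simp: filterlim_ident)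
    then have "((\<lambda>t. exp (- (k * t))) \<longlongrightarrow> 0) at_top"
      by (intro filterlim_compose[OF exp_at_bot]) (simp add: filterlim_uminus_at_top)
    then have "((\<lambda>t. - (exp (- (k * t)) / k)) \<longlongrightarrow> - (0 / k)) at_top" by (intro tendsto_intros) (use assms in auto)
    then show ?thesis by simp
  qed
  then have half: "(\<integral>\<^sup>+t. ennreal (exp (- (k * t))) * indicator {0..} t \<partial>lborel) = 0 - - (exp (- (k * 0)) / k)"
    using assms by (intro nn_integral_FTC_atLeast) (auto intro!: derivative_eq_intros simp: field_simps)
  then have h1: "(\<integral>\<^sup>+t. ennreal (exp (- (k * t))) * indicator {0..} t \<partial>lborel) < \<infinity>" by simp
  have h2: "(\<integral>\<^sup>+t. ennreal (exp (k * t)) * indicator {..0} t \<partial>lborel) < \<infinity>"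
  proof -
    have "(\<integral>\<^sup>+t. ennreal (exp (k * t)) * indicator {..0} t \<partial>lborel)
        = ennreal \<bar>-1\<bar> * (\<integral>\<^sup>+t. ennreal (exp (k * (0 + -1 * t))) * indicator {..0} (0 + -1 * t) \<partial>lborel)"
      by (rule nn_integral_real_affine) auto
    also have "\<dots> = (\<integral>\<^sup>+t. ennreal (exp (- (k * t))) * indicator {0..} t \<partial>lborel)"
      by (auto intro!: nn_integral_cong simp: indicator_def)
    finally show ?thesis using h1 by simp
  qed
  have "(\<integral>\<^sup>+t. ennreal (exp (- (k * \<bar>t\<bar>))) \<partial>lborel)
     \<le> (\<integral>\<^sup>+t. ennreal (exp (- (k * t))) * indicator {0..} t + ennreal (exp (k * t)) * indicator {..0} t \<partial>lborel)"
    by (intro nn_integral_mono) (auto simp: indicator_def abs_if)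
  also have "\<dots> = (\<integral>\<^sup>+t. ennreal (exp (- (k * t))) * indicator {0..} t \<partial>lborel) + (\<integral>\<^sup>+t. ennreal (exp (k * t)) * indicator {..0} t \<partial>lborel)"
    by (rule nn_integral_add) auto
  also have "\<dots> < \<infinity>" using h1 h2 by simp
  finally show ?thesis .
qed

text \<open>Every \<open>\<bar>x \<bullet> b\<bar>\<close> is at most \<open>norm x\<close>, so with
  \<open>k = c / DIM('a)\<close> the integrand lies below a product of functions of one coordinate,
  and Tonelli's theorem separates these.\<close>

lemma integrable_exp_norm:
  assumes "0 < c" shows "integrable lborel (\<lambda>x::'a::euclidean_space. exp (- (c * norm x)))"
proof (rule integrableI_bounded)
  define k where "k = c / DIM('a)"
  have k: "0 < k" using assms by (simp add: k_def)
  have "(\<integral>\<^sup>+(x::'a). ennreal (norm (exp (- (c * norm x)))) \<partial>lborel) \<le> (\<integral>\<^sup>+(x::'a). (\<Prod>b\<in>Basis. ennreal (exp (- (k * \<bar>x \<bullet> b\<bar>)))) \<partial>lborel)"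
  proof (intro nn_integral_mono)
    fix x :: 'a
    have "(\<Sum>b\<in>Basis. k * \<bar>x \<bullet> b\<bar>) \<le> (\<Sum>b\<in>(Basis::'a set). k * norm x)"
      using k by (intro sum_mono mult_left_mono Basis_le_norm) auto
    then have "(\<Sum>b\<in>Basis. k * \<bar>x \<bullet> b\<bar>) \<le> c * norm x" by (simp add: k_def)
    then show "ennreal (norm (exp (- (c * norm x)))) \<le> (\<Prod>b\<in>Basis. ennreal (exp (- (k * \<bar>x \<bullet> b\<bar>))))"
      by (simp add: prod_ennreal exp_sum[symmetric] sum_negf ennreal_leI)
  qed
  also have "\<dots> = (\<Prod>b\<in>(Basis::'a set). (\<integral>\<^sup>+t. ennreal (exp (- (k * \<bar>t\<bar>))) \<partial>lborel))"
    by (rule nn_integral_lborel_prod) auto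
  also have "\<dots> < \<infinity>"
    using nn_integral_exp_abs_finite[OF k] by (simp add: power_less_top_ennreal)
  finally show "(\<integral>\<^sup>+(x::'a). ennreal (norm (exp (- (c * norm x)))) \<partial>lborel) < \<infinity>" .
qed simp

lemma integrable_exp_bound:
  fixes f :: "'a::euclidean_space \<Rightarrow> 'b::{banach, second_countable_topology}"
  assumes "f \<in> borel_measurable lborel" "\<And>x. norm (f x) \<le> K * exp (- (c * norm x))" "0 < c"
  shows "integrable lborel f"
  by (rule integrable_dominated[OF integrable_mult_right[OF integrable_exp_norm[OF assms(3)], of K]])
    (use assms in auto)

definition exp_int :: "'a::euclidean_space itself \<Rightarrow> real" where
  "exp_int _ = (LINT x|lborel. exp (- norm (x::'a)))"

lemma integral_exp_bound:
  fixes f :: "'a::euclidean_space \<Rightarrow> 'b::{banach, second_countable_topology}"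
  assumes "f \<in> borel_measurable lborel" "\<And>x. norm (f x) \<le> K * exp (- norm x)"
  shows "norm (LINT x|lborel. f x) \<le> K * exp_int TYPE('a)"
proof -
  have i: "integrable lborel (\<lambda>x::'a. K * exp (- (1 * norm x)))"
    by (intro integrable_mult_right integrable_exp_norm) auto
  have "integrable lborel f" by (rule integrable_exp_bound[where c=1 and K=K]) (use assms in auto)
  then have "norm (LINT x|lborel. f x) \<le> (LINT x|lborel. norm (f x))" by (intro integral_norm_bound)
  also have "\<dots> \<le> (LINT x|lborel. K * exp (- (1 * norm (x::'a))))"
    using assms \<open>integrable lborel f\<close> i by (intro integral_mono) auto
  finally show ?thesis by (simp add: exp_int_def)
qed

text \<open>Cauchy's inequality on unit circles bounds the difference quotients at \<open>z0\<close>
  by the majorant, which is therefore taken on a disc larger by 1 than the one containing the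
  increments. Dominated convergence concerns sequences, whence the sequential form of the
  limit.\<close>

lemma holomorphic_on_integral:
  fixes g :: "complex \<Rightarrow> 'b::euclidean_space \<Rightarrow> complex"
  assumes line_holomorphic: "\<And>t. (\<lambda>z. g z t) holomorphic_on UNIV"
    and meas: "\<And>z. g z \<in> borel_measurable lborel"
    and dom: "\<And>r. \<exists>B. integrable lborel B \<and> (\<forall>z t. cmod z \<le> r \<longrightarrow> cmod (g z t) \<le> B t)"
  shows "(\<lambda>z. LINT t|lborel. g z t) holomorphic_on UNIV"
proof -
  have int: "integrable lborel (g z)" for z
  proof -
    obtain B where B: "integrable lborel B" "\<And>w t. cmod w \<le> cmod z \<Longrightarrow> cmod (g w t) \<le> B t" using dom[of "cmod z"] by blast
    show ?thesis by (rule integrable_dominated[OF B(1) meas B(2)]) simp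
  qed
  have "((\<lambda>z. LINT t|lborel. g z t) has_field_derivative (LINT t|lborel. deriv (\<lambda>z. g z t) z0)) (at z0)" for z0
    unfolding DERIV_def tendsto_at_iff_sequentially
  proof (intro allI impI)
    fix X :: "nat \<Rightarrow> complex" assume X0: "\<forall>i. X i \<in> UNIV - {0}" and X: "X \<longlonglongrightarrow> 0"
    have "Bseq X" using X by (intro convergent_imp_Bseq convergentI)
    then obtain M where M: "0 < M" "\<And>n. cmod (X n) \<le> M" by (auto elim: BseqE)
    obtain B where B: "integrable lborel B" "\<And>z t. cmod z \<le> cmod z0 + M + 1 \<Longrightarrow> cmod (g z t) \<le> B t"
      using dom[of "cmod z0 + M + 1"] by blast
    have lip: "cmod (g (z0 + X n) t - g z0 t) \<le> B t * cmod (z0 + X n - z0)" for n t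
    proof (rule field_differentiable_bound[where S="cball z0 M"])
      fix z assume z: "z \<in> cball z0 M"
      then have zM: "cmod z \<le> cmod z0 + M" using norm_triangle_ineq2[of z z0] by (simp add: dist_norm norm_minus_commute)
      show "((\<lambda>z. g z t) has_field_derivative deriv (\<lambda>z. g z t) z) (at z within cball z0 M)"
        using line_holomorphic by (intro holomorphic_derivI) auto
      have "cmod ((deriv ^^ 1) (\<lambda>z. g z t) z) \<le> fact 1 * B t / 1 ^ 1"
      proof (rule Cauchy_inequality)
        show "(\<lambda>z. g z t) holomorphic_on ball z 1" using line_holomorphic by (rule holomorphic_on_subset) auto
        show "continuous_on (cball z 1) (\<lambda>z. g z t)" using line_holomorphic by (intro holomorphic_on_imp_continuous_on) (rule holomorphic_on_subset, auto)
        fix x assume "cmod (z - x) = 1"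
        then have "cmod x \<le> cmod z0 + M + 1" using zM norm_triangle_ineq2[of x z] by (simp add: norm_minus_commute)
        then show "cmod (g x t) \<le> B t" by (rule B(2))
      qed simp
      then show "cmod (deriv (\<lambda>z. g z t) z) \<le> B t" by simp
    qed (use M in \<open>auto simp: dist_norm\<close>)
    have lim: "(\<lambda>n. (g (z0 + X n) t - g z0 t) / X n) \<longlonglongrightarrow> deriv (\<lambda>z. g z t) z0" for t
    proof -
      have "((\<lambda>z. g z t) has_field_derivative deriv (\<lambda>z. g z t) z0) (at z0)"
        using line_holomorphic by (intro holomorphic_derivI) auto
      then show ?thesis unfolding DERIV_def tendsto_at_iff_sequentially using X0 X by (auto simp: o_def)
    qed
    have "(\<lambda>n. LINT t|lborel. (g (z0 + X n) t - g z0 t) / X n) \<longlonglongrightarrow> (LINT t|lborel. deriv (\<lambda>z. g z t) z0)"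
    proof (rule integral_dominated_convergence[where w=B])
      show "(\<lambda>t. deriv (\<lambda>z. g z t) z0) \<in> borel_measurable lborel"
        by (rule borel_measurable_LIMSEQ_metric[OF _ lim]) (use meas in measurable)
      show "(\<lambda>t. (g (z0 + X n) t - g z0 t) / X n) \<in> borel_measurable lborel" for n
        using meas by measurable
      show "AE t in lborel. cmod ((g (z0 + X n) t - g z0 t) / X n) \<le> B t" for n
        using lip[of n] X0 by (intro always_eventually allI) (auto simp: norm_divide pos_divide_le_eq)
    qed (use B lim in auto)
    then show "((\<lambda>h. ((LINT t|lborel. g (z0 + h) t) - (LINT t|lborel. g z0 t)) / h) \<circ> X) \<longlonglongrightarrow> (LINT t|lborel. deriv (\<lambda>z. g z t) z0)"
      using int by (simp add: o_def)
  qed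
  then show ?thesis by (auto simp: holomorphic_on_open intro!: exI)
qed

lemma hol_integral:
  fixes H :: "'b::euclidean_space \<Rightarrow> 'a::euclidean_space \<Rightarrow> 'a \<Rightarrow> complex"
  assumes line_holomorphic: "\<And>u. line_holomorphic (H u)" and meas: "\<And>x y. (\<lambda>u. H u x y) \<in> borel_measurable lborel"
    and dom: "\<And>r. \<exists>B. integrable lborel B \<and> (\<forall>u x y. norm x \<le> r \<longrightarrow> norm y \<le> r \<longrightarrow> cmod (H u x y) \<le> B u)"
  shows "line_holomorphic (\<lambda>x y. LINT u|lborel. H u x y)"
proof (rule line_holomorphicI, rule holomorphic_on_integral)
  fix x y v :: 'a
  show "(\<lambda>z. H t (x + Re z *\<^sub>R v) (y + Im z *\<^sub>R v)) holomorphic_on UNIV" for t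
    by (rule hol_line[OF line_holomorphic])
  show "(\<lambda>t. H t (x + Re z *\<^sub>R v) (y + Im z *\<^sub>R v)) \<in> borel_measurable lborel" for z by (rule meas)
  fix r :: real
  define r' where "r' = norm x + norm y + r * norm v"
  obtain B where B: "integrable lborel B" "\<And>u x y. norm x \<le> r' \<Longrightarrow> norm y \<le> r' \<Longrightarrow> cmod (H u x y) \<le> B u"
    using dom[of r'] by blast
  have "cmod (H t (x + Re z *\<^sub>R v) (y + Im z *\<^sub>R v)) \<le> B t" if z: "cmod z \<le> r" for z t
  proof (rule B(2))
    have "\<bar>Re z\<bar> * norm v \<le> r * norm v" "\<bar>Im z\<bar> * norm v \<le> r * norm v"
      using z abs_Re_le_cmod[of z] abs_Im_le_cmod[of z] by (auto intro!: mult_right_mono)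
    then show "norm (x + Re z *\<^sub>R v) \<le> r'" "norm (y + Im z *\<^sub>R v) \<le> r'"
      using norm_triangle_ineq[of x "Re z *\<^sub>R v"] norm_triangle_ineq[of y "Im z *\<^sub>R v"] norm_ge_zero[of x] norm_ge_zero[of y]
      unfolding r'_def norm_scaleR by linarith+
  qed
  then show "\<exists>B. integrable lborel B \<and> (\<forall>z t. cmod z \<le> r \<longrightarrow> cmod (H t (x + Re z *\<^sub>R v) (y + Im z *\<^sub>R v)) \<le> B t)"
    using B(1) by blast
qed

text \<open>The tube constants \<open>B R u\<close> of the integrands serve twice: as functions of
  \<open>u\<close> they dominate the integrand locally, which gives holomorphy, and their integral
  is the tube constant of the result.\<close>

lemma ent_integral:
  fixes H :: "'b::euclidean_space \<Rightarrow> 'a::euclidean_space \<Rightarrow> 'a \<Rightarrow> complex"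
  assumes line_holomorphic: "\<And>u. line_holomorphic (H u)" and meas: "\<And>x y. (\<lambda>u. H u x y) \<in> borel_measurable lborel"
    and dom: "\<And>R. 0 \<le> R \<Longrightarrow> integrable lborel (B R)" "\<And>R u. 0 \<le> R \<Longrightarrow> tube R (B R u) (H u)"
  shows "entire (\<lambda>x y. LINT u|lborel. H u x y)" "0 \<le> R \<Longrightarrow> tube R (LINT u|lborel. B R u) (\<lambda>x y. LINT u|lborel. H u x y)"
proof -
  have t: "tube R (LINT u|lborel. B R u) (\<lambda>x y. LINT u|lborel. H u x y)" if R: "0 \<le> R" for R
    unfolding tube_def
  proof (intro allI impI)
    fix x y :: 'a assume y: "norm y \<le> R"
    have i: "integrable lborel (\<lambda>u. B R u * exp (- (R * norm x)))" using dom(1)[OF R] by simp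
    have b: "cmod (H u x y) \<le> B R u * exp (- (R * norm x))" for u
      using dom(2)[OF R] y by (simp add: tube_def)
    have "integrable lborel (\<lambda>u. H u x y)"
      using meas b by (intro integrable_dominated[OF i])
    then have "cmod (LINT u|lborel. H u x y) \<le> (LINT u|lborel. cmod (H u x y))" by (intro integral_norm_bound)
    also have "\<dots> \<le> (LINT u|lborel. B R u * exp (- (R * norm x)))"
      using \<open>integrable lborel (\<lambda>u. H u x y)\<close> i b by (intro integral_mono) auto
    finally show "cmod (LINT u|lborel. H u x y) \<le> (LINT u|lborel. B R u) * exp (- (R * norm x))" by simp
  qed
  have "line_holomorphic (\<lambda>x y. LINT u|lborel. H u x y)"
  proof (rule hol_integral[OF line_holomorphic meas])
    fix r :: real
    have "cmod (H u x y) \<le> B \<bar>r\<bar> u" if "norm x \<le> r" "norm y \<le> r" for u x y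
    proof -
      have "cmod (H u x y) \<le> B \<bar>r\<bar> u * exp (- (\<bar>r\<bar> * norm x))"
        using dom(2)[of "\<bar>r\<bar>" u] that by (auto simp: tube_def)
      also have "\<dots> \<le> B \<bar>r\<bar> u * 1" using tube_nonneg[OF dom(2)[of "\<bar>r\<bar>" u]] by (intro mult_left_mono) auto
      finally show ?thesis by simp
    qed
    then show "\<exists>B. integrable lborel B \<and> (\<forall>u x y. norm x \<le> r \<longrightarrow> norm y \<le> r \<longrightarrow> cmod (H u x y) \<le> B u)"
      using dom(1)[of "\<bar>r\<bar>"] by (intro exI[of _ "B \<bar>r\<bar>"]) auto
  qed
  moreover have "\<exists>C. tube R C (\<lambda>x y. LINT u|lborel. H u x y)" for R
    using tube_antimono[OF t[OF abs_ge_zero] abs_ge_self abs_ge_zero] by blast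
  ultimately show "entire (\<lambda>x y. LINT u|lborel. H u x y)" by (simp add: entire_def)
  show "0 \<le> R \<Longrightarrow> tube R (LINT u|lborel. B R u) (\<lambda>x y. LINT u|lborel. H u x y)" by (rule t)
qed

lemma tube_continuous:
  assumes "entire F" shows "continuous_on UNIV (\<lambda>x. F x y)"
proof (rule continuous_at_imp_continuous_on, intro ballI)
  fix x
  define R where "R = norm y + 1"
  have R: "norm y + 1 \<le> R" "0 \<le> R" by (auto simp: R_def add_nonneg_nonneg)
  obtain C where C: "tube R C F" using assms by (auto simp: entire_def)
  have F: "line_holomorphic F" using assms by (simp add: entire_def)
  have "(\<lambda>v. F (x + v) y - F x y) \<midarrow>0\<rightarrow> 0"
  proof (rule Lim_null_comparison)
    show "\<forall>\<^sub>F v in at 0. norm (F (x + v) y - F x y) \<le> norm v * (C * exp (R * (norm v + 1)) * exp (- (R * norm x)))"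
      using lipschitz_tube[OF F C R(1)] by simp
    have "isCont (\<lambda>v::'a. norm v * (C * exp (R * (norm v + 1)) * exp (- (R * norm x)))) 0"
      by (intro continuous_intros)
    from isContD[OF this] show "((\<lambda>v. norm v * (C * exp (R * (norm v + 1)) * exp (- (R * norm x)))) \<longlongrightarrow> 0) (at (0::'a))" by simp
  qed
  then have "(\<lambda>v. F (x + v) y) \<midarrow>0\<rightarrow> F x y" by (simp add: LIM_zero_iff)
  then show "continuous (at x) (\<lambda>x. F x y)" by (simp add: isCont_iff)
qed

lemma Sigma1_continuous: "f \<in> Sigma1 \<Longrightarrow> continuous_on UNIV f"
  using tube_continuous unfolding Sigma1_iff_ent by blast

lemma Sigma1_measurable: "f \<in> Sigma1 \<Longrightarrow> f \<in> borel_measurable borel"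
  by (intro borel_measurable_continuous_onI Sigma1_continuous)

lemma islimpt_Reals: "(0::complex) islimpt \<real>"
proof (rule islimpt_approachable[THEN iffD2], intro allI impI)
  fix e :: real assume "0 < e"
  then show "\<exists>x'\<in>\<real>. x' \<noteq> (0::complex) \<and> dist x' 0 < e" by (intro bexI[of _ "of_real (e / 2)"]) auto
qed

text \<open>The identity theorem, as 0 is a limit point of the real line. It turns invariance under
  real translations into invariance under imaginary ones.\<close>

lemma entire_eq_on_reals:
  assumes "f holomorphic_on UNIV" "g holomorphic_on UNIV" "\<And>t. f (of_real t) = g (of_real t)"
  shows "f z = (g z :: complex)"
proof -
  have "f z - g z = 0"
  proof (rule analytic_continuation[where f="\<lambda>z. f z - g z" and S=UNIV and U=\<real> and \<xi>=0])
    show "(\<lambda>z. f z - g z) holomorphic_on UNIV" using assms by (intro holomorphic_on_diff)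
    show "f z - g z = 0" if "z \<in> \<real>" for z using that assms(3) by (auto elim!: Reals_cases)
  qed (auto simp: islimpt_Reals)
  then show ?thesis by simp
qed

lemma integral_translate:
  fixes f :: "'a::euclidean_space \<Rightarrow> 'b::{banach, second_countable_topology}"
  assumes "f \<in> borel_measurable borel"
  shows "(LINT x|lborel. f (c + x)) = (LINT x|lborel. f x)"
proof -
  have "(LINT x|lborel. f x) = (LINT x|distr lborel borel ((+) c). f x)" by (simp only: lborel_distr_plus)
  also have "\<dots> = (LINT x|lborel. f (c + x))" using assms by (intro integral_distr) auto
  finally show ?thesis by simp
qed

lemma integral_affine:
  fixes f :: "'a::euclidean_space \<Rightarrow> 'b::{banach, second_countable_topology}"
  assumes "f \<in> borel_measurable borel" "c \<noteq> 0"
  shows "(LINT x|lborel. f x) = \<bar>c\<bar> ^ DIM('a) *\<^sub>R (LINT x|lborel. f (t + c *\<^sub>R x))"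
proof -
  have "(LINT x|lborel. f x) = (LINT x|density (distr lborel borel (\<lambda>x. t + c *\<^sub>R x)) (\<lambda>_. \<bar>c\<bar> ^ DIM('a)). f x)"
    by (subst lborel_affine[OF assms(2), of t]) simp
  also have "\<dots> = (LINT x|distr lborel borel (\<lambda>x. t + c *\<^sub>R x). \<bar>c\<bar> ^ DIM('a) *\<^sub>R f x)"
    using assms by (intro integral_density) auto
  also have "\<dots> = (LINT x|lborel. \<bar>c\<bar> ^ DIM('a) *\<^sub>R f (t + c *\<^sub>R x))"
    using assms by (intro integral_distr) auto
  finally show ?thesis by simp
qed


section \<open>Partial Fourier transformation\<close>

definition FT2 :: "real \<Rightarrow> ('m::euclidean_space \<times> 'd::euclidean_space \<Rightarrow> complex) \<Rightarrow> 'm \<times> 'd \<Rightarrow> complex" where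
  "FT2 \<sigma> \<Phi> p = (LINT t|lborel. \<Phi> (fst p, t) * exp (\<i> * of_real (\<sigma> * (t \<bullet> snd p))))"

text \<open>The integrand of the analytic extension of \<open>FT2\<close> at \<open>p + iq\<close>,
  along the contour of the points \<open>t + i\<tau>\<close>. The \<open>Complex\<close> term is the
  bilinear product of \<open>t + i\<tau>\<close> with the second component of
  \<open>p + iq\<close>.\<close>

definition FT2_shift :: "real \<Rightarrow> ('m::euclidean_space \<times> 'd::euclidean_space \<Rightarrow> 'm \<times> 'd \<Rightarrow> complex) \<Rightarrow> 'd \<Rightarrow> 'd \<Rightarrow> 'm \<times> 'd \<Rightarrow> 'm \<times> 'd \<Rightarrow> complex" where
  "FT2_shift \<sigma> G \<tau> t p q = G (fst p, t) (fst q, \<tau>) *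
     exp (\<i> * of_real \<sigma> * Complex (t \<bullet> snd p - \<tau> \<bullet> snd q) (t \<bullet> snd q + \<tau> \<bullet> snd p))"

lemma norm_FT2_shift:
  "cmod (FT2_shift \<sigma> G \<tau> t p q) = cmod (G (fst p, t) (fst q, \<tau>)) * exp (- \<sigma> * (t \<bullet> snd q + \<tau> \<bullet> snd p))"
  by (simp add: FT2_shift_def norm_mult)

lemma FT2_shift_measurable:
  assumes "entire G" shows "(\<lambda>t. FT2_shift \<sigma> G \<tau> t p q) \<in> borel_measurable borel"
proof (rule borel_measurable_continuous_onI)
  have "continuous_on UNIV (\<lambda>t. G (fst p, t) (fst q, \<tau>))"
    by (rule continuous_on_compose2[OF tube_continuous[OF assms]]) (auto intro!: continuous_intros)
  then show "continuous_on UNIV (\<lambda>t. FT2_shift \<sigma> G \<tau> t p q)"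
    unfolding FT2_shift_def by (intro continuous_intros)
qed

lemma FT2_shift_bound:
  fixes t :: "'d::euclidean_space" and p q :: "'m::euclidean_space \<times> 'd"
  assumes "tube R C G" "0 \<le> R" "\<bar>\<sigma>\<bar> = 1" "norm (fst q) + norm \<tau> \<le> R" "norm (snd q) \<le> r"
  shows "cmod (FT2_shift \<sigma> G \<tau> t p q) \<le> C * exp (- (R * norm (fst p, t))) * exp (r * norm t) * exp (- \<sigma> * (\<tau> \<bullet> snd p))"
proof -
  have "norm (fst q, \<tau>) \<le> R" using norm_Pair_le[of "fst q" \<tau>] assms(4) by linarith
  then have 1: "cmod (G (fst p, t) (fst q, \<tau>)) \<le> C * exp (- (R * norm (fst p, t)))"
    using assms(1) by (simp add: tube_def)
  have "- \<sigma> * (t \<bullet> snd q) \<le> \<bar>\<sigma>\<bar> * \<bar>t \<bullet> snd q\<bar>" by (metis abs_ge_self abs_minus_cancel abs_mult)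
  also have "\<dots> \<le> r * norm t"
    using Cauchy_Schwarz_ineq2[of t "snd q"] assms(3) mult_right_mono[OF assms(5), of "norm t"] by (simp add: mult.commute)
  finally have 2: "exp (- \<sigma> * (t \<bullet> snd q + \<tau> \<bullet> snd p)) \<le> exp (r * norm t) * exp (- \<sigma> * (\<tau> \<bullet> snd p))"
    by (simp add: distrib_left exp_add[symmetric])
  have "cmod (FT2_shift \<sigma> G \<tau> t p q) \<le> (C * exp (- (R * norm (fst p, t)))) * (exp (r * norm t) * exp (- \<sigma> * (\<tau> \<bullet> snd p)))"
    unfolding norm_FT2_shift using 1 2 tube_nonneg[OF assms(1,2)] by (intro mult_mono) auto
  then show ?thesis by (simp add: mult.assoc)
qed

text \<open>With \<open>t\<close> replaced by \<open>t + z\<tau>\<close>, the integral is an entire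
  function of the complex number \<open>z\<close>. It is constant for real \<open>z\<close> by
  translation invariance, hence constant altogether, and \<open>z = \<i>\<close> is the shift of the
  contour.\<close>

lemma FT2_shift_const:
  fixes G :: "'m::euclidean_space \<times> 'd::euclidean_space \<Rightarrow> 'm \<times> 'd \<Rightarrow> complex"
  assumes "entire G" "\<bar>\<sigma>\<bar> = 1"
  shows "(LINT t|lborel. FT2_shift \<sigma> G \<tau> t p q) = (LINT t|lborel. FT2_shift \<sigma> G 0 t p q)"
proof -
  define g where "g z t = FT2_shift \<sigma> G (Im z *\<^sub>R \<tau>) (t + Re z *\<^sub>R \<tau>) p q" for z t
  have "(\<lambda>z. LINT t|lborel. g z t) holomorphic_on UNIV"
  proof (rule holomorphic_on_integral)
    fix t
    have "(\<lambda>z. G ((fst p, t) + Re z *\<^sub>R (0, \<tau>)) ((fst q, 0) + Im z *\<^sub>R (0, \<tau>))) holomorphic_on UNIV"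
      using assms(1) by (intro hol_line) (simp add: entire_def)
    moreover have "(\<lambda>z. exp (\<i> * of_real \<sigma> * (Complex (t \<bullet> snd p) (t \<bullet> snd q) + z * Complex (\<tau> \<bullet> snd p) (\<tau> \<bullet> snd q)))) holomorphic_on UNIV"
      by (intro holomorphic_intros)
    ultimately have "(\<lambda>z. G ((fst p, t) + Re z *\<^sub>R (0, \<tau>)) ((fst q, 0) + Im z *\<^sub>R (0, \<tau>)) *
        exp (\<i> * of_real \<sigma> * (Complex (t \<bullet> snd p) (t \<bullet> snd q) + z * Complex (\<tau> \<bullet> snd p) (\<tau> \<bullet> snd q)))) holomorphic_on UNIV"
      by (rule holomorphic_on_mult)
    moreover have "Complex (t \<bullet> snd p) (t \<bullet> snd q) + z * Complex (\<tau> \<bullet> snd p) (\<tau> \<bullet> snd q)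
       = Complex ((t + Re z *\<^sub>R \<tau>) \<bullet> snd p - (Im z *\<^sub>R \<tau>) \<bullet> snd q) ((t + Re z *\<^sub>R \<tau>) \<bullet> snd q + (Im z *\<^sub>R \<tau>) \<bullet> snd p)" for z
      by (simp add: complex_eq_iff inner_add_left)
    ultimately show "(\<lambda>z. g z t) holomorphic_on UNIV"
      unfolding g_def FT2_shift_def by simp
  next
    have "(\<lambda>t. FT2_shift \<sigma> G (Im z *\<^sub>R \<tau>) (t + Re z *\<^sub>R \<tau>) p q) \<in> borel_measurable borel" for z
      by (rule measurable_compose[OF _ FT2_shift_measurable[OF assms(1)]]) simp
    then show "g z \<in> borel_measurable lborel" for z unfolding g_def[abs_def] by simp
  next
    fix r :: real
    define \<rho> where "\<rho> = \<bar>r\<bar> * norm \<tau>"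
    \<comment> \<open>Admits a shift of length \<open>\<rho>\<close>, while the rate
      \<open>norm (snd q) + 1\<close> beats the growth of the exponential and leaves
      \<open>exp (- norm t)\<close> for integrability.\<close>
    define R where "R = norm (fst q) + \<rho> + norm (snd q) + 1"
    have \<rho>0: "0 \<le> \<rho>" by (simp add: \<rho>_def)
    have R0: "0 \<le> R" "norm (snd q) + 1 \<le> R" using \<rho>0 by (simp_all add: R_def add_nonneg_nonneg)
    obtain C where C: "tube R C G" using assms(1) by (auto simp: entire_def)
    define K where "K = C * exp (norm (snd q) * \<rho> + \<rho>) * exp (\<rho> * norm (snd p)) "
    have C0: "0 \<le> C" using tube_nonneg[OF C R0(1)] .
    have b: "cmod (g z t) \<le> K * exp (- (1 * norm t))" if z: "cmod z \<le> r" for z t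
    proof -
      have "\<bar>Re z\<bar> \<le> \<bar>r\<bar>" "\<bar>Im z\<bar> \<le> \<bar>r\<bar>" using z abs_Re_le_cmod[of z] abs_Im_le_cmod[of z] by linarith+
      then have n: "norm (Im z *\<^sub>R \<tau>) \<le> \<rho>" "norm (Re z *\<^sub>R \<tau>) \<le> \<rho>"
        by (auto simp: \<rho>_def intro!: mult_right_mono)
      have "cmod (g z t) \<le> C * exp (- (R * norm (fst p, t + Re z *\<^sub>R \<tau>))) * exp (norm (snd q) * norm (t + Re z *\<^sub>R \<tau>)) * exp (- \<sigma> * ((Im z *\<^sub>R \<tau>) \<bullet> snd p))"
        unfolding g_def
      proof (rule FT2_shift_bound[OF C R0(1) assms(2) _ order_refl])
        show "norm (fst q) + norm (Im z *\<^sub>R \<tau>) \<le> R" using n(1) norm_ge_zero[of "snd q"] unfolding R_def by linarith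
      qed
      also have "\<dots> \<le> C * exp (norm (snd q) * \<rho> + \<rho> - norm t) * exp (\<rho> * norm (snd p))"
      proof -
        have "norm t \<le> norm (t + Re z *\<^sub>R \<tau>) + \<rho>"
          using norm_triangle_ineq4[of "t + Re z *\<^sub>R \<tau>" "Re z *\<^sub>R \<tau>"] n by simp
        moreover have "(norm (snd q) + 1) * norm (t + Re z *\<^sub>R \<tau>) \<le> R * norm (fst p, t + Re z *\<^sub>R \<tau>)"
          using R0 norm_snd_le[of "t + Re z *\<^sub>R \<tau>" "fst p"] by (intro mult_mono) auto
        moreover have "0 \<le> norm (snd q) * \<rho>" using \<rho>0 by simp
        ultimately have e1: "- (R * norm (fst p, t + Re z *\<^sub>R \<tau>)) + norm (snd q) * norm (t + Re z *\<^sub>R \<tau>) \<le> norm (snd q) * \<rho> + \<rho> - norm t"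
          by (simp add: distrib_right)
        have "- \<sigma> * ((Im z *\<^sub>R \<tau>) \<bullet> snd p) \<le> \<bar>\<sigma>\<bar> * \<bar>(Im z *\<^sub>R \<tau>) \<bullet> snd p\<bar>" by (metis abs_ge_self abs_minus_cancel abs_mult)
        also have "\<dots> \<le> norm (Im z *\<^sub>R \<tau>) * norm (snd p)"
          using Cauchy_Schwarz_ineq2[of "Im z *\<^sub>R \<tau>" "snd p"] assms(2) by simp
        also have "\<dots> \<le> \<rho> * norm (snd p)" using n by (intro mult_right_mono) auto
        finally have e2: "- \<sigma> * ((Im z *\<^sub>R \<tau>) \<bullet> snd p) \<le> \<rho> * norm (snd p)" .
        show ?thesis
          using C0 e1 e2 by (auto simp: mult.assoc exp_add[symmetric] intro!: mult_left_mono)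
      qed
      also have "\<dots> = K * exp (- (1 * norm t))" by (simp add: K_def exp_diff exp_minus field_simps)
      finally show ?thesis .
    qed
    have "integrable lborel (\<lambda>t::'d. K * exp (- (1 * norm t)))"
      by (intro integrable_mult_right integrable_exp_norm) auto
    then show "\<exists>B. integrable lborel B \<and> (\<forall>z t. cmod z \<le> r \<longrightarrow> cmod (g z t) \<le> B t)" using b by blast
  qed
  moreover have "(LINT t|lborel. g (of_real s) t) = (LINT t|lborel. g 0 t)" for s
    using integral_translate[OF FT2_shift_measurable[OF assms(1), of \<sigma> 0 p q], of "s *\<^sub>R \<tau>"]
    by (simp add: g_def add.commute)
  ultimately have "(LINT t|lborel. g \<i> t) = (LINT t|lborel. g 0 t)"
    by (rule entire_eq_on_reals[where f="\<lambda>z. LINT t|lborel. g z t" and g="\<lambda>_. LINT t|lborel. g 0 t", OF _ holomorphic_on_const])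
  then show ?thesis by (simp add: g_def)
qed

text \<open>A contour shift of length \<open>R\<close> in the direction of the frequency produces
  the decay in \<open>snd p\<close>. As a width, \<open>2 * R + 2\<close> admits
  \<open>fst q\<close> and the shift together; as a rate of decay it pays for
  \<open>exp (R * norm t)\<close>, for the decay in \<open>fst p\<close> and for an integrable
  \<open>exp (- norm t)\<close>.\<close>

lemma tube_FT2:
  fixes G :: "'m::euclidean_space \<times> 'd::euclidean_space \<Rightarrow> 'm \<times> 'd \<Rightarrow> complex"
  assumes G: "entire G" "\<bar>\<sigma>\<bar> = 1" and R: "0 \<le> R" and C: "tube (2 * R + 2) C G"
  shows "tube R (C * exp_int TYPE('d)) (\<lambda>p q. LINT t|lborel. FT2_shift \<sigma> G 0 t p q)"
  unfolding tube_def
proof (intro allI impI)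
  fix p q :: "'m \<times> 'd" assume q: "norm q \<le> R"
  \<comment> \<open>At \<open>snd p = 0\<close> there is no shift, as \<open>sgn 0 = 0\<close>; no
    decay in the frequency is asked for there.\<close>
  define \<tau> where "\<tau> = (\<sigma> * R) *\<^sub>R sgn (snd p)"
  have ip: "- \<sigma> * (\<tau> \<bullet> snd p) = - (R * norm (snd p))"
  proof -
    have "\<sigma> * \<sigma> = 1" using G(2) by (metis abs_mult_self_eq mult_1)
    moreover have "sgn (snd p) \<bullet> snd p = norm (snd p)" 
      by (cases "snd p = 0") (simp_all add: sgn_div_norm dot_square_norm power2_eq_square)
    ultimately show ?thesis by (simp add: \<tau>_def)
  qed
  have \<tau>: "norm \<tau> \<le> R" using R G(2) by (simp add: \<tau>_def abs_mult norm_sgn)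
  have q': "norm (fst q) \<le> R" "norm (snd q) \<le> R"
    using q norm_fst_le[of "fst q" "snd q"] norm_snd_le[of "snd q" "fst q"] by auto
  have C0: "0 \<le> C" using tube_nonneg[OF C] R by simp
  have "cmod (FT2_shift \<sigma> G \<tau> t p q) \<le> C * exp (- (R * norm p)) * exp (- norm t)" for t
  proof -
    have "cmod (FT2_shift \<sigma> G \<tau> t p q) \<le> C * exp (- ((2 * R + 2) * norm (fst p, t))) * exp (R * norm t) * exp (- \<sigma> * (\<tau> \<bullet> snd p))"
      using C R G q' \<tau> by (intro FT2_shift_bound) auto
    also have "\<dots> = C * exp (- ((2 * R + 2) * norm (fst p, t)) + R * norm t - R * norm (snd p))"
      unfolding ip by (simp add: exp_add[symmetric] mult.assoc)
    also have "\<dots> \<le> C * exp (- (R * norm p) - norm t)"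
    proof -
      have "(R + 1) * norm (fst p) \<le> (R + 1) * norm (fst p, t)" "(R + 1) * norm t \<le> (R + 1) * norm (fst p, t)"
        using R norm_fst_le[of "fst p" t] norm_snd_le[of t "fst p"] by (auto intro!: mult_left_mono)
      moreover have "R * norm p \<le> R * (norm (fst p) + norm (snd p))"
        using R norm_Pair_le[of "fst p" "snd p"] by (intro mult_left_mono) auto
      ultimately have "- ((2 * R + 2) * norm (fst p, t)) + R * norm t - R * norm (snd p) \<le> - (R * norm p) - norm t"
        using norm_ge_zero[of "fst p"] norm_ge_zero[of "(fst p, t)"] unfolding distrib_right distrib_left by linarith
      then show ?thesis using C0 by (intro mult_left_mono) auto
    qed
    finally show ?thesis by (simp add: exp_diff exp_minus field_simps)
  qed
  then have "norm (LINT t|lborel. FT2_shift \<sigma> G \<tau> t p q) \<le> C * exp (- (R * norm p)) * exp_int TYPE('d)"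
    using FT2_shift_measurable[OF G(1)] by (intro integral_exp_bound) auto
  then show "cmod (LINT t|lborel. FT2_shift \<sigma> G 0 t p q) \<le> C * exp_int TYPE('d) * exp (- (R * norm p))"
    unfolding FT2_shift_const[OF G, of \<tau>] by (simp add: mult_ac)
qed

lemma ent_FT2:
  fixes G :: "'m::euclidean_space \<times> 'd::euclidean_space \<Rightarrow> 'm \<times> 'd \<Rightarrow> complex"
  assumes G: "entire G" "\<bar>\<sigma>\<bar> = 1"
  shows "entire (\<lambda>p q. LINT t|lborel. FT2_shift \<sigma> G 0 t p q)"
  unfolding entire_def
proof (intro conjI allI)
  show "line_holomorphic (\<lambda>p q. LINT t|lborel. FT2_shift \<sigma> G 0 t p q)"
  proof (rule hol_integral)
    fix t
    have "(\<lambda>z. FT2_shift \<sigma> G 0 t (p + Re z *\<^sub>R v) (q + Im z *\<^sub>R v)) holomorphic_on UNIV" for p q v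
    proof -
      have "(\<lambda>z. G ((fst p, t) + Re z *\<^sub>R (fst v, 0)) ((fst q, 0) + Im z *\<^sub>R (fst v, 0))) holomorphic_on UNIV"
        using G(1) by (intro hol_line) (simp add: entire_def)
      moreover have "(\<lambda>z. exp (\<i> * of_real \<sigma> * (Complex (t \<bullet> snd p) (t \<bullet> snd q) + z * of_real (t \<bullet> snd v)))) holomorphic_on UNIV"
        by (intro holomorphic_intros)
      ultimately have "(\<lambda>z. G ((fst p, t) + Re z *\<^sub>R (fst v, 0)) ((fst q, 0) + Im z *\<^sub>R (fst v, 0)) *
          exp (\<i> * of_real \<sigma> * (Complex (t \<bullet> snd p) (t \<bullet> snd q) + z * of_real (t \<bullet> snd v)))) holomorphic_on UNIV"
        by (rule holomorphic_on_mult)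
      moreover have "Complex (t \<bullet> snd p) (t \<bullet> snd q) + z * of_real (t \<bullet> snd v)
         = Complex (t \<bullet> snd (p + Re z *\<^sub>R v) - 0 \<bullet> snd (q + Im z *\<^sub>R v)) (t \<bullet> snd (q + Im z *\<^sub>R v) + 0 \<bullet> snd (p + Re z *\<^sub>R v))" for z
        by (simp add: complex_eq_iff inner_add_right)
      ultimately show ?thesis unfolding FT2_shift_def by simp
    qed
    then show "line_holomorphic (FT2_shift \<sigma> G 0 t)" by (rule line_holomorphicI)
  next
    show "(\<lambda>t. FT2_shift \<sigma> G 0 t p q) \<in> borel_measurable lborel" for p q
      using FT2_shift_measurable[OF G(1)] by simp
  next
    fix r :: real
    define R where "R = \<bar>r\<bar> + 1"
    obtain C where C: "tube R C G" using G(1) by (auto simp: entire_def)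
    have C0: "0 \<le> C" using tube_nonneg[OF C] by (simp add: R_def)
    have b: "cmod (FT2_shift \<sigma> G 0 t p q) \<le> C * exp (- (1 * norm t))" if "norm p \<le> r" "norm q \<le> r" for t p q
    proof -
      have q': "norm (fst q) \<le> r" "norm (snd q) \<le> r"
        using that norm_fst_le[of "fst q" "snd q"] norm_snd_le[of "snd q" "fst q"] by auto
      have "cmod (FT2_shift \<sigma> G 0 t p q) \<le> C * exp (- (R * norm (fst p, t))) * exp (\<bar>r\<bar> * norm t) * exp (- \<sigma> * (0 \<bullet> snd p))"
        using C G q' by (intro FT2_shift_bound) (auto simp: R_def)
      also have "\<dots> = C * exp (- (R * norm (fst p, t)) + \<bar>r\<bar> * norm t)" by (simp add: exp_add[symmetric] mult.assoc)
      also have "\<dots> \<le> C * exp (- norm t)"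
        using C0 mult_left_mono[OF norm_snd_le[of t "fst p"], of R] by (intro mult_left_mono) (auto simp: R_def distrib_right)
      finally show ?thesis by simp
    qed
    have "integrable lborel (\<lambda>t::'d. C * exp (- (1 * norm t)))"
      by (intro integrable_mult_right integrable_exp_norm) auto
    then show "\<exists>B. integrable lborel B \<and> (\<forall>t p q. norm p \<le> r \<longrightarrow> norm q \<le> r \<longrightarrow> cmod (FT2_shift \<sigma> G 0 t p q) \<le> B t)"
      using b by blast
  qed
  fix R :: real
  obtain C where C: "tube (2 * \<bar>R\<bar> + 2) C G" using G(1) by (auto simp: entire_def)
  from tube_antimono[OF tube_FT2[OF G abs_ge_zero C] abs_ge_self abs_ge_zero]
  show "\<exists>C. tube R C (\<lambda>p q. LINT t|lborel. FT2_shift \<sigma> G 0 t p q)" by blast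
qed

lemma entire_bd_FT2:
  fixes \<Phi> :: "'m::euclidean_space \<times> 'd::euclidean_space \<Rightarrow> complex"
  assumes "entire_bd (2 * R + 2) C \<Phi>" "0 \<le> R" "\<bar>\<sigma>\<bar> = 1"
  shows "entire_bd R (C * exp_int TYPE('d)) (FT2 \<sigma> \<Phi>)"
proof -
  obtain G where G: "entire G" "tube (2 * R + 2) C G" "\<Phi> = (\<lambda>x. G x 0)" using assms(1) by (rule entire_bdE)
  show ?thesis
  proof (rule entire_bdI[OF ent_FT2[OF G(1) assms(3)] tube_FT2[OF G(1) assms(3,2) G(2)]])
    have "Complex a 0 = of_real a" for a by (simp add: complex_eq_iff)
    then show "(LINT t|lborel. FT2_shift \<sigma> G 0 t p 0) = FT2 \<sigma> \<Phi> p" for p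
      by (simp add: FT2_def FT2_shift_def G(3) zero_prod_def[symmetric] mult.assoc)
  qed
qed

lemma FT2_Sigma1: "\<Phi> \<in> Sigma1 \<Longrightarrow> \<bar>\<sigma>\<bar> = 1 \<Longrightarrow> FT2 \<sigma> \<Phi> \<in> Sigma1"
  using Sigma1_ent_bd[of \<Phi> "2 * 0 + 2"] entire_bd_Sigma1[OF entire_bd_FT2[OF _ order_refl]] by blast

section \<open>Fourier transforms of Gaussians and the inversion formula\<close>

lemma exp_linear_minus_square: "exp (a * r) * exp (- r\<^sup>2) \<le> exp ((a + 1)\<^sup>2 / 4) * exp (- (r::real))"
proof -
  have "0 \<le> (r - (a + 1) / 2)\<^sup>2" by simp
  then have "a * r - r\<^sup>2 \<le> (a + 1)\<^sup>2 / 4 - r" by (simp add: power2_eq_square field_simps)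
  then show ?thesis by (simp flip: exp_add)
qed

definition gauss_int :: "'a::euclidean_space itself \<Rightarrow> real" where
  "gauss_int _ = (LINT x|lborel. exp (- (norm (x::'a))\<^sup>2))"

lemma integrable_gauss_exp:
  "integrable lborel (\<lambda>x::'a::euclidean_space. exp (a * norm x) * exp (- (norm x)\<^sup>2))"
  by (rule integrable_exp_bound[where c=1 and K="exp ((a + 1)\<^sup>2 / 4)"])
    (use exp_linear_minus_square[of a] in auto)

lemma integrable_gauss: "integrable lborel (\<lambda>x::'a::euclidean_space. exp (- (norm x)\<^sup>2))"
  using integrable_gauss_exp[of 0] by simp

lemma gauss_int_pos: "0 < gauss_int TYPE('a::euclidean_space)"
proof -
  have "gauss_int TYPE('a) \<noteq> 0"
  proof
    assume "gauss_int TYPE('a) = 0"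
    then have "AE x::'a in lborel. exp (- (norm x)\<^sup>2) = 0"
      unfolding gauss_int_def using integrable_gauss by (subst (asm) integral_nonneg_eq_0_iff_AE) auto
    then have "ae_filter (lborel :: 'a measure) = bot" by (simp add: trivial_limit_def)
    then show False by (simp add: ae_filter_eq_bot_iff)
  qed
  moreover have "0 \<le> gauss_int TYPE('a)" unfolding gauss_int_def by (intro Bochner_Integration.integral_nonneg) simp
  ultimately show ?thesis by simp
qed

text \<open>With a real number in place of \<open>\<i>\<close>, completing the square and
  translating evaluate the integral. Both sides are entire in this parameter, so the formula
  persists at \<open>\<i>\<close>.\<close>

lemma fourier_gauss:
  fixes v :: "'a::euclidean_space"
  shows "(LINT t|lborel. of_real (exp (- (norm t)\<^sup>2)) * exp (\<i> * of_real (t \<bullet> v)))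
    = of_real (gauss_int TYPE('a) * exp (- (norm v)\<^sup>2 / 4))"
proof -
  have hg: "(\<lambda>z. of_real (gauss_int TYPE('a)) * exp (z\<^sup>2 * of_real ((norm v)\<^sup>2 / 4))) holomorphic_on UNIV"
    by (intro holomorphic_intros)
  define g where "g z t = complex_of_real (exp (- (norm t)\<^sup>2)) * exp (z * of_real (t \<bullet> v))" for z :: complex and t :: 'a
  have "(\<lambda>z. LINT t|lborel. g z t) holomorphic_on UNIV"
  proof (rule holomorphic_on_integral)
    show "(\<lambda>z. g z t) holomorphic_on UNIV" for t unfolding g_def by (intro holomorphic_intros)
    have "continuous_on UNIV (g z)" for z unfolding g_def by (intro continuous_intros)
    then show "g z \<in> borel_measurable lborel" for z by (simp add: borel_measurable_continuous_onI)
    fix r :: real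
    have "cmod (g z t) \<le> exp (\<bar>r\<bar> * norm v * norm t) * exp (- (norm t)\<^sup>2)" if z: "cmod z \<le> r" for z t
    proof -
      have "\<bar>Re z\<bar> \<le> \<bar>r\<bar>" using z abs_Re_le_cmod[of z] by linarith
      have "Re z * (t \<bullet> v) \<le> \<bar>Re z\<bar> * \<bar>t \<bullet> v\<bar>" by (metis abs_ge_self abs_mult)
      also have "\<dots> \<le> \<bar>r\<bar> * (norm t * norm v)"
        using \<open>\<bar>Re z\<bar> \<le> \<bar>r\<bar>\<close> Cauchy_Schwarz_ineq2[of t v] by (intro mult_mono) auto
      finally show ?thesis by (simp add: g_def norm_mult mult_ac)
    qed
    then show "\<exists>B. integrable lborel B \<and> (\<forall>z t. cmod z \<le> r \<longrightarrow> cmod (g z t) \<le> B t)"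
      using integrable_gauss_exp by blast
  qed
  moreover have "(LINT t|lborel. g (of_real s) t) = of_real (gauss_int TYPE('a)) * exp ((of_real s)\<^sup>2 * of_real ((norm v)\<^sup>2 / 4))" for s
  proof -
    have "g (of_real s) t = of_real (exp (s\<^sup>2 * ((norm v)\<^sup>2 / 4))) * of_real (exp (- (norm (- (s / 2) *\<^sub>R v + t))\<^sup>2))" for t
    proof -
      have "(norm (- (s / 2) *\<^sub>R v + t))\<^sup>2 = (norm t)\<^sup>2 - s * (t \<bullet> v) + s\<^sup>2 * ((norm v)\<^sup>2 / 4)"
        unfolding power2_norm_eq_inner
        by (simp add: inner_add_left inner_add_right inner_diff_left inner_diff_right inner_commute[of v t] power2_eq_square field_simps)
      then have "exp (s\<^sup>2 * ((norm v)\<^sup>2 / 4)) * exp (- (norm (- (s / 2) *\<^sub>R v + t))\<^sup>2) = exp (- (norm t)\<^sup>2) * exp (s * (t \<bullet> v))"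
        by (simp flip: exp_add)
      moreover have "exp (of_real s * of_real (t \<bullet> v)) = complex_of_real (exp (s * (t \<bullet> v)))"
        by (metis exp_of_real of_real_mult)
      ultimately show ?thesis unfolding g_def by (simp only: of_real_mult[symmetric])
    qed
    then have "(LINT t|lborel. g (of_real s) t) = of_real (exp (s\<^sup>2 * ((norm v)\<^sup>2 / 4)))
        * (LINT t|lborel. of_real (exp (- (norm (- (s / 2) *\<^sub>R v + t))\<^sup>2)))"
      by (simp only: integral_mult_right_zero)
    also have "(LINT t|lborel. complex_of_real (exp (- (norm (- (s / 2) *\<^sub>R v + t))\<^sup>2)))
      = of_real (LINT t|lborel. exp (- (norm (- (s / 2) *\<^sub>R v + t))\<^sup>2))" by (rule integral_complex_of_real)
    also have "(LINT t|lborel. exp (- (norm (- (s / 2) *\<^sub>R v + t))\<^sup>2)) = gauss_int TYPE('a)"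
      unfolding gauss_int_def by (rule integral_translate) simp
    finally show ?thesis by (simp add: exp_of_real[symmetric] mult.commute)
  qed
  ultimately have "(LINT t|lborel. g \<i> t) = of_real (gauss_int TYPE('a)) * exp (\<i>\<^sup>2 * of_real ((norm v)\<^sup>2 / 4))"
    by (rule entire_eq_on_reals[where f="\<lambda>z. LINT t|lborel. g z t" and
          g="\<lambda>z. of_real (gauss_int TYPE('a)) * exp (z\<^sup>2 * of_real ((norm v)\<^sup>2 / 4))", OF _ hg])
  then show ?thesis by (simp add: g_def exp_of_real[symmetric])
qed

lemma fourier_gauss_scaled:
  fixes v :: "'a::euclidean_space" and \<epsilon> :: real
  assumes "0 < \<epsilon>"
  shows "(LINT t|lborel. of_real (exp (- (\<epsilon> * norm t)\<^sup>2)) * exp (\<i> * of_real (t \<bullet> v)))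
    = of_real ((1 / \<epsilon>) ^ DIM('a) * gauss_int TYPE('a) * exp (- (norm v / (2 * \<epsilon>))\<^sup>2))"
proof -
  define f where "f t = of_real (exp (- (\<epsilon> * norm t)\<^sup>2)) * exp (\<i> * of_real (t \<bullet> v))" for t
  have "continuous_on UNIV f" unfolding f_def by (intro continuous_intros)
  then have "f \<in> borel_measurable borel" by (rule borel_measurable_continuous_onI)
  then have "(LINT t|lborel. f t) = \<bar>1 / \<epsilon>\<bar> ^ DIM('a) *\<^sub>R (LINT t|lborel. f (0 + (1 / \<epsilon>) *\<^sub>R t))"
    using assms by (intro integral_affine) auto
  also have "(\<lambda>t. f (0 + (1 / \<epsilon>) *\<^sub>R t)) = (\<lambda>t. of_real (exp (- (norm t)\<^sup>2)) * exp (\<i> * of_real (t \<bullet> ((1 / \<epsilon>) *\<^sub>R v))))"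
    using assms by (simp add: f_def fun_eq_iff)
  also have "(LINT t|lborel. of_real (exp (- (norm t)\<^sup>2)) * exp (\<i> * of_real (t \<bullet> ((1 / \<epsilon>) *\<^sub>R v))))
      = of_real (gauss_int TYPE('a) * exp (- (norm ((1 / \<epsilon>) *\<^sub>R v))\<^sup>2 / 4))" by (rule fourier_gauss)
  also have "- (norm ((1 / \<epsilon>) *\<^sub>R v))\<^sup>2 / 4 = - (norm v / (2 * \<epsilon>))\<^sup>2"
    using assms by (simp add: power_divide power_mult_distrib)
  finally show ?thesis using assms by (simp add: f_def scaleR_conv_of_real mult.assoc)
qed

text \<open>This is \<open>(2\<pi>)\<^sup>d\<close>, but its value plays no role, and the Gaussian integral need not be evaluated.\<close>

definition inv_const :: "'a::euclidean_space itself \<Rightarrow> real" where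
  "inv_const _ = 2 ^ DIM('a) * (gauss_int TYPE('a))\<^sup>2"

lemma inv_const_pos: "0 < inv_const TYPE('a::euclidean_space)"
  using gauss_int_pos[where 'a='a] by (simp add: inv_const_def)

text \<open>A Gaussian factor that tends to 1 makes Fubini's theorem applicable. Integrating over
  \<open>\<xi>\<close> first gives a Gaussian in \<open>t - x\<close> of width proportional to
  \<open>\<epsilon> n\<close>, which concentrates at \<open>x\<close>. The substitution
  \<open>t = x + (2 * \<epsilon> n) *\<^sub>R s\<close> cancels the powers of
  \<open>\<epsilon> n\<close> and leaves \<open>2 ^ DIM('a)\<close> and two Gaussian
  integrals.\<close>

lemma fourier_inversion:
  fixes g :: "'a::euclidean_space \<Rightarrow> complex"
  assumes g: "continuous_on UNIV g" "\<And>t. cmod (g t) \<le> K * exp (- norm t)" and \<sigma>: "\<bar>\<sigma>\<bar> = 1"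
    and gh: "gh = (\<lambda>\<xi>. LINT t|lborel. g t * exp (\<i> * of_real (\<sigma> * (t \<bullet> \<xi>))))"
    and gh': "gh \<in> borel_measurable borel" "\<And>t. cmod (gh t) \<le> L * exp (- norm t)"
  shows "(LINT \<xi>|lborel. gh \<xi> * exp (\<i> * of_real (- \<sigma> * (\<xi> \<bullet> x)))) = of_real (inv_const TYPE('a)) * g x"
proof -
  define \<epsilon> where "\<epsilon> n = 1 / real (Suc n)" for n
  have \<epsilon>: "0 < \<epsilon> n" for n by (simp add: \<epsilon>_def)
  have \<epsilon>0: "\<epsilon> \<longlonglongrightarrow> 0" unfolding \<epsilon>_def by (rule LIMSEQ_Suc[OF lim_1_over_n])
  define w where "w n \<xi> = complex_of_real (exp (- (\<epsilon> n * norm \<xi>)\<^sup>2))" for n and \<xi> :: 'a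
  have wc: "continuous_on UNIV (w n)" for n unfolding w_def by (intro continuous_intros)
  have K0: "0 \<le> K" using order_trans[OF norm_ge_zero g(2)[of 0]] by simp
  define ph where "ph \<xi> = exp (\<i> * of_real (- \<sigma> * (\<xi> \<bullet> x)))" for \<xi>
  have phc: "continuous_on UNIV ph" unfolding ph_def by (intro continuous_intros)
  have ph1: "cmod (ph \<xi>) = 1" for \<xi> by (simp add: ph_def)
  have lim1: "(\<lambda>n. LINT \<xi>|lborel. gh \<xi> * ph \<xi> * w n \<xi>) \<longlonglongrightarrow> (LINT \<xi>|lborel. gh \<xi> * ph \<xi>)"
  proof (rule integral_dominated_convergence[where w="\<lambda>\<xi>. L * exp (- (1 * norm \<xi>))"])
    have pm: "ph \<in> borel_measurable borel" "w n \<in> borel_measurable borel" for n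
      using phc wc by (auto intro: borel_measurable_continuous_onI)
    show "(\<lambda>\<xi>. gh \<xi> * ph \<xi>) \<in> borel_measurable lborel" "(\<lambda>\<xi>. gh \<xi> * ph \<xi> * w n \<xi>) \<in> borel_measurable lborel" for n
      using pm gh'(1) by (auto intro!: borel_measurable_times)
    show "integrable lborel (\<lambda>\<xi>::'a. L * exp (- (1 * norm \<xi>)))" by (intro integrable_mult_right integrable_exp_norm) auto
    have "(\<lambda>n. w n \<xi>) \<longlonglongrightarrow> 1" for \<xi>
    proof -
      have "(\<lambda>n. exp (- (\<epsilon> n * norm \<xi>)\<^sup>2)) \<longlonglongrightarrow> exp (- (0 * norm \<xi>)\<^sup>2)" by (intro tendsto_intros \<epsilon>0)
      then have "(\<lambda>n. w n \<xi>) \<longlonglongrightarrow> of_real (exp (- (0 * norm \<xi>)\<^sup>2))" unfolding w_def by (rule tendsto_of_real)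
      then show ?thesis by simp
    qed
    then have "(\<lambda>n. gh \<xi> * ph \<xi> * w n \<xi>) \<longlonglongrightarrow> gh \<xi> * ph \<xi> * 1" for \<xi> by (intro tendsto_intros)
    then show "AE \<xi> in lborel. (\<lambda>n. gh \<xi> * ph \<xi> * w n \<xi>) \<longlonglongrightarrow> gh \<xi> * ph \<xi>" by simp
    have "cmod (gh \<xi> * ph \<xi> * w n \<xi>) \<le> L * exp (- norm \<xi>) * 1" for n \<xi>
      unfolding norm_mult ph1 mult_1_right
      by (rule order_trans[OF mult_mono[OF gh'(2), of "cmod (w n \<xi>)" 1]])
        (use order_trans[OF norm_ge_zero gh'(2)[of \<xi>]] in \<open>auto simp: w_def\<close>)
    then show "AE \<xi> in lborel. cmod (gh \<xi> * ph \<xi> * w n \<xi>) \<le> L * exp (- (1 * norm \<xi>))" for n by simp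
  qed
  have eq: "(LINT \<xi>|lborel. gh \<xi> * ph \<xi> * w n \<xi>) = of_real (2 ^ DIM('a) * gauss_int TYPE('a)) * (LINT s|lborel. g (x + (2 * \<epsilon> n) *\<^sub>R s) * of_real (exp (- (norm s)\<^sup>2)))" for n
  proof -
    define F where "F \<xi> t = g t * exp (\<i> * of_real (\<sigma> * (t \<bullet> \<xi>))) * (ph \<xi> * w n \<xi>)" for \<xi> t
    have cF: "continuous_on UNIV (\<lambda>z. F (fst z) (snd z))"
      unfolding F_def ph_def w_def
      by (intro continuous_intros continuous_on_compose2[OF g(1)]) auto
    define M where "M = exp ((1 / \<epsilon> n)\<^sup>2 / 4 ) "
    have wb: "cmod (w n \<xi>) \<le> M * exp (- norm \<xi>)" for \<xi>
    proof -
      \<comment> \<open>For \<open>a = 1 / \<epsilon> n - 1\<close> and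
        \<open>r = \<epsilon> n * norm \<xi>\<close> one has \<open>a * r + r = norm \<xi>\<close>,
        which is the decay wanted, and \<open>(a + 1)\<^sup>2 / 4\<close> is the exponent of
        \<open>M\<close>.\<close>
      have "exp ((1 / \<epsilon> n - 1) * (\<epsilon> n * norm \<xi>)) * exp (- (\<epsilon> n * norm \<xi>)\<^sup>2) \<le> exp ((1 / \<epsilon> n)\<^sup>2 / 4) * exp (- (\<epsilon> n * norm \<xi>))"
        using exp_linear_minus_square[of "1 / \<epsilon> n - 1" "\<epsilon> n * norm \<xi>"] by simp
      moreover have "(1 / \<epsilon> n - 1) * (\<epsilon> n * norm \<xi>) = norm \<xi> - \<epsilon> n * norm \<xi>" using \<epsilon>[of n] by (simp add: field_simps)
      ultimately have "exp (norm \<xi> - \<epsilon> n * norm \<xi>) * exp (- (\<epsilon> n * norm \<xi>)\<^sup>2) \<le> M * exp (- (\<epsilon> n * norm \<xi>))" by (simp add: M_def)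
      then have "exp (norm \<xi>) * exp (- (\<epsilon> n * norm \<xi>)\<^sup>2) \<le> M" by (simp add: exp_diff exp_minus field_simps)
      moreover have "cmod (w n \<xi>) = exp (- (\<epsilon> n * norm \<xi>)\<^sup>2)" unfolding w_def norm_of_real by simp
      ultimately have "exp (norm \<xi>) * cmod (w n \<xi>) \<le> M" by (simp only:)
      then show ?thesis by (simp add: exp_minus field_simps)
    qed
    have "cmod (F (fst z) (snd z)) \<le> K * M * exp (- (1 * norm z))" for z
    proof -
      have "cmod (F (fst z) (snd z)) = cmod (g (snd z)) * cmod (w n (fst z))"
        by (simp add: F_def norm_mult ph1)
      also have "\<dots> \<le> (K * exp (- norm (snd z))) * (M * exp (- norm (fst z)))"
        using K0 by (intro mult_mono g(2) wb) auto
      also have "\<dots> = K * M * exp (- (norm (fst z) + norm (snd z)))" by (simp add: exp_diff exp_minus field_simps exp_add)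
      also have "\<dots> \<le> K * M * exp (- (1 * norm z))"
        using K0 norm_Pair_le[of "fst z" "snd z"] by (intro mult_left_mono) (auto simp: M_def)
      finally show ?thesis .
    qed
    then have "integrable lborel (\<lambda>z. F (fst z) (snd z))"
      using cF by (intro integrable_exp_bound[where c=1]) (auto intro: borel_measurable_continuous_onI)
    then have "integrable (lborel \<Otimes>\<^sub>M lborel) (\<lambda>(\<xi>, t). F \<xi> t)"
      by (simp add: lborel_prod case_prod_unfold)
    then have "(LINT t|lborel. LINT \<xi>|lborel. F \<xi> t) = (LINT \<xi>|lborel. LINT t|lborel. F \<xi> t)"
      by (rule lborel_pair.Fubini_integral)
    moreover have "(LINT t|lborel. F \<xi> t) = gh \<xi> * ph \<xi> * w n \<xi>" for \<xi>
      unfolding mult.assoc[of "gh \<xi>"] unfolding F_def gh by (rule integral_mult_left_zero)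
    moreover have "(LINT \<xi>|lborel. F \<xi> t) = g t * of_real ((1 / \<epsilon> n) ^ DIM('a) * gauss_int TYPE('a) * exp (- (norm (t - x) / (2 * \<epsilon> n))\<^sup>2))" for t
    proof -
      have "F \<xi> t = g t * (of_real (exp (- (\<epsilon> n * norm \<xi>)\<^sup>2)) * exp (\<i> * of_real (\<xi> \<bullet> (\<sigma> *\<^sub>R (t - x)))))" for \<xi>
        by (simp add: F_def ph_def w_def exp_add[symmetric] algebra_simps inner_diff_right inner_commute flip: exp_diff)
      moreover have "norm (\<sigma> *\<^sub>R (t - x)) = norm (t - x)" using \<sigma> by simp
      ultimately show ?thesis using fourier_gauss_scaled[OF \<epsilon>[of n], of "\<sigma> *\<^sub>R (t - x)"] \<sigma> by simp
    qed
    ultimately have "(LINT \<xi>|lborel. gh \<xi> * ph \<xi> * w n \<xi>) = (LINT t|lborel. g t * of_real ((1 / \<epsilon> n) ^ DIM('a) * gauss_int TYPE('a) * exp (- (norm (t - x) / (2 * \<epsilon> n))\<^sup>2)))"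
      by simp
    also have "\<dots> = \<bar>2 * \<epsilon> n\<bar> ^ DIM('a) *\<^sub>R (LINT s|lborel. g (x + (2 * \<epsilon> n) *\<^sub>R s) * of_real ((1 / \<epsilon> n) ^ DIM('a) * gauss_int TYPE('a) * exp (- (norm ((x + (2 * \<epsilon> n) *\<^sub>R s) - x) / (2 * \<epsilon> n))\<^sup>2)))"
    proof (rule integral_affine)
      have "continuous_on UNIV (\<lambda>t. g t * of_real ((1 / \<epsilon> n) ^ DIM('a) * gauss_int TYPE('a) * exp (- (norm (t - x) / (2 * \<epsilon> n))\<^sup>2)))"
        using \<epsilon>[of n] by (intro continuous_intros g(1)) auto
      then show "(\<lambda>t. g t * of_real ((1 / \<epsilon> n) ^ DIM('a) * gauss_int TYPE('a) * exp (- (norm (t - x) / (2 * \<epsilon> n))\<^sup>2))) \<in> borel_measurable borel"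
        by (rule borel_measurable_continuous_onI)
    qed (use \<epsilon>[of n] in auto)
    also have "(\<lambda>s. g (x + (2 * \<epsilon> n) *\<^sub>R s) * of_real ((1 / \<epsilon> n) ^ DIM('a) * gauss_int TYPE('a) * exp (- (norm ((x + (2 * \<epsilon> n) *\<^sub>R s) - x) / (2 * \<epsilon> n))\<^sup>2)))
       = (\<lambda>s. of_real ((1 / \<epsilon> n) ^ DIM('a) * gauss_int TYPE('a)) * (g (x + (2 * \<epsilon> n) *\<^sub>R s) * of_real (exp (- (norm s)\<^sup>2))))"
      using \<epsilon>[of n] by (simp add: mult_ac)
    finally show ?thesis
      using \<epsilon>[of n] by (simp add: scaleR_conv_of_real power_mult_distrib power_divide)
  qed
  have lim2: "(\<lambda>n. LINT s|lborel. g (x + (2 * \<epsilon> n) *\<^sub>R s) * of_real (exp (- (norm s)\<^sup>2))) \<longlonglongrightarrow> (LINT s|lborel. g x * of_real (exp (- (norm (s::'a))\<^sup>2)))"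
  proof (rule integral_dominated_convergence[where w="\<lambda>s. K * exp (- (norm s)\<^sup>2)"])
    show "integrable lborel (\<lambda>s::'a. K * exp (- (norm s)\<^sup>2))" by (intro integrable_mult_right integrable_gauss)
    have "continuous_on UNIV (\<lambda>s. g (x + (2 * \<epsilon> n) *\<^sub>R s) * of_real (exp (- (norm s)\<^sup>2)))" for n
      by (intro continuous_intros continuous_on_compose2[OF g(1)]) auto
    then show "(\<lambda>s. g (x + (2 * \<epsilon> n) *\<^sub>R s) * of_real (exp (- (norm s)\<^sup>2))) \<in> borel_measurable lborel" for n
      by (simp add: borel_measurable_continuous_onI)
    have "(\<lambda>n. g (x + (2 * \<epsilon> n) *\<^sub>R s)) \<longlonglongrightarrow> g x" for s
    proof (rule continuous_on_tendsto_compose[OF g(1)])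
      have "(\<lambda>n. x + (2 * \<epsilon> n) *\<^sub>R s) \<longlonglongrightarrow> x + (2 * 0) *\<^sub>R s" by (intro tendsto_intros \<epsilon>0)
      then show "(\<lambda>n. x + (2 * \<epsilon> n) *\<^sub>R s) \<longlonglongrightarrow> x" by simp
    qed auto
    then show "AE s in lborel. (\<lambda>n. g (x + (2 * \<epsilon> n) *\<^sub>R s) * of_real (exp (- (norm s)\<^sup>2))) \<longlonglongrightarrow> g x * of_real (exp (- (norm s)\<^sup>2))"
      by (intro always_eventually allI tendsto_intros)
    have "cmod (g t) \<le> K" for t
    proof -
      have "cmod (g t) \<le> K * exp (- norm t)" by (rule g(2))
      also have "\<dots> \<le> K * 1" using K0 by (intro mult_left_mono) auto
      finally show ?thesis by simp
    qed
    then show "AE s in lborel. cmod (g (x + (2 * \<epsilon> n) *\<^sub>R s) * of_real (exp (- (norm s)\<^sup>2))) \<le> K * exp (- (norm s)\<^sup>2)" for n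
      by (intro always_eventually allI) (simp add: norm_mult)
  qed simp
  have "(LINT s|lborel. g x * complex_of_real (exp (- (norm (s::'a))\<^sup>2))) = g x * of_real (gauss_int TYPE('a))"
    by (simp only: integral_mult_right_zero integral_complex_of_real gauss_int_def)
  with tendsto_mult[OF tendsto_const[of "of_real (2 ^ DIM('a) * gauss_int TYPE('a))"] lim2]
  have "(\<lambda>n. LINT \<xi>|lborel. gh \<xi> * ph \<xi> * w n \<xi>) \<longlonglongrightarrow> of_real (2 ^ DIM('a) * gauss_int TYPE('a)) * (g x * of_real (gauss_int TYPE('a)))"
    unfolding eq by (simp only:)
  from LIMSEQ_unique[OF lim1 this] show ?thesis
    by (simp add: ph_def inv_const_def power2_eq_square mult_ac)
qed

lemma FT2_inversion:
  fixes \<Phi> :: "'m::euclidean_space \<times> 'd::euclidean_space \<Rightarrow> complex"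
  assumes \<Phi>: "\<Phi> \<in> Sigma1" and \<sigma>: "\<bar>\<sigma>\<bar> = 1"
  shows "FT2 (- \<sigma>) (FT2 \<sigma> \<Phi>) = (\<lambda>p. of_real (inv_const TYPE('d)) * \<Phi> p)"
proof
  fix p :: "'m \<times> 'd"
  obtain z x where p: "p = (z, x)" by fastforce
  have slice: "continuous_on UNIV (\<lambda>t. f (z, t))" "\<exists>K. \<forall>t. cmod (f (z, t)) \<le> K * exp (- norm t)"
    if f: "f \<in> Sigma1" for f :: "'m \<times> 'd \<Rightarrow> complex"
  proof -
    show "continuous_on UNIV (\<lambda>t. f (z, t))"
      by (rule continuous_on_compose2[OF Sigma1_continuous[OF f]]) (auto intro!: continuous_intros)
    obtain K where K: "entire_bd 1 K f" using Sigma1_ent_bd[OF f] by blast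
    have "cmod (f (z, t)) \<le> K * exp (- norm t)" for t
    proof -
      have "cmod (f (z, t)) \<le> K * exp (- (1 * norm (z, t)))" by (rule entire_bd_real[OF K]) simp
      also have "\<dots> \<le> K * exp (- norm t)"
        using entire_bd_nonneg[OF K] norm_snd_le[of t z] by (intro mult_left_mono) auto
      finally show ?thesis .
    qed
    then show "\<exists>K. \<forall>t. cmod (f (z, t)) \<le> K * exp (- norm t)" by blast
  qed
  note F = FT2_Sigma1[OF \<Phi> \<sigma>]
  obtain K where K: "\<And>t. cmod (\<Phi> (z, t)) \<le> K * exp (- norm t)" using slice(2)[OF \<Phi>] by blast
  obtain L where L: "\<And>t. cmod (FT2 \<sigma> \<Phi> (z, t)) \<le> L * exp (- norm t)" using slice(2)[OF F] by blast
  have "(LINT \<xi>|lborel. FT2 \<sigma> \<Phi> (z, \<xi>) * exp (\<i> * of_real (- \<sigma> * (\<xi> \<bullet> x)))) = of_real (inv_const TYPE('d)) * \<Phi> (z, x)"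
  proof (rule fourier_inversion[OF slice(1)[OF \<Phi>] K \<sigma> _ _ L])
    show "(\<lambda>\<xi>. FT2 \<sigma> \<Phi> (z, \<xi>)) = (\<lambda>\<xi>. LINT t|lborel. \<Phi> (z, t) * exp (\<i> * of_real (\<sigma> * (t \<bullet> \<xi>))))"
      by (simp add: FT2_def)
    show "(\<lambda>\<xi>. FT2 \<sigma> \<Phi> (z, \<xi>)) \<in> borel_measurable borel"
      using slice(1)[OF F] by (rule borel_measurable_continuous_onI)
  qed
  then show "FT2 (- \<sigma>) (FT2 \<sigma> \<Phi>) p = of_real (inv_const TYPE('d)) * \<Phi> p"
    by (simp add: FT2_def[of "- \<sigma>"] p)
qed


section \<open>Density of Gaussians\<close>

definition gaussc :: "real \<Rightarrow> 'a::euclidean_space \<Rightarrow> complex" where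
  "gaussc s x = of_real (exp (- (s * norm x)\<^sup>2))"

text \<open>The square of \<open>norm x\<close> is continued by the bilinear, not the Hermitian,
  square of \<open>x + iy\<close>, so that the function is holomorphic.\<close>

definition gauss_ext :: "real \<Rightarrow> 'a::euclidean_space \<Rightarrow> 'a \<Rightarrow> complex" where
  "gauss_ext s x y = exp (- of_real (s\<^sup>2) * Complex (x \<bullet> x - y \<bullet> y) (2 * (x \<bullet> y)))"

lemma exp_move: "exp a * E \<le> K \<Longrightarrow> E \<le> K * exp (- (a::real))"
  by (simp add: exp_minus field_simps)

lemma ent_gauss_ext:
  assumes "0 < s" shows "entire (gauss_ext s :: 'a::euclidean_space \<Rightarrow> 'a \<Rightarrow> complex)"
  unfolding entire_def
proof (intro conjI allI line_holomorphicI)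
  fix x y v :: 'a
  have "(\<lambda>z. exp (- of_real (s\<^sup>2) * (Complex (x \<bullet> x - y \<bullet> y) (2 * (x \<bullet> y)) + 2 * z * Complex (x \<bullet> v) (y \<bullet> v) + z\<^sup>2 * of_real (v \<bullet> v)))) holomorphic_on UNIV"
    by (intro holomorphic_intros)
  moreover have "Complex (x \<bullet> x - y \<bullet> y) (2 * (x \<bullet> y)) + 2 * z * Complex (x \<bullet> v) (y \<bullet> v) + z\<^sup>2 * of_real (v \<bullet> v)
    = Complex ((x + Re z *\<^sub>R v) \<bullet> (x + Re z *\<^sub>R v) - (y + Im z *\<^sub>R v) \<bullet> (y + Im z *\<^sub>R v)) (2 * ((x + Re z *\<^sub>R v) \<bullet> (y + Im z *\<^sub>R v)))" for z
    by (simp add: complex_eq_iff inner_add_left inner_add_right inner_commute[of v x] inner_commute[of v y] inner_commute[of y x] power2_eq_square algebra_simps)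
  ultimately show "(\<lambda>z. gauss_ext s (x + Re z *\<^sub>R v) (y + Im z *\<^sub>R v)) holomorphic_on UNIV"
    unfolding gauss_ext_def by (simp only:)
next
  fix R :: real
  have "cmod (gauss_ext s x y) \<le> (exp ((s * R)\<^sup>2) * exp ((R / s + 1)\<^sup>2 / 4)) * exp (- (R * norm x))" if y: "norm y \<le> R" for x y :: 'a
  proof -
    have "cmod (gauss_ext s x y) = exp ((s * norm y)\<^sup>2 - (s * norm x)\<^sup>2)"
      by (simp add: gauss_ext_def power_mult_distrib power2_norm_eq_inner algebra_simps)
    also have "\<dots> \<le> exp ((s * R)\<^sup>2 - (s * norm x)\<^sup>2)" using y assms by (auto intro!: power_mono mult_left_mono)
    also have "\<dots> \<le> exp ((s * R)\<^sup>2) * (exp ((R / s + 1)\<^sup>2 / 4) * exp (- (R * norm x)))"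
    proof -
      have "exp ((R / s) * (s * norm x)) * exp (- (s * norm x)\<^sup>2) \<le> exp ((R / s + 1)\<^sup>2 / 4) * exp (- (s * norm x))"
        by (rule exp_linear_minus_square)
      also have "\<dots> \<le> exp ((R / s + 1)\<^sup>2 / 4) * 1" using assms by (intro mult_left_mono) auto
      also have "(R / s) * (s * norm x) = R * norm x" using assms by simp
      finally have "exp (- (s * norm x)\<^sup>2) \<le> exp ((R / s + 1)\<^sup>2 / 4) * exp (- (R * norm x))"
        by (intro exp_move) simp
      then have "exp ((s * R)\<^sup>2) * exp (- (s * norm x)\<^sup>2) \<le> exp ((s * R)\<^sup>2) * (exp ((R / s + 1)\<^sup>2 / 4) * exp (- (R * norm x)))"
        by (intro mult_left_mono) auto
      then show ?thesis by (simp only: exp_add[symmetric] diff_conv_add_uminus)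
    qed
    finally show ?thesis by (simp add: mult.assoc)
  qed
  then show "\<exists>C. tube R C (gauss_ext s :: 'a \<Rightarrow> 'a \<Rightarrow> complex)" unfolding tube_def by blast
qed

lemma gauss_ext_real: "gauss_ext s x 0 = gaussc s x"
  by (simp add: gauss_ext_def gaussc_def Complex_eq exp_of_real[symmetric] power_mult_distrib power2_norm_eq_inner)

lemma gaussc_Sigma1: "0 < s \<Longrightarrow> gaussc s \<in> Sigma1"
  using Sigma1_ent[OF ent_gauss_ext, of s] by (simp add: gauss_ext_real)

section \<open>Translation of test functions\<close>

lemma hol_shift: "line_holomorphic F \<Longrightarrow> line_holomorphic (\<lambda>x y. F (x - a) y)"
proof (rule line_holomorphicI)
  fix x y v assume "line_holomorphic F"
  from hol_line[OF this, of "x - a" v y UNIV]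
  show "(\<lambda>z. F (x + Re z *\<^sub>R v - a) (y + Im z *\<^sub>R v)) holomorphic_on UNIV" by (simp add: algebra_simps)
qed

lemma exp_shift_le:
  assumes "0 \<le> (R::real)" shows "exp (- (R * norm (x - u))) \<le> exp (R * norm u) * exp (- (R * norm x))"
proof -
  have "R * norm x \<le> R * (norm (x - u) + norm u)"
    using assms norm_triangle_ineq2[of x u] by (intro mult_left_mono) auto
  then show ?thesis by (simp add: distrib_left flip: exp_add)
qed

lemma tube_shift:
  fixes F :: "'a::euclidean_space \<Rightarrow> 'a \<Rightarrow> complex"
  assumes "tube R C F" "0 \<le> R" shows "tube R (C * exp (R * norm a)) (\<lambda>x y. F (x - a) y)"
  unfolding tube_def
proof (intro allI impI)
  fix x y :: 'a assume "norm y \<le> R"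
  then have "cmod (F (x - a) y) \<le> C * exp (- (R * norm (x - a)))" using assms by (simp add: tube_def)
  also have "\<dots> \<le> C * (exp (R * norm a) * exp (- (R * norm x)))"
    using tube_nonneg[OF assms] exp_shift_le[OF assms(2), of x a] by (intro mult_left_mono)
  finally show "cmod (F (x - a) y) \<le> C * exp (R * norm a) * exp (- (R * norm x))" by (simp add: mult.assoc)
qed

lemma ent_shift: assumes "entire F" shows "entire (\<lambda>x y. F (x - a) y)"
  unfolding entire_def
proof (intro conjI allI)
  show "line_holomorphic (\<lambda>x y. F (x - a) y)" using assms by (intro hol_shift) (simp add: entire_def)
  fix R :: real
  obtain C where C: "tube \<bar>R\<bar> C F" using assms by (auto simp: entire_def)
  from tube_antimono[OF tube_shift[OF C abs_ge_zero] abs_ge_self abs_ge_zero]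
  show "\<exists>C. tube R C (\<lambda>x y. F (x - a) y)" by blast
qed

lemma Sigma1_shift: assumes "f \<in> Sigma1" shows "(\<lambda>x. f (x - a)) \<in> Sigma1"
proof -
  obtain F where F: "entire F" "f = (\<lambda>x. F x 0)" using assms by (auto simp: Sigma1_iff_ent)
  show ?thesis using Sigma1_ent[OF ent_shift[OF F(1)], of a] by (simp add: F(2))
qed

lemma mult_exp_le: "r \<le> exp (r::real)"
  using exp_ge_add_one_self[of r] by linarith

lemma Sigma1_linear_sum:
  assumes zero: "T (\<lambda>x. 0) = (0::complex)"
    and add: "\<And>f g. f \<in> Sigma1 \<Longrightarrow> g \<in> Sigma1 \<Longrightarrow> T (\<lambda>x. f x + g x) = T f + T g"
    and "finite V" "\<And>v. v \<in> V \<Longrightarrow> f v \<in> Sigma1"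
  shows "(\<lambda>x. \<Sum>v\<in>V. f v x) \<in> Sigma1 \<and> T (\<lambda>x. \<Sum>v\<in>V. f v x) = (\<Sum>v\<in>V. T (f v))"
  using assms(3,4) by (induction V rule: finite_induct) (auto simp: zero Sigma1_zero add intro: Sigma1_add)

text \<open>The Lipschitz bound in the tube of width \<open>R + 1\<close> yields the factor
  \<open>\<epsilon>\<close>, and the Gaussian weight absorbs the growth
  \<open>exp ((R + 2) * norm v)\<close> in the displacement. Hence mollification converges in each
  seminorm at rate \<open>\<epsilon>\<close>, with \<open>M\<close> independent of
  \<open>\<epsilon>\<close>.\<close>

lemma gaussian_average_approx:
  fixes f :: "'b::euclidean_space \<Rightarrow> complex"
  assumes f: "f \<in> Sigma1" and R: "0 \<le> R"
  obtains M where "\<And>\<epsilon>. 0 < \<epsilon> \<Longrightarrow> \<epsilon> \<le> 1 \<Longrightarrow>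
    entire_bd R (\<epsilon> * M) (\<lambda>x. LINT v|lborel. of_real (exp (- (norm v)\<^sup>2)) * (f x - f (x - \<epsilon> *\<^sub>R v)))"
proof -
  obtain F where F: "entire F" "f = (\<lambda>x. F x 0)" using f by (auto simp: Sigma1_iff_ent)
  have hF: "line_holomorphic F" using F by (simp add: entire_def)
  have "\<forall>R. \<exists>C. tube R C F" using F(1) by (simp add: entire_def)
  then obtain C where C: "\<And>R. tube R (C R) F" by metis
  define B where "B \<epsilon> R v = \<epsilon> * (C (R + 1) * exp (R + 1) * (exp ((R + 2) * norm v) * exp (- (norm v)\<^sup>2)))" for \<epsilon> R and v :: 'b
  define H where "H \<epsilon> v x y = complex_of_real (exp (- (norm v)\<^sup>2)) * (F x y - F (x - \<epsilon> *\<^sub>R v) y)" for \<epsilon> and v x y :: 'b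
  have tH: "tube R (B \<epsilon> R v) (H \<epsilon> v)" if \<epsilon>: "0 < \<epsilon>" "\<epsilon> \<le> 1" and R: "0 \<le> R" for \<epsilon> R v
    unfolding tube_def
  proof (intro allI impI)
    fix x y :: 'b assume y: "norm y \<le> R"
    have C0: "0 \<le> C (R + 1)" using tube_nonneg[OF C] R by auto
    have "cmod (F (x + - (\<epsilon> *\<^sub>R v)) y - F x y) \<le> norm (- (\<epsilon> *\<^sub>R v)) * (C (R + 1) * exp ((R + 1) * (norm (- (\<epsilon> *\<^sub>R v)) + 1)) * exp (- ((R + 1) * norm x)))"
      using y by (intro lipschitz_tube hF C) auto
    also have "\<dots> \<le> (\<epsilon> * exp (norm v)) * (C (R + 1) * exp ((R + 1) * (norm v + 1)) * exp (- (R * norm x)))"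
    proof (intro mult_mono)
      show "norm (- (\<epsilon> *\<^sub>R v)) \<le> \<epsilon> * exp (norm v)" using \<epsilon> mult_exp_le[of "norm v"] by simp
      show "exp ((R + 1) * (norm (- (\<epsilon> *\<^sub>R v)) + 1)) \<le> exp ((R + 1) * (norm v + 1))"
        using \<epsilon> R by (auto intro!: mult_left_mono simp: mult_left_le_one_le)
      show "exp (- ((R + 1) * norm x)) \<le> exp (- (R * norm x))" by (simp add: distrib_right)
    qed (use C0 \<epsilon> in auto)
    finally have "cmod (F x y - F (x - \<epsilon> *\<^sub>R v) y) \<le> (\<epsilon> * exp (norm v)) * (C (R + 1) * exp ((R + 1) * (norm v + 1)) * exp (- (R * norm x)))"
      by (simp add: norm_minus_commute)
    then have "cmod (H \<epsilon> v x y) \<le> exp (- (norm v)\<^sup>2) * ((\<epsilon> * exp (norm v)) * (C (R + 1) * exp ((R + 1) * (norm v + 1)) * exp (- (R * norm x))))"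
      unfolding H_def norm_mult norm_of_real by (auto intro: mult_left_mono)
    also have "\<dots> = B \<epsilon> R v * exp (- (R * norm x))"
    proof -
      have "exp (norm v) * exp ((R + 1) * (norm v + 1)) = exp (R + 1) * exp ((R + 2) * norm v)"
        by (simp add: algebra_simps flip: exp_add)
      then show ?thesis by (simp add: B_def mult_ac)
    qed
    finally show "cmod (H \<epsilon> v x y) \<le> B \<epsilon> R v * exp (- (R * norm x))" .
  qed
  have hH: "line_holomorphic (H \<epsilon> v)" for \<epsilon> v
    unfolding H_def using hol_cmult[OF hol_add[OF hF hol_cmult[OF hol_shift[OF hF], of "-1"]]] by simp
  have mH: "(\<lambda>v. H \<epsilon> v x y) \<in> borel_measurable lborel" for \<epsilon> x y
  proof -
    have "continuous_on UNIV (\<lambda>v. H \<epsilon> v x y)"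
      unfolding H_def by (intro continuous_intros continuous_on_compose2[OF tube_continuous[OF F(1)]]) auto
    then show ?thesis by (simp add: borel_measurable_continuous_onI)
  qed
  have iB: "integrable lborel (B \<epsilon> R)" for \<epsilon> R
    unfolding B_def by (intro integrable_mult_right integrable_gauss_exp)
  show ?thesis
  proof (rule that[of "LINT v|lborel. C (R + 1) * exp (R + 1) * (exp ((R + 2) * norm v) * exp (- (norm v)\<^sup>2))"])
    fix \<epsilon> :: real assume \<epsilon>: "0 < \<epsilon>" "\<epsilon> \<le> 1"
    note E = ent_integral[of "H \<epsilon>" "B \<epsilon>", OF hH mH iB tH[OF \<epsilon>]]
    have "(LINT v|lborel. B \<epsilon> R v) = \<epsilon> * (LINT v|lborel. C (R + 1) * exp (R + 1) * (exp ((R + 2) * norm (v::'b)) * exp (- (norm v)\<^sup>2)))"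
      unfolding B_def by (rule integral_mult_right_zero)
    moreover have "tube R (LINT v|lborel. B \<epsilon> R v) (\<lambda>x y. LINT v|lborel. H \<epsilon> v x y)" by (rule E(2)[OF _ R])
    ultimately have t: "tube R (\<epsilon> * (LINT v|lborel. C (R + 1) * exp (R + 1) * (exp ((R + 2) * norm (v::'b)) * exp (- (norm v)\<^sup>2)))) (\<lambda>x y. LINT v|lborel. H \<epsilon> v x y)"
      by simp
    have "entire (\<lambda>x y. LINT v|lborel. H \<epsilon> v x y)" by (rule E(1))
    then show "entire_bd R (\<epsilon> * (LINT v|lborel. C (R + 1) * exp (R + 1) * (exp ((R + 2) * norm (v::'b)) * exp (- (norm v)\<^sup>2))))
       (\<lambda>x. LINT v|lborel. of_real (exp (- (norm v)\<^sup>2)) * (f x - f (x - \<epsilon> *\<^sub>R v)))"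
      using t by (rule entire_bdI) (simp add: H_def F(2))
  qed
qed

text \<open>To move \<open>T\<close> under the integral, the integral is replaced by finite sums. In
  the centre of the Gaussian, but not in \<open>f u\<close>, the point \<open>u\<close> is replaced
  by simple functions \<open>\<phi> j\<close> converging to \<open>u\<close>. The resulting
  \<open>gj j\<close> is a finite combination of translates, which \<open>T\<close> annihilates, and
  the error tends to 0 in the seminorm of index \<open>R\<close> by dominated convergence.\<close>

lemma functional_gauss_convolution_zero:
  fixes f :: "'b::euclidean_space \<Rightarrow> complex" and T :: "('b \<Rightarrow> complex) \<Rightarrow> complex"
  assumes f: "f \<in> Sigma1" and s: "0 < s" and R: "0 \<le> R"
    and add: "\<And>f g. f \<in> Sigma1 \<Longrightarrow> g \<in> Sigma1 \<Longrightarrow> T (\<lambda>x. f x + g x) = T f + T g"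
    and cmult: "\<And>c f. f \<in> Sigma1 \<Longrightarrow> T (\<lambda>x. c * f x) = c * T f"
    and bd: "\<And>f C. entire_bd R C f \<Longrightarrow> cmod (T f) \<le> K * C"
    and zero: "\<And>u. T (\<lambda>x. gaussc s (x - u)) = 0"
  shows "T (\<lambda>x. LINT u|lborel. f u * gaussc s (x - u)) = 0"
proof -
  have T0: "T (\<lambda>x. 0) = 0" using cmult[OF Sigma1_zero, of 0] by simp
  have fm: "f \<in> borel_measurable borel" using f by (rule Sigma1_measurable)
  define P where "P = (gauss_ext s :: 'b \<Rightarrow> 'b \<Rightarrow> complex)"
  have P: "entire P" unfolding P_def using s by (rule ent_gauss_ext)
  then have hP: "line_holomorphic P" by (simp add: entire_def)
  have "\<forall>R. \<exists>C. tube R C P" using P by (simp add: entire_def)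
  then obtain C where C: "\<And>R. tube R (C R) P" by metis
  have "\<exists>D. entire_bd R D f" for R using Sigma1_ent_bd[OF f] .
  then obtain D where D: "\<And>R. entire_bd R (D R) f" by metis
  obtain \<phi> where \<phi>: "\<And>j. simple_function lborel (\<phi> j)" "\<And>u. (\<lambda>j. \<phi> j u) \<longlonglongrightarrow> u" "\<And>j u. norm (\<phi> j u) \<le> 2 * norm (u::'b)"
    using borel_measurable_implies_sequence_metric[of "\<lambda>u::'b. u" lborel 0] by auto
  have \<phi>m: "\<phi> j \<in> borel_measurable borel" for j using borel_measurable_simple_function[OF \<phi>(1)[of j]] by simp
  \<comment> \<open>The index \<open>4 * (R + 1) + 2\<close> is a rate of decay of \<open>f\<close>:
    \<open>3 * (R + 1)\<close> offsets the Lipschitz bound, because \<open>\<phi> j u\<close> is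
    within \<open>3 * norm u\<close> of \<open>u\<close>; \<open>R + 1\<close> offsets the
    translation by \<open>u\<close>; and 2 is left over, one half of which absorbs the distance
    itself.\<close>
  define B where "B j R u = D (4 * (R + 1) + 2) * C (R + 1) * exp (R + 1) * (norm (u - \<phi> j u) * exp (- (2 * norm u)))" for j R and u :: 'b
  define H where "H j u x y = f u * (P (x - u) y - P (x - \<phi> j u) y)" for j and u x y :: 'b
  have w: "norm (u - \<phi> j u) \<le> 3 * norm u" for j u
    using norm_triangle_ineq4[of u "\<phi> j u"] \<phi>(3)[of j u] by linarith
  have tH: "tube R (B j R u) (H j u)" if R: "0 \<le> R" for j R u
    unfolding tube_def
  proof (intro allI impI)
    fix x y :: 'b assume y: "norm y \<le> R"
    have C0: "0 \<le> C (R + 1)" using tube_nonneg[OF C] R by auto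
    have D0: "0 \<le> D (4 * (R + 1) + 2)" using entire_bd_nonneg[OF D] R by auto
    define w where "w = norm (u - \<phi> j u)"
    have w0: "0 \<le> w" "w \<le> 3 * norm u" using \<open>norm (u - \<phi> j u) \<le> 3 * norm u\<close> by (auto simp: w_def)
    have "cmod (P ((x - u) + (u - \<phi> j u)) y - P (x - u) y) \<le> w * (C (R + 1) * exp ((R + 1) * (w + 1)) * exp (- ((R + 1) * norm (x - u))))"
      unfolding w_def using y by (intro lipschitz_tube hP C) auto
    also have "\<dots> \<le> w * (C (R + 1) * exp ((R + 1) * (3 * norm u + 1)) * (exp ((R + 1) * norm u) * exp (- ((R + 1) * norm x))))"
      using C0 w0 R exp_shift_le[of "R + 1" x u] by (intro mult_mono mult_nonneg_nonneg) (auto intro!: mult_left_mono)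
    also have "\<dots> \<le> w * (C (R + 1) * exp ((R + 1) * (3 * norm u + 1)) * (exp ((R + 1) * norm u) * exp (- (R * norm x))))"
      using C0 w0 by (intro mult_left_mono) (auto simp: distrib_right)
    finally have 1: "cmod (P (x - u) y - P (x - \<phi> j u) y) \<le> w * (C (R + 1) * exp ((R + 1) * (3 * norm u + 1)) * (exp ((R + 1) * norm u) * exp (- (R * norm x))))"
      by (simp add: norm_minus_commute)
    have 2: "cmod (f u) \<le> D (4 * (R + 1) + 2) * exp (- ((4 * (R + 1) + 2) * norm u))"
      using R by (intro entire_bd_real[OF D]) auto
    have "cmod (H j u x y) \<le> (D (4 * (R + 1) + 2) * exp (- ((4 * (R + 1) + 2) * norm u))) * (w * (C (R + 1) * exp ((R + 1) * (3 * norm u + 1)) * (exp ((R + 1) * norm u) * exp (- (R * norm x)))))"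
      unfolding H_def norm_mult using 1 2 D0 by (intro mult_mono) auto
    also have "\<dots> = B j R u * exp (- (R * norm x))"
    proof -
      have "exp (- ((4 * (R + 1) + 2) * norm u)) * (exp ((R + 1) * (3 * norm u + 1)) * exp ((R + 1) * norm u)) = exp (R + 1) * exp (- (2 * norm u))"
        by (simp add: algebra_simps flip: exp_add)
      moreover have "(D (4 * (R + 1) + 2) * exp (- ((4 * (R + 1) + 2) * norm u))) * (w * (C (R + 1) * exp ((R + 1) * (3 * norm u + 1)) * (exp ((R + 1) * norm u) * exp (- (R * norm x)))))
        = D (4 * (R + 1) + 2) * w * C (R + 1) * (exp (- ((4 * (R + 1) + 2) * norm u)) * (exp ((R + 1) * (3 * norm u + 1)) * exp ((R + 1) * norm u))) * exp (- (R * norm x))"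
        by (simp only: mult_ac)
      ultimately show ?thesis by (simp only: B_def w_def mult_ac)
    qed
    finally show "cmod (H j u x y) \<le> B j R u * exp (- (R * norm x))" .
  qed
  have hH: "line_holomorphic (H j u)" for j u
    unfolding H_def using hol_cmult[OF hol_add[OF hol_shift[OF hP] hol_cmult[OF hol_shift[OF hP], of "-1"]]] by simp
  have Pm: "(\<lambda>x. P x y) \<in> borel_measurable borel" for y by (intro borel_measurable_continuous_onI tube_continuous P)
  have mH: "(\<lambda>u. H j u x y) \<in> borel_measurable lborel" for j x y
    unfolding H_def using fm \<phi>m[of j]
    by (auto intro!: borel_measurable_times borel_measurable_diff measurable_compose[OF _ Pm])
  have bB: "norm u * exp (- (2 * norm u)) \<le> exp (- norm u)" for u :: 'b
  proof -
    have "norm u * exp (- (2 * norm u)) \<le> exp (norm u) * exp (- (2 * norm u))" by (intro mult_right_mono mult_exp_le) auto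
    then show ?thesis by (simp flip: exp_add)
  qed
  have mB: "B j R \<in> borel_measurable borel" for j R unfolding B_def using \<phi>m[of j] by measurable
  have iexp: "integrable lborel (\<lambda>u::'b. c * (3 * exp (- (1 * norm u))))" for c
    by (intro integrable_mult_right integrable_exp_norm) auto
  have wB: "norm (B j R u) \<le> (D (4 * (R + 1) + 2) * C (R + 1) * exp (R + 1)) * (3 * exp (- (1 * norm u)))" if "0 \<le> R" for j R u
  proof -
    have C0: "0 \<le> C (R + 1)" using tube_nonneg[OF C] that by auto
    have D0: "0 \<le> D (4 * (R + 1) + 2)" using entire_bd_nonneg[OF D] that by auto
    have "norm (u - \<phi> j u) * exp (- (2 * norm u)) \<le> (3 * norm u) * exp (- (2 * norm u))"
      using w by (intro mult_right_mono) auto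
    also have "\<dots> \<le> 3 * exp (- norm u)" using bB[of u] by simp
    finally show ?thesis
      unfolding B_def norm_mult using C0 D0 by (auto intro!: mult_left_mono)
  qed
  have iB: "integrable lborel (B j R)" if "0 \<le> R" for j R
    using mB wB[OF that] by (intro integrable_dominated[OF iexp]) auto
  have limB: "(\<lambda>j. LINT u|lborel. B j R u) \<longlonglongrightarrow> (LINT (u::'b)|lborel. (0::real))"
  proof (rule integral_dominated_convergence[where w="\<lambda>u::'b. (D (4 * (R + 1) + 2) * C (R + 1) * exp (R + 1)) * (3 * exp (- (1 * norm u)))"])
    have "(\<lambda>j. B j R u) \<longlonglongrightarrow> D (4 * (R + 1) + 2) * C (R + 1) * exp (R + 1) * (norm (u - u) * exp (- (2 * norm u)))" for u
      unfolding B_def by (intro tendsto_intros \<phi>)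
    then show "AE u in lborel. (\<lambda>j. B j R u) \<longlonglongrightarrow> 0" by simp
  qed (use mB iexp wB[OF R] in auto)
  define g where "g x = (LINT u|lborel. f u * gaussc s (x - u))" for x
  define gj where "gj j x = (LINT u|lborel. f u * gaussc s (x - \<phi> j u))" for j x
  have gm: "(gaussc s :: 'b \<Rightarrow> complex) \<in> borel_measurable borel" using Sigma1_measurable[OF gaussc_Sigma1[OF s]] .
  have g1: "cmod (gaussc s x) \<le> 1" for x :: 'b by (simp add: gaussc_def)
  have fi: "integrable lborel f"
    using fm entire_bd_real[OF D, of 1] by (intro integrable_exp_bound[where c=1 and K="D 1"]) auto
  have fgi: "integrable lborel (\<lambda>u. f u * gaussc s (x - \<psi> u))" if "\<psi> \<in> borel_measurable borel" for x and \<psi> :: "'b \<Rightarrow> 'b"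
  proof (rule integrable_dominated[OF integrable_norm[OF fi]])
    show "(\<lambda>u. f u * gaussc s (x - \<psi> u)) \<in> borel_measurable lborel"
      using fm that by (auto intro!: borel_measurable_times measurable_compose[OF _ gm])
    show "norm (f u * gaussc s (x - \<psi> u)) \<le> norm (f u)" for u
      using mult_left_mono[OF g1[of "x - \<psi> u"], of "cmod (f u)"] by (simp add: norm_mult)
  qed
  have ed: "entire_bd R (LINT u|lborel. B j R u) (\<lambda>x. g x - gj j x)" for j
  proof (rule entire_bdI)
    note E = ent_integral[of "H j" "B j", OF hH mH iB tH]
    show "entire (\<lambda>x y. LINT u|lborel. H j u x y)" by (rule E(1)) 
    show "tube R (LINT u|lborel. B j R u) (\<lambda>x y. LINT u|lborel. H j u x y)" by (rule E(2)[OF _ _ R])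
    show "(LINT u|lborel. H j u x 0) = g x - gj j x" for x
      unfolding g_def gj_def using fgi[of "\<lambda>u. u" x] fgi[OF \<phi>m, of x]
      by (subst Bochner_Integration.integral_diff[symmetric]) (auto simp: H_def P_def gauss_ext_real algebra_simps)
  qed
  have gj: "gj j \<in> Sigma1 \<and> T (gj j) = 0" for j
  proof -
    define V where "V = range (\<phi> j)"
    have V: "finite V" unfolding V_def using simple_functionD(1)[OF \<phi>(1)[of j]] by simp
    define c where "c v = (LINT u|lborel. f u * indicator {u. \<phi> j u = v} u)" for v
    have "gj j x = (\<Sum>v\<in>V. c v * gaussc s (x - v))" for x
    proof -
      have "f u * gaussc s (x - \<phi> j u) = (\<Sum>v\<in>V. (f u * indicator {u. \<phi> j u = v} u) * gaussc s (x - v))" for u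
      proof -
        have "(\<Sum>v\<in>V. (f u * indicator {u. \<phi> j u = v} u) * gaussc s (x - v)) = (\<Sum>v\<in>V. if v = \<phi> j u then f u * gaussc s (x - v) else 0)"
          by (intro sum.cong) (auto simp: indicator_def)
        also have "\<dots> = f u * gaussc s (x - \<phi> j u)" using V by (simp add: sum.delta V_def)
        finally show ?thesis by simp
      qed
      then have "gj j x = (LINT u|lborel. (\<Sum>v\<in>V. (f u * indicator {u. \<phi> j u = v} u) * gaussc s (x - v)))"
        by (simp add: gj_def)
      also have "\<dots> = (\<Sum>v\<in>V. LINT u|lborel. (f u * indicator {u. \<phi> j u = v} u) * gaussc s (x - v))"
      proof (rule Bochner_Integration.integral_sum)
        fix v
        have ind: "complex_of_real (indicator A u) = indicator A u" for A and u :: 'b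
          by (simp add: indicator_def)
        have "{u. \<phi> j u = v} \<in> sets lborel" using \<phi>m[of j] by measurable
        then have "integrable lborel (\<lambda>u. f u * indicator {u. \<phi> j u = v} u)"
          using integrable_mult_indicator[OF _ fi, of "{u. \<phi> j u = v}"]
          by (simp add: scaleR_conv_of_real mult.commute ind)
        then show "integrable lborel (\<lambda>u. f u * indicator {u. \<phi> j u = v} u * gaussc s (x - v))" by simp
      qed
      finally show ?thesis by (simp add: c_def)
    qed
    then have eq: "gj j = (\<lambda>x. \<Sum>v\<in>V. (\<lambda>x. c v * gaussc s (x - v)) x)" by auto
    have "(\<lambda>x. c v * gaussc s (x - v)) \<in> Sigma1" for v by (intro Sigma1_cmult Sigma1_shift gaussc_Sigma1 s)
    moreover have "T (\<lambda>x. c v * gaussc s (x - v)) = 0" for v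
      by (subst cmult) (auto simp: zero intro: Sigma1_shift gaussc_Sigma1 s)
    ultimately show ?thesis
      unfolding eq using Sigma1_linear_sum[where T=T, OF T0 _ V, of "\<lambda>v x. c v * gaussc s (x - v)"] add by simp
  qed
  have "cmod (T g) \<le> K * (LINT u|lborel. B j R u)" for j
  proof -
    have "T (\<lambda>x. (g x - gj j x) + gj j x) = T (\<lambda>x. g x - gj j x) + T (gj j)"
      using gj[of j] entire_bd_Sigma1[OF ed] by (intro add) auto
    then have "T g = T (\<lambda>x. g x - gj j x)" using gj[of j] by simp
    then show ?thesis using bd[OF ed[of j]] by simp
  qed
  moreover have "(\<lambda>j. K * (LINT u|lborel. B j R u)) \<longlonglongrightarrow> K * (LINT (u::'b)|lborel. (0::real))" by (intro tendsto_intros limB)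
  ultimately have "cmod (T g) \<le> 0" by (intro LIMSEQ_le_const[of "\<lambda>j. K * (LINT u|lborel. B j R u)"]) auto
  then show ?thesis by (simp add: g_def[abs_def])
qed

text \<open>\<open>h\<close> is the difference between \<open>c * f\<close> and a multiple of a
  convolution with a Gaussian of width \<open>\<epsilon>\<close>. As \<open>T\<close> annihilates
  the convolution, \<open>c * T f = T h\<close>, and the seminorm of \<open>h\<close> is
  \<open>O(\<epsilon>)\<close>.\<close>

lemma functional_zero_if_gauss:
  fixes f :: "'b::euclidean_space \<Rightarrow> complex" and T :: "('b \<Rightarrow> complex) \<Rightarrow> complex"
  assumes f: "f \<in> Sigma1" and R: "0 \<le> R"
    and add: "\<And>f g. f \<in> Sigma1 \<Longrightarrow> g \<in> Sigma1 \<Longrightarrow> T (\<lambda>x. f x + g x) = T f + T g"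
    and cmult: "\<And>c f. f \<in> Sigma1 \<Longrightarrow> T (\<lambda>x. c * f x) = c * T f"
    and bd: "\<And>f C. entire_bd R C f \<Longrightarrow> cmod (T f) \<le> K * C"
    and zero: "\<And>s u. 0 < s \<Longrightarrow> T (\<lambda>x. gaussc s (x - u)) = 0"
  shows "T f = 0"
proof -
  obtain M where M: "\<And>\<epsilon>. 0 < \<epsilon> \<Longrightarrow> \<epsilon> \<le> 1 \<Longrightarrow>
    entire_bd R (\<epsilon> * M) (\<lambda>x. LINT v|lborel. of_real (exp (- (norm v)\<^sup>2)) * (f x - f (x - \<epsilon> *\<^sub>R v)))"
    using gaussian_average_approx[OF f R] by blast
  define c where "c = complex_of_real (gauss_int TYPE('b))"
  have c: "c \<noteq> 0" using gauss_int_pos[where 'a='b] by (simp add: c_def)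
  have fm: "f \<in> borel_measurable borel" using f by (rule Sigma1_measurable)
  obtain D where D: "entire_bd 0 D f" using Sigma1_ent_bd[OF f] by blast
  have fb: "cmod (f x) \<le> D" for x using entire_bd_real[OF D order_refl, of x] by simp
  have "cmod (c * T f) \<le> K * (1 / Suc n * M)" for n
  proof -
    define \<epsilon> where "\<epsilon> = 1 / real (Suc n)"
    have \<epsilon>: "0 < \<epsilon>" "\<epsilon> \<le> 1" by (auto simp: \<epsilon>_def)
    define h where "h x = (LINT v|lborel. of_real (exp (- (norm v)\<^sup>2)) * (f x - f (x - \<epsilon> *\<^sub>R v)))" for x
    define g where "g x = (LINT u|lborel. f u * gaussc (1 / \<epsilon>) (x - u))" for x
    have i1: "integrable lborel (\<lambda>v::'b. complex_of_real (exp (- (norm v)\<^sup>2)))"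
      using integrable_gauss by (rule integrable_of_real)
    have i2: "integrable lborel (\<lambda>v. of_real (exp (- (norm v)\<^sup>2)) * f (x - \<epsilon> *\<^sub>R v))" for x
    proof (rule integrable_dominated[OF integrable_mult_right[OF integrable_gauss, of D]])
      show "(\<lambda>v. complex_of_real (exp (- (norm v)\<^sup>2)) * f (x - \<epsilon> *\<^sub>R v)) \<in> borel_measurable lborel"
        using fm by (auto intro!: borel_measurable_times measurable_compose[OF _ fm])
      show "norm (complex_of_real (exp (- (norm v)\<^sup>2)) * f (x - \<epsilon> *\<^sub>R v)) \<le> D * exp (- (norm v)\<^sup>2)" for v
        using mult_left_mono[OF fb[of "x - \<epsilon> *\<^sub>R v"], of "exp (- (norm v)\<^sup>2)"] by (simp add: norm_mult mult.commute)
    qed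
    have hx: "h x = c * f x - of_real ((1 / \<epsilon>) ^ DIM('b)) * g x" for x
    proof -
      have "g x = \<bar>- \<epsilon>\<bar> ^ DIM('b) *\<^sub>R (LINT v|lborel. f (x + (- \<epsilon>) *\<^sub>R v) * gaussc (1 / \<epsilon>) (x - (x + (- \<epsilon>) *\<^sub>R v)))"
        unfolding g_def
      proof (rule integral_affine)
        have "continuous_on UNIV (\<lambda>u. f u * gaussc (1 / \<epsilon>) (x - u))"
          unfolding gaussc_def by (intro continuous_intros Sigma1_continuous f)
        then show "(\<lambda>u. f u * gaussc (1 / \<epsilon>) (x - u)) \<in> borel_measurable borel"
          by (rule borel_measurable_continuous_onI)
      qed (use \<epsilon> in simp)
      also have "(\<lambda>v. f (x + (- \<epsilon>) *\<^sub>R v) * gaussc (1 / \<epsilon>) (x - (x + (- \<epsilon>) *\<^sub>R v))) = (\<lambda>v. of_real (exp (- (norm v)\<^sup>2)) * f (x - \<epsilon> *\<^sub>R v))"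
        using \<epsilon> by (simp add: gaussc_def fun_eq_iff)
      finally have gx: "g x = of_real (\<epsilon> ^ DIM('b)) * (LINT v|lborel. of_real (exp (- (norm v)\<^sup>2)) * f (x - \<epsilon> *\<^sub>R v))"
        using \<epsilon> by (simp add: scaleR_conv_of_real)
      have "h x = (LINT v|lborel. of_real (exp (- (norm v)\<^sup>2)) * f x - of_real (exp (- (norm v)\<^sup>2)) * f (x - \<epsilon> *\<^sub>R v))"
        by (simp add: h_def right_diff_distrib)
      also have "\<dots> = (LINT v|lborel. of_real (exp (- (norm (v::'b))\<^sup>2)) * f x) - (LINT v|lborel. of_real (exp (- (norm v)\<^sup>2)) * f (x - \<epsilon> *\<^sub>R v))"
        using i1 i2 by (intro Bochner_Integration.integral_diff) auto
      also have "(LINT v|lborel. complex_of_real (exp (- (norm (v::'b))\<^sup>2)) * f x) = c * f x"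
        by (simp only: integral_mult_left_zero integral_complex_of_real c_def gauss_int_def)
      finally show ?thesis using \<epsilon> by (simp add: gx power_divide)
    qed
    have hb: "entire_bd R (\<epsilon> * M) h" unfolding h_def using M[OF \<epsilon>] .
    have Tg: "T g = 0" unfolding g_def
    proof (rule functional_gauss_convolution_zero[where T=T, OF f _ R])
      show "0 < 1 / \<epsilon>" using \<epsilon> by simp
      then show "T (\<lambda>x. gaussc (1 / \<epsilon>) (x - u)) = 0" for u by (rule zero)
    qed (fact add cmult bd)+
    have hS: "h \<in> Sigma1" using entire_bd_Sigma1[OF hb] .
    have one: "complex_of_real (\<epsilon> ^ DIM('b)) * of_real ((1 / \<epsilon>) ^ DIM('b)) = 1"
      unfolding of_real_mult[symmetric] power_mult_distrib[symmetric] using \<epsilon> by simp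
    have "c * f x - h x = of_real ((1 / \<epsilon>) ^ DIM('b)) * g x" for x by (simp only: hx) simp
    then have "g = (\<lambda>x. of_real (\<epsilon> ^ DIM('b)) * (c * f x - h x))"
      by (simp only: mult.assoc[symmetric] one mult_1)
    then have gS: "g \<in> Sigma1" using Sigma1_cmult[OF Sigma1_diff[OF Sigma1_cmult[OF f] hS]] by simp
    have "(\<lambda>x. c * f x) = (\<lambda>x. h x + of_real ((1 / \<epsilon>) ^ DIM('b)) * g x)" by (simp only: hx) simp
    then have "c * T f = T h + of_real ((1 / \<epsilon>) ^ DIM('b)) * T g"
      using add[OF hS Sigma1_cmult[OF gS]] cmult[OF gS] cmult[OF f, of c] by simp
    then show ?thesis using bd[OF hb] by (simp add: Tg \<epsilon>_def)
  qed
  moreover have "(\<lambda>n. K * (1 / Suc n * M)) \<longlonglongrightarrow> K * (0 * M)"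
    by (intro tendsto_intros LIMSEQ_Suc[OF lim_1_over_n])
  ultimately have "cmod (c * T f) \<le> 0" by (intro LIMSEQ_le_const[of "\<lambda>n. K * (1 / Suc n * M)"]) auto
  then show ?thesis using c by simp
qed


section \<open>The complex inner product and injectivity\<close>

text \<open>The inner product of the type class is the real part of this form. Orthogonality over
  the complex numbers and complex coefficients call for the whole form, which is linear in its first
  argument.\<close>

lift_definition cip :: "'a::euclidean_space L2 \<Rightarrow> 'a L2 \<Rightarrow> complex"
  is "\<lambda>f g. LINT x|lborel. f x * cnj (g x)"
proof -
  fix f f' g g' :: "'a \<Rightarrow> complex"
  assume "L2_rel f f'" "L2_rel g g'"
  then have [measurable]: "f \<in> borel_measurable lborel" "f' \<in> borel_measurable lborel"
      "(\<lambda>x. cnj (g x)) \<in> borel_measurable lborel" "(\<lambda>x. cnj (g' x)) \<in> borel_measurable lborel"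
    and ae: "AE x in lborel. f x = f' x" "AE x in lborel. g x = g' x"
    using square_integrable_cnj by (auto simp: L2_rel_def square_integrable_def)
  show "(LINT x|lborel. f x * cnj (g x)) = (LINT x|lborel. f' x * cnj (g' x))"
  proof (rule integral_cong_AE)
    show "AE x in lborel. f x * cnj (g x) = f' x * cnj (g' x)"
      using ae by (auto elim: eventually_elim2)
  qed measurable
qed

lemma L2_rel_self: "L2_rel f f \<longleftrightarrow> square_integrable f"
  by (simp add: L2_rel_def)

lemma abs_L2_cases: obtains f where "square_integrable f" "u = abs_L2 f"
proof -
  have "\<exists>f. square_integrable f \<and> u = abs_L2 f"
  proof (induct u rule: L2.abs_induct)
    fix y :: "'a \<Rightarrow> complex" assume "L2_rel y y"
    then have "square_integrable y \<and> abs_L2 y = abs_L2 y" by (simp add: L2_rel_self)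
    then show "\<exists>f. square_integrable f \<and> abs_L2 y = abs_L2 f" by (intro exI[of _ y])
  qed
  then show ?thesis using that by (elim exE conjE)
qed

lemma abs_L2_add: "square_integrable f \<Longrightarrow> square_integrable g \<Longrightarrow> abs_L2 (\<lambda>x. f x + g x) = abs_L2 f + abs_L2 g"
  by (rule plus_L2.abs_eq[symmetric]) (simp_all add: L2_rel_self)

lemma abs_L2_cmult: "square_integrable f \<Longrightarrow> abs_L2 (\<lambda>x. c * f x) = cscale c (abs_L2 f)"
  by (rule cscale.abs_eq[symmetric]) (simp add: L2_rel_self)

lemma abs_L2_diff:
  assumes "square_integrable f" "square_integrable g"
  shows "abs_L2 (\<lambda>x. f x - g x) = abs_L2 f - abs_L2 g"
proof -
  have "abs_L2 (\<lambda>x. f x + (- 1) * g x) = abs_L2 f + cscale (- 1) (abs_L2 g)"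
    unfolding abs_L2_add[OF assms(1) square_integrable_cmult[OF assms(2)]] abs_L2_cmult[OF assms(2)] ..
  then show ?thesis by (simp only: minus_L2_def uminus_L2_def mult_minus1 diff_conv_add_uminus[symmetric])
qed

lemma cip_abs_L2: "square_integrable f \<Longrightarrow> square_integrable g \<Longrightarrow> cip (abs_L2 f) (abs_L2 g) = (LINT x|lborel. f x * cnj (g x))"
  by (rule cip.abs_eq) (simp_all add: L2_rel_self)

lemma Re_cip: "Re (cip f g) = inner f g"
  by transfer simp

lemma cip_add_left: "cip (f + g) h = cip f h + cip g h"
proof transfer
  fix f g h :: "'a \<Rightarrow> complex"
  assume "L2_rel f f" "L2_rel g g" "L2_rel h h"
  then have i: "integrable lborel (\<lambda>x. f x * cnj (h x))" "integrable lborel (\<lambda>x. g x * cnj (h x))"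
    by (auto simp: L2_rel_def intro!: square_integrable_mult square_integrable_cnj)
  show "(LINT x|lborel. (f x + g x) * cnj (h x)) = (LINT x|lborel. f x * cnj (h x)) + (LINT x|lborel. g x * cnj (h x))"
    using i by (simp add: distrib_right)
qed

lemma cip_cscale_left: "cip (cscale c f) g = c * cip f g"
  by transfer (simp add: mult.assoc)

lemma cip_cnj: "cip g f = cnj (cip f g)"
proof transfer
  fix f g :: "'a \<Rightarrow> complex"
  assume "L2_rel f f" "L2_rel g g"
  have "cnj (LINT x|lborel. f x * cnj (g x)) = (LINT x|lborel. cnj (f x * cnj (g x)))"
    by (rule integral_bounded_linear'[OF bounded_linear_cnj bounded_linear_cnj, symmetric]) simp
  then show "(LINT x|lborel. g x * cnj (f x)) = cnj (LINT x|lborel. f x * cnj (g x))"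
    by (simp add: mult.commute)
qed

lemma cip_cscale_right: "cip f (cscale c g) = cnj c * cip f g"
  unfolding cip_cnj[of f] cip_cscale_left by simp

lemma cip_self: "cip f f = of_real ((norm f)\<^sup>2)"
proof -
  have "Re (cip f f) = (norm f)\<^sup>2" by (simp add: Re_cip power2_norm_eq_inner)
  moreover have "Im (cip f f) = 0" using arg_cong[OF cip_cnj[of f f], of Im] by simp
  ultimately show ?thesis by (simp add: complex_eq_iff)
qed

lemma norm_cscale: "norm (cscale c f) = cmod c * norm f"
proof -
  have "cip (cscale c f) (cscale c f) = c * cnj c * cip f f"
    by (simp add: cip_cscale_left cip_cscale_right)
  then have "complex_of_real ((norm (cscale c f))\<^sup>2) = of_real ((cmod c)\<^sup>2 * (norm f)\<^sup>2)"
    by (simp add: cip_self complex_norm_square[symmetric])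
  then have "(norm (cscale c f))\<^sup>2 = (cmod c * norm f)\<^sup>2" by (simp only: of_real_eq_iff power_mult_distrib)
  then show ?thesis by (rule power2_eq_imp_eq) auto
qed

lemma cip_add_right: "cip f (g + h) = cip f g + cip f h"
  unfolding cip_cnj[of f] cip_add_left by simp

lemma cscale_minus_one: "cscale (- 1) f = - f"
  by (simp only: uminus_L2_def)

lemma cip_diff_left: "cip (f - g) h = cip f h - cip g h"
  by (simp only: minus_L2_def uminus_L2_def cip_add_left cip_cscale_left mult_minus1 diff_conv_add_uminus[symmetric])

lemma cip_diff_right: "cip f (g - h) = cip f g - cip f h"
  unfolding cip_cnj[of f] cip_diff_left by simp

text \<open>Rotating \<open>f\<close> by a phase makes the product real and nonnegative, and then
  the inequality for the real inner product applies.\<close>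

lemma cip_cauchy_schwarz: "cmod (cip f g) \<le> norm f * norm g"
proof (cases "cip f g = 0")
  case False
  define c where "c = cnj (cip f g) / cmod (cip f g)"
  have c: "cmod c = 1" using False by (simp add: c_def norm_divide)
  have "c * cip f g = (cip f g * cnj (cip f g)) / cmod (cip f g)" by (simp add: c_def)
  also have "\<dots> = of_real (cmod (cip f g))"
    unfolding complex_norm_square[symmetric] using False by (simp add: power2_eq_square)
  finally have "c * cip f g = of_real (cmod (cip f g))" .
  then have "cmod (cip f g) = inner (cscale c f) g"
    by (simp add: Re_cip[symmetric] cip_cscale_left)
  also have "\<dots> \<le> norm (cscale c f) * norm g" by (rule norm_cauchy_schwarz)
  finally show ?thesis by (simp add: norm_cscale c)
qed simp

lemma norm_abs_L2: "square_integrable f \<Longrightarrow> (norm (abs_L2 f))\<^sup>2 = (LINT x|lborel. (cmod (f x))\<^sup>2)"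
proof -
  assume f: "square_integrable f"
  have "of_real ((norm (abs_L2 f))\<^sup>2) = (LINT x|lborel. f x * cnj (f x))"
    using cip_self[of "abs_L2 f"] by (simp add: cip_abs_L2 f)
  also have "\<dots> = of_real (LINT x|lborel. (cmod (f x))\<^sup>2)"
    by (simp only: complex_norm_square[symmetric] integral_complex_of_real)
  finally show ?thesis by (simp only: of_real_eq_iff)
qed

section \<open>Test functions as elements of L2\<close>

definition exp_l2 :: "'a::euclidean_space itself \<Rightarrow> real" where
  "exp_l2 _ = sqrt (LINT x|lborel. exp (- (2 * norm (x::'a))))"

lemma exp_decay_L2:
  fixes f :: "'a::euclidean_space \<Rightarrow> complex"
  assumes "f \<in> borel_measurable borel" "\<And>x. cmod (f x) \<le> C * exp (- norm x)"
  shows "square_integrable f" "norm (abs_L2 f) \<le> C * exp_l2 TYPE('a)"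
proof -
  have C: "0 \<le> C" using order_trans[OF norm_ge_zero assms(2)[of 0]] by simp
  have i: "integrable lborel (\<lambda>x::'a. C\<^sup>2 * exp (- (2 * norm x)))" by (intro integrable_mult_right integrable_exp_norm) auto
  have b: "(cmod (f x))\<^sup>2 \<le> C\<^sup>2 * exp (- (2 * norm x))" for x
  proof -
    have "(cmod (f x))\<^sup>2 \<le> (C * exp (- norm x))\<^sup>2" using assms(2) by (intro power_mono) auto
    then show ?thesis by (simp add: power_mult_distrib power2_eq_square[of "exp (- norm x)"] flip: exp_add)
  qed
  have m: "(\<lambda>x. (cmod (f x))\<^sup>2) \<in> borel_measurable lborel" using assms(1) by measurable
  have ii: "integrable lborel (\<lambda>x. (cmod (f x))\<^sup>2)"
    by (rule integrable_dominated[OF i m]) (use b in auto)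
  then show sq: "square_integrable f" using assms(1) by (simp add: square_integrable_def)
  have "(norm (abs_L2 f))\<^sup>2 \<le> (LINT x|lborel. C\<^sup>2 * exp (- (2 * norm (x::'a))))"
    unfolding norm_abs_L2[OF sq] using ii i b by (intro integral_mono) auto
  also have "\<dots> = (C * exp_l2 TYPE('a))\<^sup>2"
    by (simp add: exp_l2_def power_mult_distrib Bochner_Integration.integral_nonneg)
  finally show "norm (abs_L2 f) \<le> C * exp_l2 TYPE('a)"
    by (rule power2_le_imp_le) (simp add: C exp_l2_def Bochner_Integration.integral_nonneg)
qed

lemma exp_l2_nonneg: "0 \<le> exp_l2 TYPE('a::euclidean_space)"
  by (simp add: exp_l2_def Bochner_Integration.integral_nonneg)

lemma Sigma1_square_integrable:
  assumes "f \<in> Sigma1" shows "square_integrable f"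
proof -
  obtain C where C: "entire_bd 1 C f" using Sigma1_ent_bd[OF assms] by blast
  show ?thesis using entire_bd_real[OF C] by (intro exp_decay_L2(1)[of f C] Sigma1_measurable assms) auto
qed

lemma Sigma1_slice_bound:
  fixes \<Phi> :: "'m::euclidean_space \<times> 'd::euclidean_space \<Rightarrow> complex"
  assumes "entire_bd 2 C \<Phi>" shows "cmod (\<Phi> (z, t)) \<le> C * exp (- norm z) * exp (- norm t)"
proof -
  have "cmod (\<Phi> (z, t)) \<le> C * exp (- (2 * norm (z, t)))" by (rule entire_bd_real[OF assms]) simp
  also have "\<dots> \<le> C * exp (- norm z + - norm t)"
    using entire_bd_nonneg[OF assms] norm_fst_le[of z t] norm_snd_le[of t z] by (intro mult_left_mono) auto
  finally show ?thesis by (simp only: exp_add mult.assoc)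
qed

lemma Sigma1_slice_continuous:
  assumes "\<Phi> \<in> Sigma1"
  shows "continuous_on UNIV (\<lambda>t. \<Phi> (z, t))" "continuous_on UNIV (\<lambda>z. \<Phi> (z, t))"
  by (rule continuous_on_compose2[OF Sigma1_continuous[OF assms]]; auto intro!: continuous_intros)+

lemma FT2_integrable:
  fixes \<Phi> :: "'m::euclidean_space \<times> 'd::euclidean_space \<Rightarrow> complex"
  assumes "\<Phi> \<in> Sigma1"
  shows "integrable lborel (\<lambda>t. \<Phi> (z, t) * exp (\<i> * of_real (\<sigma> * (t \<bullet> \<xi>))))"
proof -
  obtain C where C: "entire_bd 2 C \<Phi>" using Sigma1_ent_bd[OF assms] by blast
  have "continuous_on UNIV (\<lambda>t. \<Phi> (z, t) * exp (\<i> * of_real (\<sigma> * (t \<bullet> \<xi>))))"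
    by (intro continuous_intros Sigma1_slice_continuous assms)
  then have m: "(\<lambda>t. \<Phi> (z, t) * exp (\<i> * of_real (\<sigma> * (t \<bullet> \<xi>)))) \<in> borel_measurable lborel"
    by (simp add: borel_measurable_continuous_onI)
  show ?thesis
    by (rule integrable_exp_bound[OF m, of "C * exp (- norm z)" 1])
      (use Sigma1_slice_bound[OF C, of z] in \<open>auto simp: norm_mult\<close>)
qed

lemma FT2_add:
  "\<Phi> \<in> Sigma1 \<Longrightarrow> \<Psi> \<in> Sigma1 \<Longrightarrow> FT2 \<sigma> (\<lambda>p. \<Phi> p + \<Psi> p) = (\<lambda>p. FT2 \<sigma> \<Phi> p + FT2 \<sigma> \<Psi> p)"
  unfolding FT2_def distrib_right using FT2_integrable by (subst Bochner_Integration.integral_add) auto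

lemma FT2_cmult: "FT2 \<sigma> (\<lambda>p. c * \<Phi> p) = (\<lambda>p. c * FT2 \<sigma> \<Phi> p)"
  unfolding FT2_def mult.assoc by simp

section \<open>Tensor products and the cross Wigner transformation\<close>

definition tens :: "('a \<Rightarrow> complex) \<Rightarrow> ('b \<Rightarrow> complex) \<Rightarrow> 'a \<times> 'b \<Rightarrow> complex" where
  "tens f g p = f (fst p) * g (snd p)"

lemma tens_Sigma1:
  fixes f :: "'a::euclidean_space \<Rightarrow> complex" and g :: "'b::euclidean_space \<Rightarrow> complex"
  assumes "f \<in> Sigma1" "g \<in> Sigma1" shows "tens f g \<in> Sigma1"
proof -
  obtain C D where "entire_bd 0 C f" "entire_bd 0 D g" using Sigma1_ent_bd assms by metis
  from entire_bd_Sigma1[OF entire_bd_tensor[OF this order_refl]] show ?thesis by (simp add: tens_def[abs_def])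
qed

text \<open>The substitution \<open>y = z + At - t\<close>, \<open>x = z + At\<close> under the integral of \<^const>\<open>cross_wigner\<close>.\<close>

definition Lmap :: "real^'d^'d \<Rightarrow> (real^'d) \<times> (real^'d) \<Rightarrow> (real^'d) \<times> (real^'d)" where
  "Lmap A p = (fst p + A *v snd p - snd p, fst p + A *v snd p)"

definition Linv :: "real^'d^'d \<Rightarrow> (real^'d) \<times> (real^'d) \<Rightarrow> (real^'d) \<times> (real^'d)" where
  "Linv A q = (snd q - A *v (snd q - fst q), snd q - fst q)"

lemma Linv_Lmap: "Linv A (Lmap A p) = p" and Lmap_Linv: "Lmap A (Linv A q) = q"
  by (auto simp: Linv_def Lmap_def prod_eq_iff)

lemma linear_Lmap: "linear (Lmap A)" and linear_Linv: "linear (Linv A)"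
  by (auto simp: linear_iff Lmap_def Linv_def matrix_vector_right_distrib matrix_vector_mult_diff_distrib
      matrix_vector_mult_scaleR algebra_simps)

lemma linear_iso_bound:
  fixes L :: "'a::euclidean_space \<Rightarrow> 'b::euclidean_space"
  assumes "linear L" "linear M" "\<And>x. M (L x) = x"
  shows "\<exists>\<kappa>\<ge>1. \<forall>x. norm x \<le> \<kappa> * norm (L x) \<and> norm (L x) \<le> \<kappa> * norm x"
proof -
  obtain B1 where B1: "0 < B1" "\<And>x. norm (L x) \<le> B1 * norm x" using linear_bounded_pos[OF assms(1)] by blast
  obtain B2 where B2: "0 < B2" "\<And>x. norm (M x) \<le> B2 * norm x" using linear_bounded_pos[OF assms(2)] by blast
  define \<kappa> where "\<kappa> = 1 + B1 + B2"
  have "norm x \<le> \<kappa> * norm (L x)" "norm (L x) \<le> \<kappa> * norm x" for x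
  proof -
    have "norm x \<le> B2 * norm (L x)" using B2(2)[of "L x"] assms(3) by simp
    also have "\<dots> \<le> \<kappa> * norm (L x)" using B1 by (intro mult_right_mono) (auto simp: \<kappa>_def)
    finally show "norm x \<le> \<kappa> * norm (L x)" .
    show "norm (L x) \<le> \<kappa> * norm x" using B1 B2
      by (intro order_trans[OF B1(2)] mult_right_mono) (auto simp: \<kappa>_def)
  qed
  then show ?thesis using B1 B2 by (intro exI[of _ \<kappa>]) (auto simp: \<kappa>_def)
qed

lemma entire_bd_iso:
  fixes L :: "'a::euclidean_space \<Rightarrow> 'b::euclidean_space"
  assumes "linear L" "linear M" "\<And>x. M (L x) = x" "0 \<le> R"
  shows "\<exists>R'\<ge>0. \<forall>f C. entire_bd R' C f \<longrightarrow> entire_bd R C (\<lambda>x. f (L x))"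
proof -
  obtain \<kappa> where \<kappa>: "1 \<le> \<kappa>" "\<And>x. norm x \<le> \<kappa> * norm (L x)" "\<And>x. norm (L x) \<le> \<kappa> * norm x"
    using linear_iso_bound[OF assms(1-3)] by blast
  have "entire_bd R C (\<lambda>x. f (L x))" if "entire_bd (\<kappa> * R) C f" for C f
    using entire_bd_linear[OF that assms(1) \<kappa>(1) assms(4)] \<kappa>(2,3) by blast
  then show ?thesis using \<kappa>(1) assms(4) by (intro exI[of _ "\<kappa> * R"]) auto
qed

lemma Sigma1_iso:
  fixes L :: "'a::euclidean_space \<Rightarrow> 'b::euclidean_space"
  assumes "linear L" "linear M" "\<And>x. M (L x) = x" "f \<in> Sigma1"
  shows "(\<lambda>x. f (L x)) \<in> Sigma1"
proof -
  obtain R' where "\<forall>f C. entire_bd R' C f \<longrightarrow> entire_bd 0 C (\<lambda>x. f (L x))" using entire_bd_iso[OF assms(1-3) order_refl] by blast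
  moreover obtain C where "entire_bd R' C f" using Sigma1_ent_bd[OF assms(4)] by blast
  ultimately show ?thesis using entire_bd_Sigma1 by blast
qed

lemma cross_wigner_eq: "cross_wigner A f \<phi> = FT2 1 (\<lambda>p. tens f \<phi> (Lmap A p))"
  by (auto simp: cross_wigner_def FT2_def tens_def Lmap_def)

lemma cross_wigner_Sigma1: "f \<in> Sigma1 \<Longrightarrow> \<phi> \<in> Sigma1 \<Longrightarrow> cross_wigner A f \<phi> \<in> Sigma1"
  unfolding cross_wigner_eq by (intro FT2_Sigma1 Sigma1_iso[OF linear_Lmap linear_Linv Linv_Lmap] tens_Sigma1) auto

lemma gaussc_tens: "gaussc s (p - u) = tens (\<lambda>x. gaussc s (x - fst u)) (\<lambda>x. gaussc s (x - snd u)) p"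
  by (auto simp: gaussc_def tens_def norm_prod_def power_mult_distrib distrib_left exp_add[symmetric] simp flip: of_real_mult)

text \<open>The functional is pulled back along the substitution and the partial Fourier
  transformation. The pullback vanishes on tensor products, in particular on translated Gaussians,
  hence on all of \<open>Sigma1\<close>; and since both transformations are invertible, every test
  function is reached up to a nonzero factor.\<close>

lemma cross_wigner_dense:
  assumes add: "\<And>f g. f \<in> Sigma1 \<Longrightarrow> g \<in> Sigma1 \<Longrightarrow> a (\<lambda>x. f x + g x) = a f + a g"
    and cmult: "\<And>c f. f \<in> Sigma1 \<Longrightarrow> a (\<lambda>x. c * f x) = c * a f"
    and bd: "\<And>f C. entire_bd R C f \<Longrightarrow> cmod (a f) \<le> K * C" and R: "0 \<le> R"
    and zero: "\<And>f \<phi>. f \<in> Sigma1 \<Longrightarrow> \<phi> \<in> Sigma1 \<Longrightarrow> a (cross_wigner A f \<phi>) = 0"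
    and \<Phi>: "\<Phi> \<in> Sigma1"
  shows "a \<Phi> = 0"
proof -
  define T where "T \<Psi> = a (FT2 1 (\<lambda>p. \<Psi> (Lmap A p)))" for \<Psi>
  have iso: "(\<lambda>p. \<Psi> (Lmap A p)) \<in> Sigma1" if "\<Psi> \<in> Sigma1" for \<Psi>
    using that by (rule Sigma1_iso[OF linear_Lmap linear_Linv Linv_Lmap])
  obtain R' where R': "0 \<le> R'" "\<And>f C. entire_bd R' C f \<Longrightarrow> entire_bd (2 * R + 2) C (\<lambda>x. f (Lmap A x))"
    using entire_bd_iso[OF linear_Lmap linear_Linv Linv_Lmap, of "2 * R + 2" A] R by auto
  have T0: "T \<Psi> = 0" if "\<Psi> \<in> Sigma1" for \<Psi>
  proof (rule functional_zero_if_gauss[OF that R'(1), where K="K * exp_int TYPE(real^'a)"])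
    show "T (\<lambda>x. f x + g x) = T f + T g" if "f \<in> Sigma1" "g \<in> Sigma1" for f g
      using that by (simp add: T_def FT2_add iso add FT2_Sigma1)
    show "T (\<lambda>x. c * f x) = c * T f" if "f \<in> Sigma1" for c f
      using that by (simp add: T_def FT2_cmult iso cmult FT2_Sigma1)
    show "cmod (T f) \<le> K * exp_int TYPE(real^'a) * C" if "entire_bd R' C f" for f C
      using bd[OF entire_bd_FT2[OF R'(2)[OF that] R, of 1]] by (simp add: T_def mult_ac)
    show "T (\<lambda>x. gaussc s (x - u)) = 0" if "0 < s" for s u
      using zero[OF Sigma1_shift[OF gaussc_Sigma1[OF that], of "fst u"] Sigma1_shift[OF gaussc_Sigma1[OF that], of "snd u"]]
      by (simp add: T_def gaussc_tens cross_wigner_eq)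
  qed
  define \<Psi> where "\<Psi> q = FT2 (- 1) \<Phi> (Linv A q)" for q
  have "\<Psi> \<in> Sigma1" unfolding \<Psi>_def
    using \<Phi> by (intro Sigma1_iso[OF linear_Linv linear_Lmap Lmap_Linv] FT2_Sigma1) auto
  then have "0 = T \<Psi>" by (simp add: T0)
  also have "\<dots> = a (FT2 1 (FT2 (- 1) \<Phi>))" by (simp add: T_def \<Psi>_def Linv_Lmap)
  also have "\<dots> = of_real (inv_const TYPE(real^'a)) * a \<Phi>"
    using FT2_inversion[OF \<Phi>, of "- 1"] \<Phi> by (simp add: cmult)
  finally show ?thesis using inv_const_pos[where 'a="real^'a"] by simp
qed

lemma inj_on_Op: "inj_on (Op A) Sigma1_dual"
proof (rule inj_onI)
  fix a b assume a: "a \<in> Sigma1_dual" and b: "b \<in> Sigma1_dual" and eq: "Op A a = Op A b"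
  obtain R1 K1 where 1: "0 \<le> R1" "0 \<le> K1" "\<And>f C. entire_bd R1 C f \<Longrightarrow> cmod (a f) \<le> K1 * C" using Sigma1_dual_bound[OF a] by blast
  obtain R2 K2 where 2: "0 \<le> R2" "0 \<le> K2" "\<And>f C. entire_bd R2 C f \<Longrightarrow> cmod (b f) \<le> K2 * C" using Sigma1_dual_bound[OF b] by blast
  have "a \<Phi> - b \<Phi> = 0" if "\<Phi> \<in> Sigma1" for \<Phi>
  proof (rule cross_wigner_dense[where a="\<lambda>\<Phi>. a \<Phi> - b \<Phi>" and A=A and R="max R1 R2" and K="K1 + K2"])
    show "cmod (a f - b f) \<le> (K1 + K2) * C" if "entire_bd (max R1 R2) C f" for f C
    proof -
      have "entire_bd R1 C f" "entire_bd R2 C f" using that 1 2 by (auto elim: entire_bd_antimono)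
      then show ?thesis using 1(3) 2(3) norm_triangle_ineq4[of "a f" "b f"] by (force simp: distrib_right)
    qed
    show "a (cross_wigner A f \<phi>) - b (cross_wigner A f \<phi>) = 0" if "f \<in> Sigma1" "\<phi> \<in> Sigma1" for f \<phi>
      using fun_cong[OF fun_cong[OF eq, of f], of \<phi>] that by (simp add: Op_def)
  qed (use a b that 1 in \<open>auto simp: Sigma1_dual_def algebra_simps\<close>)
  then show "a = b" using a b by (intro extensionalityI[of a Sigma1 b]) (auto simp: Sigma1_dual_def)
qed


section \<open>Symbols of bounded operators\<close>

lemma clinear_L2_iff: "clinear_L2 T \<longleftrightarrow> (\<forall>f g. T (f + g) = T f + T g) \<and> (\<forall>c f. T (cscale c f) = cscale c (T f))"
  by (simp add: Vector_Spaces.linear_iff L2.vector_space_axioms)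

lemma clinear_L2_add: "clinear_L2 T \<Longrightarrow> T (f + g) = T f + T g"
  and clinear_L2_cscale: "clinear_L2 T \<Longrightarrow> T (cscale c f) = cscale c (T f)"
  by (simp_all add: clinear_L2_iff)

lemma clinear_L2_linear: "clinear_L2 T \<Longrightarrow> linear T"
  by (rule linearI) (simp_all add: clinear_L2_iff scaleR_L2_def)

lemma clinear_L2_bounded_linear:
  assumes "clinear_L2 T" "\<And>f. norm (T f) \<le> K * norm f" shows "bounded_linear T"
proof (rule bounded_linear_intro[where K=K])
  show "norm (T f) \<le> norm f * K" for f using assms(2)[of f] by (simp add: mult.commute)
qed (simp_all only: linear_add[OF clinear_L2_linear[OF assms(1)]] linear_scale[OF clinear_L2_linear[OF assms(1)]])

lemma bounded_bilinear_cip: "bounded_bilinear (cip :: 'a::euclidean_space L2 \<Rightarrow> 'a L2 \<Rightarrow> complex)"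
proof (rule bounded_bilinear.intro)
  show "\<exists>K. \<forall>a b. norm (cip a b) \<le> norm (a :: 'a L2) * norm b * K"
    by (intro exI[of _ 1]) (simp add: cip_cauchy_schwarz)
qed (simp_all add: cip_add_left cip_add_right scaleR_L2_def cip_cscale_left cip_cscale_right scaleR_conv_of_real)

text \<open>The sum of \<open>cosh (2 * DIM('a) * (x \<bullet> b))\<close> over the basis. Being
  entire of exponential growth, it multiplies \<open>Sigma1\<close> into itself; and because some
  coordinate is at least \<open>norm x / DIM('a)\<close> in absolute value, it is at least
  \<open>exp (2 * norm x) / 2\<close>.\<close>

definition wt :: "'a::euclidean_space \<Rightarrow> real" where
  "wt x = (\<Sum>b\<in>Basis. (exp (2 * DIM('a) * (x \<bullet> b)) + exp (- (2 * DIM('a) * (x \<bullet> b)))) / 2)"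

definition wext :: "'a::euclidean_space \<Rightarrow> 'a \<Rightarrow> complex" where
  "wext x y = (\<Sum>b\<in>Basis. (exp (of_real (2 * DIM('a)) * Complex (x \<bullet> b) (y \<bullet> b))
     + exp (- (of_real (2 * DIM('a)) * Complex (x \<bullet> b) (y \<bullet> b)))) / 2)"

lemma wext_real: "wext x 0 = of_real (wt x)"
proof -
  have "Complex a 0 = of_real a" for a by (simp add: complex_eq_iff)
  then show ?thesis by (simp add: wext_def wt_def exp_of_real[symmetric])
qed

lemma hol_wext: "line_holomorphic wext"
proof (rule line_holomorphicI)
  fix x y v :: 'a
  have "Complex ((x + Re z *\<^sub>R v) \<bullet> b) ((y + Im z *\<^sub>R v) \<bullet> b) = Complex (x \<bullet> b) (y \<bullet> b) + z * of_real (v \<bullet> b)" for z b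
    by (simp add: complex_eq_iff inner_add_left)
  then show "(\<lambda>z. wext (x + Re z *\<^sub>R v) (y + Im z *\<^sub>R v)) holomorphic_on UNIV"
    unfolding wext_def by (auto intro!: holomorphic_intros)
qed

lemma norm_wext_le:
  fixes x y :: "'a::euclidean_space"
  shows "cmod (wext x y) \<le> DIM('a) * exp (2 * DIM('a) * norm x)"
proof -
  have "cmod (wext x y) \<le> (\<Sum>b\<in>(Basis::'a set). exp (2 * DIM('a) * norm x))"
    unfolding wext_def
  proof (rule sum_norm_le)
    fix b :: 'a assume b: "b \<in> Basis"
    define c where "c = of_real (2 * DIM('a)) * Complex (x \<bullet> b) (y \<bullet> b)"
    have c: "\<bar>Re c\<bar> \<le> 2 * DIM('a) * norm x" using Basis_le_norm[OF b, of x] by (simp add: c_def abs_mult)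
    have "cmod (exp c + exp (- c)) \<le> exp (Re c) + exp (- Re c)"
      by (rule norm_triangle_le) simp
    also have "\<dots> \<le> exp (2 * DIM('a) * norm x) + exp (2 * DIM('a) * norm x)"
      using c by (intro add_mono) auto
    finally show "cmod ((exp c + exp (- c)) / 2) \<le> exp (2 * DIM('a) * norm x)" by (simp add: norm_divide)
  qed
  then show ?thesis by simp
qed

lemma wt_ge: "exp (2 * norm x) / 2 \<le> wt (x :: 'a::euclidean_space)"
proof -
  have "Max ((\<lambda>b. \<bar>x \<bullet> b\<bar>) ` Basis) \<in> (\<lambda>b. \<bar>x \<bullet> b\<bar>) ` Basis" by (intro Max_in) auto
  then obtain b0 where b0': "b0 \<in> Basis" "Max ((\<lambda>b. \<bar>x \<bullet> b\<bar>) ` Basis) = \<bar>x \<bullet> b0\<bar>" by (elim imageE)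
  have b0: "\<And>b. b \<in> Basis \<Longrightarrow> \<bar>x \<bullet> b\<bar> \<le> \<bar>x \<bullet> b0\<bar>" using b0' by (auto simp flip: b0'(2))
  have "norm x \<le> (\<Sum>b\<in>Basis. \<bar>x \<bullet> b\<bar>)" by (rule norm_le_l1)
  also have "\<dots> \<le> (\<Sum>b\<in>(Basis::'a set). \<bar>x \<bullet> b0\<bar>)" using b0 by (intro sum_mono) auto
  finally have xt: "norm x \<le> DIM('a) * \<bar>x \<bullet> b0\<bar>" by simp
  have "exp (2 * norm x) \<le> exp (2 * DIM('a) * \<bar>x \<bullet> b0\<bar>)" using xt by simp
  also have "\<dots> \<le> exp (2 * DIM('a) * (x \<bullet> b0)) + exp (- (2 * DIM('a) * (x \<bullet> b0)))"
    by (cases "0 \<le> x \<bullet> b0") (auto simp: abs_if)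
  finally have "exp (2 * norm x) / 2 \<le> (exp (2 * DIM('a) * (x \<bullet> b0)) + exp (- (2 * DIM('a) * (x \<bullet> b0)))) / 2" by simp
  also have "\<dots> \<le> wt x"
    unfolding wt_def using b0'(1) by (intro member_le_sum) (auto intro: add_nonneg_nonneg)
  finally show ?thesis .
qed

lemma wt_pos: "0 < wt x"
  by (rule less_le_trans[OF _ wt_ge]) simp

lemma wt_nonzero: "wt x \<noteq> 0"
  using wt_pos[of x] by simp

lemma continuous_wt: "continuous_on S wt"
  unfolding wt_def[abs_def] by (intro continuous_intros) auto

lemma inverse_wt_le: "1 / wt x \<le> 2 * exp (- (2 * norm x))"
proof -
  have "1 / wt x \<le> 1 / (exp (2 * norm x) / 2)" using wt_ge[of x] by (intro divide_left_mono) (auto simp: wt_pos)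
  then show ?thesis by (simp add: exp_minus field_simps)
qed

lemma tube_mult_growth:
  assumes "tube (R + a) C F" "\<And>x y. cmod (M x y) \<le> D * exp (a * norm x)" "0 \<le> a" "0 \<le> R" "0 \<le> D"
  shows "tube R (D * C) (\<lambda>x y. M x y * F x y)"
  unfolding tube_def
proof (intro allI impI)
  fix x y :: 'a assume "norm y \<le> R"
  then have "cmod (F x y) \<le> C * exp (- ((R + a) * norm x))" using assms(1,3) by (simp add: tube_def)
  then have "cmod (M x y * F x y) \<le> (D * exp (a * norm x)) * (C * exp (- ((R + a) * norm x)))"
    unfolding norm_mult using assms(2,5) by (intro mult_mono) auto
  also have "\<dots> = (D * C) * (exp (a * norm x) * exp (- ((R + a) * norm x)))" by (simp only: mult_ac)
  also have "exp (a * norm x) * exp (- ((R + a) * norm x)) = exp (- (R * norm x))" by (simp add: algebra_simps flip: exp_add)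
  finally show "cmod (M x y * F x y) \<le> D * C * exp (- (R * norm x))" .
qed

lemma entire_bd_wt:
  fixes \<Psi> :: "'m::euclidean_space \<times> 'd::euclidean_space \<Rightarrow> complex" and R C :: real
  assumes "entire_bd (R + 2 * DIM('d)) C \<Psi>" "0 \<le> R"
  shows "entire_bd R (DIM('d) * C) (\<lambda>p. of_real (wt (snd p)) * \<Psi> p)"
proof -
  obtain F where F: "entire F" "tube (R + 2 * DIM('d)) C F" "\<Psi> = (\<lambda>x. F x 0)" using assms(1) by (rule entire_bdE)
  have M: "cmod (wext (snd p) (snd q)) \<le> DIM('d) * exp (2 * DIM('d) * norm p)" for p q :: "'m \<times> 'd"
    using norm_wext_le[of "snd p" "snd q"] norm_snd_le[of "snd p" "fst p"]
    by (auto elim!: order_trans)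
  have t: "tube R (DIM('d) * C) (\<lambda>p q. wext (snd p) (snd q) * F p q)" if "tube (R + 2 * DIM('d)) C F" "0 \<le> R" for R C :: real
    by (rule tube_mult_growth[OF _ M]) (use that in auto)
  have "line_holomorphic (\<lambda>p q. wext (snd p) (snd q) * F p q)"
    using F(1) by (intro hol_mult[OF hol_compose_linear[OF hol_wext, of snd]]) (auto simp: entire_def linear_iff)
  moreover have "\<exists>C. tube R C (\<lambda>p q. wext (snd p) (snd q) * F p q)" for R :: real
  proof -
    obtain C where C: "tube (\<bar>R\<bar> + 2 * DIM('d)) C F" using F(1) by (auto simp: entire_def)
    from tube_antimono[OF t[OF C abs_ge_zero] abs_ge_self abs_ge_zero] show ?thesis by blast
  qed
  ultimately have "entire (\<lambda>p q. wext (snd p) (snd q) * F p q)" by (simp add: entire_def)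
  then show ?thesis using t[OF F(2) assms(2)] by (rule entire_bdI) (simp add: wext_real F(3))
qed

lemma wt_Sigma1:
  fixes \<Psi> :: "'m::euclidean_space \<times> 'd::euclidean_space \<Rightarrow> complex"
  assumes "\<Psi> \<in> Sigma1" shows "(\<lambda>p. of_real (wt (snd p)) * \<Psi> p) \<in> Sigma1"
proof -
  obtain C where "entire_bd (0 + real (2 * DIM('d))) C \<Psi>" using Sigma1_ent_bd[OF assms] by blast
  from entire_bd_Sigma1[OF entire_bd_wt[OF this order_refl]] show ?thesis .
qed

definition ew :: "'a::euclidean_space \<Rightarrow> 'a \<Rightarrow> complex" where
  "ew \<xi> x = of_real (1 / wt x) * exp (\<i> * of_real (x \<bullet> \<xi>))"

lemma ew_continuous: "continuous_on UNIV (ew \<xi>)"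
  unfolding ew_def[abs_def] by (intro continuous_intros continuous_wt) (simp add: wt_nonzero)

lemma ew_measurable: "ew \<xi> \<in> borel_measurable borel"
  by (intro borel_measurable_continuous_onI ew_continuous)

lemma ew_bound: "cmod (ew \<xi> x) \<le> 2 * exp (- norm x)"
proof -
  have "cmod (ew \<xi> x) = 1 / wt x" using wt_pos[of x] by (simp add: ew_def norm_mult norm_divide)
  also have "\<dots> \<le> 2 * exp (- (2 * norm x))" by (rule inverse_wt_le)
  finally show ?thesis by (rule order_trans) simp
qed

lemma norm_exp_i_diff_le: "cmod (exp (\<i> * of_real a) - exp (\<i> * of_real b)) \<le> \<bar>a - b\<bar>"
proof -
  have "exp (\<i> * of_real a) - exp (\<i> * of_real b) = exp (\<i> * of_real b) * (exp (\<i> * of_real (a - b)) - 1)"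
    by (simp add: algebra_simps flip: exp_add)
  then have "cmod (exp (\<i> * of_real a) - exp (\<i> * of_real b)) = 2 * \<bar>sin ((a - b) / 2)\<bar>"
    by (simp only: norm_mult dist_exp_i_1) simp
  also have "\<dots> \<le> 2 * \<bar>(a - b) / 2\<bar>" by (intro mult_left_mono abs_sin_x_le_abs_x) auto
  finally show ?thesis by simp
qed

text \<open>The difference of two exponentials costs a factor \<open>norm x\<close>, which the
  surplus decay of \<open>1 / wt x\<close> pays for. This makes \<open>ew\<close> continuous as a
  map into L2, and thereby \<open>pair_T\<close> measurable.\<close>

lemma ew_lipschitz: "cmod (ew \<xi> x - ew \<eta> x) \<le> (2 * norm (\<xi> - \<eta>)) * exp (- norm x)"
proof -
  have "ew \<xi> x - ew \<eta> x = of_real (1 / wt x) * (exp (\<i> * of_real (x \<bullet> \<xi>)) - exp (\<i> * of_real (x \<bullet> \<eta>)))"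
    by (simp add: ew_def right_diff_distrib)
  then have "cmod (ew \<xi> x - ew \<eta> x) = 1 / wt x * cmod (exp (\<i> * of_real (x \<bullet> \<xi>)) - exp (\<i> * of_real (x \<bullet> \<eta>)))"
    using wt_pos[of x] by (simp add: norm_mult norm_divide)
  also have "\<dots> \<le> (2 * exp (- (2 * norm x))) * (norm x * norm (\<xi> - \<eta>))"
  proof (intro mult_mono inverse_wt_le)
    have "cmod (exp (\<i> * of_real (x \<bullet> \<xi>)) - exp (\<i> * of_real (x \<bullet> \<eta>))) \<le> \<bar>x \<bullet> (\<xi> - \<eta>)\<bar>"
      using norm_exp_i_diff_le[of "x \<bullet> \<xi>" "x \<bullet> \<eta>"] by (simp add: inner_diff_right)
    then show "cmod (exp (\<i> * of_real (x \<bullet> \<xi>)) - exp (\<i> * of_real (x \<bullet> \<eta>))) \<le> norm x * norm (\<xi> - \<eta>)"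
      using Cauchy_Schwarz_ineq2[of x "\<xi> - \<eta>"] by linarith
  qed auto
  also have "\<dots> \<le> (2 * exp (- (2 * norm x))) * (exp (norm x) * norm (\<xi> - \<eta>))"
    using mult_exp_le[of "norm x"] by (intro mult_left_mono mult_right_mono) auto
  also have "\<dots> = (2 * norm (\<xi> - \<eta>)) * (exp (- (2 * norm x)) * exp (norm x))" by (simp only: mult_ac)
  also have "exp (- (2 * norm x)) * exp (norm x) = exp (- norm x)" by (simp flip: exp_add)
  finally show ?thesis .
qed

lemma ew_square_integrable: "square_integrable (ew \<xi>)" "norm (abs_L2 (ew (\<xi>::'a::euclidean_space))) \<le> 2 * exp_l2 TYPE('a)"
  by (rule exp_decay_L2[OF ew_measurable ew_bound])+

lemma continuous_at_if_norm_diff_le: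
  fixes f :: "'a::t2_space \<Rightarrow> 'b::real_normed_vector"
  assumes "\<And>\<eta>. norm (f \<eta> - f \<xi>) \<le> b \<eta>" "(b \<longlongrightarrow> 0) (at \<xi>)" shows "continuous (at \<xi>) f"
proof -
  have "((\<lambda>\<eta>. f \<eta> - f \<xi>) \<longlongrightarrow> 0) (at \<xi>)"
    by (rule Lim_null_comparison[OF always_eventually[OF allI[OF assms(1)]] assms(2)])
  then show ?thesis by (simp add: continuous_at LIM_zero_iff)
qed

lemma continuous_abs_ew: "continuous_on UNIV (\<lambda>\<xi>. abs_L2 (ew (\<xi>::'a::euclidean_space)))"
proof (rule continuous_at_imp_continuous_on, intro ballI)
  fix \<xi> :: 'a
  show "continuous (at \<xi>) (\<lambda>\<xi>. abs_L2 (ew \<xi>))"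
  proof (rule continuous_at_if_norm_diff_le)
    fix \<eta> :: 'a
    have "(\<lambda>x. ew \<eta> x - ew \<xi> x) \<in> borel_measurable borel" using ew_measurable by measurable
    then have "norm (abs_L2 (\<lambda>x. ew \<eta> x - ew \<xi> x)) \<le> 2 * norm (\<eta> - \<xi>) * exp_l2 TYPE('a)"
      by (rule exp_decay_L2(2)) (rule ew_lipschitz)
    then show "norm (abs_L2 (ew \<eta>) - abs_L2 (ew \<xi>)) \<le> 2 * norm (\<eta> - \<xi>) * exp_l2 TYPE('a)"
      by (simp only: abs_L2_diff[OF ew_square_integrable(1) ew_square_integrable(1)])
  next
    have "((\<lambda>\<eta>. 2 * norm (\<eta> - \<xi>) * exp_l2 TYPE('a)) \<longlongrightarrow> 2 * norm (\<xi> - \<xi>) * exp_l2 TYPE('a)) (at \<xi>)"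
      by (intro tendsto_intros)
    then show "((\<lambda>\<eta>. 2 * norm (\<eta> - \<xi>) * exp_l2 TYPE('a)) \<longlongrightarrow> 0) (at \<xi>)" by simp
  qed
qed

section \<open>Slices of test functions as maps into L2, and the pairing with a bounded
  operator\<close>

lemma slice_L2:
  fixes Q :: "'m::euclidean_space \<times> 'd::euclidean_space \<Rightarrow> complex"
  assumes "entire_bd 2 C Q"
  shows "square_integrable (\<lambda>y. Q (y, \<xi>))" "norm (abs_L2 (\<lambda>y. Q (y, \<xi>))) \<le> C * exp (- norm \<xi>) * exp_l2 TYPE('m)"
proof -
  have m: "(\<lambda>y. Q (y, \<xi>)) \<in> borel_measurable borel"
    by (intro borel_measurable_continuous_onI Sigma1_slice_continuous entire_bd_Sigma1[OF assms])
  have b: "cmod (Q (y, \<xi>)) \<le> (C * exp (- norm \<xi>)) * exp (- norm y)" for y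
    using Sigma1_slice_bound[OF assms, of y \<xi>] by (simp add: mult_ac)
  show "square_integrable (\<lambda>y. Q (y, \<xi>))" "norm (abs_L2 (\<lambda>y. Q (y, \<xi>))) \<le> C * exp (- norm \<xi>) * exp_l2 TYPE('m)"
    using exp_decay_L2[OF m b] by auto
qed

lemma continuous_abs_slice:
  fixes Q :: "'m::euclidean_space \<times> 'd::euclidean_space \<Rightarrow> complex"
  assumes "Q \<in> Sigma1" shows "continuous_on UNIV (\<lambda>\<xi>. abs_L2 (\<lambda>y. Q (y, \<xi>)))"
proof (rule continuous_at_imp_continuous_on, intro ballI)
  fix \<xi> :: 'd
  obtain F where F: "entire F" "Q = (\<lambda>x. F x 0)" using assms by (auto simp: Sigma1_iff_ent)
  obtain C where C: "tube 1 C F" using F(1) by (auto simp: entire_def)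
  obtain D where D: "entire_bd 2 D Q" using Sigma1_ent_bd[OF assms] by blast
  have C0: "0 \<le> C" using tube_nonneg[OF C] by simp
  have "norm (abs_L2 (\<lambda>y. Q (y, \<eta>)) - abs_L2 (\<lambda>y. Q (y, \<xi>))) \<le> norm (\<eta> - \<xi>) * (C * exp (norm (\<eta> - \<xi>) + 1)) * exp_l2 TYPE('m)" for \<eta> :: 'd
  proof -
    have m: "(\<lambda>y. Q (y, \<eta>) - Q (y, \<xi>)) \<in> borel_measurable borel"
      by (intro borel_measurable_continuous_onI continuous_intros Sigma1_slice_continuous assms)
    have b: "cmod (Q (y, \<eta>) - Q (y, \<xi>)) \<le> norm (\<eta> - \<xi>) * (C * exp (norm (\<eta> - \<xi>) + 1)) * exp (- norm y)" for y
    proof -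
      have "cmod (F ((y, \<xi>) + (0, \<eta> - \<xi>)) 0 - F (y, \<xi>) 0) \<le> norm ((0, \<eta> - \<xi>) :: 'm \<times> 'd) * (C * exp (1 * (norm ((0, \<eta> - \<xi>) :: 'm \<times> 'd) + 1)) * exp (- (1 * norm (y, \<xi>))))"
        using F(1) C by (intro lipschitz_tube) (auto simp: entire_def)
      also have "\<dots> \<le> norm (\<eta> - \<xi>) * (C * exp (norm (\<eta> - \<xi>) + 1) * exp (- norm y))"
        using C0 norm_fst_le[of y \<xi>] by (auto simp: norm_prod_def intro!: mult_left_mono)
      finally show ?thesis by (simp add: F(2) mult.assoc)
    qed
    from exp_decay_L2(2)[OF m b] show ?thesis by (simp only: abs_L2_diff[OF slice_L2(1)[OF D] slice_L2(1)[OF D]])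
  qed
  moreover have "((\<lambda>\<eta>. norm (\<eta> - \<xi>) * (C * exp (norm (\<eta> - \<xi>) + 1)) * exp_l2 TYPE('m)) \<longlongrightarrow> norm (\<xi> - \<xi>) * (C * exp (norm (\<xi> - \<xi>) + 1)) * exp_l2 TYPE('m)) (at \<xi>)"
    by (intro tendsto_intros)
  then have "((\<lambda>\<eta>. norm (\<eta> - \<xi>) * (C * exp (norm (\<eta> - \<xi>) + 1)) * exp_l2 TYPE('m)) \<longlongrightarrow> 0) (at \<xi>)" by simp
  ultimately show "continuous (at \<xi>) (\<lambda>\<xi>. abs_L2 (\<lambda>y. Q (y, \<xi>)))" by (rule continuous_at_if_norm_diff_le)
qed

text \<open>If \<open>Q (y, \<xi>)\<close> is the Fourier transform of \<open>w(x) \<Psi>(y, x)\<close> with respect to \<open>x\<close>, then the integral of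
  \<open>pair_T T Q\<close> over \<open>\<xi>\<close> pairs the kernel of \<open>T\<close> with \<open>\<Psi>\<close>, up to a constant. The weight makes the
  exponentials square-integrable.\<close>

definition pair_T :: "('a::euclidean_space L2 \<Rightarrow> 'a L2) \<Rightarrow> ('a \<times> 'a \<Rightarrow> complex) \<Rightarrow> 'a \<Rightarrow> complex" where
  "pair_T T Q \<xi> = cip (T (abs_L2 (\<lambda>y. Q (y, \<xi>)))) (abs_L2 (ew \<xi>))"

lemma pair_T_bound:
  fixes Q :: "'a::euclidean_space \<times> 'a \<Rightarrow> complex"
  assumes T: "clinear_L2 T" "\<And>f. norm (T f) \<le> K * norm f" "0 \<le> K" and Q: "entire_bd 2 C Q"
  shows "pair_T T Q \<in> borel_measurable borel"
    "cmod (pair_T T Q \<xi>) \<le> (K * C * (exp_l2 TYPE('a) * (2 * exp_l2 TYPE('a)))) * exp (- norm \<xi>)"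
proof -
  have "continuous_on UNIV (\<lambda>\<xi>. T (abs_L2 (\<lambda>y. Q (y, \<xi>))))"
    by (rule bounded_linear.continuous_on[OF clinear_L2_bounded_linear[OF T(1,2)] continuous_abs_slice[OF entire_bd_Sigma1[OF Q]]])
  then have "continuous_on UNIV (pair_T T Q)"
    unfolding pair_T_def[abs_def] by (intro bounded_bilinear.continuous_on[OF bounded_bilinear_cip] continuous_abs_ew)
  then show "pair_T T Q \<in> borel_measurable borel" by (rule borel_measurable_continuous_onI)
  have C: "0 \<le> C" using entire_bd_nonneg[OF Q] by simp
  have "cmod (pair_T T Q \<xi>) \<le> norm (T (abs_L2 (\<lambda>y. Q (y, \<xi>)))) * norm (abs_L2 (ew \<xi>))"
    unfolding pair_T_def by (rule cip_cauchy_schwarz)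
  also have "\<dots> \<le> (K * (C * exp (- norm \<xi>) * exp_l2 TYPE('a))) * (2 * exp_l2 TYPE('a))"
  proof (intro mult_mono ew_square_integrable)
    show "norm (T (abs_L2 (\<lambda>y. Q (y, \<xi>)))) \<le> K * (C * exp (- norm \<xi>) * exp_l2 TYPE('a))"
      using T(3) by (intro order_trans[OF T(2) mult_left_mono[OF slice_L2(2)[OF Q]]])
  qed (use T(3) C exp_l2_nonneg[where 'a='a] in auto)
  finally show "cmod (pair_T T Q \<xi>) \<le> (K * C * (exp_l2 TYPE('a) * (2 * exp_l2 TYPE('a)))) * exp (- norm \<xi>)"
    by (simp add: mult_ac)
qed

lemma pair_T_integrable:
  assumes T: "clinear_L2 T" "\<And>f. norm (T f) \<le> K * norm f" "0 \<le> K" and Q: "Q \<in> Sigma1"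
  shows "integrable lborel (pair_T T Q)"
proof -
  obtain C where C: "entire_bd 2 C Q" using Sigma1_ent_bd[OF Q] by blast
  show ?thesis using pair_T_bound[OF T C] by (intro integrable_exp_bound[where c=1]) auto
qed

text \<open>The inverse Fourier transform and \<open>Linv\<close> lead, up to a constant factor,
  from a cross Wigner transform back to \<open>f y * \<phi> x\<close> as a function of the pair of
  \<open>y\<close> and \<open>x\<close>. The weight and the outer transformation act on
  \<open>x\<close>.\<close>

definition Qmap :: "real^'d^'d \<Rightarrow> ((real^'d) \<times> (real^'d) \<Rightarrow> complex) \<Rightarrow> (real^'d) \<times> (real^'d) \<Rightarrow> complex" where
  "Qmap A \<Phi> = FT2 1 (\<lambda>p. of_real (wt (snd p)) * FT2 (- 1) \<Phi> (Linv A p))"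

lemma Qmap_pre_Sigma1: "\<Phi> \<in> Sigma1 \<Longrightarrow> (\<lambda>p. of_real (wt (snd p)) * FT2 (- 1) \<Phi> (Linv A p)) \<in> Sigma1"
  by (intro wt_Sigma1 Sigma1_iso[OF linear_Linv linear_Lmap Lmap_Linv] FT2_Sigma1) auto

lemma Qmap_Sigma1: "\<Phi> \<in> Sigma1 \<Longrightarrow> Qmap A \<Phi> \<in> Sigma1"
  unfolding Qmap_def by (intro FT2_Sigma1 Qmap_pre_Sigma1) auto

lemma Qmap_add: "\<Phi> \<in> Sigma1 \<Longrightarrow> \<Psi> \<in> Sigma1 \<Longrightarrow> Qmap A (\<lambda>p. \<Phi> p + \<Psi> p) = (\<lambda>p. Qmap A \<Phi> p + Qmap A \<Psi> p)"
  unfolding Qmap_def using FT2_add[OF Qmap_pre_Sigma1 Qmap_pre_Sigma1, of \<Phi> \<Psi> 1 A A]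
  by (simp add: FT2_add distrib_left)

lemma Qmap_cmult: "Qmap A (\<lambda>p. c * \<Phi> p) = (\<lambda>p. c * Qmap A \<Phi> p)"
  unfolding Qmap_def FT2_cmult mult.left_commute[of _ c] ..

lemma Qmap_bound:
  fixes A :: "real^'d^'d"
  shows "\<exists>R\<ge>0. \<exists>K\<ge>0. \<forall>\<Phi> C. entire_bd R C \<Phi> \<longrightarrow> entire_bd 2 (K * C) (Qmap A \<Phi>)"
proof -
  define N where "N = real DIM(real^'d)"
  define I where "I = exp_int TYPE(real^'d)"
  have I: "0 \<le> I" unfolding I_def exp_int_def by (intro Bochner_Integration.integral_nonneg) simp
  have N: "0 \<le> N" by (simp add: N_def)
  \<comment> \<open>Widths are found backwards: \<open>FT2\<close> lowers \<open>2 * R + 2\<close>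
    to \<open>R\<close>, so the final 2 takes 6, to which the weight adds
    \<open>2 * N\<close>.\<close>
  obtain R1 where R1: "0 \<le> R1" "\<And>f C. entire_bd R1 C f \<Longrightarrow> entire_bd (6 + 2 * N) C (\<lambda>x. f (Linv A x))"
    using entire_bd_iso[OF linear_Linv linear_Lmap Lmap_Linv, of "6 + 2 * N" A] N by auto
  have "entire_bd 2 (N * I * I * C) (Qmap A \<Phi>)" if "entire_bd (2 * R1 + 2) C \<Phi>" for C \<Phi>
  proof -
    have "entire_bd R1 (C * I) (FT2 (- 1) \<Phi>)" unfolding I_def using that R1(1) by (intro entire_bd_FT2) auto
    then have "entire_bd (6 + 2 * N) (C * I) (\<lambda>p. FT2 (- 1) \<Phi> (Linv A p))" by (rule R1(2))
    then have "entire_bd 6 (N * (C * I)) (\<lambda>p. of_real (wt (snd p)) * FT2 (- 1) \<Phi> (Linv A p))"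
      unfolding N_def by (intro entire_bd_wt) auto
    then have "entire_bd 2 (N * (C * I) * I) (Qmap A \<Phi>)"
      unfolding Qmap_def I_def by (intro entire_bd_FT2) auto
    then show ?thesis by (simp add: mult_ac)
  qed
  then show ?thesis using R1(1) N I by (intro exI[of _ "2 * R1 + 2"] conjI exI[of _ "N * I * I"]) auto
qed

text \<open>On a cross Wigner transform \<open>Qmap\<close> separates into
  \<open>c * h \<xi> * f y\<close>, so that \<open>T\<close> acts on \<open>f\<close> alone.
  Fubini's theorem and inversion of the Fourier transform \<open>h\<close> of \<open>g\<close> then
  return \<open>g x\<close>, whose weight cancels that of \<open>ew\<close>. One inversion takes
  place inside \<open>Qmap\<close> and one here, whence the square of the constant.\<close>

lemma integral_pair_T_cross_wigner:
  fixes A :: "real^'d^'d"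
  assumes T: "clinear_L2 T" and f: "f \<in> Sigma1" and \<phi>: "\<phi> \<in> Sigma1"
  shows "(LINT \<xi>|lborel. pair_T T (Qmap A (cross_wigner A f \<phi>)) \<xi>)
    = of_real ((inv_const TYPE(real^'d))\<^sup>2) * L2_functional (T (abs_L2 f)) \<phi>"
proof -
  define c where "c = complex_of_real (inv_const TYPE(real^'d))"
  define g where "g x = of_real (wt x) * \<phi> x" for x
  define h where "h \<xi> = (LINT t|lborel. g t * exp (\<i> * of_real (1 * (t \<bullet> \<xi>))))" for \<xi>
  obtain u where u: "square_integrable u" "T (abs_L2 f) = abs_L2 u" using abs_L2_cases by blast
  have um: "u \<in> borel_measurable borel" using u(1) by (simp add: square_integrable_def)
  have ft: "f \<in> borel_measurable borel" using f by (rule Sigma1_measurable)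
  have tS: "(\<lambda>p. tens f \<phi> (Lmap A p)) \<in> Sigma1"
    using f \<phi> by (intro Sigma1_iso[OF linear_Lmap linear_Linv Linv_Lmap] tens_Sigma1)
  have "FT2 (- 1) (cross_wigner A f \<phi>) = (\<lambda>p. c * tens f \<phi> (Lmap A p))"
    unfolding cross_wigner_eq c_def by (rule FT2_inversion[OF tS]) simp
  then have "Qmap A (cross_wigner A f \<phi>) = FT2 1 (\<lambda>p. c * tens f g p)"
    by (simp add: Qmap_def Lmap_Linv tens_def g_def mult_ac)
  then have Q: "Qmap A (cross_wigner A f \<phi>) (y, \<xi>) = c * h \<xi> * f y" for y \<xi>
    by (simp add: FT2_cmult) (simp add: FT2_def tens_def h_def mult_ac)
  \<comment> \<open>The results on \<open>FT2\<close> concern functions of two variables. Tensoring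
    with a Gaussian, which is 1 at the origin, exhibits \<open>g\<close> and \<open>h\<close> as
    slices of such functions.\<close>
  have gS: "tens (gaussc 1 :: real^'d \<Rightarrow> complex) g \<in> Sigma1"
    using wt_Sigma1[OF tens_Sigma1[OF gaussc_Sigma1[OF zero_less_one] \<phi>]]
    by (simp add: tens_def[abs_def] g_def mult_ac)
  have hF: "h \<xi> = FT2 1 (tens (gaussc 1 :: real^'d \<Rightarrow> complex) g) (0, \<xi>)" for \<xi>
    by (simp add: FT2_def tens_def gaussc_def h_def)
  have hS: "FT2 1 (tens (gaussc 1 :: real^'d \<Rightarrow> complex) g) \<in> Sigma1" using gS by (intro FT2_Sigma1) auto
  have hc: "continuous_on UNIV h" unfolding hF[abs_def] by (rule Sigma1_slice_continuous(1)[OF hS])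
  obtain L where L: "entire_bd 2 L (FT2 1 (tens (gaussc 1 :: real^'d \<Rightarrow> complex) g))" using Sigma1_ent_bd[OF hS] by blast
  have hb: "cmod (h \<xi>) \<le> L * exp (- norm \<xi>)" for \<xi>
    using Sigma1_slice_bound[OF L, of 0 \<xi>] by (simp add: hF)
  obtain M where M: "entire_bd 2 M (tens (gaussc 1 :: real^'d \<Rightarrow> complex) g)" using Sigma1_ent_bd[OF gS] by blast
  have gb: "cmod (g t) \<le> M * exp (- norm t)" for t
    using Sigma1_slice_bound[OF M, of 0 t] by (simp add: tens_def gaussc_def)
  have gc: "continuous_on UNIV g" unfolding g_def[abs_def]
    by (intro continuous_intros continuous_wt Sigma1_continuous \<phi>)
  have inv: "(LINT \<xi>|lborel. h \<xi> * exp (\<i> * of_real (- 1 * (\<xi> \<bullet> x)))) = c * g x" for x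
    unfolding c_def
    by (rule fourier_inversion[OF gc gb _ _ borel_measurable_continuous_onI[OF hc] hb]) (auto simp: h_def)
  have pT: "pair_T T (Qmap A (cross_wigner A f \<phi>)) \<xi> = c * h \<xi> * (LINT x|lborel. u x * cnj (ew \<xi> x))" for \<xi>
  proof -
    have "abs_L2 (\<lambda>y. Qmap A (cross_wigner A f \<phi>) (y, \<xi>)) = cscale (c * h \<xi>) (abs_L2 f)"
      unfolding Q by (rule abs_L2_cmult[OF Sigma1_square_integrable[OF f]])
    then have "pair_T T (Qmap A (cross_wigner A f \<phi>)) \<xi> = c * h \<xi> * cip (abs_L2 u) (abs_L2 (ew \<xi>))"
      unfolding pair_T_def by (simp only: clinear_L2_cscale[OF T] u(2) cip_cscale_left)
    then show ?thesis by (simp only: cip_abs_L2[OF u(1) ew_square_integrable(1)])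
  qed
  define H where "H \<xi> x = c * h \<xi> * (u x * cnj (ew \<xi> x))" for \<xi> x
  have Hm: "(\<lambda>(\<xi>, x). H \<xi> x) \<in> borel_measurable (lborel \<Otimes>\<^sub>M lborel)"
  proof -
    have "continuous_on UNIV (\<lambda>z. c * h (fst z) * cnj (ew (fst z) (snd z)))"
      unfolding ew_def
      by (intro continuous_intros continuous_on_compose2[OF hc] continuous_on_compose2[OF continuous_wt[of UNIV]])
        (auto simp: wt_nonzero)
    then have "(\<lambda>z. c * h (fst z) * cnj (ew (fst z) (snd z))) \<in> borel_measurable borel" by (rule borel_measurable_continuous_onI)
    moreover have "(\<lambda>z::(real^'d)\<times>(real^'d). u (snd z)) \<in> borel_measurable borel"
      by (rule measurable_compose[OF _ um]) (intro borel_measurable_continuous_onI continuous_intros)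
    ultimately have "(\<lambda>z. (c * h (fst z) * cnj (ew (fst z) (snd z))) * u (snd z)) \<in> borel_measurable borel" by (rule borel_measurable_times)
    then show ?thesis by (simp add: lborel_prod H_def case_prod_unfold mult_ac)
  qed
  \<comment> \<open>The majorant in \<open>x\<close> is the product of an L2 function and a decaying
    exponential; the decay in \<open>\<xi>\<close> comes from \<open>h\<close>.\<close>
  define W where "W x = cmod (u x) * (2 * exp (- norm x))" for x
  have "integrable lborel (\<lambda>x. u x * of_real (2 * exp (- norm x)))"
  proof (rule square_integrable_mult[OF u(1)])
    have "continuous_on UNIV (\<lambda>x::real^'d. complex_of_real (2 * exp (- norm x)))" by (intro continuous_intros)
    then show "square_integrable (\<lambda>x::real^'d. complex_of_real (2 * exp (- norm x)))"
      by (intro exp_decay_L2(1)[where C=2] borel_measurable_continuous_onI) auto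
  qed
  from integrable_norm[OF this] have Wi: "integrable lborel W" by (simp add: W_def[abs_def] norm_mult)
  have Hb: "cmod (H \<xi> x) \<le> cmod c * L * exp (- norm \<xi>) * W x" for \<xi> x
  proof -
    have "cmod (H \<xi> x) \<le> cmod c * (L * exp (- norm \<xi>)) * (cmod (u x) * (2 * exp (- norm x)))"
      unfolding H_def norm_mult complex_mod_cnj
      using order_trans[OF norm_ge_zero hb[of \<xi>]] by (intro mult_mono hb ew_bound) auto
    then show ?thesis by (simp add: W_def mult_ac)
  qed
  have "integrable (lborel \<Otimes>\<^sub>M lborel) (\<lambda>(\<xi>, x). H \<xi> x)"
  proof (rule lborel_pair.Fubini_integrable[OF Hm])
    have Hx: "integrable lborel (H \<xi>)" for \<xi>
    proof -
      have "H \<xi> \<in> borel_measurable lborel" unfolding H_def[abs_def] using um ew_measurable[of \<xi>]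
        by (auto intro!: borel_measurable_times borel_measurable_const measurable_compose[OF ew_measurable borel_measurable_continuous_onI[OF continuous_on_cnj[OF continuous_on_id]]])
      then show ?thesis using Hb[of \<xi>] by (intro integrable_dominated[OF integrable_mult_right[OF Wi]])
    qed
    then show "AE \<xi> in lborel. integrable lborel (\<lambda>x. (\<lambda>(\<xi>, x). H \<xi> x) (\<xi>, x))" by simp
    have "(\<lambda>\<xi>. LINT x|lborel. cmod (H \<xi> x)) \<in> borel_measurable lborel"
      by (rule lborel.borel_measurable_lebesgue_integral) (use Hm in \<open>simp add: case_prod_unfold\<close>)
    moreover have "norm (LINT x|lborel. cmod (H \<xi> x)) \<le> (cmod c * L * (LINT x|lborel. W x)) * exp (- (1 * norm \<xi>))" for \<xi>
    proof -
      have "(LINT x|lborel. cmod (H \<xi> x)) \<le> (LINT x|lborel. cmod c * L * exp (- norm \<xi>) * W x)"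
        using Hx Wi Hb by (intro integral_mono) auto
      then show ?thesis by (simp add: mult_ac)
    qed
    ultimately show "integrable lborel (\<lambda>\<xi>. LINT x|lborel. cmod ((\<lambda>(\<xi>, x). H \<xi> x) (\<xi>, x)))"
      by (intro integrable_exp_bound[where c=1]) auto
  qed
  then have "(LINT x|lborel. LINT \<xi>|lborel. H \<xi> x) = (LINT \<xi>|lborel. LINT x|lborel. H \<xi> x)"
    by (rule lborel_pair.Fubini_integral)
  moreover have "(LINT x|lborel. H \<xi> x) = pair_T T (Qmap A (cross_wigner A f \<phi>)) \<xi>" for \<xi>
    unfolding pT H_def by (rule integral_mult_right_zero)
  moreover have "(LINT \<xi>|lborel. H \<xi> x) = c\<^sup>2 * (u x * \<phi> x)" for x
  proof -
    have "H \<xi> x = (c * u x * of_real (1 / wt x)) * (h \<xi> * exp (\<i> * of_real (- 1 * (\<xi> \<bullet> x))))" for \<xi>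
      by (simp add: H_def ew_def exp_cnj mult_ac inner_commute)
    then have "(LINT \<xi>|lborel. H \<xi> x) = (c * u x * of_real (1 / wt x)) * (c * g x)"
      by (simp only: integral_mult_right_zero inv)
    then show ?thesis using wt_pos[of x] by (simp add: g_def power2_eq_square)
  qed
  ultimately have "(LINT \<xi>|lborel. pair_T T (Qmap A (cross_wigner A f \<phi>)) \<xi>) = c\<^sup>2 * (LINT x|lborel. u x * \<phi> x)"
    by simp
  also have "(LINT x|lborel. u x * \<phi> x) = L2_functional (T (abs_L2 f)) \<phi>"
    using \<phi> by (simp add: u(2) L2_functional.abs_eq L2_rel_self u(1))
  finally show ?thesis by (simp add: c_def)
qed

lemma Op_surj:
  fixes A :: "real^'d^'d"
  assumes T: "clinear_L2 T" "\<And>f. norm (T f) \<le> K * norm f" "0 \<le> K"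
  shows "\<exists>a\<in>Sigma1_dual. Op A a = L2_restrict T"
proof -
  define c where "c = complex_of_real ((inv_const TYPE(real^'d))\<^sup>2)"
  have c: "c \<noteq> 0" using inv_const_pos[where 'a="real^'d"] by (simp add: c_def)
  define d where "d = complex_of_real ((2 * pi) ^ CARD('d))"
  have d: "d \<noteq> 0" by (simp add: d_def)
  \<comment> \<open>\<open>c\<close> compensates for the two Fourier inversions and \<open>d\<close>
    for the normalization in \<open>Op\<close>.\<close>
  define a where "a = (\<lambda>\<Phi>\<in>Sigma1. d / c * (LINT \<xi>|lborel. pair_T T (Qmap A \<Phi>) \<xi>))"
  note int = pair_T_integrable[OF T Qmap_Sigma1]
  obtain R K1 where R: "0 \<le> R" "0 \<le> K1" "\<And>\<Phi> C. entire_bd R C \<Phi> \<Longrightarrow> entire_bd 2 (K1 * C) (Qmap A \<Phi>)"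
    using Qmap_bound[of A] by blast
  define e where "e = exp_l2 TYPE(real^'d)"
  define I where "I = exp_int TYPE(real^'d)"
  have I: "0 \<le> I" unfolding I_def exp_int_def by (intro Bochner_Integration.integral_nonneg) simp
  have sl: "square_integrable (\<lambda>y. Qmap A \<Phi> (y, \<xi>))" if "\<Phi> \<in> Sigma1" for \<Phi> \<xi>
    using Sigma1_ent_bd[OF Qmap_Sigma1[OF that], of 2] slice_L2(1) by blast
  have "a \<in> Sigma1_dual"
  proof (rule Sigma1_dualI[where R=R and K="cmod (d / c) * (K * K1 * (e * (2 * e)) * I)"])
    show "a \<in> extensional Sigma1" by (simp add: a_def)
    show "a (\<lambda>x. f x + g x) = a f + a g" if "f \<in> Sigma1" "g \<in> Sigma1" for f g
    proof -
      have "pair_T T (Qmap A (\<lambda>x. f x + g x)) = (\<lambda>\<xi>. pair_T T (Qmap A f) \<xi> + pair_T T (Qmap A g) \<xi>)"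
        using that by (simp add: pair_T_def[abs_def] Qmap_add abs_L2_add sl clinear_L2_add[OF T(1)] cip_add_left)
      then show ?thesis using that int by (simp add: a_def Sigma1_add distrib_left add_divide_distrib)
    qed
    show "a (\<lambda>x. k * f x) = k * a f" if "f \<in> Sigma1" for k f
    proof -
      have "pair_T T (Qmap A (\<lambda>x. k * f x)) = (\<lambda>\<xi>. k * pair_T T (Qmap A f) \<xi>)"
        using that by (simp add: pair_T_def[abs_def] Qmap_cmult abs_L2_cmult sl clinear_L2_cscale[OF T(1)] cip_cscale_left)
      then show ?thesis using that by (simp add: a_def Sigma1_cmult)
    qed
    show "cmod (a f) \<le> cmod (d / c) * (K * K1 * (e * (2 * e)) * I) * C" if "entire_bd R C f" for f C
    proof -
      note pb = pair_T_bound[OF T R(3)[OF that], folded e_def]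
      have "cmod (LINT \<xi>|lborel. pair_T T (Qmap A f) \<xi>) \<le> (K * (K1 * C) * (e * (2 * e))) * I"
        unfolding I_def using pb by (intro integral_exp_bound) auto
      then have "cmod (d / c) * cmod (LINT \<xi>|lborel. pair_T T (Qmap A f) \<xi>) \<le> cmod (d / c) * ((K * (K1 * C) * (e * (2 * e))) * I)"
        by (rule mult_left_mono) simp
      then have "cmod (d / c * (LINT \<xi>|lborel. pair_T T (Qmap A f) \<xi>)) \<le> cmod (d / c) * ((K * (K1 * C) * (e * (2 * e))) * I)"
        by (simp only: norm_mult)
      then show ?thesis using entire_bd_Sigma1[OF that] by (simp add: a_def mult_ac)
    qed
    show "0 \<le> cmod (d / c) * (K * K1 * (e * (2 * e)) * I)"
      using T(3) R(2) I exp_l2_nonneg[where 'a="real^'d"] by (auto simp: e_def intro!: mult_nonneg_nonneg)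
  qed (rule R(1))
  moreover have "Op A a = L2_restrict T"
  proof (intro ext)
    fix f \<phi>
    show "Op A a f \<phi> = L2_restrict T f \<phi>"
    proof (cases "f \<in> Sigma1")
      case f: True
      show ?thesis
      proof (cases "\<phi> \<in> Sigma1")
        case \<phi>: True
        have "a (cross_wigner A f \<phi>) = d / c * (c * L2_functional (T (abs_L2 f)) \<phi>)"
          using integral_pair_T_cross_wigner[OF T(1) f \<phi>, of A] cross_wigner_Sigma1[OF f \<phi>, of A] by (simp add: a_def c_def)
        then show ?thesis using f \<phi> c d by (simp add: Op_def L2_restrict_def d_def)
      next
        case False
        \<comment> \<open>Outside \<open>Sigma1\<close> both sides are \<open>undefined\<close>, by
          the restrictions in \<open>Op\<close> and in \<open>L2_functional\<close>.\<close>
        have "L2_functional (T (abs_L2 f)) \<phi> = undefined"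
          by (rule abs_L2_cases[of "T (abs_L2 f)"]) (simp add: L2_functional.abs_eq L2_rel_self False)
        then show ?thesis using f False by (simp add: Op_def L2_restrict_def)
      qed
    qed (simp add: Op_def L2_restrict_def)
  qed
  ultimately show ?thesis by blast
qed


section \<open>Completeness of $L^2$ and density of test functions\<close>

lemma L2_dominated_convergence:
  fixes f :: "nat \<Rightarrow> 'a::euclidean_space \<Rightarrow> complex"
  assumes m: "\<And>n. f n \<in> borel_measurable borel" "g \<in> borel_measurable borel"
    and lim: "AE x in lborel. (\<lambda>n. f n x) \<longlonglongrightarrow> g x"
    and bd: "\<And>n. AE x in lborel. cmod (f n x) \<le> w x" and w: "integrable lborel (\<lambda>x. (w x)\<^sup>2)"
  shows "square_integrable g" "\<And>n. square_integrable (f n)" "(\<lambda>n. abs_L2 (f n)) \<longlonglongrightarrow> abs_L2 g"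
proof -
  have wm: "(\<lambda>x. (w x)\<^sup>2) \<in> borel_measurable lborel" using w by simp
  have gb: "AE x in lborel. cmod (g x) \<le> w x"
    using lim bd[unfolded AE_all_countable[symmetric]] 
  proof -
    have "AE x in lborel. \<forall>n. cmod (f n x) \<le> w x" using bd by (simp add: AE_all_countable)
    with lim show ?thesis
    proof eventually_elim
      case (elim x)
      then show ?case by (intro LIMSEQ_le_const2[OF tendsto_norm[OF elim(1)]]) auto
    qed
  qed
  have si: "square_integrable h" if "h \<in> borel_measurable borel" "AE x in lborel. cmod (h x) \<le> w x" for h
    unfolding square_integrable_def
  proof
    show "h \<in> borel_measurable lborel" using that by simp
    show "integrable lborel (\<lambda>x. (cmod (h x))\<^sup>2)"
    proof (rule Bochner_Integration.integrable_bound[OF w])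
      show "(\<lambda>x. (cmod (h x))\<^sup>2) \<in> borel_measurable lborel" using that(1) by measurable
      show "AE x in lborel. norm ((cmod (h x))\<^sup>2) \<le> norm ((w x)\<^sup>2)"
        using that(2) by eventually_elim (auto intro: power_mono)
    qed
  qed
  show g: "square_integrable g" using m(2) gb by (rule si)
  show f: "square_integrable (f n)" for n using m(1) bd by (rule si)
  have "(\<lambda>n. LINT x|lborel. (cmod (f n x - g x))\<^sup>2) \<longlonglongrightarrow> (LINT (x::'a)|lborel. 0)"
  proof (rule integral_dominated_convergence[where w="\<lambda>x. 4 * (w x)\<^sup>2"])
    show "(\<lambda>x. (cmod (f n x - g x))\<^sup>2) \<in> borel_measurable lborel" for n using m by measurable
    show "integrable lborel (\<lambda>x. 4 * (w x)\<^sup>2)" using w by simp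
    show "AE x in lborel. (\<lambda>n. (cmod (f n x - g x))\<^sup>2) \<longlonglongrightarrow> 0"
      using lim
    proof eventually_elim
      case (elim x)
      then have "(\<lambda>n. (cmod (f n x - g x))\<^sup>2) \<longlonglongrightarrow> (cmod (g x - g x))\<^sup>2" by (intro tendsto_intros)
      then show ?case by simp
    qed
    show "AE x in lborel. norm ((cmod (f n x - g x))\<^sup>2) \<le> 4 * (w x)\<^sup>2" for n
      using bd[of n] gb
    proof eventually_elim
      case (elim x)
      have "cmod (f n x - g x) \<le> 2 * w x" using elim norm_triangle_ineq4[of "f n x" "g x"] by linarith
      then have "(cmod (f n x - g x))\<^sup>2 \<le> (2 * w x)\<^sup>2" by (intro power_mono) auto
      then show ?case by (simp add: power_mult_distrib)
    qed
  qed simp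
  moreover have "(LINT x|lborel. (cmod (f n x - g x))\<^sup>2) = (norm (abs_L2 (f n) - abs_L2 g))\<^sup>2" for n
  proof -
    have "square_integrable (\<lambda>x. f n x + (- 1) * g x)" by (intro square_integrable_add square_integrable_cmult f g)
    then have "square_integrable (\<lambda>x. f n x - g x)" by simp
    then show ?thesis by (simp only: norm_abs_L2[symmetric] abs_L2_diff[OF f g])
  qed
  ultimately have "(\<lambda>n. (norm (abs_L2 (f n) - abs_L2 g))\<^sup>2) \<longlonglongrightarrow> 0" by simp
  then have "(\<lambda>n. sqrt ((norm (abs_L2 (f n) - abs_L2 g))\<^sup>2)) \<longlonglongrightarrow> sqrt 0" by (rule tendsto_real_sqrt)
  then have "(\<lambda>n. norm (abs_L2 (f n) - abs_L2 g)) \<longlonglongrightarrow> 0" by simp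
  then show "(\<lambda>n. abs_L2 (f n)) \<longlonglongrightarrow> abs_L2 g" by (simp add: tendsto_norm_zero_iff LIM_zero_iff)
qed

text \<open>The Riesz-Fischer argument. The sum \<open>S\<close> of
  \<open>4 ^ n * (d n x)\<^sup>2\<close> has integral at most the sum of the powers of
  \<open>4 / 64\<close>, so it is finite almost everywhere. Where it is finite, \<open>d n x\<close>
  is at most \<open>sqrt (s x) * (1 / 2) ^ n\<close>, which gives the pointwise limit and the
  square-integrable majorant \<open>w\<close> at once.\<close>

lemma L2_fast_Cauchy_convergent:
  fixes Y :: "nat \<Rightarrow> 'a::euclidean_space L2"
  assumes Y: "\<And>n. norm (Y (Suc n) - Y n) \<le> (1 / 8) ^ n"
  shows "convergent Y"
proof -
  have "\<forall>n. \<exists>f. square_integrable f \<and> Y n = abs_L2 f" using abs_L2_cases by metis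
  then obtain f where f: "\<And>n. square_integrable (f n)" "\<And>n. Y n = abs_L2 (f n)" by metis
  have fm: "f n \<in> borel_measurable borel" for n using f(1)[of n] by (simp add: square_integrable_def)
  define d where "d n x = cmod (f (Suc n) x - f n x)" for n x
  have dm: "d n \<in> borel_measurable borel" for n unfolding d_def[abs_def] using fm by measurable
  have sd: "square_integrable (\<lambda>x. f (Suc n) x - f n x)" for n
  proof -
    have "square_integrable (\<lambda>x. f (Suc n) x + (- 1) * f n x)" by (intro square_integrable_add square_integrable_cmult f)
    then show ?thesis by simp
  qed
  have di: "integrable lborel (\<lambda>x. (d n x)\<^sup>2)" for n using sd[of n] by (simp add: square_integrable_def d_def)
  have dn: "(LINT x|lborel. (d n x)\<^sup>2) \<le> (1 / 64) ^ n" for n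
  proof -
    have "(LINT x|lborel. (d n x)\<^sup>2) = (norm (Y (Suc n) - Y n))\<^sup>2"
      unfolding d_def f(2) norm_abs_L2[OF sd, symmetric] abs_L2_diff[OF f(1) f(1)] ..
    also have "\<dots> \<le> ((1 / 8) ^ n)\<^sup>2" using Y by (intro power_mono) auto
    also have "\<dots> = (1 / 64) ^ n" by (simp add: power_mult_distrib[symmetric] power2_eq_square)
    finally show ?thesis .
  qed
  define S where "S x = (\<Sum>n. ennreal (4 ^ n * (d n x)\<^sup>2))" for x
  have Sm: "S \<in> borel_measurable borel" unfolding S_def[abs_def] using dm by measurable
  have "(\<integral>\<^sup>+x. S x \<partial>lborel) = (\<Sum>n. \<integral>\<^sup>+x. ennreal (4 ^ n * (d n x)\<^sup>2) \<partial>lborel)"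
    unfolding S_def using dm by (intro nn_integral_suminf) measurable
  also have "\<dots> \<le> (\<Sum>n. ennreal ((1 / 16) ^ n))"
  proof (intro suminf_le summableI)
    fix n
    have "(\<integral>\<^sup>+x. ennreal (4 ^ n * (d n x)\<^sup>2) \<partial>lborel) = ennreal (LINT x|lborel. 4 ^ n * (d n x)\<^sup>2)"
      using di[of n] by (intro nn_integral_eq_integral) auto
    also have "(LINT x|lborel. 4 ^ n * (d n x)\<^sup>2) \<le> 4 ^ n * (1 / 64) ^ n"
      using dn[of n] by simp
    also have "4 ^ n * (1 / 64) ^ n = (1 / 16 :: real) ^ n" by (simp add: power_mult_distrib[symmetric])
    finally show "(\<integral>\<^sup>+x. ennreal (4 ^ n * (d n x)\<^sup>2) \<partial>lborel) \<le> ennreal ((1 / 16) ^ n)" by (simp add: ennreal_leI)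
  qed
  also have "\<dots> = ennreal (\<Sum>n. (1 / 16) ^ n)"
    by (rule suminf_ennreal2) (auto intro: summable_geometric)
  also have "\<dots> < \<infinity>" by simp
  finally have SI: "(\<integral>\<^sup>+x. S x \<partial>lborel) < \<infinity>" .
  have ae: "AE x in lborel. S x \<noteq> \<infinity>" using SI Sm by (intro nn_integral_PInf_AE) auto
  define s where "s x = enn2real (S x)" for x
  have si: "integrable lborel s"
  proof (rule integrableI_bounded)
    show "s \<in> borel_measurable lborel" unfolding s_def[abs_def] using Sm by measurable
    have "(\<integral>\<^sup>+x. ennreal (norm (s x)) \<partial>lborel) \<le> (\<integral>\<^sup>+x. S x \<partial>lborel)"
      by (intro nn_integral_mono) (simp add: s_def ennreal_enn2real_if)
    also note SI
    finally show "(\<integral>\<^sup>+x. ennreal (norm (s x)) \<partial>lborel) < \<infinity>" .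
  qed
  define w where "w x = cmod (f 0 x) + 2 * sqrt (s x)" for x
  have key: "(\<forall>n. cmod (f n x) \<le> w x) \<and> convergent (\<lambda>n. f n x)" if fin: "S x \<noteq> \<infinity>" for x
  proof -
    have dle: "d n x \<le> sqrt (s x) * (1 / 2) ^ n" for n
    proof -
      have "(\<Sum>n\<in>{n}. ennreal (4 ^ n * (d n x)\<^sup>2)) \<le> S x"
        unfolding S_def by (rule sum_le_suminf) auto
      then have "ennreal (4 ^ n * (d n x)\<^sup>2) \<le> S x" by simp
      also have "S x = ennreal (s x)" using fin by (simp add: s_def ennreal_enn2real_if)
      finally have "4 ^ n * (d n x)\<^sup>2 \<le> s x" by (simp add: s_def ennreal_le_iff)
      moreover have "(2 ^ n)\<^sup>2 = (4 :: real) ^ n" by (simp add: power2_eq_square power_mult_distrib[symmetric])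
      ultimately have "(2 ^ n * d n x)\<^sup>2 \<le> s x" by (simp only: power_mult_distrib)
      then have "2 ^ n * d n x \<le> sqrt (s x)" by (rule real_le_rsqrt)
      then show ?thesis by (simp add: power_divide field_simps)
    qed
    have sg: "summable (\<lambda>n. sqrt (s x) * (1 / 2) ^ n)" by (intro summable_mult summable_geometric) auto
    have s0: "0 \<le> s x" by (simp add: s_def)
    have tel: "f n x = f 0 x + (\<Sum>i<n. f (Suc i) x - f i x)" for n
      by (induction n) auto
    have "cmod (f n x) \<le> w x" for n
    proof -
      have "cmod (\<Sum>i<n. f (Suc i) x - f i x) \<le> (\<Sum>i<n. sqrt (s x) * (1 / 2) ^ i)"
        using dle by (intro sum_norm_le) (simp add: d_def)
      also have "\<dots> \<le> (\<Sum>i. sqrt (s x) * (1 / 2) ^ i)" using s0 by (intro sum_le_suminf sg) auto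
      also have "\<dots> = 2 * sqrt (s x)" by (subst suminf_mult) (auto simp: suminf_geometric)
      finally show ?thesis unfolding tel[of n] w_def by (intro norm_triangle_le) simp
    qed
    moreover have "summable (\<lambda>n. f (Suc n) x - f n x)"
      by (rule summable_comparison_test'[OF sg, of 0]) (use dle in \<open>simp add: d_def\<close>)
    then have "convergent (\<lambda>n. f 0 x + (\<Sum>i<n. f (Suc i) x - f i x))"
      by (intro convergent_add convergent_const) (simp add: summable_iff_convergent)
    then have "convergent (\<lambda>n. f n x)" by (simp only: tel[symmetric])
    ultimately show ?thesis by blast
  qed
  define g where "g x = lim (\<lambda>n. f n x)" for x
  have "(\<lambda>n. abs_L2 (f n)) \<longlonglongrightarrow> abs_L2 g"
  proof (rule L2_dominated_convergence(3))
    show "g \<in> borel_measurable borel" unfolding g_def[abs_def] using fm by (rule borel_measurable_lim_metric)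
    show "AE x in lborel. (\<lambda>n. f n x) \<longlonglongrightarrow> g x"
      using ae by eventually_elim (use key in \<open>auto simp: g_def convergent_LIMSEQ_iff\<close>)
    show "AE x in lborel. cmod (f n x) \<le> w x" for n
      using ae by eventually_elim (use key in auto)
    have wb: "norm ((w x)\<^sup>2) \<le> 2 * (cmod (f 0 x))\<^sup>2 + 8 * s x" for x
    proof -
      have "0 \<le> (cmod (f 0 x) - 2 * sqrt (s x))\<^sup>2" by simp
      then show ?thesis by (simp add: w_def power2_eq_square algebra_simps s_def)
    qed
    have wi: "integrable lborel (\<lambda>x. 2 * (cmod (f 0 x))\<^sup>2 + 8 * s x)"
      using f(1)[of 0] si by (simp add: square_integrable_def)
    have "w \<in> borel_measurable borel" 
    proof -
      have "s \<in> borel_measurable borel" using si by simp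
      then show ?thesis unfolding w_def[abs_def] using fm[of 0] by measurable
    qed
    then have "(\<lambda>x. (w x)\<^sup>2) \<in> borel_measurable lborel" by measurable
    then show "integrable lborel (\<lambda>x. (w x)\<^sup>2)" using wb by (rule integrable_dominated[OF wi])
  qed (use fm in auto)
  moreover have "Y = (\<lambda>n. abs_L2 (f n))" by (rule ext) (rule f(2))
  ultimately show ?thesis by (simp only: convergentI)
qed

instance L2 :: (euclidean_space) complete_space
proof
  fix X :: "nat \<Rightarrow> 'a L2" assume X: "Cauchy X"
  have "\<forall>k. \<exists>N. \<forall>m\<ge>N. \<forall>n\<ge>N. dist (X m) (X n) < (1 / 8) ^ k"
    using X unfolding Cauchy_def by simp
  then obtain N where N: "\<And>k m n. N k \<le> m \<Longrightarrow> N k \<le> n \<Longrightarrow> dist (X m) (X n) < (1 / 8) ^ k" by metis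
  \<comment> \<open>The partial sums of \<open>N i + 1\<close> increase strictly and dominate
    \<open>N k\<close>.\<close>
  define r where "r k = (\<Sum>i\<le>k. N i + 1)" for k
  have r: "strict_mono r" by (rule strict_mono_Suc_iff[THEN iffD2]) (simp add: r_def)
  have "N k \<le> r k" for k by (cases k) (auto simp: r_def)
  moreover have "r k \<le> r (Suc k)" for k by (simp add: r_def)
  ultimately have "norm ((X \<circ> r) (Suc k) - (X \<circ> r) k) \<le> (1 / 8) ^ k" for k
    using N[of k "r (Suc k)" "r k"] by (simp add: dist_norm less_imp_le) (meson less_imp_le order_trans)
  then have "convergent (X \<circ> r)" by (rule L2_fast_Cauchy_convergent)
  then obtain l where "(X \<circ> r) \<longlonglongrightarrow> l" by (auto simp: convergent_def)
  then have "X \<longlonglongrightarrow> l" by (rule Cauchy_converges_subseq[OF X r])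
  then show "convergent X" by (rule convergentI)
qed

instance L2 :: (euclidean_space) banach ..

text \<open>Mollification by Gaussians. A bounded function of bounded support decays at every
  exponential rate, so its convolution with a Gaussian has an extension that is bounded in all
  tubes. A majorant that is independent of \<open>n\<close> turns pointwise convergence into
  convergence in L2.\<close>

lemma Cc_in_closure_Sigma1:
  fixes \<phi> :: "'a::euclidean_space \<Rightarrow> complex"
  assumes c: "continuous_on UNIV \<phi>" and M: "\<And>x. cmod (\<phi> x) \<le> M" and supp: "\<And>x. m \<le> norm x \<Longrightarrow> \<phi> x = 0" and m: "0 \<le> m"
  shows "abs_L2 \<phi> \<in> closure (abs_L2 ` Sigma1)"
proof -
  have \<phi>m: "\<phi> \<in> borel_measurable borel" using c by (rule borel_measurable_continuous_onI)
  have M0: "0 \<le> M" using order_trans[OF norm_ge_zero M] .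
  have dec: "cmod (\<phi> x) \<le> M * exp (a * m) * exp (- (a * norm x))" if a: "0 \<le> a" for a x
  proof (cases "m \<le> norm x")
    case False
    then have "1 \<le> exp (a * m - a * norm x)" using a by (simp add: mult_left_mono)
    then have "M * 1 \<le> M * exp (a * m - a * norm x)" using M0 by (rule mult_left_mono)
    then show ?thesis using M[of x] by (simp add: exp_diff exp_minus divide_inverse)
  qed (simp add: supp M0)
  define \<epsilon> where "\<epsilon> n = 1 / real (Suc n)" for n
  have \<epsilon>: "0 < \<epsilon> n" "\<epsilon> n \<le> 1" for n by (auto simp: \<epsilon>_def)
  have \<epsilon>0: "\<epsilon> \<longlonglongrightarrow> 0" unfolding \<epsilon>_def by (rule LIMSEQ_Suc[OF lim_1_over_n])
  define c0 where "c0 = complex_of_real (1 / gauss_int TYPE('a))"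
  define f where "f n x = c0 * (LINT v|lborel. of_real (exp (- (norm v)\<^sup>2)) * \<phi> (x - \<epsilon> n *\<^sub>R v))" for n and x :: 'a
  have f1: "f n \<in> Sigma1" for n
  proof -
    define s where "s = 1 / \<epsilon> n"
    have s: "0 < s" using \<epsilon> by (simp add: s_def)
    define P where "P = (gauss_ext s :: 'a \<Rightarrow> 'a \<Rightarrow> complex)"
    have P: "entire P" unfolding P_def using s by (rule ent_gauss_ext)
    then have "\<forall>R. \<exists>C. tube R C P" by (simp add: entire_def)
    then obtain C where C: "\<And>R. tube R (C R) P" by metis
    define B where "B R u = C R * (M * exp ((R + 1) * m)) * exp (- (1 * norm u))" for R and u :: 'a
    have "entire (\<lambda>x y. LINT u|lborel. \<phi> u * P (x - u) y)"
    proof (rule ent_integral(1)[where B=B])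
      show "line_holomorphic (\<lambda>x y. \<phi> u * P (x - u) y)" for u using P by (intro hol_cmult hol_shift) (simp add: entire_def)
      show "(\<lambda>u. \<phi> u * P (x - u) y) \<in> borel_measurable lborel" for x y
      proof -
        have "continuous_on UNIV (\<lambda>u. \<phi> u * P (x - u) y)"
          by (intro continuous_intros c continuous_on_compose2[OF tube_continuous[OF P]]) auto
        then show ?thesis by (simp add: borel_measurable_continuous_onI)
      qed
      show "integrable lborel (B R)" for R unfolding B_def by (intro integrable_mult_right integrable_exp_norm) auto
      fix R :: real and u :: 'a assume R: "0 \<le> R"
      have C0: "0 \<le> C R" using tube_nonneg[OF C R] .
      have "tube R (cmod (\<phi> u) * (C R * exp (R * norm u))) (\<lambda>x y. \<phi> u * P (x - u) y)"
        by (intro tube_cmult tube_shift C R)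
      moreover have "cmod (\<phi> u) * (C R * exp (R * norm u)) \<le> B R u"
      proof -
        have "cmod (\<phi> u) * (C R * exp (R * norm u)) \<le> (M * exp ((R + 1) * m) * exp (- ((R + 1) * norm u))) * (C R * exp (R * norm u))"
          using C0 R by (intro mult_right_mono dec) auto
        also have "\<dots> = C R * (M * exp ((R + 1) * m)) * (exp (- ((R + 1) * norm u)) * exp (R * norm u))" by (simp only: mult_ac)
        also have "exp (- ((R + 1) * norm u)) * exp (R * norm u) = exp (- (1 * norm u))" by (simp add: algebra_simps flip: exp_add)
        finally show ?thesis by (simp only: B_def)
      qed
      ultimately show "tube R (B R u) (\<lambda>x y. \<phi> u * P (x - u) y)" by (rule tube_mono)
    qed
    from Sigma1_ent[OF this] have g: "(\<lambda>x. LINT u|lborel. \<phi> u * gaussc s (x - u)) \<in> Sigma1"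
      by (simp add: P_def gauss_ext_real)
    have "f n x = (c0 * of_real (s ^ DIM('a))) * (LINT u|lborel. \<phi> u * gaussc s (x - u))" for x
    proof -
      have "(LINT u|lborel. \<phi> u * gaussc s (x - u)) = \<bar>- \<epsilon> n\<bar> ^ DIM('a) *\<^sub>R (LINT v|lborel. \<phi> (x + (- \<epsilon> n) *\<^sub>R v) * gaussc s (x - (x + (- \<epsilon> n) *\<^sub>R v)))"
      proof (rule integral_affine)
        have "continuous_on UNIV (\<lambda>u. \<phi> u * gaussc s (x - u))" unfolding gaussc_def by (intro continuous_intros c)
        then show "(\<lambda>u. \<phi> u * gaussc s (x - u)) \<in> borel_measurable borel" by (rule borel_measurable_continuous_onI)
      qed (use \<epsilon>[of n] in simp)
      also have "(\<lambda>v. \<phi> (x + (- \<epsilon> n) *\<^sub>R v) * gaussc s (x - (x + (- \<epsilon> n) *\<^sub>R v))) = (\<lambda>v. of_real (exp (- (norm v)\<^sup>2)) * \<phi> (x - \<epsilon> n *\<^sub>R v))"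
        using \<epsilon>[of n] by (simp add: gaussc_def s_def fun_eq_iff)
      finally have e: "(LINT u|lborel. \<phi> u * gaussc s (x - u)) = of_real (\<epsilon> n ^ DIM('a)) * (LINT v|lborel. of_real (exp (- (norm v)\<^sup>2)) * \<phi> (x - \<epsilon> n *\<^sub>R v))"
        using \<epsilon>[of n] by (simp add: scaleR_conv_of_real)
      have one: "complex_of_real (s ^ DIM('a)) * of_real (\<epsilon> n ^ DIM('a)) = 1"
        unfolding of_real_mult[symmetric] power_mult_distrib[symmetric] using \<epsilon>[of n] by (simp add: s_def)
      have "(c0 * of_real (s ^ DIM('a))) * (LINT u|lborel. \<phi> u * gaussc s (x - u)) = c0 * ((of_real (s ^ DIM('a)) * of_real (\<epsilon> n ^ DIM('a))) * (LINT v|lborel. of_real (exp (- (norm v)\<^sup>2)) * \<phi> (x - \<epsilon> n *\<^sub>R v)))"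
        unfolding e by (simp only: mult.assoc)
      then show ?thesis unfolding one f_def mult_1 by (rule sym)
    qed
    then have "f n = (\<lambda>x. (c0 * of_real (s ^ DIM('a))) * (LINT u|lborel. \<phi> u * gaussc s (x - u)))" by auto
    then show ?thesis using Sigma1_cmult[OF g] by simp
  qed
  have int_m: "(\<lambda>v. complex_of_real (exp (- (norm v)\<^sup>2)) * \<phi> (x - e *\<^sub>R v)) \<in> borel_measurable lborel" for x e
  proof -
    have "continuous_on UNIV (\<lambda>v. complex_of_real (exp (- (norm v)\<^sup>2)) * \<phi> (x - e *\<^sub>R v))"
      by (intro continuous_intros continuous_on_compose2[OF c]) auto
    then show ?thesis by (simp add: borel_measurable_continuous_onI)
  qed
  have lim: "(\<lambda>n. f n x) \<longlonglongrightarrow> \<phi> x" for x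
  proof -
    have "(\<lambda>n. LINT v|lborel. of_real (exp (- (norm v)\<^sup>2)) * \<phi> (x - \<epsilon> n *\<^sub>R v)) \<longlonglongrightarrow> (LINT v|lborel. of_real (exp (- (norm v)\<^sup>2)) * \<phi> (x - 0 *\<^sub>R v))"
    proof (rule integral_dominated_convergence[where w="\<lambda>v. M * exp (- (norm v)\<^sup>2)", OF int_m int_m])
      show "integrable lborel (\<lambda>v::'a. M * exp (- (norm v)\<^sup>2))" by (intro integrable_mult_right integrable_gauss)
      have "(\<lambda>n. \<phi> (x - \<epsilon> n *\<^sub>R v)) \<longlonglongrightarrow> \<phi> (x - 0 *\<^sub>R v)" for v
      proof (rule continuous_on_tendsto_compose[OF c])
        show "(\<lambda>n. x - \<epsilon> n *\<^sub>R v) \<longlonglongrightarrow> x - 0 *\<^sub>R v" by (intro tendsto_intros \<epsilon>0)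
      qed auto
      then show "AE v in lborel. (\<lambda>n. of_real (exp (- (norm v)\<^sup>2)) * \<phi> (x - \<epsilon> n *\<^sub>R v)) \<longlonglongrightarrow> of_real (exp (- (norm v)\<^sup>2)) * \<phi> (x - 0 *\<^sub>R v)"
        by (intro always_eventually allI tendsto_mult tendsto_const)
      have "cmod (of_real (exp (- (norm v)\<^sup>2)) * \<phi> (x - \<epsilon> n *\<^sub>R v)) \<le> M * exp (- (norm v)\<^sup>2)" for n and v
        using mult_left_mono[OF M[of "x - \<epsilon> n *\<^sub>R v"], of "exp (- (norm v)\<^sup>2)"] by (simp add: norm_mult mult.commute)
      then show "AE v in lborel. cmod (of_real (exp (- (norm v)\<^sup>2)) * \<phi> (x - \<epsilon> n *\<^sub>R v)) \<le> M * exp (- (norm v)\<^sup>2)" for n by simp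
    qed
    moreover have "(LINT (v::'a)|lborel. complex_of_real (exp (- (norm v)\<^sup>2)) * \<phi> (x - 0 *\<^sub>R v)) = of_real (gauss_int TYPE('a)) * \<phi> x"
      by (simp only: scaleR_zero_left diff_zero integral_mult_left_zero integral_complex_of_real gauss_int_def)
    ultimately have "(\<lambda>n. f n x) \<longlonglongrightarrow> c0 * (of_real (gauss_int TYPE('a)) * \<phi> x)"
      unfolding f_def by (intro tendsto_mult tendsto_const) (simp only:)
    then show ?thesis using gauss_int_pos[where 'a='a] by (simp add: c0_def)
  qed
  define I where "I = (LINT (v::'a)|lborel. exp (1 * norm v) * exp (- (norm v)\<^sup>2))"
  have fb: "cmod (f n x) \<le> (cmod c0 * (M * exp m * I)) * exp (- norm x)" for n x
  proof -
    have b: "cmod (of_real (exp (- (norm v)\<^sup>2)) * \<phi> (x - \<epsilon> n *\<^sub>R v)) \<le> M * exp m * exp (- norm x) * (exp (1 * norm v) * exp (- (norm v)\<^sup>2))" for v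
    proof -
      have "cmod (\<phi> (x - \<epsilon> n *\<^sub>R v)) \<le> M * exp m * exp (- norm (x - \<epsilon> n *\<^sub>R v))" using dec[of 1] by simp
      also have "\<dots> \<le> M * exp m * (exp (norm v) * exp (- norm x))"
      proof -
        have "norm (\<epsilon> n *\<^sub>R v) \<le> norm v" using \<epsilon>[of n] by (simp add: mult_left_le_one_le)
        then have "- norm (x - \<epsilon> n *\<^sub>R v) \<le> norm v - norm x" using norm_triangle_ineq2[of x "\<epsilon> n *\<^sub>R v"] by linarith
        then show ?thesis using M0 by (intro mult_left_mono) (auto simp flip: exp_add)
      qed
      finally have "exp (- (norm v)\<^sup>2) * cmod (\<phi> (x - \<epsilon> n *\<^sub>R v)) \<le> exp (- (norm v)\<^sup>2) * (M * exp m * (exp (norm v) * exp (- norm x)))"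
        by (rule mult_left_mono) simp
      then show ?thesis by (simp add: norm_mult mult_ac)
    qed
    have i: "integrable lborel (\<lambda>v::'a. M * exp m * exp (- norm x) * (exp (1 * norm v) * exp (- (norm v)\<^sup>2)))"
      by (intro integrable_mult_right integrable_gauss_exp)
    have ii: "integrable lborel (\<lambda>v. complex_of_real (exp (- (norm v)\<^sup>2)) * \<phi> (x - \<epsilon> n *\<^sub>R v))"
      by (rule integrable_dominated[OF i int_m b])
    have "cmod (LINT v|lborel. of_real (exp (- (norm v)\<^sup>2)) * \<phi> (x - \<epsilon> n *\<^sub>R v)) \<le> (LINT v|lborel. cmod (of_real (exp (- (norm v)\<^sup>2)) * \<phi> (x - \<epsilon> n *\<^sub>R v)))"
      by (rule integral_norm_bound)
    also have "\<dots> \<le> (LINT (v::'a)|lborel. M * exp m * exp (- norm x) * (exp (1 * norm v) * exp (- (norm v)\<^sup>2)))"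
      by (rule integral_mono[OF integrable_norm[OF ii] i b])
    also have "\<dots> = M * exp m * exp (- norm x) * I" unfolding I_def by (rule integral_mult_right_zero)
    finally have "cmod c0 * cmod (LINT v|lborel. of_real (exp (- (norm v)\<^sup>2)) * \<phi> (x - \<epsilon> n *\<^sub>R v)) \<le> cmod c0 * (M * exp m * exp (- norm x) * I)"
      by (rule mult_left_mono) simp
    then show ?thesis unfolding f_def norm_mult by (simp only: mult_ac)
  qed
  have "(\<lambda>n. abs_L2 (f n)) \<longlonglongrightarrow> abs_L2 \<phi>"
  proof (rule L2_dominated_convergence(3)[where w="\<lambda>x. (cmod c0 * (M * exp m * I)) * exp (- norm x)"])
    show "integrable lborel (\<lambda>x::'a. ((cmod c0 * (M * exp m * I)) * exp (- norm x))\<^sup>2)"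
    proof -
      have "integrable lborel (\<lambda>x::'a. (cmod c0 * (M * exp m * I))\<^sup>2 * exp (- (2 * norm x)))"
        by (intro integrable_mult_right integrable_exp_norm) auto
      then show ?thesis by (simp add: power_mult_distrib exp_double[symmetric] flip: exp_double)
    qed
  qed (use \<phi>m Sigma1_measurable[OF f1] lim fb in auto)
  then show ?thesis unfolding closure_sequential using f1 by (intro exI[of _ "\<lambda>n. abs_L2 (f n)"]) auto
qed

text \<open>A measurable function is almost everywhere a limit of continuous ones. Composing these
  with the retraction \<open>tr\<close> onto the disc of radius \<open>M\<close> and multiplying by
  the cut-off \<open>ch\<close> keeps them continuous, makes them bounded with bounded support, and
  does not change the limit.\<close>

lemma bounded_support_in_closure_Sigma1:
  fixes h :: "'a::euclidean_space \<Rightarrow> complex"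
  assumes hm: "h \<in> borel_measurable borel" and M: "\<And>x. cmod (h x) \<le> M" "0 < M" and supp: "\<And>x. m < norm x \<Longrightarrow> h x = 0" "0 \<le> m"
  shows "abs_L2 h \<in> closure (abs_L2 ` Sigma1)"
proof -
  have "h \<in> borel_measurable lebesgue" using hm by (intro measurable_completion) simp
  then have "h measurable_on UNIV" by (rule lebesgue_measurable_imp_measurable_on) simp
  then obtain N g where N: "negligible N" and g: "\<And>n. continuous_on UNIV (g n)" and lim: "\<And>x. x \<notin> N \<Longrightarrow> (\<lambda>n. g n x) \<longlonglongrightarrow> h x"
    unfolding measurable_on_def by auto
  have "AE x in lebesgue. x \<notin> N" using N by (intro AE_not_in) (simp add: negligible_iff_null_sets)
  then have ae: "AE x in lborel. x \<notin> N" by (simp add: AE_completion_iff)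
  define tr where "tr z = z / of_real (max 1 (cmod z / M))" for z
  have trb: "cmod (tr z) \<le> M" for z
  proof -
    have "M * (cmod z / M) \<le> M * max 1 (cmod z / M)" using M(2) by (intro mult_left_mono) auto
    then have "cmod z \<le> M * max 1 (cmod z / M)" using M(2) by simp
    then show ?thesis by (simp add: tr_def norm_divide divide_le_eq)
  qed
  have trh: "tr (h x) = h x" for x using M(1)[of x] M(2) by (simp add: tr_def max_def)
  have trc: "continuous_on UNIV tr" unfolding tr_def
    by (intro continuous_intros) (use M(2) in auto)
  define ch where "ch x = max 0 (min 1 (m + 1 - norm x))" for x :: 'a
  have ch: "0 \<le> ch x" "ch x \<le> 1" "m + 1 \<le> norm x \<Longrightarrow> ch x = 0" "norm x \<le> m \<Longrightarrow> ch x = 1" for x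
    by (auto simp: ch_def)
  define \<phi> where "\<phi> n x = of_real (ch x) * tr (g n x)" for n x
  have \<phi>c: "continuous_on UNIV (\<phi> n)" for n
    unfolding \<phi>_def ch_def by (intro continuous_intros continuous_on_compose2[OF trc] g) auto
  have \<phi>b: "cmod (\<phi> n x) \<le> M" for n x
    using mult_mono[OF ch(2)[of x] trb[of "g n x"]] ch(1)[of x] by (simp add: \<phi>_def norm_mult)
  have \<phi>s: "\<phi> n x = 0" if "m + 1 \<le> norm x" for n x using ch(3)[OF that] by (simp add: \<phi>_def)
  have dec: "cmod (\<phi> n x) \<le> M * exp (m + 1) * exp (- norm x)" for n x
  proof (cases "m + 1 \<le> norm x")
    case False
    then have "M * 1 \<le> M * exp (m + 1 - norm x)" using M(2) by (intro mult_left_mono) auto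
    then show ?thesis using \<phi>b[of n x] by (simp add: exp_diff exp_minus divide_inverse)
  qed (use \<phi>s M(2) in simp)
  have lim': "(\<lambda>n. abs_L2 (\<phi> n)) \<longlonglongrightarrow> abs_L2 h"
  proof (rule L2_dominated_convergence(3)[where w="\<lambda>x. M * exp (m + 1) * exp (- norm x)"])
    show "integrable lborel (\<lambda>x::'a. (M * exp (m + 1) * exp (- norm x))\<^sup>2)"
    proof -
      have "integrable lborel (\<lambda>x::'a. (M * exp (m + 1))\<^sup>2 * exp (- (2 * norm x)))"
        by (intro integrable_mult_right integrable_exp_norm) auto
      moreover have "(exp (- norm x))\<^sup>2 = exp (- (2 * norm x))" for x :: 'a by (simp add: power2_eq_square flip: exp_add)
      ultimately show ?thesis by (simp add: power_mult_distrib)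
    qed
    show "AE x in lborel. (\<lambda>n. \<phi> n x) \<longlonglongrightarrow> h x"
      using ae
    proof eventually_elim
      case (elim x)
      have "(\<lambda>n. tr (g n x)) \<longlonglongrightarrow> tr (h x)"
        by (rule continuous_on_tendsto_compose[OF trc lim[OF elim]]) auto
      then have "(\<lambda>n. \<phi> n x) \<longlonglongrightarrow> of_real (ch x) * h x" unfolding \<phi>_def trh by (intro tendsto_intros)
      moreover have "of_real (ch x) * h x = h x" using ch(4)[of x] supp(1)[of x] by (cases "norm x \<le> m") auto
      ultimately show ?case by simp
    qed
  qed (use hm dec borel_measurable_continuous_onI[OF \<phi>c] in auto)
  have mem: "abs_L2 (\<phi> n) \<in> closure (abs_L2 ` Sigma1)" for n
    by (rule Cc_in_closure_Sigma1[OF \<phi>c \<phi>b, of "m + 1"]) (use supp(2) \<phi>s in auto)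
  show ?thesis by (rule closed_sequentially[OF closed_closure mem lim'])
qed

lemma Sigma1_dense: "closure (abs_L2 ` (Sigma1 :: ('a::euclidean_space \<Rightarrow> complex) set)) = UNIV"
proof -
  have "u \<in> closure (abs_L2 ` Sigma1)" for u :: "'a L2"
  proof -
    obtain g where g: "square_integrable g" "u = abs_L2 g" using abs_L2_cases by blast
    have gm: "g \<in> borel_measurable borel" using g(1) by (simp add: square_integrable_def)
    define h where "h n x = (if norm x \<le> real n \<and> cmod (g x) \<le> real n then g x else 0)" for n x
    have hm: "h n \<in> borel_measurable borel" for n
      unfolding h_def[abs_def] using gm by measurable
    have lim: "(\<lambda>n. abs_L2 (h n)) \<longlonglongrightarrow> abs_L2 g"
    proof (rule L2_dominated_convergence(3)[where w="\<lambda>x. cmod (g x)"])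
      have "(\<lambda>n. h n x) \<longlonglongrightarrow> g x" for x
      proof (rule tendsto_eventually)
        obtain k where k: "max (norm x) (cmod (g x)) \<le> real k" using real_arch_simple by blast
        show "\<forall>\<^sub>F n in sequentially. h n x = g x"
          using eventually_ge_at_top[of k]
        proof eventually_elim
          case (elim n)
          then have "real k \<le> real n" by simp
          with k show ?case by (simp add: h_def)
        qed
      qed
      then show "AE x in lborel. (\<lambda>n. h n x) \<longlonglongrightarrow> g x" by simp
      show "AE x in lborel. cmod (h n x) \<le> cmod (g x)" for n by (simp add: h_def)
    qed (use gm hm g in \<open>auto simp: square_integrable_def\<close>)
    have mem: "abs_L2 (h n) \<in> closure (abs_L2 ` Sigma1)" for n
      by (rule bounded_support_in_closure_Sigma1[OF hm, of n "real n + 1" "real n"]) (auto simp: h_def)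
    show ?thesis unfolding g(2) by (rule closed_sequentially[OF closed_closure mem lim])
  qed
  then show ?thesis by auto
qed

text \<open>If the operators differ at a test function, the difference \<open>w\<close> of the
  values is orthogonal to the conjugates of all test functions, as \<open>L2_functional\<close> is a
  bilinear pairing. These conjugates are dense, and one within less than \<open>norm w\<close> of
  \<open>w\<close> contradicts Cauchy-Schwarz. Continuity then extends the agreement to all of
  L2.\<close>

lemma clinear_L2_ext:
  assumes T: "clinear_L2 T" "\<And>f. norm (T f) \<le> K * norm f" and T': "clinear_L2 T'" "\<And>f. norm (T' f) \<le> K' * norm f"
    and eq: "L2_restrict T = L2_restrict T'"
  shows "T = (T' :: 'a::euclidean_space L2 \<Rightarrow> 'a L2)"
proof -
  have on_dense: "T (abs_L2 f) = T' (abs_L2 f)" if f: "f \<in> Sigma1" for f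
  proof (rule ccontr)
    assume ne: "T (abs_L2 f) \<noteq> T' (abs_L2 f)"
    define w where "w = T (abs_L2 f) - T' (abs_L2 f)"
    have w0: "0 < norm w" using ne by (simp add: w_def)
    obtain g where g: "square_integrable g" "w = abs_L2 g" using abs_L2_cases by blast
    have "abs_L2 (\<lambda>x. cnj (g x)) \<in> closure (abs_L2 ` Sigma1)" by (simp add: Sigma1_dense)
    from this[unfolded closure_approachable, rule_format, OF w0]
    obtain \<phi> where \<phi>: "\<phi> \<in> Sigma1" "norm (abs_L2 \<phi> - abs_L2 (\<lambda>x. cnj (g x))) < norm w"
      by (auto simp: dist_norm)
    have \<phi>s: "square_integrable \<phi>" using \<phi>(1) by (rule Sigma1_square_integrable)
    obtain u where u: "square_integrable u" "T (abs_L2 f) = abs_L2 u" using abs_L2_cases by blast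
    obtain u' where u': "square_integrable u'" "T' (abs_L2 f) = abs_L2 u'" using abs_L2_cases by blast
    have "L2_functional (T (abs_L2 f)) \<phi> = L2_functional (T' (abs_L2 f)) \<phi>"
      using fun_cong[OF eq, of f] f by (simp add: L2_restrict_def)
    then have "cip (abs_L2 u) (abs_L2 (\<lambda>x. cnj (\<phi> x))) = cip (abs_L2 u') (abs_L2 (\<lambda>x. cnj (\<phi> x)))"
      using u u' \<phi>(1) \<phi>s by (simp add: L2_functional.abs_eq L2_rel_self cip_abs_L2 square_integrable_cnj)
    then have orth: "cip w (abs_L2 (\<lambda>x. cnj (\<phi> x))) = 0"
      by (simp only: w_def u u' cip_diff_left right_minus_eq)
    have "(norm (abs_L2 (\<lambda>x. cnj (\<phi> x)) - w))\<^sup>2 = (norm (abs_L2 \<phi> - abs_L2 (\<lambda>x. cnj (g x))))\<^sup>2"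
    proof -
      have d: "square_integrable (\<lambda>x. p x - q x)" if "square_integrable p" "square_integrable q" for p q :: "'a \<Rightarrow> complex"
        using square_integrable_add[OF that(1) square_integrable_cmult[OF that(2), of "- 1"]] by simp
      have "cmod (cnj (\<phi> x) - g x) = cmod (\<phi> x - cnj (g x))" for x
        using complex_mod_cnj[of "\<phi> x - cnj (g x)"] by simp
      then show ?thesis using \<phi>s g
        by (simp add: g(2) norm_abs_L2 d square_integrable_cnj flip: abs_L2_diff)
    qed
    then have "norm (w - abs_L2 (\<lambda>x. cnj (\<phi> x))) < norm w"
      using \<phi>(2) by (metis norm_minus_commute norm_ge_zero power2_eq_iff_nonneg)
    then have "norm w * norm (w - abs_L2 (\<lambda>x. cnj (\<phi> x))) < norm w * norm w" using w0 by simp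
    moreover have "cip w (w - abs_L2 (\<lambda>x. cnj (\<phi> x))) = of_real ((norm w)\<^sup>2)"
      by (simp only: cip_diff_right orth cip_self diff_zero)
    then have "(norm w)\<^sup>2 \<le> norm w * norm (w - abs_L2 (\<lambda>x. cnj (\<phi> x)))"
      using cip_cauchy_schwarz[of w "w - abs_L2 (\<lambda>x. cnj (\<phi> x))"] by (simp add: norm_power)
    ultimately show False by (simp add: power2_eq_square)
  qed
  have "continuous_on UNIV T" "continuous_on UNIV T'"
    using clinear_L2_bounded_linear[OF T] clinear_L2_bounded_linear[OF T'] by (auto intro: linear_continuous_on)
  then have "closed {u. T u = T' u}" by (intro closed_Collect_eq)
  then have "closure (abs_L2 ` Sigma1) \<subseteq> {u. T u = T' u}"
    by (rule closure_minimal[rotated]) (use on_dense in auto)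
  then show ?thesis unfolding Sigma1_dense by auto
qed


section \<open>Orthogonal families and compact operators\<close>

definition orthofam :: "(nat \<Rightarrow> 'a::euclidean_space L2) \<Rightarrow> bool" where
  "orthofam v \<longleftrightarrow> (\<forall>i. v i = 0 \<or> norm (v i) = 1) \<and> (\<forall>i j. i \<noteq> j \<longrightarrow> cip (v i) (v j) = 0)"

definition proj :: "(nat \<Rightarrow> 'a::euclidean_space L2) \<Rightarrow> nat \<Rightarrow> 'a L2 \<Rightarrow> 'a L2" where
  "proj v N f = (\<Sum>i<N. cscale (cip f (v i)) (v i))"

lemma cip_zero [simp]: "cip 0 f = 0" "cip f 0 = 0"
  using bounded_bilinear.zero_left[OF bounded_bilinear_cip] bounded_bilinear.zero_right[OF bounded_bilinear_cip] by blast+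

lemma cip_sum_left: "cip (sum f I) g = (\<Sum>i\<in>I. cip (f i) g)"
  by (rule bounded_bilinear.sum_left[OF bounded_bilinear_cip])

lemma cip_sum_right: "cip g (sum f I) = (\<Sum>i\<in>I. cip g (f i))"
  by (rule bounded_bilinear.sum_right[OF bounded_bilinear_cip])

lemma cip_sum_cscale_right: "cip g (\<Sum>i\<in>I. cscale (c i) (v i)) = (\<Sum>i\<in>I. cnj (c i) * cip g (v i))"
  by (simp only: cip_sum_right cip_cscale_right)

lemma orthofam_orthogonal: "orthofam v \<Longrightarrow> i \<noteq> j \<Longrightarrow> cip (v i) (v j) = 0"
  by (simp add: orthofam_def)

lemma orthofam_norm: "orthofam v \<Longrightarrow> norm (v i) \<le> 1"
  unfolding orthofam_def by (metis norm_zero order_refl zero_le_one)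

text \<open>Both sides vanish if \<open>v i = 0\<close>. This removes the norm factors of
  \<open>cip_sum_orthofam\<close> without a case distinction each time.\<close>

lemma orthofam_cip_self: "orthofam v \<Longrightarrow> cip f (v i) * of_real ((norm (v i))\<^sup>2) = cip f (v i)"
  unfolding orthofam_def by (cases "v i = 0") (simp_all, metis mult.right_neutral of_real_1 power_one)

lemma cip_sum_orthofam:
  assumes "orthofam v" "finite I"
  shows "cip (\<Sum>i\<in>I. cscale (c i) (v i)) (v j) = (if j \<in> I then c j * of_real ((norm (v j))\<^sup>2) else 0)"
proof -
  have "cip (\<Sum>i\<in>I. cscale (c i) (v i)) (v j) = (\<Sum>i\<in>I. if i = j then c j * of_real ((norm (v j))\<^sup>2) else 0)"
    unfolding cip_sum_left by (intro sum.cong) (auto simp: cip_cscale_left cip_self orthofam_orthogonal[OF assms(1)])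
  then show ?thesis using assms(2) by (simp add: sum.delta')
qed

lemma norm_sum_orthofam:
  assumes "orthofam v" "finite I"
  shows "(norm (\<Sum>i\<in>I. cscale (c i) (v i)))\<^sup>2 = (\<Sum>i\<in>I. (cmod (c i))\<^sup>2 * (norm (v i))\<^sup>2)"
proof -
  let ?x = "\<Sum>i\<in>I. cscale (c i) (v i)"
  have "cip ?x ?x = (\<Sum>j\<in>I. cnj (c j) * cip ?x (v j))"
    by (rule cip_sum_cscale_right)
  also have "\<dots> = (\<Sum>j\<in>I. of_real ((cmod (c j))\<^sup>2 * (norm (v j))\<^sup>2))"
    by (intro sum.cong) (auto simp: cip_sum_orthofam[OF assms] complex_norm_square mult.commute mult.left_commute simp del: of_real_power)
  finally have "complex_of_real ((norm ?x)\<^sup>2) = of_real (\<Sum>j\<in>I. (cmod (c j))\<^sup>2 * (norm (v j))\<^sup>2)"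
    unfolding cip_self of_real_sum .
  then show ?thesis by (simp only: of_real_eq_iff)
qed

lemma norm_sum_orthofam_le:
  assumes "orthofam v" "finite I"
  shows "(norm (\<Sum>i\<in>I. cscale (c i) (v i)))\<^sup>2 \<le> (\<Sum>i\<in>I. (cmod (c i))\<^sup>2)"
  unfolding norm_sum_orthofam[OF assms]
proof (rule sum_mono)
  fix i
  have "(norm (v i))\<^sup>2 \<le> 1" using orthofam_norm[OF assms(1), of i] by (simp add: power_le_one)
  then show "(cmod (c i))\<^sup>2 * (norm (v i))\<^sup>2 \<le> (cmod (c i))\<^sup>2" by (rule mult_left_le) simp
qed

lemma pythagoras: "cip f g = 0 \<Longrightarrow> (norm (f + g))\<^sup>2 = (norm f)\<^sup>2 + (norm g)\<^sup>2"
  using Re_cip[of f g] Re_cip[of g f] by (simp add: power2_norm_eq_inner inner_add_left inner_add_right inner_commute)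

lemma cip_minus_proj:
  assumes "orthofam v" "i < N" shows "cip (f - proj v N f) (v i) = 0"
  unfolding cip_diff_left proj_def cip_sum_orthofam[OF assms(1) finite_lessThan]
  using assms(2) by (simp add: orthofam_cip_self[OF assms(1)] del: of_real_power)

lemma norm_proj_pythagoras:
  assumes "orthofam v" shows "(norm f)\<^sup>2 = (norm (f - proj v N f))\<^sup>2 + (norm (proj v N f))\<^sup>2"
proof -
  have "cip (f - proj v N f) (proj v N f) = (\<Sum>i<N. cnj (cip f (v i)) * cip (f - proj v N f) (v i))"
    unfolding proj_def[of v N f] by (rule cip_sum_cscale_right)
  also have "\<dots> = 0" using cip_minus_proj[OF assms] by (intro sum.neutral) auto
  finally show ?thesis using pythagoras[of "f - proj v N f" "proj v N f"] by simp
qed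

lemma norm_minus_proj_le:
  assumes "orthofam v" shows "norm (f - proj v N f) \<le> norm f"
proof (rule power2_le_imp_le)
  show "(norm (f - proj v N f))\<^sup>2 \<le> (norm f)\<^sup>2" unfolding norm_proj_pythagoras[OF assms, of f N] by simp
qed simp

lemma bessel:
  assumes "orthofam v" "finite I" shows "(\<Sum>i\<in>I. (cmod (cip f (v i)))\<^sup>2) \<le> (norm f)\<^sup>2"
proof -
  obtain N where N: "I \<subseteq> {..<N}" using finite_nat_iff_bounded assms(2) by blast
  have "(\<Sum>i\<in>I. (cmod (cip f (v i)))\<^sup>2) \<le> (\<Sum>i<N. (cmod (cip f (v i)))\<^sup>2)"
    using N by (intro sum_mono2) auto
  also have "\<dots> = (\<Sum>i<N. (cmod (cip f (v i)))\<^sup>2 * (norm (v i))\<^sup>2)"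
  proof (rule sum.cong)
    fix i
    have "v i = 0 \<or> norm (v i) = 1" using assms(1) by (simp add: orthofam_def)
    then show "(cmod (cip f (v i)))\<^sup>2 = (cmod (cip f (v i)))\<^sup>2 * (norm (v i))\<^sup>2" by auto
  qed simp
  also have "\<dots> = (norm (proj v N f))\<^sup>2" unfolding proj_def by (rule norm_sum_orthofam[OF assms(1) finite_lessThan, symmetric])
  also have "\<dots> \<le> (norm f)\<^sup>2" unfolding norm_proj_pythagoras[OF assms(1), of f N] by simp
  finally show ?thesis .
qed

lemma clinear_proj: "clinear_L2 (proj v N)"
  unfolding clinear_L2_iff proj_def
  by (auto simp: cip_add_left L2.scale_left_distrib sum.distrib cip_cscale_left L2.scale_sum_right)

lemma gram_schmidt:
  assumes "finite B"
  shows "\<exists>v. orthofam v \<and> (\<forall>i\<ge>card B. v i = 0) \<and> (\<forall>f\<in>L2.span B. proj v (card B) f = f)"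
  using assms
proof (induction B rule: finite_induct)
  case empty
  show ?case by (rule exI[of _ "\<lambda>_. 0"]) (simp add: orthofam_def proj_def)
next
  case (insert b B)
  then obtain v where v: "orthofam v" "\<And>i. card B \<le> i \<Longrightarrow> v i = 0" "\<And>f. f \<in> L2.span B \<Longrightarrow> proj v (card B) f = f" by blast
  define n where "n = card B"
  define d where "d = b - proj v n b"
  \<comment> \<open>As \<open>inverse 0 = 0\<close>, a vector \<open>b\<close> that depends on its
    predecessors contributes the zero vector.\<close>
  define r where "r = cscale (of_real (inverse (norm d))) d"
  define v' where "v' = v(n := r)"
  have nr: "r = 0 \<or> norm r = 1" by (cases "d = 0") (simp_all add: r_def norm_cscale norm_inverse)
  have dr: "cscale (of_real (norm d)) r = d" by (cases "d = 0") (auto simp: r_def)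
  have orth: "cip r (v i) = 0" for i
  proof (cases "i < n")
    case True
    then show ?thesis using cip_minus_proj[OF v(1) True, of b] by (simp add: r_def d_def cip_cscale_left)
  qed (use v(2)[of i] in \<open>simp add: n_def\<close>)
  have orth': "cip (v i) r = 0" for i using orth[of i] by (subst cip_cnj) simp
  have ov: "orthofam v'" using v(1) nr orth orth' by (simp add: orthofam_def v'_def)
  have P: "proj v' (Suc n) f = proj v n f + cscale (cip f r) r" for f
    by (simp add: proj_def v'_def)
  have Pr: "cip (proj v n f) r = 0" for f
    by (simp add: proj_def cip_sum_left cip_cscale_left orth')
  have "proj v' (Suc n) f = f" if "f \<in> L2.span (insert b B)" for f
  proof -
    have "L2.span (insert b B) \<subseteq> {f. proj v' (Suc n) f = f}"
    proof (rule L2.span_minimal)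
      show "L2.subspace {f. proj v' (Suc n) f = f}"
      proof (rule L2.subspaceI)
        show "0 \<in> {f. proj v' (Suc n) f = f}" by (simp add: proj_def)
      qed (use clinear_proj[of v' "Suc n"] in \<open>simp_all add: clinear_L2_add clinear_L2_cscale\<close>)
      show "insert b B \<subseteq> {f. proj v' (Suc n) f = f}"
      proof (intro insert_subsetI subsetI CollectI)
        have "b = proj v n b + d" by (simp add: d_def)
        then have "cip b r = cip d r" using Pr[of b] cip_add_left[of "proj v n b" d r] by simp
        also have "\<dots> = of_real (norm d) * cip r r" by (subst dr[symmetric]) (rule cip_cscale_left)
        finally have "cscale (cip b r) r = d" using nr dr by (auto simp: cip_self)
        then show "proj v' (Suc n) b = b" by (simp add: P d_def)
      next
        fix f assume "f \<in> B"
        then have f: "proj v n f = f" using v(3)[of f] L2.span_base n_def by blast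
        then have "cip f r = 0" using Pr[of f] by simp
        then show "proj v' (Suc n) f = f" using f by (simp add: P)
      qed
    qed
    then show ?thesis using that by auto
  qed
  moreover have "v' i = 0" if "Suc n \<le> i" for i using that v(2)[of i] by (simp add: v'_def n_def)
  ultimately show ?case using ov insert(1,2) by (intro exI[of _ v']) (simp add: n_def)
qed

section \<open>Operator norms and a criterion for compactness\<close>

lemma op_norm_le:
  assumes "\<And>f. norm (T f) \<le> K * norm f" "0 \<le> K" shows "op_norm T \<le> ennreal K"
  unfolding op_norm_def
proof (rule SUP_least)
  fix f :: "'a L2" assume "f \<in> cball 0 1"
  then have "norm (T f) \<le> K * 1" using assms(1)[of f] mult_left_mono[OF _ assms(2), of "norm f" 1] by simp
  then show "ennreal (norm (T f)) \<le> ennreal K" by (simp add: ennreal_leI)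
qed

lemma op_norm_bound:
  assumes T: "clinear_L2 T" and K: "op_norm T \<le> ennreal K" "0 \<le> K" shows "norm (T f) \<le> K * norm f"
proof (cases "f = 0")
  case True
  then show ?thesis using linear_0[OF clinear_L2_linear[OF T]] by simp
next
  case False
  let ?g = "f /\<^sub>R norm f"
  have "?g \<in> cball 0 1" using False by simp
  then have "ennreal (norm (T ?g)) \<le> op_norm T" unfolding op_norm_def by (rule SUP_upper)
  then have "norm (T ?g) \<le> K" using K order_trans by (metis ennreal_le_iff)
  then have "norm (T f) / norm f \<le> K" by (simp add: linear_scale[OF clinear_L2_linear[OF T]] divide_inverse mult.commute)
  then show ?thesis using False by (simp add: divide_le_eq)
qed

lemma clinear_L2_zero: "clinear_L2 (\<lambda>_. 0)" by (simp add: clinear_L2_iff)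

lemma clinear_L2_diff: "clinear_L2 T \<Longrightarrow> clinear_L2 S \<Longrightarrow> clinear_L2 (\<lambda>f. T f - S f)"
  by (simp add: clinear_L2_iff L2.scale_right_diff_distrib)

lemma clinear_L2_comp: "clinear_L2 T \<Longrightarrow> clinear_L2 S \<Longrightarrow> clinear_L2 (T \<circ> S)"
  by (simp add: clinear_L2_iff)

lemma op_norm_finite_bound:
  assumes "clinear_L2 T" "op_norm T < \<infinity>" shows "\<exists>K\<ge>0. \<forall>f. norm (T f) \<le> K * norm f"
proof -
  have "op_norm T = ennreal (enn2real (op_norm T))" using assms(2) by (simp add: ennreal_enn2real_if)
  then show ?thesis using op_norm_bound[OF assms(1), of "enn2real (op_norm T)"] enn2real_nonneg by (metis order_refl)
qed

lemma compact_combinations: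
  fixes v :: "nat \<Rightarrow> 'a::euclidean_space L2"
  shows "compact {\<Sum>i<n. cscale (z i) (v i) |z. \<forall>i<n. cmod (z i) \<le> K}"
proof (induction n)
  case (Suc n)
  have cont: "continuous_on S (\<lambda>z. cscale z (v n))" for S
  proof -
    have "bounded_linear (\<lambda>z. cscale z (v n))"
      by (rule bounded_linear_intro[where K="norm (v n)"])
        (auto simp: L2.scale_left_distrib scaleR_L2_def scaleR_conv_of_real norm_cscale)
    then show ?thesis by (rule linear_continuous_on)
  qed
  have "compact ((\<lambda>z. cscale z (v n)) ` cball 0 K)" by (intro compact_continuous_image cont compact_cball)
  from compact_sums[OF Suc this]
  have "compact {x + y |x y. x \<in> {\<Sum>i<n. cscale (z i) (v i) |z. \<forall>i<n. cmod (z i) \<le> K} \<and> y \<in> (\<lambda>z. cscale z (v n)) ` cball 0 K}" .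
  also have "{x + y |x y. x \<in> {\<Sum>i<n. cscale (z i) (v i) |z. \<forall>i<n. cmod (z i) \<le> K} \<and> y \<in> (\<lambda>z. cscale z (v n)) ` cball 0 K}
      = {\<Sum>i<Suc n. cscale (z i) (v i) |z. \<forall>i<Suc n. cmod (z i) \<le> K}" (is "?L = ?R")
  proof (intro equalityI subsetI)
    fix x assume "x \<in> ?L"
    then obtain z w where zw: "x = (\<Sum>i<n. cscale (z i) (v i)) + cscale w (v n)" "\<forall>i<n. cmod (z i) \<le> K" "cmod w \<le> K" by auto
    have "(\<Sum>i<n. cscale ((z(n := w)) i) (v i)) = (\<Sum>i<n. cscale (z i) (v i))" by (intro sum.cong) auto
    then have "x = (\<Sum>i<Suc n. cscale ((z(n := w)) i) (v i))" using zw(1) by simp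
    moreover have "\<forall>i<Suc n. cmod ((z(n := w)) i) \<le> K" using zw by (auto simp: less_Suc_eq)
    ultimately show "x \<in> ?R" by blast
  next
    fix x assume "x \<in> ?R"
    then obtain z where z: "x = (\<Sum>i<Suc n. cscale (z i) (v i))" "\<forall>i<Suc n. cmod (z i) \<le> K" by blast
    have "(\<Sum>i<n. cscale (z i) (v i)) \<in> {\<Sum>i<n. cscale (z i) (v i) |z. \<forall>i<n. cmod (z i) \<le> K}" using z(2) by auto
    moreover have "cscale (z n) (v n) \<in> (\<lambda>z. cscale z (v n)) ` cball 0 K" using z(2) by auto
    ultimately show "x \<in> ?L" unfolding z(1) sum.lessThan_Suc by blast
  qed
  finally show ?case .
qed simp

text \<open>\<open>T0\<close> maps the unit ball into the combinations of finitely many orthogonal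
  vectors with coefficients bounded by \<open>\<bar>K\<bar>\<close>, a compact set. A finite net of
  mesh \<open>e/4\<close> for that set is one of mesh \<open>e/2\<close> for the image under
  \<open>T\<close>, and completeness of L2 turns total boundedness into compactness.\<close>

lemma compact_op_approx:
  assumes T: "clinear_L2 T"
    and approx: "\<And>\<epsilon>. 0 < \<epsilon> \<Longrightarrow> \<exists>B K T0. finite B \<and> range T0 \<subseteq> L2.span B \<and> (\<forall>f. norm (T0 f) \<le> K * norm f) \<and> (\<forall>f. norm (T f - T0 f) \<le> \<epsilon> * norm f)"
  shows "compact_op (T :: 'a::euclidean_space L2 \<Rightarrow> 'a L2)"
  unfolding compact_op_def compact_eq_totally_bounded
proof (intro conjI T allI impI)
  show "complete (closure (T ` cball 0 1))" by (simp add: complete_eq_closed)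
  fix e :: real assume e: "0 < e"
  obtain B K T0 where B: "finite B" "range T0 \<subseteq> L2.span B" and K: "\<And>f. norm (T0 f) \<le> K * norm f" and d: "\<And>f. norm (T f - T0 f) \<le> e/4 * norm f"
    using approx[of "e/4"] e by auto
  obtain v where v: "orthofam v" "\<And>f. f \<in> L2.span B \<Longrightarrow> proj v (card B) f = f" using gram_schmidt[OF B(1)] by blast
  let ?C = "{\<Sum>i<card B. cscale (z i) (v i) |z. \<forall>i<card B. cmod (z i) \<le> \<bar>K\<bar>}"
  have T0: "T0 f \<in> ?C" if "f \<in> cball 0 1" for f
  proof -
    have "norm (T0 f) \<le> \<bar>K\<bar> * norm f" using K[of f] mult_right_mono[OF abs_ge_self[of K] norm_ge_zero[of f]] by linarith
    also have "\<dots> \<le> \<bar>K\<bar> * 1" using that by (intro mult_left_mono) auto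
    finally have n: "norm (T0 f) \<le> \<bar>K\<bar>" by simp
    have a: "cmod (cip (T0 f) (v i)) \<le> \<bar>K\<bar>" for i
    proof -
      have "cmod (cip (T0 f) (v i)) \<le> norm (T0 f) * norm (v i)" by (rule cip_cauchy_schwarz)
      also have "\<dots> \<le> norm (T0 f)" using orthofam_norm[OF v(1), of i] by (intro mult_left_le) auto
      finally show ?thesis using n by simp
    qed
    have "T0 f = (\<Sum>i<card B. cscale (cip (T0 f) (v i)) (v i))" using v(2)[OF subsetD[OF B(2) rangeI]] by (simp add: proj_def)
    with a show ?thesis by (intro CollectI exI[of _ "\<lambda>i. cip (T0 f) (v i)"]) simp
  qed
  have "\<forall>e>0. \<exists>k. finite k \<and> ?C \<subseteq> (\<Union>x\<in>k. ball x e)" using compact_combinations[where n="card B" and v=v and K="\<bar>K\<bar>"] unfolding compact_eq_totally_bounded by blast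
  then obtain k where k: "finite k" "?C \<subseteq> (\<Union>x\<in>k. ball x (e/4))" using e by (meson zero_less_divide_iff zero_less_numeral)
  have "T ` cball 0 1 \<subseteq> (\<Union>x\<in>k. cball x (e/2))"
  proof
    fix y assume "y \<in> T ` cball 0 1"
    then obtain f where f: "f \<in> cball 0 1" "y = T f" by blast
    obtain x where x: "x \<in> k" "dist x (T0 f) < e/4" using T0[OF f(1)] k(2) by auto
    have "dist (T0 f) (T f) \<le> e/4 * norm f" using d[of f] by (simp add: dist_norm norm_minus_commute)
    also have "\<dots> \<le> e/4 * 1" using f(1) e by (intro mult_left_mono) auto
    finally have "dist x y \<le> e/2" using x(2) dist_triangle[of x "T f" "T0 f"] f(2) by simp
    then show "y \<in> (\<Union>x\<in>k. cball x (e/2))" using x(1) by auto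
  qed
  moreover have "closed (\<Union>x\<in>k. cball x (e/2))" using k(1) by (intro closed_UN) auto
  ultimately have "closure (T ` cball 0 1) \<subseteq> (\<Union>x\<in>k. cball x (e/2))" by (rule closure_minimal)
  also have "\<dots> \<subseteq> (\<Union>x\<in>k. ball x e)" using e by (intro UN_mono) auto
  finally show "\<exists>k. finite k \<and> closure (T ` cball 0 1) \<subseteq> (\<Union>x\<in>k. ball x e)" using k(1) by blast
qed

lemma compact_op_bounded:
  assumes "compact_op T" shows "\<exists>K\<ge>0. \<forall>f. norm (T f) \<le> K * norm f"
proof -
  have T: "clinear_L2 T" using assms by (simp add: compact_op_def)
  have "bounded (T ` cball 0 1)" using assms compact_imp_bounded bounded_subset closure_subset unfolding compact_op_def by blast
  then obtain K where K: "0 < K" "\<And>f. f \<in> cball 0 1 \<Longrightarrow> norm (T f) \<le> K" unfolding bounded_pos by auto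
  have "op_norm T \<le> ennreal K" unfolding op_norm_def using K(2) by (intro SUP_least ennreal_leI) auto
  then show ?thesis using op_norm_bound[OF T] K(1) by (intro exI[of _ K]) auto
qed


section \<open>Singular vectors of compact operators\<close>

text \<open>For \<open>z = t * A\<close> the left side is linear and the right side quadratic in
  \<open>t\<close>, so a small positive \<open>t\<close> excludes
  \<open>A \<noteq> 0\<close>.\<close>

lemma cip_zero_scale_bound:
  fixes A :: complex
  assumes "\<And>z. 2 * Re (cnj z * A) \<le> C * (cmod z)\<^sup>2" shows "A = 0"
proof (rule ccontr)
  assume A: "A \<noteq> 0"
  define t where "t = 1 / (\<bar>C\<bar> + 1)"
  have t: "0 < t" "C * t < 2"
  proof -
    have "C < 2 * (\<bar>C\<bar> + 1)" using abs_ge_self[of C] abs_ge_zero[of C] by (simp add: distrib_left)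
    then show "C * t < 2" "0 < t" by (simp_all add: t_def divide_less_eq)
  qed
  have e: "Re (cnj (of_real t * A) * A) = t * (cmod A)\<^sup>2"
    unfolding cmod_power2 by (simp add: power2_eq_square algebra_simps)
  have "2 * (t * (cmod A)\<^sup>2) \<le> C * (cmod (of_real t * A))\<^sup>2"
    using assms[of "of_real t * A"] by (simp only: e)
  also have "\<dots> = (C * t) * (t * (cmod A)\<^sup>2)" using t by (simp add: norm_mult power_mult_distrib power2_eq_square)
  also have "\<dots> < 2 * (t * (cmod A)\<^sup>2)" using A t by (intro mult_strict_right_mono) auto
  finally show False by simp
qed

lemma orthogonal_subspace:
  "cip f u = 0 \<Longrightarrow> cip g u = 0 \<Longrightarrow> cip (f + g) u = 0" "cip f u = 0 \<Longrightarrow> cip (cscale c f) u = 0"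
  "cip f u = 0 \<Longrightarrow> cip (f /\<^sub>R r) u = 0"
  by (simp_all add: cip_add_left cip_cscale_left scaleR_L2_def)

text \<open>Compactness makes the images of a maximizing sequence converge along a subsequence
  \<open>g\<close>, and the parallelogram law transfers the Cauchy property from the images back to
  \<open>g\<close>. If the supremum is 0, the zero vector serves.\<close>

lemma compact_op_attains_norm:
  fixes T :: "'a::euclidean_space L2 \<Rightarrow> 'a L2"
  assumes T: "compact_op T"
  shows "\<exists>r. (\<forall>u\<in>V. cip r u = 0) \<and> (r = 0 \<or> norm r = 1) \<and> (\<forall>w. (\<forall>u\<in>V. cip w u = 0) \<longrightarrow> norm (T w) \<le> norm (T r) * norm w)"
proof -
  have cT: "clinear_L2 T" using T by (simp add: compact_op_def)
  have lin: "linear T" by (rule clinear_L2_linear[OF cT])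
  obtain K where K: "0 \<le> K" "\<And>f. norm (T f) \<le> K * norm f" using compact_op_bounded[OF T] by blast
  have blT: "bounded_linear T" by (rule clinear_L2_bounded_linear[OF cT K(2)])
  define S where "S = {w. \<forall>u\<in>V. cip w u = 0}"
  define X where "X = (\<lambda>w. norm (T w)) ` (S \<inter> cball 0 1)"
  have X0: "0 \<in> X" unfolding X_def using linear_0[OF lin] by (intro image_eqI[of _ _ 0]) (auto simp: S_def)
  have Xb: "bdd_above X"
  proof (rule bdd_aboveI)
    fix x assume "x \<in> X"
    then obtain w where w: "x = norm (T w)" "norm w \<le> 1" by (auto simp: X_def)
    then show "x \<le> K" using K(2)[of w] mult_left_mono[OF w(2) K(1)] by simp
  qed
  define M where "M = Sup X"
  have M0: "0 \<le> M" unfolding M_def by (rule cSup_upper[OF X0 Xb])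
  have MS: "norm (T w) \<le> M * norm w" if w: "w \<in> S" for w
  proof (cases "w = 0")
    case False
    have "w /\<^sub>R norm w \<in> S" using w by (simp add: S_def orthogonal_subspace)
    then have "norm (T (w /\<^sub>R norm w)) \<in> X" unfolding X_def using False by (intro imageI) auto
    then have "norm (T (w /\<^sub>R norm w)) \<le> M" unfolding M_def by (rule cSup_upper[OF _ Xb])
    then have "norm (T w) / norm w \<le> M" by (simp add: linear_scale[OF lin] divide_inverse mult.commute)
    then show ?thesis using False by (simp add: divide_le_eq)
  qed (use linear_0[OF lin] in simp)
  show ?thesis
  proof (cases "M = 0")
    case True
    then show ?thesis using MS linear_0[OF lin] by (intro exI[of _ 0]) (auto simp: S_def)
  next
    case False
    then have M: "0 < M" using M0 by simp
    have "\<exists>f. f \<in> S \<and> norm f \<le> 1 \<and> M - 1 / Suc k < norm (T f)" for k :: nat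
    proof -
      have "M - 1 / Suc k < Sup X" by (simp add: M_def)
      then obtain x where "x \<in> X" "M - 1 / Suc k < x" using less_cSup_iff[of X] X0 Xb by blast
      then show ?thesis by (auto simp: X_def)
    qed
    then obtain f where f: "\<And>k. f k \<in> S" "\<And>k. norm (f k) \<le> 1" "\<And>k. M - 1 / Suc k < norm (T (f k))" by metis
    have "T (f k) \<in> closure (T ` cball 0 1)" for k
      by (rule subsetD[OF closure_subset]) (use f(2) in auto)
    moreover have "seq_compact (closure (T ` cball 0 1))" using T by (simp add: compact_op_def compact_eq_seq_compact_metric)
    ultimately obtain y \<rho> where y: "strict_mono (\<rho> :: nat \<Rightarrow> nat)" "((\<lambda>k. T (f k)) \<circ> \<rho>) \<longlonglongrightarrow> y"
      unfolding seq_compact_def by metis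
    define g where "g = f \<circ> \<rho>"
    have g: "g k \<in> S" "norm (g k) \<le> 1" for k using f by (simp_all add: g_def)
    have Tg: "(\<lambda>k. T (g k)) \<longlonglongrightarrow> y" using y(2) by (simp add: g_def o_def)
    have ny: "norm y = M"
    proof (rule LIMSEQ_unique[OF tendsto_norm[OF Tg]])
      have low: "M - 1 / Suc (\<rho> k) \<le> norm (T (g k))" for k using f(3)[of "\<rho> k"] by (simp add: g_def)
      have up: "norm (T (g k)) \<le> M" for k using MS[OF g(1), of k] mult_left_mono[OF g(2) M0, of k] by simp
      have "(\<lambda>k. M - 1 / real (Suc k)) \<longlonglongrightarrow> M - 0" by (intro tendsto_diff tendsto_const LIMSEQ_Suc[OF lim_1_over_n])
      from LIMSEQ_subseq_LIMSEQ[OF this y(1)] have "(\<lambda>k. M - 1 / real (Suc (\<rho> k))) \<longlonglongrightarrow> M" by (simp add: o_def)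
      then show "(\<lambda>k. norm (T (g k))) \<longlonglongrightarrow> M"
        by (rule tendsto_sandwich[rotated 2, OF _ tendsto_const]) (use low up in auto)
    qed
    \<comment> \<open>If both images are close to \<open>y\<close>, their sum has norm close to
      \<open>2 * M\<close>, so \<open>norm (g k + g l)\<close> is close to 2; for two vectors in the
      unit ball this forces them to be close to each other.\<close>
    have gap: "M * (norm (g k - g l))\<^sup>2 \<le> 4 * (norm (T (g k) - y) + norm (T (g l) - y))" for k l
    proof -
      define \<delta> where "\<delta> = norm (T (g k) - y) + norm (T (g l) - y)"
      have par: "(norm (g k - g l))\<^sup>2 + (norm (g k + g l))\<^sup>2 = 2 * (norm (g k))\<^sup>2 + 2 * (norm (g l))\<^sup>2"
        by (simp add: power2_norm_eq_inner inner_add_left inner_add_right inner_diff_left inner_diff_right inner_commute)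
      have "(norm (g k))\<^sup>2 \<le> 1" "(norm (g l))\<^sup>2 \<le> 1" using g(2) by (simp_all add: power_le_one)
      then have a: "(norm (g k - g l))\<^sup>2 + (norm (g k + g l))\<^sup>2 \<le> 4" using par by linarith
      have "norm (T (g k + g l)) \<le> M * norm (g k + g l)" by (rule MS) (use g(1) in \<open>simp add: S_def orthogonal_subspace\<close>)
      then have "(norm (T (g k) + T (g l)))\<^sup>2 \<le> M\<^sup>2 * (norm (g k + g l))\<^sup>2"
        unfolding linear_add[OF lin] power_mult_distrib[symmetric] by (rule power_mono) simp
      moreover have "4 * M\<^sup>2 - 4 * M * \<delta> \<le> (norm (T (g k) + T (g l)))\<^sup>2"
      proof -
        have "norm (2 *\<^sub>R y) \<le> norm (T (g k) + T (g l)) + norm (2 *\<^sub>R y - (T (g k) + T (g l)))" by norm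
        also have "2 *\<^sub>R y - (T (g k) + T (g l)) = (y - T (g k)) + (y - T (g l))" by (simp add: scaleR_2)
        also have "norm \<dots> \<le> \<delta>" unfolding \<delta>_def using norm_triangle_ineq[of "y - T (g k)" "y - T (g l)"] by (simp add: norm_minus_commute)
        finally have b: "2 * M - \<delta> \<le> norm (T (g k) + T (g l))" by (simp add: ny)
        show ?thesis
        proof (cases "\<delta> \<le> 2 * M")
          case True
          then have "(2 * M - \<delta>)\<^sup>2 \<le> (norm (T (g k) + T (g l)))\<^sup>2" using b by (intro power_mono) auto
          moreover have "(2 * M - \<delta>)\<^sup>2 = 4 * M\<^sup>2 - 4 * M * \<delta> + \<delta>\<^sup>2" by (simp add: power2_eq_square algebra_simps)
          ultimately show ?thesis using zero_le_power2[of \<delta>] by linarith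
        next
          case False
          then have "M * M \<le> M * \<delta>" using M by (intro mult_left_mono) auto
          then have "4 * M\<^sup>2 - 4 * M * \<delta> \<le> 0" by (simp add: power2_eq_square)
          then show ?thesis using zero_le_power2 order_trans by blast
        qed
      qed
      moreover have "M\<^sup>2 * ((norm (g k - g l))\<^sup>2 + (norm (g k + g l))\<^sup>2) \<le> M\<^sup>2 * 4" using a by (rule mult_left_mono) simp
      ultimately have "M\<^sup>2 * (norm (g k - g l))\<^sup>2 \<le> 4 * M * \<delta>" by (simp add: distrib_left)
      then have "M * (M * (norm (g k - g l))\<^sup>2) \<le> M * (4 * \<delta>)" by (simp add: power2_eq_square mult.assoc mult.left_commute)
      then show ?thesis using M by (simp add: \<delta>_def)
    qed
    have "Cauchy g"
    proof (rule metric_CauchyI)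
      fix e :: real assume e: "0 < e"
      have "0 < M * e\<^sup>2 / 8" using M e by simp
      from metric_LIMSEQ_D[OF Tg this] obtain n where n: "\<And>k. n \<le> k \<Longrightarrow> dist (T (g k)) y < M * e\<^sup>2 / 8" by blast
      have "dist (g k) (g l) < e" if "n \<le> k" "n \<le> l" for k l
      proof -
        have "M * (norm (g k - g l))\<^sup>2 < M * e\<^sup>2" using gap[of k l] n[OF that(1)] n[OF that(2)] by (simp add: dist_norm)
        then have "(norm (g k - g l))\<^sup>2 < e\<^sup>2" using M by simp
        then show ?thesis using e by (simp add: dist_norm power2_less_imp_less)
      qed
      then show "\<exists>n. \<forall>k\<ge>n. \<forall>l\<ge>n. dist (g k) (g l) < e" by blast
    qed
    then obtain r where r: "g \<longlonglongrightarrow> r" using Cauchy_convergent_iff convergent_def by blast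
    have "T r = y" by (rule LIMSEQ_unique[OF bounded_linear.tendsto[OF blT r] Tg])
    then have Tr: "norm (T r) = M" by (simp add: ny)
    have rS: "cip r u = 0" if "u \<in> V" for u
    proof (rule LIMSEQ_unique)
      show "(\<lambda>k. cip (g k) u) \<longlonglongrightarrow> cip r u" by (rule bounded_bilinear.tendsto[OF bounded_bilinear_cip r tendsto_const])
      show "(\<lambda>k. cip (g k) u) \<longlonglongrightarrow> 0" using g(1) that by (simp add: S_def)
    qed
    have "norm r \<le> 1" by (rule LIMSEQ_le_const2[OF tendsto_norm[OF r]]) (use g(2) in auto)
    moreover have "M * 1 \<le> M * norm r" using MS[of r] rS Tr by (simp add: S_def)
    then have "1 \<le> norm r" using M by simp
    ultimately have "norm r = 1" by simp
    then show ?thesis using rS MS Tr by (intro exI[of _ r]) (auto simp: S_def)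
  qed
qed

text \<open>Dependent choice of maximizers on the orthogonal complement of the vectors already
  chosen. These are the right singular vectors, obtained without the adjoint and the spectral
  theorem.\<close>

lemma singular_vectors:
  fixes T :: "'a::euclidean_space L2 \<Rightarrow> 'a L2"
  assumes T: "compact_op T"
  shows "\<exists>v. orthofam v \<and> (\<forall>n f. (\<forall>i<n. cip f (v i) = 0) \<longrightarrow> norm (T f) \<le> norm (T (v n)) * norm f)"
proof -
  define P where "P v n r \<longleftrightarrow> (\<forall>u\<in>v ` {..<n}. cip r u = 0) \<and> (r = 0 \<or> norm r = 1) \<and>
      (\<forall>w. (\<forall>u\<in>v ` {..<n}. cip w u = 0) \<longrightarrow> norm (T w) \<le> norm (T r) * norm w)" for v :: "nat \<Rightarrow> 'a L2" and n r
  have "\<exists>v. \<forall>n. P v n (v n)"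
  proof (rule dependent_wellorder_choice)
    fix r :: "'a L2" and f g :: "nat \<Rightarrow> 'a L2" and n :: nat assume "\<And>k. k < n \<Longrightarrow> f k = g k"
    then have "f ` {..<n} = g ` {..<n}" by (intro image_cong) auto
    then show "P f n r = P g n r" by (simp only: P_def)
  next
    fix n and f :: "nat \<Rightarrow> 'a L2"
    show "\<exists>r. P f n r" unfolding P_def by (rule compact_op_attains_norm[OF T])
  qed
  then obtain v where v: "\<And>n. P v n (v n)" by blast
  have lt: "cip (v j) (v i) = 0" if "i < j" for i j using v[of j] that by (simp add: P_def)
  have "cip (v i) (v j) = 0" if "i \<noteq> j" for i j
    using that
  proof (cases i j rule: linorder_cases)
    case less
    then show ?thesis using lt[of i j] by (subst cip_cnj) simp
  qed (use lt in auto)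
  then have "orthofam v" using v by (simp add: orthofam_def P_def)
  moreover have "norm (T f) \<le> norm (T (v n)) * norm f" if "\<forall>i<n. cip f (v i) = 0" for n f
    using v[of n] that by (simp add: P_def)
  ultimately show ?thesis by blast
qed

text \<open>Orthogonality of the images is variational: for \<open>i < j\<close> the vector
  \<open>v i + cscale z (v j)\<close> competes with \<open>v i\<close>, so the term linear in
  \<open>z\<close> has to vanish. If the norms did not tend to 0, the orthogonal images would stay
  at a fixed distance from one another, against compactness.\<close>

lemma singular_vectors_properties:
  fixes T :: "'a::euclidean_space L2 \<Rightarrow> 'a L2"
  assumes T: "compact_op T" and v: "orthofam v"
    and max: "\<And>n f. (\<And>i. i < n \<Longrightarrow> cip f (v i) = 0) \<Longrightarrow> norm (T f) \<le> norm (T (v n)) * norm f"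
  shows "antimono (\<lambda>n. norm (T (v n)))"
    and "i \<noteq> j \<Longrightarrow> cip (T (v i)) (T (v j)) = 0"
    and "(\<lambda>n. norm (T (v n))) \<longlonglongrightarrow> 0"
    and "norm (T (f - proj v N f)) \<le> norm (T (v N)) * norm f"
proof -
  have cT: "clinear_L2 T" using T by (simp add: compact_op_def)
  have lin: "linear T" by (rule clinear_L2_linear[OF cT])
  have step: "norm (T (v m)) \<le> norm (T (v n))" if "n \<le> m" for m n
  proof -
    have "norm (T (v m)) \<le> norm (T (v n)) * norm (v m)" by (rule max) (use that orthofam_orthogonal[OF v] in auto)
    also have "\<dots> \<le> norm (T (v n))" using orthofam_norm[OF v] by (intro mult_left_le) auto
    finally show ?thesis .
  qed
  then show anti: "antimono (\<lambda>n. norm (T (v n)))" by (rule antimonoI)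
  have lt: "cip (T (v i)) (T (v j)) = 0" if ij: "i < j" for i j
  proof (rule cip_zero_scale_bound)
    fix z
    let ?w = "v i + cscale z (v j)"
    have "norm (T ?w) \<le> norm (T (v i)) * norm ?w"
      by (rule max) (use ij orthofam_orthogonal[OF v] in \<open>auto simp: cip_add_left cip_cscale_left\<close>)
    then have le: "(norm (T ?w))\<^sup>2 \<le> (norm (T (v i)))\<^sup>2 * (norm ?w)\<^sup>2" unfolding power_mult_distrib[symmetric] by (rule power_mono) simp
    have nw: "(norm ?w)\<^sup>2 = (norm (v i))\<^sup>2 + (cmod z * norm (v j))\<^sup>2"
    proof -
      have "cip (v i) (cscale z (v j)) = 0" using orthofam_orthogonal[OF v, of i j] ij by (simp add: cip_cscale_right)
      from pythagoras[OF this] show ?thesis by (simp add: norm_cscale)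
    qed
    have nT: "(norm (T ?w))\<^sup>2 = (norm (T (v i)))\<^sup>2 + 2 * Re (cnj z * cip (T (v i)) (T (v j))) + (cmod z * norm (T (v j)))\<^sup>2"
    proof -
      have "inner (T (v i)) (cscale z (T (v j))) = Re (cnj z * cip (T (v i)) (T (v j)))"
        by (simp only: Re_cip[symmetric] cip_cscale_right)
      moreover have "(norm (T (v i) + cscale z (T (v j))))\<^sup>2 = (norm (T (v i)))\<^sup>2 + 2 * inner (T (v i)) (cscale z (T (v j))) + (norm (cscale z (T (v j))))\<^sup>2"
        by (simp add: power2_norm_eq_inner inner_add_left inner_add_right inner_commute)
      ultimately show ?thesis by (simp only: clinear_L2_add[OF cT] clinear_L2_cscale[OF cT] norm_cscale)
    qed
    have up: "(norm (T (v i)))\<^sup>2 * ((norm (v i))\<^sup>2 + (cmod z * norm (v j))\<^sup>2) \<le> (norm (T (v i)))\<^sup>2 * (1 + (cmod z)\<^sup>2)"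
    proof (intro mult_left_mono add_mono)
      show "(norm (v i))\<^sup>2 \<le> 1" using orthofam_norm[OF v, of i] by (simp add: power_le_one)
      show "(cmod z * norm (v j))\<^sup>2 \<le> (cmod z)\<^sup>2" using orthofam_norm[OF v, of j] by (intro power_mono mult_left_le) auto
    qed simp
    have "0 \<le> (cmod z * norm (T (v j)))\<^sup>2" by simp
    then show "2 * Re (cnj z * cip (T (v i)) (T (v j))) \<le> (norm (T (v i)))\<^sup>2 * (cmod z)\<^sup>2"
      using order_trans[OF le[unfolded nw nT] up] unfolding distrib_left mult_1_right by linarith
  qed
  have orth: "cip (T (v i)) (T (v j)) = 0" if "i \<noteq> j" for i j
    using that
  proof (cases i j rule: linorder_cases)
    case greater
    then show ?thesis using lt[of j i] by (subst cip_cnj) simp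
  qed (use lt in auto)
  then show "i \<noteq> j \<Longrightarrow> cip (T (v i)) (T (v j)) = 0" .
  show "(\<lambda>n. norm (T (v n))) \<longlonglongrightarrow> 0"
  proof (rule ccontr)
    assume not: "\<not> (\<lambda>n. norm (T (v n))) \<longlonglongrightarrow> 0"
    have "\<exists>e>0. \<forall>n. e \<le> norm (T (v n))"
    proof (rule ccontr)
      assume "\<nexists>e. 0 < e \<and> (\<forall>n. e \<le> norm (T (v n)))"
      then have small: "\<exists>n. norm (T (v n)) < e" if "0 < e" for e using that not_less by blast
      have "(\<lambda>n. norm (T (v n))) \<longlonglongrightarrow> 0"
      proof (rule LIMSEQ_I)
        fix e :: real assume "0 < e"
        then obtain n where "norm (T (v n)) < e" using small by blast
        then have "\<forall>m\<ge>n. norm (norm (T (v m)) - 0) < e" using step by (auto intro: le_less_trans)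
        then show "\<exists>n. \<forall>m\<ge>n. norm (norm (T (v m)) - 0) < e" by blast
      qed
      with not show False by blast
    qed
    then obtain e where e: "0 < e" "\<And>n. e \<le> norm (T (v n))" by blast
    have "T (v k) \<in> closure (T ` cball 0 1)" for k
      by (rule subsetD[OF closure_subset]) (use orthofam_norm[OF v] in auto)
    moreover have "seq_compact (closure (T ` cball 0 1))" using T by (simp add: compact_op_def compact_eq_seq_compact_metric)
    ultimately obtain y \<rho> where y: "strict_mono (\<rho> :: nat \<Rightarrow> nat)" "((\<lambda>k. T (v k)) \<circ> \<rho>) \<longlonglongrightarrow> y"
      unfolding seq_compact_def by metis
    have "Cauchy ((\<lambda>k. T (v k)) \<circ> \<rho>)" using y(2) by (rule LIMSEQ_imp_Cauchy)
    from metric_CauchyD[OF this e(1)] obtain n where "\<forall>k\<ge>n. \<forall>l\<ge>n. dist (((\<lambda>k. T (v k)) \<circ> \<rho>) k) (((\<lambda>k. T (v k)) \<circ> \<rho>) l) < e" by blast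
    then have "dist (T (v (\<rho> n))) (T (v (\<rho> (Suc n)))) < e" by simp
    moreover have "e \<le> norm (T (v (\<rho> n)) - T (v (\<rho> (Suc n))))"
    proof -
      have "\<rho> n \<noteq> \<rho> (Suc n)" using y(1) by (simp add: strict_mono_eq)
      from orth[OF this] have "cip (T (v (\<rho> n))) (- T (v (\<rho> (Suc n)))) = 0"
        by (simp only: cscale_minus_one[symmetric] cip_cscale_right mult_zero_right)
      from pythagoras[OF this] have "(norm (T (v (\<rho> n))))\<^sup>2 \<le> (norm (T (v (\<rho> n)) - T (v (\<rho> (Suc n)))))\<^sup>2" by simp
      then have "norm (T (v (\<rho> n))) \<le> norm (T (v (\<rho> n)) - T (v (\<rho> (Suc n))))" by (rule power2_le_imp_le) simp
      then show ?thesis using e(2) order_trans by blast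
    qed
    ultimately show False by (simp add: dist_norm)
  qed
  have "norm (T (f - proj v N f)) \<le> norm (T (v N)) * norm (f - proj v N f)" by (rule max) (rule cip_minus_proj[OF v])
  also have "\<dots> \<le> norm (T (v N)) * norm f" by (intro mult_left_mono norm_minus_proj_le[OF v]) simp
  finally show "norm (T (f - proj v N f)) \<le> norm (T (v N)) * norm f" .
qed


section \<open>Diagonal operators\<close>

text \<open>The \<open>i - i div 2\<close> terms with indices from \<open>i div 2\<close> to
  \<open>i - 1\<close> are each at least \<open>a i\<close>. Consequently \<open>i * a i\<close>
  tends to 0.\<close>

lemma summable_antimono_tail:
  fixes a :: "nat \<Rightarrow> real"
  assumes "antimono a" "\<And>i. 0 \<le> a i" "summable a"
  shows "real i * a i \<le> 2 * (\<Sum>k. a (k + i div 2))"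
proof -
  let ?m = "i - i div 2"
  have "real ?m * a i = (\<Sum>k<?m. a i)" by simp
  also have "\<dots> \<le> (\<Sum>k<?m. a (k + i div 2))" using assms(1) by (intro sum_mono) (auto simp: antimono_def)
  also have "\<dots> \<le> (\<Sum>k. a (k + i div 2))" using assms by (intro sum_le_suminf) auto
  finally have "real ?m * a i \<le> (\<Sum>k. a (k + i div 2))" .
  moreover have "real i \<le> 2 * real ?m" by linarith
  then have "real i * a i \<le> 2 * real ?m * a i" by (intro mult_right_mono assms)
  ultimately show ?thesis by linarith
qed

text \<open>With \<open>R i = \<Sum>k\<ge>i. a k\<close>, the sequence \<open>a i / sqrt (R i)\<close> is dominated by a telescoping one.
  Adding \<open>i * a i\<close> under the root makes both factors monotone.\<close>

lemma summable_antimono_factor: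
  fixes a :: "nat \<Rightarrow> real"
  assumes a: "antimono a" "\<And>i. 0 \<le> a i" "summable a"
  shows "\<exists>\<tau> \<kappa>. antimono \<tau> \<and> antimono \<kappa> \<and> (\<forall>i. 0 \<le> \<tau> i) \<and> (\<forall>i. 0 \<le> \<kappa> i) \<and> summable \<tau> \<and> \<kappa> \<longlonglongrightarrow> 0 \<and> (\<forall>i. a i = \<tau> i * \<kappa> i)"
proof -
  define R where "R i = (\<Sum>k. a (k + i))" for i
  \<comment> \<open>This is the sum of \<open>a (max k i)\<close> over all \<open>k\<close>, from
    which it is plain that \<open>c\<close> decreases and dominates \<open>R\<close>.\<close>
  define c where "c i = real i * a i + R i" for i
  have sm: "summable (\<lambda>k. a (k + i))" for i using a(3) by simp
  have R0: "0 \<le> R i" for i unfolding R_def using a sm by (intro suminf_nonneg) auto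
  have RS: "R i = a i + R (Suc i)" for i
    using suminf_split_head[OF sm[of i]] by (simp add: R_def)
  have Rlim: "R \<longlonglongrightarrow> 0" unfolding R_def[abs_def] by (rule suminf_exist_split2[OF a(3)])
  have c0: "0 \<le> c i" for i using a(2) R0 by (simp add: c_def)
  have cS: "c i = c (Suc i) + real (Suc i) * (a i - a (Suc i))" for i
    using RS[of i] by (simp add: c_def algebra_simps)
  have aS: "a (Suc i) \<le> a i" for i using a(1) by (simp add: antimono_def)
  have c_Suc: "c (Suc i) \<le> c i" for i using aS[of i] cS[of i] mult_nonneg_nonneg[of "real (Suc i)" "a i - a (Suc i)"] by linarith
  have cge: "real i * a i \<le> c i" "R i \<le> c i" "a i \<le> c i" for i
    using a(2)[of i] R0[of i] R0[of "Suc i"] RS[of i] mult_nonneg_nonneg[of "real i" "a i"] by (auto simp: c_def)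
  have clim: "c \<longlonglongrightarrow> 0"
  proof (rule tendsto_sandwich[OF _ _ tendsto_const])
    have "\<forall>\<^sub>F i in sequentially. Z \<le> i div 2" for Z :: nat
      by (rule eventually_sequentiallyI[of "2 * Z"]) linarith
    then have "filterlim (\<lambda>i::nat. i div 2) sequentially sequentially"
      by (simp add: filterlim_at_top)
    then have "(\<lambda>i. R (i div 2)) \<longlonglongrightarrow> 0" by (rule filterlim_compose[OF Rlim])
    then have "(\<lambda>i. 2 * R (i div 2) + R i) \<longlonglongrightarrow> 2 * 0 + 0" by (intro tendsto_intros Rlim)
    then show "(\<lambda>i. 2 * R (i div 2) + R i) \<longlonglongrightarrow> 0" by simp
    show "\<forall>\<^sub>F i in sequentially. c i \<le> 2 * R (i div 2) + R i"
      using summable_antimono_tail[OF a] by (simp add: c_def R_def)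
  qed (use c0 in simp)
  define \<kappa> where "\<kappa> i = sqrt (c i)" for i
  define \<tau> where "\<tau> i = a i / sqrt (c i)" for i
  have \<tau>0: "0 \<le> \<tau> i" for i using a(2) c0 by (simp add: \<tau>_def)
  show ?thesis
  proof (rule exI[of _ \<tau>], rule exI[of _ \<kappa>], intro conjI allI)
    show "antimono \<kappa>" unfolding decseq_Suc_iff \<kappa>_def using c_Suc by simp
    show "\<kappa> \<longlonglongrightarrow> 0" using tendsto_real_sqrt[OF clim] by (simp add: \<kappa>_def[abs_def])
    show "0 \<le> \<kappa> i" for i using c0 by (simp add: \<kappa>_def)
    show "a i = \<tau> i * \<kappa> i" for i
    \<comment> \<open>Where \<open>c i = 0\<close>, the quotient \<open>\<tau> i\<close> is 0 by
      convention, and \<open>a i \<le> c i\<close> makes the left side 0 as well.\<close>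
    proof (cases "c i = 0")
      case True
      then show ?thesis using cge(3)[of i] a(2)[of i] by (simp add: \<tau>_def \<kappa>_def)
    qed (use c0[of i] in \<open>simp add: \<tau>_def \<kappa>_def\<close>)
    show "summable \<tau>"
    proof (rule summable_comparison_test')
      have "(\<lambda>i. 2 * (sqrt (R i) - sqrt (R (Suc i)))) sums (2 * (sqrt (R 0) - sqrt 0))"
        by (intro sums_mult telescope_sums' tendsto_real_sqrt Rlim)
      then show "summable (\<lambda>i. 2 * (sqrt (R i) - sqrt (R (Suc i))))" by (rule sums_summable)
      fix i :: nat assume "0 \<le> i"
      have "\<tau> i \<le> 2 * (sqrt (R i) - sqrt (R (Suc i)))"
      proof (cases "R i = 0")
        case True
        then have "a i = 0" "R (Suc i) = 0" using RS[of i] a(2)[of i] R0[of "Suc i"] by linarith+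
        with True show ?thesis by (simp add: \<tau>_def)
      next
        case False
        then have R: "0 < sqrt (R i)" using R0[of i] by simp
        have le: "sqrt (R (Suc i)) \<le> sqrt (R i)" using RS[of i] a(2)[of i] by simp
        have "\<tau> i \<le> a i / sqrt (R i)" unfolding \<tau>_def
          using R cge(2)[of i] a(2)[of i] by (intro divide_left_mono mult_pos_pos) (auto intro: less_le_trans)
        also have "a i = (sqrt (R i) - sqrt (R (Suc i))) * (sqrt (R i) + sqrt (R (Suc i)))"
          using RS[of i] R0[of i] R0[of "Suc i"] by (simp add: algebra_simps)
        also have "\<dots> \<le> (sqrt (R i) - sqrt (R (Suc i))) * (2 * sqrt (R i))" using le by (intro mult_left_mono) auto
        finally show ?thesis using R by (simp add: divide_right_mono)
      qed
      then show "norm (\<tau> i) \<le> 2 * (sqrt (R i) - sqrt (R (Suc i)))" using \<tau>0[of i] by simp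
    qed
    show "antimono \<tau>" unfolding decseq_Suc_iff
    proof
      fix i
      show "\<tau> (Suc i) \<le> \<tau> i"
      proof (cases "a (Suc i) = 0")
        case True
        then show ?thesis using \<tau>0[of i] by (simp add: \<tau>_def)
      next
        case False
        then have b: "0 < a (Suc i)" using a(2)[of "Suc i"] by simp
        have cpos: "0 < c (Suc i)" "0 < c i" using cge(3)[of "Suc i"] b c_Suc[of i] by linarith+
        \<comment> \<open>After squaring, the claim is
          \<open>(a (Suc i))\<^sup>2 * c i \<le> (a i)\<^sup>2 * c (Suc i)\<close>. Here
          \<open>c i\<close> exceeds \<open>c (Suc i)\<close> by \<open>Suc i * ?d\<close>, and
          \<open>Suc i * a (Suc i) \<le> c (Suc i)\<close> bounds the effect of this excess. It is
          the summand \<open>i * a i\<close> of \<open>c\<close> that provides this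
          inequality.\<close>
        let ?d = "a i - a (Suc i)"
        have d: "0 \<le> ?d" using aS[of i] by simp
        have "(a (Suc i))\<^sup>2 * real (Suc i) = a (Suc i) * (real (Suc i) * a (Suc i))" by (simp add: power2_eq_square)
        also have "\<dots> \<le> (a i + a (Suc i)) * c (Suc i)"
          using cge(1)[of "Suc i"] b a(2)[of i] by (intro mult_mono) auto
        finally have "?d * ((a (Suc i))\<^sup>2 * real (Suc i)) \<le> ?d * ((a i + a (Suc i)) * c (Suc i))"
          using d by (rule mult_left_mono)
        moreover have "(a (Suc i))\<^sup>2 * c i = (a (Suc i))\<^sup>2 * c (Suc i) + ?d * ((a (Suc i))\<^sup>2 * real (Suc i))"
          by (simp add: cS[of i] algebra_simps)
        moreover have "?d * ((a i + a (Suc i)) * c (Suc i)) = (a i)\<^sup>2 * c (Suc i) - (a (Suc i))\<^sup>2 * c (Suc i)"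
          by (simp add: power2_eq_square algebra_simps)
        ultimately have "(a (Suc i))\<^sup>2 * c i \<le> (a i)\<^sup>2 * c (Suc i)" by linarith
        then have "sqrt ((a (Suc i))\<^sup>2 * c i) \<le> sqrt ((a i)\<^sup>2 * c (Suc i))" by (rule real_sqrt_le_mono)
        then have "a (Suc i) * sqrt (c i) \<le> a i * sqrt (c (Suc i))" using a(2) by (simp add: real_sqrt_mult)
        then show ?thesis using cpos by (simp add: \<tau>_def field_simps)
      qed
    qed
  qed (use \<tau>0 in auto)
qed

section \<open>Operators that are diagonal with respect to two orthogonal families\<close>

definition dsum :: "(nat \<Rightarrow> real) \<Rightarrow> (nat \<Rightarrow> 'a L2) \<Rightarrow> (nat \<Rightarrow> 'a L2) \<Rightarrow> nat \<Rightarrow> 'a::euclidean_space L2 \<Rightarrow> 'a L2" where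
  "dsum l v e N f = (\<Sum>i<N. cscale (of_real (l i) * cip f (v i)) (e i))"

definition diag :: "(nat \<Rightarrow> real) \<Rightarrow> (nat \<Rightarrow> 'a L2) \<Rightarrow> (nat \<Rightarrow> 'a L2) \<Rightarrow> 'a::euclidean_space L2 \<Rightarrow> 'a L2" where
  "diag l v e f = lim (\<lambda>N. dsum l v e N f)"

text \<open>With decreasing coefficients, Bessel's inequality bounds everything after the first
  \<open>N\<close> terms by \<open>l N\<close>. This one estimate gives convergence, compactness and
  the bound for the singular values.\<close>

definition singular_system :: "(nat \<Rightarrow> real) \<Rightarrow> (nat \<Rightarrow> 'a L2) \<Rightarrow> (nat \<Rightarrow> 'a::euclidean_space L2) \<Rightarrow> bool" where
  "singular_system l v e \<longleftrightarrow> orthofam v \<and> orthofam e \<and> antimono l \<and> (\<forall>i. 0 \<le> l i) \<and> l \<longlonglongrightarrow> 0"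

lemma clinear_dsum: "clinear_L2 (dsum l v e N)"
  unfolding clinear_L2_iff dsum_def
  by (auto simp: cip_add_left L2.scale_left_distrib distrib_left sum.distrib cip_cscale_left L2.scale_sum_right mult.left_commute)

lemma dsum_tail:
  assumes s: "singular_system l v e" and MN: "M \<le> N"
  shows "norm (dsum l v e N f - dsum l v e M f) \<le> l M * norm f"
proof -
  have v: "orthofam v" and e: "orthofam e" and l: "antimono l" "\<And>i. 0 \<le> l i" using s by (auto simp: singular_system_def)
  have "dsum l v e N f - dsum l v e M f = (\<Sum>i\<in>{M..<N}. cscale (of_real (l i) * cip f (v i)) (e i))"
    unfolding dsum_def lessThan_atLeast0 using MN by (subst sum.atLeastLessThan_concat[of 0 M N, symmetric]) auto
  then have "(norm (dsum l v e N f - dsum l v e M f))\<^sup>2 \<le> (\<Sum>i\<in>{M..<N}. (cmod (of_real (l i) * cip f (v i)))\<^sup>2)"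
    using norm_sum_orthofam_le[OF e finite_atLeastLessThan] by simp
  also have "\<dots> \<le> (\<Sum>i\<in>{M..<N}. (l M)\<^sup>2 * (cmod (cip f (v i)))\<^sup>2)"
  proof (rule sum_mono)
    fix i assume "i \<in> {M..<N}"
    then have "l i \<le> l M" using l(1) by (simp add: antimono_def)
    then have "(l i)\<^sup>2 \<le> (l M)\<^sup>2" using l(2) by (intro power_mono) auto
    then have "(l i)\<^sup>2 * (cmod (cip f (v i)))\<^sup>2 \<le> (l M)\<^sup>2 * (cmod (cip f (v i)))\<^sup>2" by (rule mult_right_mono) simp
    then show "(cmod (of_real (l i) * cip f (v i)))\<^sup>2 \<le> (l M)\<^sup>2 * (cmod (cip f (v i)))\<^sup>2"
      by (simp add: norm_mult power_mult_distrib)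
  qed
  also have "\<dots> \<le> (l M)\<^sup>2 * (norm f)\<^sup>2" unfolding sum_distrib_left[symmetric]
    by (intro mult_left_mono bessel[OF v]) auto
  also have "\<dots> = (l M * norm f)\<^sup>2" by (simp add: power_mult_distrib)
  finally show ?thesis by (rule power2_le_imp_le) (simp add: l(2))
qed

lemma dsum_tendsto_diag:
  assumes s: "singular_system l v e" shows "(\<lambda>N. dsum l v e N f) \<longlonglongrightarrow> diag l v e f"
proof -
  have l: "antimono l" "\<And>i. 0 \<le> l i" "l \<longlonglongrightarrow> 0" using s by (auto simp: singular_system_def)
  have "Cauchy (\<lambda>N. dsum l v e N f)"
    unfolding Cauchy_altdef2
  proof (intro allI impI)
    fix \<epsilon> :: real assume "0 < \<epsilon>"
    moreover have "(\<lambda>n. l n * norm f) \<longlonglongrightarrow> 0 * norm f" by (intro tendsto_intros l)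
    ultimately have "\<forall>\<^sub>F n in sequentially. l n * norm f < \<epsilon>" by (intro order_tendstoD(2)) auto
    then obtain N where "l N * norm f < \<epsilon>" by (auto simp: eventually_sequentially)
    then have "dist (dsum l v e n f) (dsum l v e N f) < \<epsilon>" if "N \<le> n" for n
      using dsum_tail[OF s that, of f] by (simp add: dist_norm)
    then show "\<exists>N. \<forall>n\<ge>N. dist (dsum l v e n f) (dsum l v e N f) < \<epsilon>" by blast
  qed
  then show ?thesis unfolding diag_def convergent_LIMSEQ_iff[symmetric] by (rule Cauchy_convergent)
qed

lemma diag_approx:
  assumes s: "singular_system l v e" shows "norm (diag l v e f - dsum l v e N f) \<le> l N * norm f"
proof (rule LIMSEQ_le_const2)
  show "(\<lambda>n. norm (dsum l v e n f - dsum l v e N f)) \<longlonglongrightarrow> norm (diag l v e f - dsum l v e N f)"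
    by (intro tendsto_intros dsum_tendsto_diag s)
  show "\<exists>M. \<forall>n\<ge>M. norm (dsum l v e n f - dsum l v e N f) \<le> l N * norm f" using dsum_tail[OF s] by blast
qed

lemma clinear_diag:
  assumes s: "singular_system l v e" shows "clinear_L2 (diag l v e)"
  unfolding clinear_L2_iff
proof (intro conjI allI)
  fix f g :: "'a L2" and c
  note lim = dsum_tendsto_diag[OF s]
  show "diag l v e (f + g) = diag l v e f + diag l v e g"
  proof (rule LIMSEQ_unique[OF lim])
    show "(\<lambda>N. dsum l v e N (f + g)) \<longlonglongrightarrow> diag l v e f + diag l v e g"
      unfolding clinear_L2_add[OF clinear_dsum] by (rule tendsto_add[OF lim lim])
  qed
  have cl: "bounded_linear (cscale c :: 'a L2 \<Rightarrow> 'a L2)"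
    by (rule clinear_L2_bounded_linear[where K="cmod c"])
      (auto simp: clinear_L2_iff L2.scale_right_distrib norm_cscale mult.commute)
  have "(\<lambda>N. dsum l v e N (cscale c f)) \<longlonglongrightarrow> cscale c (diag l v e f)"
    unfolding clinear_L2_cscale[OF clinear_dsum] by (rule bounded_linear.tendsto[OF cl lim])
  then show "diag l v e (cscale c f) = cscale c (diag l v e f)" by (rule LIMSEQ_unique[OF lim])
qed

lemma cip_diag:
  assumes s: "singular_system l v v" shows "cip (diag l v v f) (v j) = of_real (l j) * cip f (v j)"
proof (rule LIMSEQ_unique)
  have v: "orthofam v" using s by (simp add: singular_system_def)
  show "(\<lambda>N. cip (dsum l v v N f) (v j)) \<longlonglongrightarrow> cip (diag l v v f) (v j)"
    by (intro bounded_bilinear.tendsto[OF bounded_bilinear_cip] dsum_tendsto_diag s tendsto_const)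
  have "cip (dsum l v v N f) (v j) = of_real (l j) * cip f (v j)" if "j < N" for N
    unfolding dsum_def cip_sum_orthofam[OF v finite_lessThan] using that
    by (simp add: mult.assoc orthofam_cip_self[OF v] del: of_real_power)
  then show "(\<lambda>N. cip (dsum l v v N f) (v j)) \<longlonglongrightarrow> of_real (l j) * cip f (v j)"
    by (intro tendsto_eventually eventually_sequentiallyI[of "Suc j"]) auto
qed

lemma rank_dsum: "range (dsum l v e N) \<subseteq> L2.span (e ` {..<N})"
proof (rule image_subsetI)
  fix f
  show "dsum l v e N f \<in> L2.span (e ` {..<N})"
    unfolding dsum_def by (rule L2.span_sum, rule L2.span_scale, rule L2.span_base) simp
qed

lemma compact_diag:
  assumes s: "singular_system l v e" shows "compact_op (diag l v e)"
proof (rule compact_op_approx[OF clinear_diag[OF s]])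
  fix \<epsilon> :: real assume \<epsilon>: "0 < \<epsilon>"
  have "\<forall>\<^sub>F n in sequentially. l n < \<epsilon>" using s \<epsilon> by (intro order_tendstoD(2)) (auto simp: singular_system_def)
  then obtain N where N: "l N < \<epsilon>" by (auto simp: eventually_sequentially)
  have K: "norm (dsum l v e N f) \<le> l 0 * norm f" for f using dsum_tail[OF s, of 0 N f] by (simp add: dsum_def)
  have "norm (diag l v e f - dsum l v e N f) \<le> \<epsilon> * norm f" for f
    using diag_approx[OF s, of f N] mult_right_mono[OF less_imp_le[OF N] norm_ge_zero[of f]] by linarith
  then show "\<exists>B K T0. finite B \<and> range T0 \<subseteq> L2.span B \<and> (\<forall>f. norm (T0 f) \<le> K * norm f) \<and> (\<forall>f. norm (diag l v e f - T0 f) \<le> \<epsilon> * norm f)"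
    using K by (intro exI[of _ "e ` {..<N}"] exI[of _ "l 0"] exI[of _ "dsum l v e N"] conjI allI rank_dsum) simp_all
qed

lemma sing_val_diag:
  assumes s: "singular_system l v e" shows "sing_val (Suc N) (diag l v e) \<le> ennreal (l N)"
  unfolding sing_val_def
proof (rule INF_lower2)
  \<comment> \<open>\<open>sing_val (Suc N)\<close> admits competitors of rank \<open>N\<close>,
    hence the truncation to the indices below \<open>N\<close>, whose error is
    \<open>l N\<close>.\<close>
  have "rank_le (dsum l v e N) N" unfolding rank_le_def
    using rank_dsum[of l v e N] card_image_le[of "{..<N}" e] by (intro exI[of _ "e ` {..<N}"]) (simp only: finite_imageI finite_lessThan card_lessThan)
  then show "dsum l v e N \<in> {T0. clinear_L2 T0 \<and> rank_le T0 (Suc N - 1)}" by (simp add: clinear_dsum)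
  show "op_norm (\<lambda>f. diag l v e f - dsum l v e N f) \<le> ennreal (l N)"
    by (rule op_norm_le[OF diag_approx[OF s]]) (use s in \<open>simp add: singular_system_def\<close>)
qed


section \<open>Schatten classes\<close>

text \<open>There are \<open>N + 1\<close> vectors in a space of dimension at most \<open>N\<close>.
  Linear dependence is a property of sets, so a repetition among the \<open>x i\<close> is treated
  apart, with coefficients 1 and -1.\<close>

lemma rank_dependent:
  fixes x :: "nat \<Rightarrow> 'a::euclidean_space L2"
  assumes B: "finite B" "card B \<le> N" and x: "\<And>i. x i \<in> L2.span B"
  shows "\<exists>c. (\<exists>i\<le>N. c i \<noteq> 0) \<and> (\<Sum>i\<le>N. cscale (c i) (x i)) = 0"
proof (cases "inj_on x {..N}")
  case True
  have "card (x ` {..N}) = Suc N" using card_image[OF True] by simp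
  then have "L2.dependent (x ` {..N})"
    using L2.independent_span_bound[OF B(1), of "x ` {..N}"] x B(2) by fastforce
  then obtain u where u: "\<exists>y\<in>x ` {..N}. u y \<noteq> 0" "(\<Sum>y\<in>x ` {..N}. cscale (u y) y) = 0"
    unfolding L2.dependent_finite[OF finite_imageI[OF finite_atMost]] by blast
  then show ?thesis
    by (intro exI[of _ "u \<circ> x"]) (auto simp: sum.reindex[OF True])
next
  case False
  then obtain i j where ij: "i \<le> N" "j \<le> N" "i \<noteq> j" "x i = x j" by (auto simp: inj_on_def)
  define c :: "nat \<Rightarrow> complex" where "c k = (if k = i then 1 else 0) - (if k = j then 1 else 0)" for k
  have "(\<Sum>k\<le>N. cscale (c k) (x k)) = (\<Sum>k\<le>N. (if k = i then x k else 0) - (if k = j then x k else 0))"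
    unfolding c_def by (intro sum.cong) (auto simp: L2.scale_left_diff_distrib)
  also have "\<dots> = x i - x j" using ij(1,2) by (simp add: sum_subtractf)
  finally show ?thesis using ij by (intro exI[of _ c] conjI exI[of _ i]) (auto simp: c_def)
qed

text \<open>An operator of rank at most \<open>N\<close> annihilates a nontrivial combination
  \<open>w\<close> of the \<open>N + 1\<close> vectors \<open>v 0\<close> to \<open>v N\<close>,
  while \<open>T\<close> maps \<open>w\<close> to a vector of norm at least
  \<open>s N * norm w\<close>.\<close>

lemma sing_val_ge:
  fixes T :: "'a::euclidean_space L2 \<Rightarrow> 'a L2"
  assumes T: "clinear_L2 T" and v: "orthofam v" and e: "orthofam e" and s: "antimono s" "\<And>i. 0 \<le> s i"
    and Tv: "\<And>i. T (v i) = cscale (of_real (s i)) (e i)" "\<And>i. norm (T (v i)) = s i"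
  shows "ennreal (s N) \<le> sing_val (Suc N) T"
  unfolding sing_val_def
proof (rule INF_greatest)
  fix T0 :: "'a L2 \<Rightarrow> 'a L2" assume "T0 \<in> {T0. clinear_L2 T0 \<and> rank_le T0 (Suc N - 1)}"
  then obtain B where T0: "clinear_L2 T0" and B: "finite B" "card B \<le> N" "range T0 \<subseteq> L2.span B" by (auto simp: rank_le_def)
  show "ennreal (s N) \<le> op_norm (\<lambda>f. T f - T0 f)"
  proof (rule ccontr)
    assume "\<not> ennreal (s N) \<le> op_norm (\<lambda>f. T f - T0 f)"
    then have lt: "op_norm (\<lambda>f. T f - T0 f) < ennreal (s N)" by simp
    define K where "K = enn2real (op_norm (\<lambda>f. T f - T0 f))"
    have K0: "0 \<le> K" by (simp add: K_def)
    have "op_norm (\<lambda>f. T f - T0 f) < top" using lt by (rule less_trans) simp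
    then have Ke: "op_norm (\<lambda>f. T f - T0 f) = ennreal K" by (simp add: K_def)
    have Ks: "K < s N" using lt K0 by (simp add: Ke ennreal_less_iff)
    \<comment> \<open>If the bound failed, \<open>s N\<close> would be positive, so no vector up to
      index \<open>N\<close> is zero padding.\<close>
    have pos: "0 < s i" if "i \<le> N" for i
      using s(1) that K0 Ks unfolding antimono_def by (meson le_less_trans less_le_trans)
    obtain c where c: "\<exists>i\<le>N. c i \<noteq> 0" "(\<Sum>i\<le>N. cscale (c i) (T0 (v i))) = 0"
      using rank_dependent[OF B(1,2), of "\<lambda>i. T0 (v i)"] subsetD[OF B(3) rangeI] by blast
    define w where "w = (\<Sum>i\<le>N. cscale (c i) (v i))"
    have sum: "S w = (\<Sum>i\<le>N. cscale (c i) (S (v i)))" if "clinear_L2 S" for S :: "'a L2 \<Rightarrow> 'a L2"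
      unfolding w_def linear_sum[OF clinear_L2_linear[OF that]] by (simp add: clinear_L2_cscale[OF that])
    have T0w: "T0 w = 0" unfolding sum[OF T0] by (rule c(2))
    have nv: "norm (v i) = 1" "norm (e i) = 1" if "i \<le> N" for i
    proof -
      have "v i \<noteq> 0" "e i \<noteq> 0" using pos[OF that] Tv[of i] linear_0[OF clinear_L2_linear[OF T]] by auto
      then show "norm (v i) = 1" "norm (e i) = 1" using v e by (auto simp: orthofam_def)
    qed
    have nw: "(norm w)\<^sup>2 = (\<Sum>i\<le>N. (cmod (c i))\<^sup>2)"
      unfolding w_def norm_sum_orthofam[OF v finite_atMost] by (intro sum.cong) (auto simp: nv)
    have "T w = (\<Sum>i\<le>N. cscale (c i * of_real (s i)) (e i))" unfolding sum[OF T] Tv(1) by simp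
    then have "(norm (T w))\<^sup>2 = (\<Sum>i\<le>N. (cmod (c i * of_real (s i)))\<^sup>2 * (norm (e i))\<^sup>2)"
      by (simp only: norm_sum_orthofam[OF e finite_atMost])
    also have "\<dots> = (\<Sum>i\<le>N. (cmod (c i))\<^sup>2 * (s i)\<^sup>2)" by (intro sum.cong) (auto simp: nv norm_mult power_mult_distrib)
    also have "\<dots> \<ge> (\<Sum>i\<le>N. (cmod (c i))\<^sup>2 * (s N)\<^sup>2)"
      using s by (intro sum_mono mult_left_mono power_mono) (auto simp: antimono_def)
    finally have "(s N)\<^sup>2 * (norm w)\<^sup>2 \<le> (norm (T w))\<^sup>2" by (simp add: nw sum_distrib_right mult.commute[of "(s N)\<^sup>2"])
    then have low: "s N * norm w \<le> norm (T w)" unfolding power_mult_distrib[symmetric] by (rule power2_le_imp_le) simp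
    have "norm (T w - T0 w) \<le> K * norm w"
      by (rule op_norm_bound[OF clinear_L2_diff[OF T T0]]) (simp_all add: Ke K0)
    then have "s N * norm w \<le> K * norm w" using low T0w by simp
    moreover obtain k where "k \<le> N" "c k \<noteq> 0" using c(1) by blast
    then have "0 < (norm w)\<^sup>2" unfolding nw by (intro sum_pos2[where i=k]) auto
    then have "0 < norm w" by simp
    ultimately show False using Ks by simp
  qed
qed

section \<open>The Schatten classes in terms of real bounds for the singular values\<close>

lemma rank_zero: "rank_le (\<lambda>_. 0) k"
  unfolding rank_le_def by (intro exI[of _ "{}"]) (auto simp: L2.span_empty)

lemma sing_val_le_op_norm: "sing_val j T \<le> op_norm T"
  unfolding sing_val_def
  by (rule INF_lower2[of "\<lambda>_. 0"]) (simp_all add: clinear_L2_zero rank_zero)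

lemma op_norm_le_sing_val:
  fixes T :: "'a::euclidean_space L2 \<Rightarrow> 'a L2"
  shows "op_norm T \<le> sing_val (Suc 0) T"
  unfolding sing_val_def
proof (rule INF_greatest)
  fix T0 :: "'a L2 \<Rightarrow> 'a L2" assume "T0 \<in> {T0. clinear_L2 T0 \<and> rank_le T0 (Suc 0 - 1)}"
  then have "range T0 \<subseteq> {0}" by (auto simp: rank_le_def L2.span_empty)
  then have "T0 f = 0" for f by blast
  then show "op_norm T \<le> op_norm (\<lambda>f. T f - T0 f)" by simp
qed

lemma schatten_class_Infty_iff:
  "T \<in> schatten_class Infty \<longleftrightarrow> clinear_L2 T \<and> (\<exists>K\<ge>0. \<forall>f. norm (T f) \<le> K * norm f)"
proof (intro iffI conjI)
  assume "T \<in> schatten_class Infty"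
  then have T: "clinear_L2 T" and S: "(SUP j\<in>{1..}. sing_val j T) < \<infinity>" by (auto simp: schatten_class_def)
  show "clinear_L2 T" by (rule T)
  have "op_norm T \<le> (SUP j\<in>{1..}. sing_val j T)"
  proof (rule order_trans[OF op_norm_le_sing_val])
    show "sing_val (Suc 0) T \<le> (SUP j\<in>{1..}. sing_val j T)" by (rule SUP_upper) simp
  qed
  then have "op_norm T < \<infinity>" using S by (rule le_less_trans)
  then show "\<exists>K\<ge>0. \<forall>f. norm (T f) \<le> K * norm f" by (rule op_norm_finite_bound[OF T])
next
  assume T: "clinear_L2 T \<and> (\<exists>K\<ge>0. \<forall>f. norm (T f) \<le> K * norm f)"
  then obtain K where "0 \<le> K" "\<And>f. norm (T f) \<le> K * norm f" by blast
  then have "op_norm T \<le> ennreal K" by (intro op_norm_le)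
  then have "(SUP j\<in>{1..}. sing_val j T) \<le> ennreal K"
    by (intro SUP_least order_trans[OF sing_val_le_op_norm])
  also have "\<dots> < \<infinity>" by simp
  finally show "T \<in> schatten_class Infty" using T by (simp add: schatten_class_def)
qed

lemma schatten_class_Sharp_subset: "schatten_class Sharp \<subseteq> schatten_class Infty"
  using compact_op_bounded by (auto simp: schatten_class_Infty_iff) (auto simp: schatten_class_def compact_op_def)

lemma ennreal_powr_less_top: "ennreal_powr x r < \<infinity> \<longleftrightarrow> x < \<infinity>"
  by (cases "x = \<infinity>") (auto simp: ennreal_powr_def less_top)

lemma schatten_class_FinD:
  assumes "T \<in> schatten_class (Fin p)"
  shows "clinear_L2 T \<and> (\<exists>r. (\<forall>j. 0 \<le> r j) \<and> (\<forall>j. sing_val (Suc j) T = ennreal (r j)) \<and> summable (\<lambda>j. r j powr p))"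
proof -
  define r where "r j = enn2real (sing_val (Suc j) T)" for j
  have T: "clinear_L2 T" and S: "(\<Sum>j. ennreal_powr (sing_val (Suc j) T) p) < \<infinity>"
    using assms by (auto simp: schatten_class_def ennreal_powr_less_top[unfolded infinity_ennreal_def])
  have fin: "sing_val (Suc j) T < \<infinity>" for j
  proof -
    have "ennreal_powr (sing_val (Suc j) T) p = (\<Sum>k\<in>{j}. ennreal_powr (sing_val (Suc k) T) p)" by simp
    also have "\<dots> \<le> (\<Sum>j. ennreal_powr (sing_val (Suc j) T) p)" by (rule sum_le_suminf) auto
    also note S
    finally show ?thesis by (simp only: ennreal_powr_less_top)
  qed
  have "ennreal_powr (sing_val (Suc j) T) p = ennreal (r j powr p)" for j
    using fin[of j] by (simp add: ennreal_powr_def r_def less_top)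
  then have "(\<Sum>j. ennreal (r j powr p)) \<noteq> top" using S by (simp add: less_top)
  then have sm: "summable (\<lambda>j. r j powr p)" by (rule summable_suminf_not_top[rotated]) simp
  have r0: "0 \<le> r j" for j by (simp add: r_def)
  have eq: "sing_val (Suc j) T = ennreal (r j)" for j using fin[of j] by (simp add: r_def less_top)
  show ?thesis using T r0 eq sm by blast
qed

text \<open>By monotonicity upper bounds for the singular values suffice; truncations and
  compositions provide just these.\<close>

lemma schatten_class_FinI:
  assumes T: "clinear_L2 T" and p: "0 < p" and r: "\<And>j. 0 \<le> r j" "\<And>j. sing_val (Suc j) T \<le> ennreal (r j)" "summable (\<lambda>j. r j powr p)"
  shows "T \<in> schatten_class (Fin p)"
proof -
  have "ennreal_powr (sing_val (Suc j) T) p \<le> ennreal (r j powr p)" for j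
  proof -
    have fin: "sing_val (Suc j) T < top" using r(2)[of j] ennreal_less_top le_less_trans by blast
    have "enn2real (sing_val (Suc j) T) \<le> r j" using enn2real_mono[OF r(2)[of j]] r(1)[of j] by simp
    then have "enn2real (sing_val (Suc j) T) powr p \<le> r j powr p" using p by (intro powr_mono2) auto
    then show ?thesis using less_imp_neq[OF fin] by (simp add: ennreal_powr_def ennreal_leI)
  qed
  then have "(\<Sum>j. ennreal_powr (sing_val (Suc j) T) p) \<le> (\<Sum>j. ennreal (r j powr p))" by (intro suminf_le) auto
  also have "\<dots> = ennreal (\<Sum>j. r j powr p)" by (rule suminf_ennreal2[OF _ r(3)]) simp
  also have "\<dots> < \<infinity>" by simp
  finally show ?thesis using T by (simp add: schatten_class_def ennreal_powr_less_top[unfolded infinity_ennreal_def])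
qed

text \<open>Summability forces the singular values to 0. Each is an infimum of distances to
  operators of finite rank, which therefore approximate \<open>T\<close> in norm.\<close>

lemma schatten_class_Fin_compact:
  assumes T: "T \<in> schatten_class (Fin p)" and p: "0 < p" shows "compact_op T"
proof -
  obtain r where cT: "clinear_L2 T" and r: "\<And>j. 0 \<le> r j" "\<And>j. sing_val (Suc j) T = ennreal (r j)" "summable (\<lambda>j. r j powr p)"
    using schatten_class_FinD[OF T] by blast
  have "op_norm T \<le> ennreal (r 0)" using op_norm_le_sing_val[of T] r(2)[of 0] by simp
  then have bT: "norm (T f) \<le> r 0 * norm f" for f by (rule op_norm_bound[OF cT]) (rule r(1))
  show ?thesis
  proof (rule compact_op_approx[OF cT])
    fix \<epsilon> :: real assume \<epsilon>: "0 < \<epsilon>"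
    have "\<forall>\<^sub>F j in sequentially. r j powr p < \<epsilon> powr p"
      using summable_LIMSEQ_zero[OF r(3)] \<epsilon> by (intro order_tendstoD(2)) auto
    then obtain j where "r j powr p < \<epsilon> powr p" by (auto simp: eventually_sequentially)
    then have "r j < \<epsilon>" using \<epsilon> p powr_mono2[of p \<epsilon> "r j"] by (metis less_imp_le not_less)
    then have "sing_val (Suc j) T < ennreal \<epsilon>" using r(1,2) by (simp add: ennreal_lessI \<epsilon>)
    then obtain T0 where T0: "clinear_L2 T0" "rank_le T0 j" "op_norm (\<lambda>f. T f - T0 f) < ennreal \<epsilon>"
      unfolding sing_val_def by (auto simp: INF_less_iff)
    have d: "norm (T f - T0 f) \<le> \<epsilon> * norm f" for f
      by (rule op_norm_bound[OF clinear_L2_diff[OF cT T0(1)]]) (use T0(3) \<epsilon> in auto)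
    have b: "norm (T0 f) \<le> (r 0 + \<epsilon>) * norm f" for f
      using norm_triangle_ineq4[of "T f" "T f - T0 f"] bT[of f] d[of f] by (simp add: distrib_right)
    obtain B where "finite B" "range T0 \<subseteq> L2.span B" using T0(2) by (auto simp: rank_le_def)
    then show "\<exists>B K T0. finite B \<and> range T0 \<subseteq> L2.span B \<and> (\<forall>f. norm (T0 f) \<le> K * norm f) \<and> (\<forall>f. norm (T f - T0 f) \<le> \<epsilon> * norm f)"
      using d b by blast
  qed
qed

text \<open>Composing a competitor for \<open>T\<close> with \<open>S\<close> does not raise the
  rank and multiplies the error by at most \<open>K\<close>. The infimum may not be attained, whence
  the \<open>e / K\<close>.\<close>

lemma sing_val_comp:
  assumes T: "clinear_L2 T" and S: "clinear_L2 S" "\<And>f. norm (S f) \<le> K * norm f" "0 < K"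
    and r: "sing_val j T = ennreal r" "0 \<le> r"
  shows "sing_val j (T \<circ> S) \<le> ennreal (r * K)"
proof (rule ennreal_le_epsilon)
  fix e :: real assume e: "0 < e"
  have "sing_val j T < ennreal (r + e / K)" using e S(3) r by (simp add: ennreal_lessI)
  then obtain T0 where T0: "clinear_L2 T0" "rank_le T0 (j - 1)" "op_norm (\<lambda>f. T f - T0 f) < ennreal (r + e / K)"
    unfolding sing_val_def by (auto simp: INF_less_iff)
  have rk: "rank_le (T0 \<circ> S) (j - 1)" using T0(2) unfolding rank_le_def by (metis image_comp image_mono order_trans subset_UNIV)
  have b: "norm ((T \<circ> S) f - (T0 \<circ> S) f) \<le> (r * K + e) * norm f" for f
  proof -
    have "norm (T (S f) - T0 (S f)) \<le> (r + e / K) * norm (S f)"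
      by (rule op_norm_bound[OF clinear_L2_diff[OF T T0(1)]]) (use T0(3) e S(3) r in auto)
    also have "\<dots> \<le> (r + e / K) * (K * norm f)" using e S(3) r by (intro mult_left_mono S(2)) auto
    also have "\<dots> = (r * K + e) * norm f" using S(3) by (simp add: field_simps)
    finally show ?thesis by simp
  qed
  have "sing_val j (T \<circ> S) \<le> op_norm (\<lambda>f. (T \<circ> S) f - (T0 \<circ> S) f)"
    unfolding sing_val_def by (rule INF_lower) (use clinear_L2_comp[OF T0(1) S(1)] rk in \<open>simp add: o_def\<close>)
  also have "\<dots> \<le> ennreal (r * K + e)" by (rule op_norm_le[OF b]) (use e S(3) r in simp)
  also have "\<dots> = ennreal (r * K) + ennreal e" using e S(3) r by (simp add: ennreal_plus)
  finally show "sing_val j (T \<circ> S) \<le> ennreal (r * K) + ennreal e" .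
qed

lemma schatten_class_comp:
  assumes p: "p \<in> Rsharp" "p \<le> Sharp" and T: "T \<in> schatten_class p" and S: "S \<in> schatten_class Infty"
  shows "T \<circ> S \<in> schatten_class p"
proof -
  obtain K' where S': "clinear_L2 S" "0 \<le> K'" "\<And>f. norm (S f) \<le> K' * norm f" using S by (auto simp: schatten_class_Infty_iff)
  \<comment> \<open>Positive, so that one can divide by it.\<close>
  define K where "K = K' + 1"
  have K: "0 < K" "\<And>f. norm (S f) \<le> K * norm f"
    using S'(2,3) by (auto simp: K_def distrib_right intro: add_increasing2)
  show ?thesis
  proof (cases p)
    case (Fin q)
    have q: "0 < q" using p(1) Fin by (simp add: Rsharp_def)
    obtain r where cT: "clinear_L2 T" and r: "\<And>j. 0 \<le> r j" "\<And>j. sing_val (Suc j) T = ennreal (r j)" "summable (\<lambda>j. r j powr q)"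
      using schatten_class_FinD[OF T[unfolded Fin]] by blast
    have "summable (\<lambda>j. (r j * K) powr q)"
      using summable_mult2[OF r(3), of "K powr q"] r(1) K(1) by (simp add: powr_mult)
    then show ?thesis unfolding Fin
      by (intro schatten_class_FinI[OF clinear_L2_comp[OF cT S'(1)] q, of "\<lambda>j. r j * K"])
        (use r(1) K(1) sing_val_comp[OF cT S'(1) K(2,1) r(2,1)] in auto)
  next
    case Sharp
    have cT: "clinear_L2 T" and cp: "compact (closure (T ` cball 0 1))" using T Sharp by (auto simp: schatten_class_def compact_op_def)
    \<comment> \<open>\<open>S\<close> maps the unit ball into \<open>K\<close> times the unit ball,
      so the composition maps it into this dilate of a compact set.\<close>
    let ?C = "(\<lambda>x. K *\<^sub>R x) ` closure (T ` cball 0 1)"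
    have C: "compact ?C" by (rule compact_scaling[OF cp])
    have "(T \<circ> S) ` cball 0 1 \<subseteq> ?C"
    proof (rule image_subsetI)
      fix f :: "'a L2" assume "f \<in> cball 0 1"
      then have "K * norm f \<le> K * 1" using K(1) by (intro mult_left_mono) auto
      then have "norm (S f) \<le> K * 1" using K(2)[of f] by (rule order_trans[rotated])
      then have "S f /\<^sub>R K \<in> cball 0 1" using K(1) by (simp add: field_simps)
      then have "T (S f /\<^sub>R K) \<in> closure (T ` cball 0 1)" by (intro subsetD[OF closure_subset] imageI)
      moreover have "(T \<circ> S) f = K *\<^sub>R T (S f /\<^sub>R K)" using K(1) by (simp add: linear_scale[OF clinear_L2_linear[OF cT]])
      ultimately show "(T \<circ> S) f \<in> ?C" by blast
    qed
    then have "closure ((T \<circ> S) ` cball 0 1) \<subseteq> ?C" by (rule closure_minimal) (rule compact_imp_closed[OF C])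
    then have "closure ((T \<circ> S) ` cball 0 1) \<inter> ?C = closure ((T \<circ> S) ` cball 0 1)" by (rule inf_absorb1)
    then have "compact (closure ((T \<circ> S) ` cball 0 1))"
      using closed_Int_compact[OF closed_closure C, of "(T \<circ> S) ` cball 0 1"] by (simp only:)
    then show ?thesis using clinear_L2_comp[OF cT S'(1)] Sharp by (simp add: schatten_class_def compact_op_def)
  qed (use p(2) in simp)
qed

text \<open>\<open>e n\<close> is the normalized image of the singular vector \<open>v n\<close>, or
  0 if that image vanishes. Since \<open>dsum s v e N f\<close> is \<open>T (proj v N f)\<close>,
  the maximality of \<open>v N\<close> controls the remainder.\<close>

lemma singular_value_decomposition:
  fixes T :: "'a::euclidean_space L2 \<Rightarrow> 'a L2"
  assumes T: "compact_op T"
  obtains s v e where "singular_system s v e" "\<And>N. ennreal (s N) \<le> sing_val (Suc N) T"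
    "\<And>f. (\<lambda>N. dsum s v e N f) \<longlonglongrightarrow> T f"
proof -
  have cT: "clinear_L2 T" using T by (simp add: compact_op_def)
  obtain v where v: "orthofam v" "\<And>n f. (\<And>i. i < n \<Longrightarrow> cip f (v i) = 0) \<Longrightarrow> norm (T f) \<le> norm (T (v n)) * norm f"
    using singular_vectors[OF T] by blast
  have pr1: "antimono (\<lambda>n. norm (T (v n)))" by (rule singular_vectors_properties(1)[OF T v(1)]) (rule v(2), blast)
  have pr2: "cip (T (v i)) (T (v j)) = 0" if "i \<noteq> j" for i j
    by (rule singular_vectors_properties(2)[OF T v(1) _ that]) (rule v(2), blast)
  have pr3: "(\<lambda>n. norm (T (v n))) \<longlonglongrightarrow> 0" by (rule singular_vectors_properties(3)[OF T v(1)]) (rule v(2), blast)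
  have pr4: "norm (T (f - proj v N f)) \<le> norm (T (v N)) * norm f" for f N
    by (rule singular_vectors_properties(4)[OF T v(1)]) (rule v(2), blast)
  define s where "s n = norm (T (v n))" for n
  define e where "e n = cscale (of_real (inverse (s n))) (T (v n))" for n
  have Tv: "T (v n) = cscale (of_real (s n)) (e n)" for n by (cases "s n = 0") (auto simp: e_def s_def)
  have e: "orthofam e"
    unfolding orthofam_def
  proof (intro conjI allI impI)
    show "e n = 0 \<or> norm (e n) = 1" for n
      by (cases "s n = 0") (auto simp: e_def norm_cscale norm_inverse s_def)
    show "cip (e i) (e j) = 0" if "i \<noteq> j" for i j
      using pr2[OF that] by (simp add: e_def cip_cscale_left cip_cscale_right)
  qed
  have sys: "singular_system s v e" unfolding singular_system_def
    using v(1) e pr1 pr3 by (simp add: s_def[abs_def])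
  have "(\<lambda>N. dsum s v e N f) \<longlonglongrightarrow> T f" for f
  proof -
    have "dsum s v e N f = T (proj v N f)" for N
      unfolding proj_def dsum_def linear_sum[OF clinear_L2_linear[OF cT]]
      by (intro sum.cong) (simp_all add: clinear_L2_cscale[OF cT] Tv mult.commute)
    then have b: "norm (T f - dsum s v e N f) \<le> s N * norm f" for N
      using pr4[of f N] by (simp add: linear_diff[OF clinear_L2_linear[OF cT]] s_def)
    have z: "(\<lambda>N. s N * norm f) \<longlonglongrightarrow> 0" using tendsto_mult_left_zero[OF pr3, of "norm f"] by (simp add: s_def)
    show ?thesis
      by (rule LIM_zero_cancel, rule Lim_null_comparison[OF _ z]) (use b in \<open>simp add: norm_minus_commute\<close>)
  qed
  moreover have "ennreal (s N) \<le> sing_val (Suc N) T" for N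
    by (rule sing_val_ge[OF cT v(1) e _ _ Tv]) (use pr1 in \<open>simp_all add: s_def[abs_def]\<close>)
  ultimately show ?thesis using sys by (intro that[of s v e])
qed

text \<open>The right factor is diagonal in the single family \<open>v\<close>, so it multiplies the
  coefficient \<open>cip f (v i)\<close> by \<open>\<mu> i\<close>, and composing with the left
  factor multiplies the two sequences. What remains is to factor the singular values.\<close>

lemma schatten_class_factor:
  assumes p: "p \<in> Rsharp" "p \<le> Sharp" and T: "T \<in> schatten_class p"
  shows "\<exists>T1\<in>schatten_class p. \<exists>T2\<in>schatten_class Sharp. T = T1 \<circ> T2"
proof -
  have cT: "compact_op T"
  proof (cases p)
    case (Fin q)
    then show ?thesis using schatten_class_Fin_compact T p(1) by (auto simp: Rsharp_def)
  qed (use T p in \<open>auto simp: schatten_class_def\<close>)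
  obtain s v e where sys: "singular_system s v e" and sv: "\<And>N. ennreal (s N) \<le> sing_val (Suc N) T"
    and lim: "\<And>f. (\<lambda>N. dsum s v e N f) \<longlonglongrightarrow> T f"
    using singular_value_decomposition[OF cT] by blast
  have v: "orthofam v" and e: "orthofam e" and s: "antimono s" "\<And>i. 0 \<le> s i" "s \<longlonglongrightarrow> 0"
    using sys by (auto simp: singular_system_def)
  have "\<exists>t \<mu>. singular_system t v e \<and> singular_system \<mu> v v \<and> diag t v e \<in> schatten_class p \<and> (\<forall>i. s i = t i * \<mu> i)"
  proof (cases p)
    case Sharp
    \<comment> \<open>A square root serves for both factors here, as mere convergence to 0 is at
      stake.\<close>
    have "(\<lambda>i. sqrt (s i)) \<longlonglongrightarrow> 0" using tendsto_real_sqrt[OF s(3)] by simp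
    then have sq: "singular_system (\<lambda>i. sqrt (s i)) v u" if "orthofam u" for u
      using that v s(1,2) by (simp add: singular_system_def antimono_def)
    show ?thesis using sq[OF v] sq[OF e] s(2) compact_diag[OF sq[OF e]]
      by (intro exI[of _ "\<lambda>i. sqrt (s i)"]) (simp add: schatten_class_def Sharp)
  next
    case (Fin q)
    have q: "0 < q" using p(1) Fin by (simp add: Rsharp_def)
    obtain r where "clinear_L2 T" and r: "\<And>j. 0 \<le> r j" "\<And>j. sing_val (Suc j) T = ennreal (r j)" "summable (\<lambda>j. r j powr q)"
      using schatten_class_FinD[OF T[unfolded Fin]] by blast
    have sr: "s j \<le> r j" for j
    proof -
      have "ennreal (s j) \<le> ennreal (r j)" using sv[of j] unfolding r(2) .
      then show ?thesis using r(1)[of j] by simp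
    qed
    have pw: "s j powr q \<le> r j powr q" for j by (rule powr_mono2) (use q s(2) sr in auto)
    have sm: "summable (\<lambda>j. s j powr q)" by (rule summable_comparison_test'[OF r(3), of 0]) (use pw in simp)
    have am: "antimono (\<lambda>j. s j powr q)" using s(1,2) q by (auto simp: antimono_def intro!: powr_mono2)
    \<comment> \<open>The factored sequence is \<open>s i powr q\<close>, which is summable. Taking
      powers with exponent \<open>1 / q\<close> afterwards puts the first factor into l^q and lets
      the second tend to 0.\<close>
    obtain \<tau> \<kappa> where tk: "antimono \<tau>" "antimono \<kappa>" "\<And>i. 0 \<le> \<tau> i" "\<And>i. 0 \<le> \<kappa> i" "summable \<tau>" "\<kappa> \<longlonglongrightarrow> 0"
      "\<And>i. s i powr q = \<tau> i * \<kappa> i"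
      using summable_antimono_factor[OF am powr_ge_zero sm] by blast
    have sys': "singular_system (\<lambda>i. x i powr (1 / q)) v u"
      if "orthofam u" "antimono x" "\<And>i. 0 \<le> x i" "x \<longlonglongrightarrow> 0" for u x
      unfolding singular_system_def
    proof (intro conjI)
      show "(\<lambda>i. x i powr (1 / q)) \<longlonglongrightarrow> 0"
        by (rule tendsto_zero_powrI[OF that(4) tendsto_const]) (use that q in auto)
      show "antimono (\<lambda>i. x i powr (1 / q))" using that q by (auto simp: antimono_def intro!: powr_mono2)
    qed (use that v in auto)
    have st: "singular_system (\<lambda>i. \<tau> i powr (1 / q)) v e" by (rule sys'[OF e tk(1,3) summable_LIMSEQ_zero[OF tk(5)]])
    have sm: "singular_system (\<lambda>i. \<kappa> i powr (1 / q)) v v" by (rule sys'[OF v tk(2,4,6)])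
    have "diag (\<lambda>i. \<tau> i powr (1 / q)) v e \<in> schatten_class (Fin q)"
      by (rule schatten_class_FinI[OF clinear_diag[OF st] q _ sing_val_diag[OF st]])
        (use tk(3,5) q in \<open>simp_all add: powr_powr\<close>)
    moreover have "s i = \<tau> i powr (1 / q) * \<kappa> i powr (1 / q)" for i
    proof -
      have "s i = (s i powr q) powr (1 / q)" using s(2)[of i] q by (simp add: powr_powr)
      then show ?thesis using tk(3,4)[of i] by (simp add: tk(7) powr_mult)
    qed
    ultimately show ?thesis using st sm Fin by blast
  qed (use p(2) in simp)
  then obtain t \<mu> where t: "singular_system t v e" and \<mu>: "singular_system \<mu> v v"
    and cl: "diag t v e \<in> schatten_class p" and st: "\<And>i. s i = t i * \<mu> i" by blast
  have "T f = diag t v e (diag \<mu> v v f)" for f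
  proof (rule LIMSEQ_unique[OF lim])
    have "dsum t v e N (diag \<mu> v v f) = dsum s v e N f" for N
      by (simp add: dsum_def cip_diag[OF \<mu>] st mult.assoc)
    then show "(\<lambda>N. dsum s v e N f) \<longlonglongrightarrow> diag t v e (diag \<mu> v v f)"
      using dsum_tendsto_diag[OF t, of "diag \<mu> v v f"] by simp
  qed
  then have "T = diag t v e \<circ> diag \<mu> v v" by auto
  moreover have "diag \<mu> v v \<in> schatten_class Sharp" using compact_diag[OF \<mu>] by (simp add: schatten_class_def)
  ultimately show ?thesis using cl by blast
qed

lemma schatten_class_subset_Infty:
  assumes "p \<in> Rsharp" "p \<le> Sharp" shows "schatten_class p \<subseteq> schatten_class Infty"
proof
  fix T assume "T \<in> schatten_class p"
  from schatten_class_factor[OF assms this] obtain T1 T2 where "T1 \<in> schatten_class p" "T2 \<in> schatten_class Sharp" "T = T1 \<circ> T2" by blast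
  show "T \<in> schatten_class Infty"
  proof (cases p)
    case (Fin q)
    then have "compact_op T" using schatten_class_Fin_compact \<open>T \<in> schatten_class p\<close> assms(1) by (auto simp: Rsharp_def)
    then show ?thesis using schatten_class_Sharp_subset by (auto simp: schatten_class_def)
  qed (use assms schatten_class_Sharp_subset \<open>T \<in> schatten_class p\<close> in auto)
qed

section \<open>Passage from operators to symbols\<close>

lemma L2_extension_restrict:
  assumes T: "T \<in> schatten_class Infty" shows "L2_extension (L2_restrict T) = T"
  unfolding L2_extension_def
proof (rule the_equality)
  show "T \<in> schatten_class Infty \<and> L2_restrict T = L2_restrict T" using T by simp
  fix T' assume "T' \<in> schatten_class Infty \<and> L2_restrict T' = L2_restrict T"
  then show "T' = T" using T clinear_L2_ext[of T' _ T] by (auto simp: schatten_class_Infty_iff)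
qed

lemma Op_surj_bounded:
  assumes "T \<in> schatten_class Infty" shows "\<exists>a\<in>Sigma1_dual. Op A a = L2_restrict T"
  using assms Op_surj unfolding schatten_class_Infty_iff by blast

text \<open>Uniqueness of the L2 extensions identifies the composition of the two operators with
  \<open>T1 \<circ> T2\<close>, and injectivity of \<open>Op A\<close> then evaluates the inverse in
  the definition of the product.\<close>

lemma symbol_product_eq:
  assumes "a \<in> Sigma1_dual" "b \<in> Sigma1_dual" "c \<in> Sigma1_dual"
    and "T1 \<in> schatten_class Infty" "T2 \<in> schatten_class Infty"
    and "Op A a = L2_restrict T1" "Op A b = L2_restrict T2" "Op A c = L2_restrict (T1 \<circ> T2)"
  shows "symbol_product A a b = c"
proof -
  have "Op A a \<circ>\<^sub>L Op A b = Op A c" using assms by (simp add: op_comp_def L2_extension_restrict)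
  then show ?thesis unfolding symbol_product_def using the_inv_into_f_f[OF inj_on_Op assms(3)] by simp
qed

theorem theorem5p14:
  fixes A :: "real^'d^'d" and p :: schatten_index
  assumes "p \<in> Rsharp" and "p \<le> Sharp"
  shows "symbol_set_product A (symbol_class p A) (symbol_class Sharp A) =
           symbol_set_product A (symbol_class p A) (symbol_class Infty A) \<and>
         symbol_set_product A (symbol_class p A) (symbol_class Infty A) = symbol_class p A"
proof -
  note sub = schatten_class_subset_Infty[OF assms]
  \<comment> \<open>This inclusion and the next two form a cycle through the three sets, so all of
    them are equal.\<close>
  have "symbol_set_product A (symbol_class p A) (symbol_class Sharp A) \<subseteq> symbol_set_product A (symbol_class p A) (symbol_class Infty A)"
    using schatten_class_Sharp_subset unfolding symbol_set_product_def symbol_class_def by blast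
  moreover have "symbol_set_product A (symbol_class p A) (symbol_class Infty A) \<subseteq> symbol_class p A"
  proof
    fix c assume "c \<in> symbol_set_product A (symbol_class p A) (symbol_class Infty A)"
    then obtain a b T1 T2 where ab: "a \<in> Sigma1_dual" "b \<in> Sigma1_dual" "c = symbol_product A a b"
      and T1: "T1 \<in> schatten_class p" "L2_restrict T1 = Op A a" and T2: "T2 \<in> schatten_class Infty" "L2_restrict T2 = Op A b"
      unfolding symbol_set_product_def symbol_class_def by blast
    have T: "T1 \<circ> T2 \<in> schatten_class p" by (rule schatten_class_comp[OF assms T1(1) T2(1)])
    obtain c' where c': "c' \<in> Sigma1_dual" "Op A c' = L2_restrict (T1 \<circ> T2)" using Op_surj_bounded[OF subsetD[OF sub T]] by blast
    have "c = c'" unfolding ab(3)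
      by (rule symbol_product_eq[OF ab(1,2) c'(1) subsetD[OF sub T1(1)] T2(1) T1(2)[symmetric] T2(2)[symmetric] c'(2)])
    then show "c \<in> symbol_class p A" using c' T by (auto simp: symbol_class_def)
  qed
  moreover have "symbol_class p A \<subseteq> symbol_set_product A (symbol_class p A) (symbol_class Sharp A)"
  proof
    fix c assume "c \<in> symbol_class p A"
    then obtain T where c: "c \<in> Sigma1_dual" and T: "T \<in> schatten_class p" "L2_restrict T = Op A c" by (auto simp: symbol_class_def)
    obtain T1 T2 where T12: "T1 \<in> schatten_class p" "T2 \<in> schatten_class Sharp" "T = T1 \<circ> T2"
      using schatten_class_factor[OF assms T(1)] by blast
    have i: "T1 \<in> schatten_class Infty" "T2 \<in> schatten_class Infty" using T12 sub schatten_class_Sharp_subset by auto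
    obtain a b where a: "a \<in> Sigma1_dual" "Op A a = L2_restrict T1" and b: "b \<in> Sigma1_dual" "Op A b = L2_restrict T2"
      using Op_surj_bounded i by metis
    have "c = symbol_product A a b"
      by (rule symbol_product_eq[OF a(1) b(1) c i a(2) b(2), symmetric]) (simp add: T(2)[symmetric] T12(3))
    moreover have "a \<in> symbol_class p A" using a T12(1) by (auto simp: symbol_class_def)
    moreover have "b \<in> symbol_class Sharp A" using b T12(2) by (auto simp: symbol_class_def)
    ultimately show "c \<in> symbol_set_product A (symbol_class p A) (symbol_class Sharp A)"
      unfolding symbol_set_product_def by blast
  qed
  ultimately show ?thesis by blast
qed

end
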